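(* Let $(\Gamma_1,\Delta_1)$ and $(\Gamma_2,\Delta_2)$ be arbitrary pairs of simplicial complexes ($\Delta_i$ a subcomplex of $\Gamma_i$, the vertex sets of $\Gamma_1$ and $\Gamma_2$ being disjoint), let $\mathbf R$ be a principal ideal domain and let $\mathbf G,\mathbf G'$ be $\mathbf R$-modules with $\mathrm{Tor}_1^{\mathbf R}(\mathbf G,\mathbf G')=0$. Then, for every $q$, $$\hat{\mathbf H}_{q+1}\big((\Gamma_1,\Delta_1)*(\Gamma_2,\Delta_2);\mathbf G\otimes\mathbf G'\big)\cong\bigoplus_{i+j=q}\big[\hat{\mathbf H}_i(\Gamma_1,\Delta_1;\mathbf G)\otimes\hat{\mathbf H}_j(\Gamma_2,\Delta_2;\mathbf G')\big]\oplus\bigoplus_{i+j=q-1}\mathrm{Tor}_1^{\mathbf R}\big(\hat{\mathbf H}_i(\Gamma_1,\Delta_1;\mathbf G),\hat{\mathbf H}_j(\Gamma_2,\Delta_2;\mathbf G')\big),$$ where the tensor products are over $\mathbf R$.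
   Context: A simplicial complex on a vertex set $V_\Sigma$ is a collection $\Sigma$ of finite, possibly empty, subsets of $V_\Sigma$ (simplices) closed under taking subsets and containing $\{v\}$ for all $v\in V_\Sigma$. The complexes $\emptyset$ and $\{\emptyset_o\}$ are distinct, $\emptyset_o$ being the empty set viewed as a simplex of dimension $-1$. The join of complexes with disjoint vertex sets is $\Sigma_1*\Sigma_2=\{\sigma_1\cup\sigma_2\mid\sigma_i\in\Sigma_i,\ i=1,2\}$, so $\emptyset*\Sigma=\emptyset$ and $\{\emptyset_o\}*\Sigma=\Sigma$. For pairs, $(\Gamma_1,\Delta_1)*(\Gamma_2,\Delta_2)=\big(\Gamma_1*\Gamma_2,\ (\Gamma_1*\Delta_2)\cup(\Delta_1*\Gamma_2)\big)$. The augmental simplicial chain complex $\mathbf C^o(\Sigma)$ is generated in degree $q\ge-1$ by the (ordered) $q$-simplices of $\Sigma$, with $\emptyset_o$ the generator in degree $-1$, and with the usual simplicial boundary, each vertex having boundary $\emptyset_o$; $\mathbf C^o(\emptyset)=0$. $\hat{\mathbf H}_i(\Sigma_1,\Sigma_2;\mathbf G)$ is the $i$-th homology of $\mathbf C^o(\Sigma_1)/\mathbf C^o(\Sigma_2)$ with coefficients in $\mathbf G$. *)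

theory Defs
  imports "HOL-Algebra.Module" "HOL-Algebra.AbelCoset" "HOL-Algebra.Ring_Divisibility"
begin

section \<open>Modules over a commutative ring\<close>

text \<open>
  Modules are the records of \<^theory>\<open>HOL-Algebra.Module\<close>. These inherit the fields \<open>mult\<close> and
  \<open>one\<close> from rings; they play no role in the notion of a module and are left undefined below.
\<close>

definition module_hom ::
    "'r ring \<Rightarrow> ('r, 'm) module \<Rightarrow> ('r, 'n) module \<Rightarrow> ('m \<Rightarrow> 'n) set" where
  "module_hom R M N = {h \<in> carrier M \<rightarrow> carrier N.
     (\<forall>x\<in>carrier M. \<forall>y\<in>carrier M. h (x \<oplus>\<^bsub>M\<^esub> y) = h x \<oplus>\<^bsub>N\<^esub> h y) \<and>
     (\<forall>r\<in>carrier R. \<forall>x\<in>carrier M. h (r \<odot>\<^bsub>M\<^esub> x) = r \<odot>\<^bsub>N\<^esub> h x)}"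

definition module_isomorphic ::
    "'r ring \<Rightarrow> ('r, 'm) module \<Rightarrow> ('r, 'n) module \<Rightarrow> bool" where
  "module_isomorphic R M N \<longleftrightarrow> (\<exists>h\<in>module_hom R M N. bij_betw h (carrier M) (carrier N))"

definition module_span :: "'r ring \<Rightarrow> ('r, 'm) module \<Rightarrow> 'm set \<Rightarrow> 'm set" where
  "module_span R M S = \<Inter>{H. submodule H R M \<and> S \<subseteq> H}"

text \<open>
  In a quotient, \<open>r \<cdot> X\<close> is \<open>H + {r x | x \<in> X}\<close>: adding \<open>H\<close> is needed as \<open>{r x | x \<in> X}\<close> alone
  need not be a full coset.
\<close>

definition quotient_module :: "('r, 'm) module \<Rightarrow> 'm set \<Rightarrow> ('r, 'm set) module" where
  "quotient_module M H =
     \<lparr>carrier = a_rcosets\<^bsub>M\<^esub> H, mult = undefined, one = undefined, zero = H, add = set_add M,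
      smult = (\<lambda>r X. H <+>\<^bsub>M\<^esub> (\<lambda>x. r \<odot>\<^bsub>M\<^esub> x) ` X)\<rparr>"

text \<open>The map \<open>M/H \<rightarrow> M'/H'\<close> induced by a homomorphism \<open>f : M \<rightarrow> M'\<close> with \<open>f(H) \<subseteq> H'\<close>:\<close>

definition induced_map :: "('r, 'n) module \<Rightarrow> 'n set \<Rightarrow> ('m \<Rightarrow> 'n) \<Rightarrow> 'm set \<Rightarrow> 'n set" where
  "induced_map M' H' f X = H' <+>\<^bsub>M'\<^esub> f ` X"

definition module_sum :: "('r, 'm) module \<Rightarrow> ('r, 'n) module \<Rightarrow> ('r, 'm \<times> 'n) module" where
  "module_sum M N =
     \<lparr>carrier = carrier M \<times> carrier N, mult = undefined, one = undefined,
      zero = (\<zero>\<^bsub>M\<^esub>, \<zero>\<^bsub>N\<^esub>), add = (\<lambda>(x, y) (x', y'). (x \<oplus>\<^bsub>M\<^esub> x', y \<oplus>\<^bsub>N\<^esub> y')),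
      smult = (\<lambda>r (x, y). (r \<odot>\<^bsub>M\<^esub> x, r \<odot>\<^bsub>N\<^esub> y))\<rparr>"

definition direct_sum :: "'i set \<Rightarrow> ('i \<Rightarrow> ('r, 'm) module) \<Rightarrow> ('r, 'i \<Rightarrow> 'm) module" where
  "direct_sum I M =
     \<lparr>carrier = {f \<in> (\<Pi>\<^sub>E i\<in>I. carrier (M i)). finite {i \<in> I. f i \<noteq> \<zero>\<^bsub>M i\<^esub>}},
      mult = undefined, one = undefined, zero = (\<lambda>i\<in>I. \<zero>\<^bsub>M i\<^esub>),
      add = (\<lambda>f g. \<lambda>i\<in>I. f i \<oplus>\<^bsub>M i\<^esub> g i), smult = (\<lambda>r f. \<lambda>i\<in>I. r \<odot>\<^bsub>M i\<^esub> f i)\<rparr>"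

text \<open>Formal finite sums of elements of \<open>S\<close> with coefficients in the module \<open>M\<close>:\<close>

definition supp :: "('r, 'm) module \<Rightarrow> ('s \<Rightarrow> 'm) \<Rightarrow> 's set" where
  "supp M c = {s. c s \<noteq> \<zero>\<^bsub>M\<^esub>}"

definition formal_sums :: "('r, 'm) module \<Rightarrow> 's set \<Rightarrow> ('r, 's \<Rightarrow> 'm) module" where
  "formal_sums M S =
     \<lparr>carrier = {c. range c \<subseteq> carrier M \<and> finite (supp M c) \<and> supp M c \<subseteq> S},
      mult = undefined, one = undefined, zero = (\<lambda>_. \<zero>\<^bsub>M\<^esub>),
      add = (\<lambda>c d s. c s \<oplus>\<^bsub>M\<^esub> d s), smult = (\<lambda>r c s. r \<odot>\<^bsub>M\<^esub> c s)\<rparr>"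

definition ring_module :: "'r ring \<Rightarrow> ('r, 'r) module" where
  "ring_module R = ring.extend R \<lparr>smult = mult R\<rparr>"

definition free_module :: "'r ring \<Rightarrow> 's set \<Rightarrow> ('r, 's \<Rightarrow> 'r) module" where
  "free_module R S = formal_sums (ring_module R) S"

definition free_gen :: "'r ring \<Rightarrow> 's \<Rightarrow> 's \<Rightarrow> 'r" where
  "free_gen R s = (\<lambda>t. if t = s then \<one>\<^bsub>R\<^esub> else \<zero>\<^bsub>R\<^esub>)"

text \<open>The linear extension to free modules of a map \<open>\<phi>\<close> between the bases:\<close>

definition free_map :: "'r ring \<Rightarrow> ('s \<Rightarrow> 't) \<Rightarrow> ('s \<Rightarrow> 'r) \<Rightarrow> 't \<Rightarrow> 'r" where
  "free_map R \<phi> c = (\<lambda>t. \<Oplus>\<^bsub>R\<^esub> s\<in>{s \<in> supp (ring_module R) c. \<phi> s = t}. c s)"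


section \<open>Tensor product and torsion product\<close>

definition tensor_rels ::
    "'r ring \<Rightarrow> ('r, 'm) module \<Rightarrow> ('r, 'n) module \<Rightarrow> ('m \<times> 'n \<Rightarrow> 'r) set" where
  "tensor_rels R M N =
    (let F = free_module R (carrier M \<times> carrier N); e = free_gen R in
      {e (x \<oplus>\<^bsub>M\<^esub> x', y) \<ominus>\<^bsub>F\<^esub> (e (x, y) \<oplus>\<^bsub>F\<^esub> e (x', y)) | x x' y.
         x \<in> carrier M \<and> x' \<in> carrier M \<and> y \<in> carrier N} \<union>
      {e (x, y \<oplus>\<^bsub>N\<^esub> y') \<ominus>\<^bsub>F\<^esub> (e (x, y) \<oplus>\<^bsub>F\<^esub> e (x, y')) | x y y'.
         x \<in> carrier M \<and> y \<in> carrier N \<and> y' \<in> carrier N} \<union>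
      {e (r \<odot>\<^bsub>M\<^esub> x, y) \<ominus>\<^bsub>F\<^esub> (r \<odot>\<^bsub>F\<^esub> e (x, y)) | r x y.
         r \<in> carrier R \<and> x \<in> carrier M \<and> y \<in> carrier N} \<union>
      {e (x, r \<odot>\<^bsub>N\<^esub> y) \<ominus>\<^bsub>F\<^esub> (r \<odot>\<^bsub>F\<^esub> e (x, y)) | r x y.
         r \<in> carrier R \<and> x \<in> carrier M \<and> y \<in> carrier N})"

definition tensor_kernel ::
    "'r ring \<Rightarrow> ('r, 'm) module \<Rightarrow> ('r, 'n) module \<Rightarrow> ('m \<times> 'n \<Rightarrow> 'r) set" where
  "tensor_kernel R M N =
     module_span R (free_module R (carrier M \<times> carrier N)) (tensor_rels R M N)"

definition tensor ::
    "'r ring \<Rightarrow> ('r, 'm) module \<Rightarrow> ('r, 'n) module \<Rightarrow> ('r, ('m \<times> 'n \<Rightarrow> 'r) set) module" where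
  "tensor R M N =
     quotient_module (free_module R (carrier M \<times> carrier N)) (tensor_kernel R M N)"

text \<open>The homomorphism from a tensor product to \<open>M' \<otimes> N'\<close> that sends \<open>x \<otimes> y\<close> to \<open>f x \<otimes> g y\<close>:\<close>

definition tensor_map ::
    "'r ring \<Rightarrow> ('r, 'm') module \<Rightarrow> ('r, 'n') module \<Rightarrow> ('m \<Rightarrow> 'm') \<Rightarrow> ('n \<Rightarrow> 'n') \<Rightarrow>
     ('m \<times> 'n \<Rightarrow> 'r) set \<Rightarrow> ('m' \<times> 'n' \<Rightarrow> 'r) set" where
  "tensor_map R M' N' f g =
     induced_map (free_module R (carrier M' \<times> carrier N')) (tensor_kernel R M' N')
       (free_map R (map_prod f g))"

text \<open>
  The canonical presentation \<open>0 \<rightarrow> K \<rightarrow> F \<rightarrow> M \<rightarrow> 0\<close> of \<open>M\<close>, where \<open>F\<close> is free on the set of elements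
  of \<open>M\<close>. Over a principal ideal domain \<open>K\<close> is free, being a submodule of a free module, so that
  \<open>0 \<rightarrow> K \<rightarrow> F\<close> is a free resolution of \<open>M\<close>, and \<open>Tor\<^sub>1(M, N)\<close> is the homology in degree 1 of
  \<open>0 \<rightarrow> K \<otimes> N \<rightarrow> F \<otimes> N\<close>, i.e. the kernel of the last map.
\<close>

definition pres_map :: "'r ring \<Rightarrow> ('r, 'm) module \<Rightarrow> ('m \<Rightarrow> 'r) \<Rightarrow> 'm" where
  "pres_map R M c = (\<Oplus>\<^bsub>M\<^esub> x\<in>supp (ring_module R) c. c x \<odot>\<^bsub>M\<^esub> x)"

definition pres_free :: "'r ring \<Rightarrow> ('r, 'm) module \<Rightarrow> ('r, 'm \<Rightarrow> 'r) module" where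
  "pres_free R M = free_module R (carrier M)"

definition pres_kernel :: "'r ring \<Rightarrow> ('r, 'm) module \<Rightarrow> ('r, 'm \<Rightarrow> 'r) module" where
  "pres_kernel R M =
     (pres_free R M)\<lparr>carrier := a_kernel (pres_free R M) M (pres_map R M)\<rparr>"

definition Tor1 ::
    "'r ring \<Rightarrow> ('r, 'm) module \<Rightarrow> ('r, 'n) module \<Rightarrow>
     ('r, (('m \<Rightarrow> 'r) \<times> 'n \<Rightarrow> 'r) set) module" where
  "Tor1 R M N =
    (let KN = tensor R (pres_kernel R M) N; FN = tensor R (pres_free R M) N in
       KN\<lparr>carrier := a_kernel KN FN (tensor_map R (pres_free R M) N id id)\<rparr>)"


section \<open>Simplicial complexes and joins\<close>

definition simplicial_complex :: "'v set \<Rightarrow> 'v set set \<Rightarrow> bool" where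
  "simplicial_complex V \<Sigma> \<longleftrightarrow>
     (\<forall>\<sigma>\<in>\<Sigma>. finite \<sigma> \<and> \<sigma> \<subseteq> V) \<and> (\<forall>\<sigma>\<in>\<Sigma>. \<forall>\<tau>. \<tau> \<subseteq> \<sigma> \<longrightarrow> \<tau> \<in> \<Sigma>) \<and> (\<forall>v\<in>V. {v} \<in> \<Sigma>)"

type_synonym 'v complex_pair = "'v set set \<times> 'v set set"

definition complex_join :: "'v set set \<Rightarrow> 'v set set \<Rightarrow> 'v set set" where
  "complex_join \<Sigma>\<^sub>1 \<Sigma>\<^sub>2 = {\<sigma>\<^sub>1 \<union> \<sigma>\<^sub>2 | \<sigma>\<^sub>1 \<sigma>\<^sub>2. \<sigma>\<^sub>1 \<in> \<Sigma>\<^sub>1 \<and> \<sigma>\<^sub>2 \<in> \<Sigma>\<^sub>2}"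

fun join_pair :: "'v complex_pair \<Rightarrow> 'v complex_pair \<Rightarrow> 'v complex_pair" where
  "join_pair (\<Gamma>\<^sub>1, \<Delta>\<^sub>1) (\<Gamma>\<^sub>2, \<Delta>\<^sub>2) = (complex_join \<Gamma>\<^sub>1 \<Gamma>\<^sub>2, complex_join \<Gamma>\<^sub>1 \<Delta>\<^sub>2 \<union> complex_join \<Delta>\<^sub>1 \<Gamma>\<^sub>2)"


section \<open>Augmental simplicial homology\<close>

text \<open>
  An ordered \<open>q\<close>-simplex is a sequence of \<open>q + 1\<close> vertices, repetitions allowed, that all belong to
  some common simplex. As complexes are closed under subsets, this means that the set of its entries
  is a simplex. The empty sequence is the generator in degree \<open>-1\<close>; it is present precisely when
  \<open>{} \<in> \<Sigma>\<close>, so the complexes \<open>{}\<close> and \<open>{{}}\<close> are told apart.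
\<close>

definition ordered_simplices :: "'v set set \<Rightarrow> int \<Rightarrow> 'v list set" where
  "ordered_simplices \<Sigma> q = {l. set l \<in> \<Sigma> \<and> int (length l) = q + 1}"

definition chains ::
    "('r, 'g) module \<Rightarrow> 'v set set \<Rightarrow> int \<Rightarrow> ('r, 'v list \<Rightarrow> 'g) module" where
  "chains G \<Sigma> q = formal_sums G (ordered_simplices \<Sigma> q)"

definition face :: "nat \<Rightarrow> 'v list \<Rightarrow> 'v list" where
  "face i l = take i l @ drop (Suc i) l"

text \<open>
  Linear extension of \<open>g l \<mapsto> \<Sum>\<^sub>i (-1)\<^sup>i g (face i l)\<close>, written as a function of the ordered simplex \<open>k\<close>
  whose coefficient is taken. In particular a vertex is mapped to the empty sequence, and the empty
  sequence to \<open>0\<close>.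
\<close>

definition boundary :: "('r, 'g) module \<Rightarrow> ('v list \<Rightarrow> 'g) \<Rightarrow> 'v list \<Rightarrow> 'g" where
  "boundary G c = (\<lambda>k. \<Oplus>\<^bsub>G\<^esub> l\<in>supp G c. \<Oplus>\<^bsub>G\<^esub> i\<in>{..<length l}.
     if face i l = k then (if even i then c l else \<ominus>\<^bsub>G\<^esub> c l) else \<zero>\<^bsub>G\<^esub>)"

fun rel_chains ::
    "('r, 'g) module \<Rightarrow> 'v complex_pair \<Rightarrow> int \<Rightarrow> ('r, ('v list \<Rightarrow> 'g) set) module" where
  "rel_chains G (\<Gamma>, \<Delta>) q = quotient_module (chains G \<Gamma> q) (carrier (chains G \<Delta> q))"

fun rel_boundary ::
    "('r, 'g) module \<Rightarrow> 'v complex_pair \<Rightarrow> int \<Rightarrow> ('v list \<Rightarrow> 'g) set \<Rightarrow> ('v list \<Rightarrow> 'g) set" where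
  "rel_boundary G (\<Gamma>, \<Delta>) q =
     induced_map (chains G \<Gamma> (q - 1)) (carrier (chains G \<Delta> (q - 1))) (boundary G)"

text \<open>Homology in degree \<open>q\<close> of a complex of modules \<open>C q\<close> with differentials \<open>d q : C q \<rightarrow> C (q - 1)\<close>:\<close>

definition homology_module ::
    "(int \<Rightarrow> ('r, 'c) module) \<Rightarrow> (int \<Rightarrow> 'c \<Rightarrow> 'c) \<Rightarrow> int \<Rightarrow> ('r, 'c set) module" where
  "homology_module C d q =
     quotient_module ((C q)\<lparr>carrier := a_kernel (C q) (C (q - 1)) (d q)\<rparr>)
       (d (q + 1) ` carrier (C (q + 1)))"

definition aug_homology ::
    "('r, 'g) module \<Rightarrow> 'v complex_pair \<Rightarrow> int \<Rightarrow> ('r, ('v list \<Rightarrow> 'g) set set) module" where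
  "aug_homology G P = homology_module (rel_chains G P) (rel_boundary G P)"

end

theory Submission
  imports Defs
begin

text \<open>
  The homology of a join is that of a tensor product with a shift by one: an ordered simplex
  \<open>v\<^sub>0 \<dots> v\<^sub>m\<close> of the first complex and an ordered simplex \<open>w\<^sub>0 \<dots> w\<^sub>n\<close> of the second one can be
  concatenated to an ordered simplex of the join with \<open>(m + 1) + (n + 1)\<close> vertices. As repetitions are
  allowed and vertices come in any order, most ordered simplices of the join are not of this form.
  Concatenation (\<open>merge\<close>) is nevertheless a homotopy equivalence; an inverse (\<open>split\<close>) separates the
  vertices of the two complexes at the expense of a sign, and the homotopy (\<open>shuffle_htpy\<close>) repeatedly
  takes cones. All these maps respect subcomplexes, so they give the relative statement
  \<open>join_shuffle.TT_has_homology\<close>: the homology of the join with coefficients in a module \<open>N\<close> is that of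
  \<open>S\<^sub>1 \<otimes> S\<^sub>2 \<otimes> N\<close>, where \<open>S\<^sub>i\<close> is the free complex on the ordered simplices of \<open>\<Gamma>\<^sub>i\<close> outside \<open>\<Delta>\<^sub>i\<close>.

  It remains to prove a Kuenneth formula for \<open>S\<^sub>1 \<otimes> S\<^sub>2 \<otimes> (G \<otimes> G')\<close>, in terms of the homology \<open>A\<close> of
  \<open>S\<^sub>1 \<otimes> G\<close> and the homology \<open>A'\<close> of \<open>S\<^sub>2 \<otimes> G'\<close>. A complex of free modules tensored with any complex
  preserves quasi-isomorphisms (\<open>quasi_iso_tens\<close>), and over a principal ideal domain, where submodules
  of free modules are free, every complex \<open>K\<close> is quasi-isomorphic to the direct sum of the
  canonical two-term free presentations of its homology modules (\<open>free_approximation\<close>). Let \<open>E\<close>, \<open>P\<close>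
  and \<open>Q\<close> be the free complexes that arise in this way from \<open>G\<close>, \<open>A\<close> and \<open>A'\<close>. As
  \<open>Tor\<^sub>1(G, G') = 0\<close>, the complex \<open>E \<otimes> G'\<close> is quasi-isomorphic to \<open>G \<otimes> G'\<close>, whence
  \<open>S\<^sub>1 \<otimes> S\<^sub>2 \<otimes> (G \<otimes> G') \<simeq> S\<^sub>1 \<otimes> S\<^sub>2 \<otimes> E \<otimes> G' \<simeq> (S\<^sub>1 \<otimes> E) \<otimes> (S\<^sub>2 \<otimes> G') \<simeq> P \<otimes> Q \<simeq> P \<otimes> A'\<close>,
  the last complex having \<open>A'\<close> with zero differential as its second factor. It splits into the two-term
  complexes \<open>K\<^sub>i \<otimes> A'\<^sub>j \<rightarrow> F\<^sub>i \<otimes> A'\<^sub>j\<close> given by the presentations of the \<open>A\<^sub>i\<close>. Their cokernels \<open>A\<^sub>i \<otimes> A'\<^sub>j\<close>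
  and kernels \<open>Tor\<^sub>1(A\<^sub>i, A'\<^sub>j)\<close> are the summands of the formula (\<open>presentation_tensor_homology\<close>).
\<close>

section \<open>Homomorphisms, submodules and quotients of modules\<close>

lemma module_homI:
 assumes "\<And>x. x \<in> carrier M ==> h x \<in> carrier N"
  and "\<And>x y. x \<in> carrier M ==> y \<in> carrier M ==> h (x \<oplus>\<^bsub>M\<^esub> y) = h x \<oplus>\<^bsub>N\<^esub> h y"
  and "\<And>r x. r \<in> carrier R ==> x \<in> carrier M ==> h (r \<odot>\<^bsub>M\<^esub> x) = r \<odot>\<^bsub>N\<^esub> h x"
 shows "h \<in> module_hom R M N"
 using assms by (auto simp: module_hom_def)

lemma module_hom_closed: "h \<in> module_hom R M N ==> x \<in> carrier M ==> h x \<in> carrier N"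
 and module_hom_add: "h \<in> module_hom R M N ==> x \<in> carrier M ==> y \<in> carrier M ==>
    h (x \<oplus>\<^bsub>M\<^esub> y) = h x \<oplus>\<^bsub>N\<^esub> h y"
 and module_hom_smult: "h \<in> module_hom R M N ==> r \<in> carrier R ==> x \<in> carrier M ==>
    h (r \<odot>\<^bsub>M\<^esub> x) = r \<odot>\<^bsub>N\<^esub> h x"
 by (auto simp: module_hom_def)

lemma module_hom_zero:
 assumes "module R M" "module R N" and h: "h \<in> module_hom R M N"
 shows "h \<zero>\<^bsub>M\<^esub> = \<zero>\<^bsub>N\<^esub>"
proof -
 interpret M: module R M by fact
 interpret N: module R N by fact
 have "h (\<zero>\<^bsub>R\<^esub> \<odot>\<^bsub>M\<^esub> \<zero>\<^bsub>M\<^esub>) = \<zero>\<^bsub>R\<^esub> \<odot>\<^bsub>N\<^esub> h \<zero>\<^bsub>M\<^esub>"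
  by (rule module_hom_smult[OF h]) simp_all
 then show ?thesis using module_hom_closed[OF h] by simp
qed

lemma module_neg_eq_smult:
 assumes "module R M" and "x \<in> carrier M"
 shows "\<ominus>\<^bsub>M\<^esub> x = (\<ominus>\<^bsub>R\<^esub> \<one>\<^bsub>R\<^esub>) \<odot>\<^bsub>M\<^esub> x"
proof -
 interpret M: module R M by fact
 show ?thesis using M.smult_l_minus[of "\<one>\<^bsub>R\<^esub>" x] assms by simp
qed

lemma module_hom_neg:
 assumes M: "module R M" and N: "module R N" and h: "h \<in> module_hom R M N" and x: "x \<in> carrier M"
 shows "h (\<ominus>\<^bsub>M\<^esub> x) = \<ominus>\<^bsub>N\<^esub> h x"
proof -
 interpret M: module R M by fact
 show ?thesis using module_neg_eq_smult[OF M x] module_neg_eq_smult[OF N module_hom_closed[OF h x]]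
   module_hom_smult[OF h _ x] by simp
qed

lemma module_hom_minus:
 assumes M: "module R M" and N: "module R N" and h: "h \<in> module_hom R M N"
  and x: "x \<in> carrier M" "y \<in> carrier M"
 shows "h (x \<ominus>\<^bsub>M\<^esub> y) = h x \<ominus>\<^bsub>N\<^esub> h y"
proof -
 interpret M: module R M by fact
 show ?thesis using module_hom_neg[OF M N h x(2)] module_hom_add[OF h x(1)] x
  by (simp add: a_minus_def)
qed

lemma module_minus_eq_zero:
 assumes "module R M" and "x \<in> carrier M" and "y \<in> carrier M"
 shows "x \<ominus>\<^bsub>M\<^esub> y = \<zero>\<^bsub>M\<^esub> \<longleftrightarrow> x = y"
proof -
 interpret M: module R M by fact
 show ?thesis using assms(2,3) M.minus_equality[of x "\<ominus>\<^bsub>M\<^esub> y"] M.minus_minus M.r_neg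
  by (auto simp: a_minus_def)
qed

lemma module_hom_comp:
 assumes "g \<in> module_hom R M N" and "h \<in> module_hom R N K"
 shows "(\<lambda>x. h (g x)) \<in> module_hom R M K"
 using assms by (auto simp: module_hom_def Pi_def)

lemma module_hom_finsum:
 assumes M: "module R M" and N: "module R N" and h: "h \<in> module_hom R M N"
  and "finite A" and "f \<in> A \<rightarrow> carrier M"
 shows "h (\<Oplus>\<^bsub>M\<^esub> i\<in>A. f i) = (\<Oplus>\<^bsub>N\<^esub> i\<in>A. h (f i))"
proof -
 interpret M: module R M by fact
 interpret N: module R N by fact
 show ?thesis using assms(4,5)
 proof (induction A)
  case empty
  then show ?case using module_hom_zero[OF M N h] by simp
 next
  case (insert a A)
  have f: "f \<in> A \<rightarrow> carrier M" "f a \<in> carrier M" using insert.prems by auto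
  have "(\<lambda>i. h (f i)) \<in> A \<rightarrow> carrier N" "h (f a) \<in> carrier N"
   using f module_hom_closed[OF h] by auto
  then show ?case using insert f module_hom_add[OF h] by simp
 qed
qed

lemma submodule_iff:
 assumes "module R M"
 shows "submodule H R M \<longleftrightarrow> H \<subseteq> carrier M \<and> \<zero>\<^bsub>M\<^esub> \<in> H \<and> (\<forall>x\<in>H. \<forall>y\<in>H. x \<oplus>\<^bsub>M\<^esub> y \<in> H) \<and>
   (\<forall>r\<in>carrier R. \<forall>x\<in>H. r \<odot>\<^bsub>M\<^esub> x \<in> H)" (is "_ \<longleftrightarrow> ?R")
proof
 interpret M: module R M by fact
 assume H: "submodule H R M"
 have "\<zero>\<^bsub>M\<^esub> \<in> H" using subgroup.one_closed[OF submodule.axioms(1)[OF H]] by simp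
 then show ?R using M.submoduleE[OF H] by blast
next
 interpret M: module R M by fact
 assume R: ?R
 have "\<ominus>\<^bsub>M\<^esub> a \<in> H" if "a \<in> H" for a
  using R that module_neg_eq_smult[OF assms, of a] by auto
 then show "submodule H R M" using R by (intro M.submoduleI) auto
qed

lemma submoduleD:
 assumes "module R M" and "submodule H R M"
 shows "H \<subseteq> carrier M" and "\<zero>\<^bsub>M\<^esub> \<in> H"
  and "x \<in> H ==> y \<in> H ==> x \<oplus>\<^bsub>M\<^esub> y \<in> H"
  and "r \<in> carrier R ==> x \<in> H ==> r \<odot>\<^bsub>M\<^esub> x \<in> H"
 using submodule_iff[OF assms(1), THEN iffD1, OF assms(2)] by auto

lemma submodule_finsum:
 assumes "module R M" and H: "submodule H R M" and "finite A" and "f \<in> A \<rightarrow> H"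
 shows "(\<Oplus>\<^bsub>M\<^esub> i\<in>A. f i) \<in> H"
proof -
 interpret M: module R M by fact
 have H': "H \<subseteq> carrier M" "\<zero>\<^bsub>M\<^esub> \<in> H" "\<And>x y. x \<in> H ==> y \<in> H ==> x \<oplus>\<^bsub>M\<^esub> y \<in> H"
  using H submodule_iff[OF assms(1)] by auto
 show ?thesis using assms(3,4)
 proof (induction A)
  case (insert a A)
  then have "f \<in> A \<rightarrow> carrier M" "f a \<in> carrier M" using H'(1) by auto
  with insert H' show ?case by simp
 qed (simp add: H')
qed

lemma submodule_minus:
 assumes "module R M" and "submodule H R M" and "x \<in> H" and "y \<in> H"
 shows "x \<ominus>\<^bsub>M\<^esub> y \<in> H"
 using module.submoduleE[OF assms(1,2)] assms(3,4) by (simp add: a_minus_def)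

lemma submodule_neg:
 assumes "module R M" and "submodule H R M" and "y \<in> H"
 shows "\<ominus>\<^bsub>M\<^esub> y \<in> H"
 using module.submoduleE[OF assms(1,2)] assms(3) by simp

lemma submodule_vimage:
 assumes M: "module R M" and N: "module R N" and h: "h \<in> module_hom R M N"
  and L: "submodule L R M" and H: "submodule H R N"
 shows "submodule {x \<in> L. h x \<in> H} R M"
proof -
 interpret M: module R M by fact
 interpret N: module R N by fact
 show ?thesis
  using L H unfolding submodule_iff[OF M] submodule_iff[OF N]
  using module_hom_add[OF h] module_hom_smult[OF h] module_hom_zero[OF M N h]
  by (auto simp: subset_iff)
qed

lemma submodule_image:
 assumes M: "module R M" and N: "module R N" and h: "h \<in> module_hom R M N"
  and L: "submodule L R M"
 shows "submodule (h ` L) R N"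
 unfolding submodule_iff[OF N]
proof (intro conjI ballI)
 have L': "L \<subseteq> carrier M" "\<zero>\<^bsub>M\<^esub> \<in> L" "\<And>x y. x \<in> L ==> y \<in> L ==> x \<oplus>\<^bsub>M\<^esub> y \<in> L"
   "\<And>r x. r \<in> carrier R ==> x \<in> L ==> r \<odot>\<^bsub>M\<^esub> x \<in> L"
  using L submodule_iff[OF M] by auto
 show "h ` L \<subseteq> carrier N" using L' module_hom_closed[OF h] by auto
 show "\<zero>\<^bsub>N\<^esub> \<in> h ` L" using L' module_hom_zero[OF M N h] by (metis image_eqI)
 show "x \<oplus>\<^bsub>N\<^esub> y \<in> h ` L" if "x \<in> h ` L" "y \<in> h ` L" for x y
  using that L' module_hom_add[OF h] by (smt (verit) image_iff subset_iff)
 show "r \<odot>\<^bsub>N\<^esub> x \<in> h ` L" if "r \<in> carrier R" "x \<in> h ` L" for x r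
  using that L' module_hom_smult[OF h] by (smt (verit) image_iff subset_iff)
qed

lemma submodule_zero:
 assumes "module R M" shows "submodule {\<zero>\<^bsub>M\<^esub>} R M"
proof -
 interpret M: module R M by fact
 show ?thesis by (simp add: submodule_iff[OF assms])
qed

lemma submodule_mono:
 assumes M: "module R M" and "submodule H R M" "submodule L R M" "H \<subseteq> L"
 shows "submodule H R (M\<lparr>carrier := L\<rparr>)"
proof -
 have "module R (M\<lparr>carrier := L\<rparr>)" using submodule.submodule_is_module[OF assms(3) M] .
 then show ?thesis using assms(2,4) by (simp add: submodule_iff[OF M] submodule_iff)
qed

context
 fixes R :: "'r ring" and M :: "('r, 'm) module" and H :: "'m set"
 assumes M: "module R M" and H: "submodule H R M"
begin

interpretation M: module R M by (rule M)

lemma submodule_abelian_subgroup: "abelian_subgroup H M"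
 using H M.abelian_group_axioms by (intro abelian_subgroupI3 additive_subgroup.intro)
  (simp_all add: submodule_def)

interpretation A: abelian_subgroup H M by (rule submodule_abelian_subgroup)

lemma coset_smult:
 assumes r: "r \<in> carrier R" and x: "x \<in> carrier M"
 shows "H <+>\<^bsub>M\<^esub> (\<lambda>x. r \<odot>\<^bsub>M\<^esub> x) ` (H +>\<^bsub>M\<^esub> x) = H +>\<^bsub>M\<^esub> (r \<odot>\<^bsub>M\<^esub> x)"
proof
 have sub: "\<And>h. h \<in> H ==> h \<in> carrier M" "\<And>h k. h \<in> H ==> k \<in> H ==> h \<oplus>\<^bsub>M\<^esub> k \<in> H"
   "\<And>h. h \<in> H ==> r \<odot>\<^bsub>M\<^esub> h \<in> H" "\<zero>\<^bsub>M\<^esub> \<in> H"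
  using H r submodule_iff[OF M] by auto
 show "H <+>\<^bsub>M\<^esub> (\<lambda>x. r \<odot>\<^bsub>M\<^esub> x) ` (H +>\<^bsub>M\<^esub> x) \<subseteq> H +>\<^bsub>M\<^esub> (r \<odot>\<^bsub>M\<^esub> x)"
 proof
  fix z assume "z \<in> H <+>\<^bsub>M\<^esub> (\<lambda>x. r \<odot>\<^bsub>M\<^esub> x) ` (H +>\<^bsub>M\<^esub> x)"
  then obtain h k where hk: "h \<in> H" "k \<in> H" "z = h \<oplus>\<^bsub>M\<^esub> r \<odot>\<^bsub>M\<^esub> (k \<oplus>\<^bsub>M\<^esub> x)"
   by (auto simp: set_add_def' a_r_coset_def')
  then have "z = (h \<oplus>\<^bsub>M\<^esub> r \<odot>\<^bsub>M\<^esub> k) \<oplus>\<^bsub>M\<^esub> r \<odot>\<^bsub>M\<^esub> x"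
   using sub r x by (simp add: M.smult_r_distr M.a_assoc)
  moreover have "h \<oplus>\<^bsub>M\<^esub> r \<odot>\<^bsub>M\<^esub> k \<in> H" using hk sub by blast
  ultimately show "z \<in> H +>\<^bsub>M\<^esub> (r \<odot>\<^bsub>M\<^esub> x)" by (auto simp: a_r_coset_def')
 qed
 show "H +>\<^bsub>M\<^esub> (r \<odot>\<^bsub>M\<^esub> x) \<subseteq> H <+>\<^bsub>M\<^esub> (\<lambda>x. r \<odot>\<^bsub>M\<^esub> x) ` (H +>\<^bsub>M\<^esub> x)"
 proof
  fix z assume "z \<in> H +>\<^bsub>M\<^esub> (r \<odot>\<^bsub>M\<^esub> x)"
  then obtain h where h: "h \<in> H" "z = h \<oplus>\<^bsub>M\<^esub> r \<odot>\<^bsub>M\<^esub> x" by (auto simp: a_r_coset_def')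
  have "r \<odot>\<^bsub>M\<^esub> x \<in> (\<lambda>x. r \<odot>\<^bsub>M\<^esub> x) ` (H +>\<^bsub>M\<^esub> x)" using A.a_rcos_self[OF x] by blast
  with h show "z \<in> H <+>\<^bsub>M\<^esub> (\<lambda>x. r \<odot>\<^bsub>M\<^esub> x) ` (H +>\<^bsub>M\<^esub> x)" unfolding set_add_def' by blast
 qed
qed

lemma quotient_carrier_iff:
 "X \<in> carrier (quotient_module M H) \<longleftrightarrow> (\<exists>x\<in>carrier M. X = H +>\<^bsub>M\<^esub> x)"
 by (auto simp: quotient_module_def A_RCOSETS_def')

lemma quotient_class_zero: "x \<in> carrier M ==> H +>\<^bsub>M\<^esub> x = \<zero>\<^bsub>quotient_module M H\<^esub> \<longleftrightarrow> x \<in> H"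
 using M.a_coset_join2[of x H] A.a_rcos_self A.a_subgroup
 by (auto simp: quotient_module_def)

lemma quotient_class_eq:
 assumes "x \<in> carrier M" "y \<in> carrier M"
 shows "H +>\<^bsub>M\<^esub> x = H +>\<^bsub>M\<^esub> y \<longleftrightarrow> x \<ominus>\<^bsub>M\<^esub> y \<in> H"
 unfolding a_minus_def A.a_rcos_module[OF assms(2,1), symmetric]
 using A.a_repr_independence'[of x y] A.a_rcos_self[OF assms(1)] assms by metis

lemma quotient_class_add:
 "x \<in> carrier M ==> y \<in> carrier M ==>
   (H +>\<^bsub>M\<^esub> x) \<oplus>\<^bsub>quotient_module M H\<^esub> (H +>\<^bsub>M\<^esub> y) = H +>\<^bsub>M\<^esub> (x \<oplus>\<^bsub>M\<^esub> y)"
 by (simp add: quotient_module_def A.a_rcos_sum)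

lemma quotient_class_smult:
 "r \<in> carrier R ==> x \<in> carrier M ==>
   r \<odot>\<^bsub>quotient_module M H\<^esub> (H +>\<^bsub>M\<^esub> x) = H +>\<^bsub>M\<^esub> (r \<odot>\<^bsub>M\<^esub> x)"
 using coset_smult by (simp add: quotient_module_def)

lemma quotient_class_closed: "x \<in> carrier M ==> H +>\<^bsub>M\<^esub> x \<in> carrier (quotient_module M H)"
 by (auto simp: quotient_carrier_iff)

lemma quotient_zero_eq: "\<zero>\<^bsub>quotient_module M H\<^esub> = H +>\<^bsub>M\<^esub> \<zero>\<^bsub>M\<^esub>"
 using quotient_class_zero[of "\<zero>\<^bsub>M\<^esub>"] H submodule_iff[OF M] by simp

lemma quotient_is_module: "module R (quotient_module M H)"
proof (rule moduleI[OF M.R.is_cring], rule abelian_groupI)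
 let ?Q = "quotient_module M H"
 note q = quotient_carrier_iff quotient_class_add quotient_class_smult quotient_zero_eq
 show "\<exists>y\<in>carrier ?Q. y \<oplus>\<^bsub>?Q\<^esub> x = \<zero>\<^bsub>?Q\<^esub>" if x: "x \<in> carrier ?Q" for x
 proof -
  obtain x' where x': "x' \<in> carrier M" "x = H +>\<^bsub>M\<^esub> x'" using x by (auto simp: q)
  then show ?thesis
   by (intro bexI[of _ "H +>\<^bsub>M\<^esub> (\<ominus>\<^bsub>M\<^esub> x')"]) (auto simp: q M.l_neg)
 qed
next
 fix x y assume "x \<in> carrier (quotient_module M H)" "y \<in> carrier (quotient_module M H)"
 then obtain x' y' where xy: "x' \<in> carrier M" "x = H +>\<^bsub>M\<^esub> x'" "y' \<in> carrier M" "y = H +>\<^bsub>M\<^esub> y'"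
  by (auto simp: quotient_carrier_iff)
 show "x \<oplus>\<^bsub>quotient_module M H\<^esub> y = y \<oplus>\<^bsub>quotient_module M H\<^esub> x"
  unfolding xy quotient_class_add[OF xy(1,3)] quotient_class_add[OF xy(3,1)] M.a_comm[OF xy(1,3)] ..
qed (auto simp: quotient_carrier_iff quotient_class_add quotient_class_smult quotient_zero_eq
   M.a_assoc M.smult_l_distr M.smult_r_distr M.smult_assoc1)

lemma quotient_proj_hom: "(\<lambda>x. H +>\<^bsub>M\<^esub> x) \<in> module_hom R M (quotient_module M H)"
 by (rule module_homI)
  (auto simp: quotient_class_closed quotient_class_add quotient_class_smult)

lemma quotient_factor:
 assumes f: "f \<in> module_hom R M N" and N: "module R N"
  and ker: "\<And>x. x \<in> H ==> f x = \<zero>\<^bsub>N\<^esub>"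
 obtains h where "h \<in> module_hom R (quotient_module M H) N"
  and "\<And>x. x \<in> carrier M ==> h (H +>\<^bsub>M\<^esub> x) = f x"
proof -
 interpret N: module R N by fact
 define h where "h X = f (SOME x. x \<in> carrier M \<and> X = H +>\<^bsub>M\<^esub> x)" for X
 have h: "h (H +>\<^bsub>M\<^esub> x) = f x" if x: "x \<in> carrier M" for x
 proof -
  define y where "y = (SOME y. y \<in> carrier M \<and> H +>\<^bsub>M\<^esub> x = H +>\<^bsub>M\<^esub> y)"
  have y: "y \<in> carrier M" "H +>\<^bsub>M\<^esub> x = H +>\<^bsub>M\<^esub> y"
   using someI[of "\<lambda>y. y \<in> carrier M \<and> H +>\<^bsub>M\<^esub> x = H +>\<^bsub>M\<^esub> y" x] x by (auto simp: y_def)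
  have "f (x \<ominus>\<^bsub>M\<^esub> y) = \<zero>\<^bsub>N\<^esub>" using y x quotient_class_eq ker by auto
  then have "f x = f y" using module_hom_minus[OF M N f x y(1)] module_hom_closed[OF f] x y
   by (simp add: module_minus_eq_zero[OF N])
  then show ?thesis by (simp add: h_def y_def)
 qed
 have "h \<in> module_hom R (quotient_module M H) N"
  by (rule module_homI) (auto simp: quotient_carrier_iff quotient_class_add quotient_class_smult h
    module_hom_closed[OF f] module_hom_add[OF f] module_hom_smult[OF f])
 then show thesis using h that by blast
qed

lemma induced_map_class:
 assumes f: "f \<in> module_hom R M N" and N: "module R N" and L: "submodule L R N"
  and HL: "\<And>x. x \<in> H ==> f x \<in> L" and x: "x \<in> carrier M"
 shows "induced_map N L f (H +>\<^bsub>M\<^esub> x) = L +>\<^bsub>N\<^esub> f x"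
proof -
 interpret N: module R N by fact
 have HM: "\<And>h. h \<in> H ==> h \<in> carrier M" and H0: "\<zero>\<^bsub>M\<^esub> \<in> H" using H submodule_iff[OF M] by auto
 have LN: "\<And>h. h \<in> L ==> h \<in> carrier N" "\<And>h k. h \<in> L ==> k \<in> L ==> h \<oplus>\<^bsub>N\<^esub> k \<in> L"
  using L submodule_iff[OF N] by auto
 have fx: "f x \<in> carrier N" using module_hom_closed[OF f x] .
 show ?thesis
 proof
  show "induced_map N L f (H +>\<^bsub>M\<^esub> x) \<subseteq> L +>\<^bsub>N\<^esub> f x"
  proof
   fix z assume "z \<in> induced_map N L f (H +>\<^bsub>M\<^esub> x)"
   then obtain l h where lh: "l \<in> L" "h \<in> H" "z = l \<oplus>\<^bsub>N\<^esub> f (h \<oplus>\<^bsub>M\<^esub> x)"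
    by (auto simp: induced_map_def set_add_def' a_r_coset_def')
   then have "z = (l \<oplus>\<^bsub>N\<^esub> f h) \<oplus>\<^bsub>N\<^esub> f x"
    using module_hom_add[OF f HM x] HL LN fx by (simp add: N.a_assoc)
   moreover have "l \<oplus>\<^bsub>N\<^esub> f h \<in> L" using lh HL LN by blast
   ultimately show "z \<in> L +>\<^bsub>N\<^esub> f x" by (auto simp: a_r_coset_def')
  qed
  show "L +>\<^bsub>N\<^esub> f x \<subseteq> induced_map N L f (H +>\<^bsub>M\<^esub> x)"
  proof
   fix z assume "z \<in> L +>\<^bsub>N\<^esub> f x"
   then obtain h where h: "h \<in> L" "z = h \<oplus>\<^bsub>N\<^esub> f x" by (auto simp: a_r_coset_def')
   have "f x \<in> f ` (H +>\<^bsub>M\<^esub> x)" using A.a_rcos_self[OF x] by blast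
   with h show "z \<in> induced_map N L f (H +>\<^bsub>M\<^esub> x)" unfolding induced_map_def set_add_def' by blast
  qed
 qed
qed

end

section \<open>Formal sums\<close>

definition single :: "('r, 'm) module => 's => 'm => 's => 'm" where
 "single M s x = (\<lambda>t. if t = s then x else \<zero>\<^bsub>M\<^esub>)"

definition lin :: "('r, 'm) module => ('r, 'n) module => ('s => 'm => 'n) => ('s => 'm) => 'n" where
 "lin M N \<phi> c = (\<Oplus>\<^bsub>N\<^esub> s\<in>supp M c. \<phi> s (c s))"

lemma formal_sums_carrier:
 "c \<in> carrier (formal_sums M S) \<longleftrightarrow>
   (\<forall>s. c s \<in> carrier M) \<and> finite (supp M c) \<and> supp M c \<subseteq> S"
 by (auto simp: formal_sums_def)

lemma formal_sums_simps [simp]: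
 "\<zero>\<^bsub>formal_sums M S\<^esub> = (\<lambda>_. \<zero>\<^bsub>M\<^esub>)"
 "c \<oplus>\<^bsub>formal_sums M S\<^esub> d = (\<lambda>s. c s \<oplus>\<^bsub>M\<^esub> d s)"
 "r \<odot>\<^bsub>formal_sums M S\<^esub> c = (\<lambda>s. r \<odot>\<^bsub>M\<^esub> c s)"
 by (simp_all add: formal_sums_def)

lemma supp_iff: "s \<in> supp M c \<longleftrightarrow> c s \<noteq> \<zero>\<^bsub>M\<^esub>"
 by (simp add: supp_def)

lemma formal_sums_closed: "c \<in> carrier (formal_sums M S) ==> c s \<in> carrier M"
 and formal_sums_finite: "c \<in> carrier (formal_sums M S) ==> finite (supp M c)"
 and formal_sums_outside: "c \<in> carrier (formal_sums M S) ==> s \<notin> S ==> c s = \<zero>\<^bsub>M\<^esub>"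
 by (auto simp: formal_sums_carrier supp_def)

lemma formal_sumsI:
 assumes "\<And>s. c s \<in> carrier M" and "finite A" and "\<And>s. s \<notin> A ==> c s = \<zero>\<^bsub>M\<^esub>"
  and "\<And>s. s \<notin> S ==> c s = \<zero>\<^bsub>M\<^esub>"
 shows "c \<in> carrier (formal_sums M S)"
proof -
 have "supp M c \<subseteq> A" using assms(3) by (auto simp: supp_def)
 then show ?thesis using assms finite_subset by (auto simp: formal_sums_carrier supp_def)
qed

lemma formal_sums_mono: "S \<subseteq> T ==> c \<in> carrier (formal_sums M S) ==> c \<in> carrier (formal_sums M T)"
 by (auto simp: formal_sums_carrier)

lemma formal_sums_add_closed:
 assumes M: "module R M" and c: "c \<in> carrier (formal_sums M S)" and d: "d \<in> carrier (formal_sums M S)"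
 shows "(\<lambda>s. c s \<oplus>\<^bsub>M\<^esub> d s) \<in> carrier (formal_sums M S)"
proof (rule formal_sumsI[of _ _ "supp M c \<union> supp M d"])
 interpret M: module R M by fact
 have cl: "c s \<in> carrier M" "d s \<in> carrier M" for s
  using c d by (simp_all add: formal_sums_carrier)
 show "c s \<oplus>\<^bsub>M\<^esub> d s \<in> carrier M" for s using cl by simp
 show "finite (supp M c \<union> supp M d)" using c d by (simp add: formal_sums_carrier)
 show "c s \<oplus>\<^bsub>M\<^esub> d s = \<zero>\<^bsub>M\<^esub>" if "s \<notin> supp M c \<union> supp M d" for s
  using that by (simp add: supp_def)
 show "c s \<oplus>\<^bsub>M\<^esub> d s = \<zero>\<^bsub>M\<^esub>" if "s \<notin> S" for s
  using formal_sums_outside[OF c that] formal_sums_outside[OF d that] by simp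
qed

lemma formal_sums_smult_closed:
 assumes M: "module R M" and c: "c \<in> carrier (formal_sums M S)" and r: "r \<in> carrier R"
 shows "(\<lambda>s. r \<odot>\<^bsub>M\<^esub> c s) \<in> carrier (formal_sums M S)"
proof (rule formal_sumsI[of _ _ "supp M c"])
 interpret M: module R M by fact
 show "r \<odot>\<^bsub>M\<^esub> c s \<in> carrier M" for s using c r by (simp add: formal_sums_carrier)
 show "finite (supp M c)" using c by (simp add: formal_sums_carrier)
 show "r \<odot>\<^bsub>M\<^esub> c s = \<zero>\<^bsub>M\<^esub>" if "s \<notin> supp M c" for s using that r by (simp add: supp_def)
 show "r \<odot>\<^bsub>M\<^esub> c s = \<zero>\<^bsub>M\<^esub>" if "s \<notin> S" for s using formal_sums_outside[OF c that] r by simp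
qed

lemma formal_sums_module:
 assumes M: "module R M"
 shows "module R (formal_sums M S)"
proof (rule moduleI)
 interpret M: module R M by fact
 show "cring R" by (rule M.R.is_cring)
 let ?F = "formal_sums M S"
 note cl = formal_sums_closed[of _ M S]
 show "abelian_group ?F"
 proof (rule abelian_groupI)
  show "\<exists>y\<in>carrier ?F. y \<oplus>\<^bsub>?F\<^esub> x = \<zero>\<^bsub>?F\<^esub>" if x: "x \<in> carrier ?F" for x
  proof
   show "(\<lambda>s. (\<ominus>\<^bsub>R\<^esub> \<one>\<^bsub>R\<^esub>) \<odot>\<^bsub>M\<^esub> x s) \<in> carrier ?F"
    by (rule formal_sums_smult_closed[OF M x]) simp
   show "(\<lambda>s. (\<ominus>\<^bsub>R\<^esub> \<one>\<^bsub>R\<^esub>) \<odot>\<^bsub>M\<^esub> x s) \<oplus>\<^bsub>?F\<^esub> x = \<zero>\<^bsub>?F\<^esub>"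
    using cl[OF x] by (simp add: M.smult_l_minus M.l_neg)
  qed
  show "\<zero>\<^bsub>?F\<^esub> \<in> carrier ?F" by (rule formal_sumsI[of _ _ "{}"]) auto
  show "x \<oplus>\<^bsub>?F\<^esub> y \<in> carrier ?F" if "x \<in> carrier ?F" "y \<in> carrier ?F" for x y
   using formal_sums_add_closed[OF M that] by simp
  show "x \<oplus>\<^bsub>?F\<^esub> y \<oplus>\<^bsub>?F\<^esub> z = x \<oplus>\<^bsub>?F\<^esub> (y \<oplus>\<^bsub>?F\<^esub> z)"
   if "x \<in> carrier ?F" "y \<in> carrier ?F" "z \<in> carrier ?F" for x y z
   using cl[OF that(1)] cl[OF that(2)] cl[OF that(3)] by (simp add: M.a_assoc)
  show "x \<oplus>\<^bsub>?F\<^esub> y = y \<oplus>\<^bsub>?F\<^esub> x" if "x \<in> carrier ?F" "y \<in> carrier ?F" for x y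
   using cl[OF that(1)] cl[OF that(2)] by (simp add: M.a_comm)
  show "\<zero>\<^bsub>?F\<^esub> \<oplus>\<^bsub>?F\<^esub> x = x" if "x \<in> carrier ?F" for x
   using cl[OF that(1)] by simp
 qed
 show "a \<odot>\<^bsub>?F\<^esub> x \<in> carrier ?F" if "a \<in> carrier R" "x \<in> carrier ?F" for a x
  using formal_sums_smult_closed[OF M that(2,1)] by simp
 show "(a \<oplus>\<^bsub>R\<^esub> b) \<odot>\<^bsub>?F\<^esub> x = a \<odot>\<^bsub>?F\<^esub> x \<oplus>\<^bsub>?F\<^esub> b \<odot>\<^bsub>?F\<^esub> x"
  if "a \<in> carrier R" "b \<in> carrier R" "x \<in> carrier ?F" for a b x
  using cl[OF that(3)] that(1,2) by (simp add: M.smult_l_distr)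
 show "(a \<otimes>\<^bsub>R\<^esub> b) \<odot>\<^bsub>?F\<^esub> x = a \<odot>\<^bsub>?F\<^esub> (b \<odot>\<^bsub>?F\<^esub> x)"
  if "a \<in> carrier R" "b \<in> carrier R" "x \<in> carrier ?F" for a b x
  using cl[OF that(3)] that(1,2) by (simp add: M.smult_assoc1)
 show "\<one>\<^bsub>R\<^esub> \<odot>\<^bsub>?F\<^esub> x = x" if "x \<in> carrier ?F" for x
  using cl[OF that] by simp
 show "a \<odot>\<^bsub>?F\<^esub> (x \<oplus>\<^bsub>?F\<^esub> y) = a \<odot>\<^bsub>?F\<^esub> x \<oplus>\<^bsub>?F\<^esub> a \<odot>\<^bsub>?F\<^esub> y"
  if "a \<in> carrier R" "x \<in> carrier ?F" "y \<in> carrier ?F" for a x y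
  using cl[OF that(2)] cl[OF that(3)] that(1) by (simp add: M.smult_r_distr)
qed

lemma ring_module_simps [simp]:
 "carrier (ring_module R) = carrier R" "\<zero>\<^bsub>ring_module R\<^esub> = \<zero>\<^bsub>R\<^esub>"
 "x \<oplus>\<^bsub>ring_module R\<^esub> y = x \<oplus>\<^bsub>R\<^esub> y" "x \<odot>\<^bsub>ring_module R\<^esub> y = x \<otimes>\<^bsub>R\<^esub> y"
 by (simp_all add: ring_module_def ring.extend_def)

lemma ring_module_module:
 assumes "cring R" shows "module R (ring_module R)"
proof -
 interpret R: cring R by fact
 show ?thesis
 proof (rule moduleI[OF assms], rule abelian_groupI)
  show "\<exists>y\<in>carrier (ring_module R). y \<oplus>\<^bsub>ring_module R\<^esub> x = \<zero>\<^bsub>ring_module R\<^esub>"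
   if "x \<in> carrier (ring_module R)" for x
   using that R.l_neg by (intro bexI[of _ "\<ominus>\<^bsub>R\<^esub> x"]) auto
 qed (auto simp: R.a_ac R.l_distr R.r_distr R.m_assoc)
qed

lemma ring_module_finsum: "(\<Oplus>\<^bsub>ring_module R\<^esub> i\<in>A. f i) = (\<Oplus>\<^bsub>R\<^esub> i\<in>A. f i)"
 unfolding finsum_def finprod_def by (simp add: ring_module_def ring.extend_def)

lemma single_closed:
 "module R M ==> s \<in> S ==> x \<in> carrier M ==> single M s x \<in> carrier (formal_sums M S)"
 by (rule formal_sumsI[of _ _ "{s}"])
  (auto simp: single_def abelian_monoid.zero_closed abelian_group_def module_def)

lemma eval_hom: "(\<lambda>c. c t) \<in> module_hom R (formal_sums M S) M"
 by (rule module_homI) (auto simp: formal_sums_carrier)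

lemma finsum_apply:
 fixes R :: "'r ring"
 assumes M: "module R M" and "finite A" and "f \<in> A \<rightarrow> carrier (formal_sums M S)"
 shows "(\<Oplus>\<^bsub>formal_sums M S\<^esub> i\<in>A. f i) t = (\<Oplus>\<^bsub>M\<^esub> i\<in>A. f i t)"
 by (rule module_hom_finsum[OF formal_sums_module[OF M] M eval_hom assms(2,3)])

lemma formal_sums_induct [consumes 2, case_names zero add]:
 assumes M: "module R M" and c: "c \<in> carrier (formal_sums M S)"
  and zero: "P (\<lambda>_. \<zero>\<^bsub>M\<^esub>)"
  and add: "\<And>s x c. s \<in> S ==> x \<in> carrier M ==> c \<in> carrier (formal_sums M S) ==> P c ==>
    P (\<lambda>t. single M s x t \<oplus>\<^bsub>M\<^esub> c t)"
 shows "P c"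
proof -
 interpret M: module R M by fact
 have "P c" if "finite A" "supp M c = A" "c \<in> carrier (formal_sums M S)" for A c
  using that
 proof (induction A arbitrary: c)
  case empty
  then have "c = (\<lambda>_. \<zero>\<^bsub>M\<^esub>)" by (auto simp: supp_def)
  then show ?case using zero by simp
 next
  case (insert a A)
  have cl: "c s \<in> carrier M" for s using insert.prems by (auto simp: formal_sums_carrier)
  have a: "a \<in> S" using insert.prems by (auto simp: formal_sums_carrier)
  define d where "d = (\<lambda>t. if t = a then \<zero>\<^bsub>M\<^esub> else c t)"
  have "supp M d = A" using insert.hyps(2) insert.prems(1) by (auto simp: supp_def d_def)
  moreover have d: "d \<in> carrier (formal_sums M S)"
   using cl \<open>supp M d = A\<close> insert.hyps insert.prems by (auto simp: formal_sums_carrier d_def)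
  ultimately have "P d" using insert.IH by blast
  from add[OF a cl[of a] d this] have "P (\<lambda>t. single M a (c a) t \<oplus>\<^bsub>M\<^esub> d t)" .
  moreover have "(\<lambda>t. single M a (c a) t \<oplus>\<^bsub>M\<^esub> d t) = c"
   using cl by (auto simp: single_def d_def)
  ultimately show ?case by simp
 qed
 then show ?thesis using c by (auto simp: formal_sums_carrier)
qed

lemma formal_sums_hom_eqI:
 assumes M: "module R M" and N: "module R N"
  and f: "f \<in> module_hom R (formal_sums M S) N" and g: "g \<in> module_hom R (formal_sums M S) N"
  and eq: "\<And>s x. s \<in> S ==> x \<in> carrier M ==> f (single M s x) = g (single M s x)"
  and c: "c \<in> carrier (formal_sums M S)"
 shows "f c = g c"
 using M c
proof (induction rule: formal_sums_induct)
 case zero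
 show ?case using module_hom_zero[OF formal_sums_module[OF M] N f]
   module_hom_zero[OF formal_sums_module[OF M] N g] by simp
next
 case (add s x c)
 then show ?case
  using module_hom_add[OF f single_closed[OF M add(1,2)] add(3)]
   module_hom_add[OF g single_closed[OF M add(1,2)] add(3)] eq[OF add(1,2)] by simp
qed

context
 fixes R :: "'r ring" and M :: "('r, 'm) module" and N :: "('r, 'n) module" and S :: "'s set"
  and \<phi> :: "'s => 'm => 'n"
 assumes M: "module R M" and N: "module R N"
  and \<phi>: "\<And>s. s \<in> S ==> \<phi> s \<in> module_hom R M N"
begin

interpretation M: module R M by (rule M)
interpretation N: module R N by (rule N)

lemma lin_superset:
 assumes c: "c \<in> carrier (formal_sums M S)" and A: "finite A" "supp M c \<subseteq> A" "A \<subseteq> S"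
 shows "lin M N \<phi> c = (\<Oplus>\<^bsub>N\<^esub> s\<in>A. \<phi> s (c s))"
 unfolding lin_def
proof (rule N.add.finprod_mono_neutral_cong_left[OF A(1,2)])
 show "\<phi> i (c i) = \<zero>\<^bsub>N\<^esub>" if "i \<in> A - supp M c" for i
  using that A \<phi>[of i] module_hom_zero[OF M N] by (auto simp: supp_def)
 show "(\<lambda>s. \<phi> s (c s)) \<in> A \<rightarrow> carrier N"
  using A \<phi> module_hom_closed formal_sums_closed[OF c] by (fastforce simp: Pi_def)
qed simp

lemma lin_hom: "lin M N \<phi> \<in> module_hom R (formal_sums M S) N"
proof (rule module_homI)
 let ?F = "formal_sums M S"
 have P: "(\<lambda>s. \<phi> s (c s)) \<in> A \<rightarrow> carrier N" if "c \<in> carrier ?F" "A \<subseteq> S" for A c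
  using that \<phi> module_hom_closed formal_sums_closed[OF that(1)] by (fastforce simp: Pi_def)
 show "lin M N \<phi> c \<in> carrier N" if c: "c \<in> carrier ?F" for c
  unfolding lin_def using c P[OF c, of "supp M c"] by (auto simp: formal_sums_carrier intro!: N.finsum_closed)
 show "lin M N \<phi> (c \<oplus>\<^bsub>?F\<^esub> d) = lin M N \<phi> c \<oplus>\<^bsub>N\<^esub> lin M N \<phi> d"
  if c: "c \<in> carrier ?F" and d: "d \<in> carrier ?F" for c d
 proof -
  let ?A = "supp M c \<union> supp M d"
  have A: "finite ?A" "?A \<subseteq> S" using c d by (auto simp: formal_sums_carrier)
  have "supp M (c \<oplus>\<^bsub>?F\<^esub> d) \<subseteq> ?A" by (auto simp: supp_def)
  then have "lin M N \<phi> (c \<oplus>\<^bsub>?F\<^esub> d) = (\<Oplus>\<^bsub>N\<^esub> s\<in>?A. \<phi> s (c s \<oplus>\<^bsub>M\<^esub> d s))"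
   using lin_superset[of "c \<oplus>\<^bsub>?F\<^esub> d" ?A] A formal_sums_add_closed[OF M c d] by simp
  also have "\<dots> = (\<Oplus>\<^bsub>N\<^esub> s\<in>?A. \<phi> s (c s) \<oplus>\<^bsub>N\<^esub> \<phi> s (d s))"
   using A(2) \<phi> P[OF c A(2)] P[OF d A(2)] formal_sums_closed[OF c] formal_sums_closed[OF d]
   by (intro N.finsum_cong') (auto intro!: module_hom_add[OF \<phi>])
  also have "\<dots> = (\<Oplus>\<^bsub>N\<^esub> s\<in>?A. \<phi> s (c s)) \<oplus>\<^bsub>N\<^esub> (\<Oplus>\<^bsub>N\<^esub> s\<in>?A. \<phi> s (d s))"
   by (rule N.finsum_addf[OF P[OF c A(2)] P[OF d A(2)]])
  finally show ?thesis using lin_superset[OF c A(1) _ A(2)] lin_superset[OF d A(1) _ A(2)] by simp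
 qed
 show "lin M N \<phi> (r \<odot>\<^bsub>?F\<^esub> c) = r \<odot>\<^bsub>N\<^esub> lin M N \<phi> c"
  if r: "r \<in> carrier R" and c: "c \<in> carrier ?F" for r c
 proof -
  let ?A = "supp M c"
  have A: "finite ?A" "?A \<subseteq> S" using c by (auto simp: formal_sums_carrier)
  have "supp M (r \<odot>\<^bsub>?F\<^esub> c) \<subseteq> ?A" using r by (auto simp: supp_def)
  then have "lin M N \<phi> (r \<odot>\<^bsub>?F\<^esub> c) = (\<Oplus>\<^bsub>N\<^esub> s\<in>?A. \<phi> s (r \<odot>\<^bsub>M\<^esub> c s))"
   using lin_superset[of "r \<odot>\<^bsub>?F\<^esub> c" ?A] A formal_sums_smult_closed[OF M c r] by simp
  also have "\<dots> = (\<Oplus>\<^bsub>N\<^esub> s\<in>?A. r \<odot>\<^bsub>N\<^esub> \<phi> s (c s))"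
   using A(2) \<phi> P[OF c A(2)] formal_sums_closed[OF c] r
   by (intro N.finsum_cong') (auto intro!: module_hom_smult[OF \<phi>])
  also have "\<dots> = r \<odot>\<^bsub>N\<^esub> (\<Oplus>\<^bsub>N\<^esub> s\<in>?A. \<phi> s (c s))"
   by (rule N.finsum_smult_ldistr[OF A(1) r P[OF c A(2)], symmetric])
  finally show ?thesis by (simp add: lin_def)
 qed
qed

lemma lin_single:
 assumes s: "s \<in> S" and x: "x \<in> carrier M"
 shows "lin M N \<phi> (single M s x) = \<phi> s x"
proof -
 have "supp M (single M s x) \<subseteq> {s}" by (auto simp: supp_def single_def)
 then have "lin M N \<phi> (single M s x) = (\<Oplus>\<^bsub>N\<^esub> t\<in>{s}. \<phi> t (single M s x t))"
  by (intro lin_superset single_closed[OF M s x]) (use s in auto)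
 moreover have "\<phi> s x \<in> carrier N" using \<phi>[OF s] x module_hom_closed by fast
 ultimately show ?thesis by (simp add: single_def)
qed

lemma lin_in_submodule:
 assumes H: "submodule H R N" and c: "c \<in> carrier (formal_sums M S)"
  and "\<And>s. s \<in> supp M c ==> \<phi> s (c s) \<in> H"
 shows "lin M N \<phi> c \<in> H"
 unfolding lin_def using c assms(3)
 by (intro submodule_finsum[OF N H]) (auto simp: formal_sums_carrier)

end

section \<open>Chain complexes and quasi-isomorphisms\<close>

text \<open>
  A complex is one module with a family of submodules, its graded pieces, and one endomorphism. Chain
  maps are then single homomorphisms, and the differential of a tensor product is one linear extension
  instead of a family indexed by degrees. The pieces need not span the ambient module.
\<close>

record ('r, 'm) chain_cpx =
 amb :: "('r, 'm) module"
 grd :: "int => 'm set"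
 dif :: "'m => 'm"

definition chain_cpx :: "'r ring => ('r, 'm) chain_cpx => bool" where
 "chain_cpx R K \<longleftrightarrow> module R (amb K) \<and> (\<forall>n. submodule (grd K n) R (amb K)) \<and>
   dif K \<in> module_hom R (amb K) (amb K) \<and> (\<forall>n. \<forall>x\<in>grd K n. dif K x \<in> grd K (n - 1)) \<and>
   (\<forall>x\<in>carrier (amb K). dif K (dif K x) = \<zero>\<^bsub>amb K\<^esub>)"

lemma chain_cpxD:
 assumes "chain_cpx R K"
 shows "module R (amb K)" "submodule (grd K n) R (amb K)" "dif K \<in> module_hom R (amb K) (amb K)"
  "x \<in> grd K n ==> dif K x \<in> grd K (n - 1)"
  "x \<in> carrier (amb K) ==> dif K (dif K x) = \<zero>\<^bsub>amb K\<^esub>"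
 using assms by (auto simp: chain_cpx_def)

lemma grd_carrier:
 assumes "chain_cpx R K" and "x \<in> grd K n"
 shows "x \<in> carrier (amb K)"
 using submodule_iff[OF chain_cpxD(1)[OF assms(1)], THEN iffD1, OF chain_cpxD(2)[OF assms(1)], of n] assms(2)
 by auto

lemma grd_closed:
 assumes K: "chain_cpx R K"
 shows "\<zero>\<^bsub>amb K\<^esub> \<in> grd K n"
  "x \<in> grd K n ==> y \<in> grd K n ==> x \<oplus>\<^bsub>amb K\<^esub> y \<in> grd K n"
  "r \<in> carrier R ==> x \<in> grd K n ==> r \<odot>\<^bsub>amb K\<^esub> x \<in> grd K n"
  "x \<in> grd K n ==> y \<in> grd K n ==> x \<ominus>\<^bsub>amb K\<^esub> y \<in> grd K n"
 using chain_cpxD(2)[OF K, of n] submodule_iff[OF chain_cpxD(1)[OF K], of "grd K n"]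
  submodule_minus[OF chain_cpxD(1,2)[OF K]] by auto

definition cycles :: "('r, 'm) chain_cpx => int => 'm set" where
 "cycles K n = {x \<in> grd K n. dif K x = \<zero>\<^bsub>amb K\<^esub>}"

definition boundaries :: "('r, 'm) chain_cpx => int => 'm set" where
 "boundaries K n = dif K ` grd K (n + 1)"

text \<open>
  Homology is given up to isomorphism, by exhibiting the module as cycles modulo boundaries. In this form
  it is transported along quasi-isomorphisms without forming quotients.
\<close>

definition has_homology ::
  "'r ring => ('r, 'm) chain_cpx => int => ('r, 'x) module => bool" where
 "has_homology R K n X \<longleftrightarrow> (\<exists>\<theta>\<in>module_hom R ((amb K)\<lparr>carrier := cycles K n\<rparr>) X.
   \<theta> ` cycles K n = carrier X \<and> (\<forall>z\<in>cycles K n. \<theta> z = \<zero>\<^bsub>X\<^esub> \<longleftrightarrow> z \<in> boundaries K n))"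

lemma cycles_submodule:
 assumes K: "chain_cpx R K" shows "submodule (cycles K n) R (amb K)"
 using submodule_vimage[OF chain_cpxD(1)[OF K] chain_cpxD(1)[OF K] chain_cpxD(3)[OF K] chain_cpxD(2)[OF K]
  submodule_zero[OF chain_cpxD(1)[OF K]]]
 by (simp add: cycles_def)

lemma boundaries_submodule:
 assumes K: "chain_cpx R K" shows "submodule (boundaries K n) R (amb K)"
 using submodule_image[OF chain_cpxD(1)[OF K] chain_cpxD(1)[OF K] chain_cpxD(3)[OF K] chain_cpxD(2)[OF K]]
 by (simp add: boundaries_def)

lemma boundaries_subset_cycles:
 assumes K: "chain_cpx R K" shows "boundaries K n \<subseteq> cycles K n"
proof
 fix x assume "x \<in> boundaries K n"
 then obtain y where y: "y \<in> grd K (n + 1)" "x = dif K y" by (auto simp: boundaries_def)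
 then show "x \<in> cycles K n"
  using chain_cpxD(4)[OF K y(1)] chain_cpxD(5)[OF K grd_carrier[OF K y(1)]] by (simp add: cycles_def)
qed

text \<open>
  The last clause says that the mapping cone of \<open>f\<close> is acyclic. This is equivalent to \<open>f\<close> being
  bijective on homology, but as a lifting property of elements it can be attacked one basis element at
  a time in a tensor product.
\<close>

definition quasi_iso ::
  "'r ring => ('r, 'm) chain_cpx => ('r, 'n) chain_cpx => ('m => 'n) => bool" where
 "quasi_iso R K L f \<longleftrightarrow> chain_cpx R K \<and> chain_cpx R L \<and> f \<in> module_hom R (amb K) (amb L) \<and>
   (\<forall>n. \<forall>x\<in>grd K n. f x \<in> grd L n) \<and> (\<forall>x\<in>carrier (amb K). f (dif K x) = dif L (f x)) \<and>
   (\<forall>n. \<forall>q\<in>grd K (n - 1). \<forall>l\<in>grd L n. dif K q = \<zero>\<^bsub>amb K\<^esub> \<longrightarrow> dif L l = f q \<longrightarrow>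
    (\<exists>q'\<in>grd K n. \<exists>l'\<in>grd L (n + 1). dif K q' = q \<and> l = f q' \<oplus>\<^bsub>amb L\<^esub> dif L l'))"

lemma quasi_isoD:
 assumes "quasi_iso R K L f"
 shows "chain_cpx R K" "chain_cpx R L" "f \<in> module_hom R (amb K) (amb L)"
  "x \<in> grd K n ==> f x \<in> grd L n" "x \<in> carrier (amb K) ==> f (dif K x) = dif L (f x)"
 using assms unfolding quasi_iso_def by blast+

lemma quasi_iso_lift:
 assumes "quasi_iso R K L f" "q \<in> grd K (n - 1)" "l \<in> grd L n" "dif K q = \<zero>\<^bsub>amb K\<^esub>" "dif L l = f q"
 obtains q' l' where "q' \<in> grd K n" "l' \<in> grd L (n + 1)" "dif K q' = q" "l = f q' \<oplus>\<^bsub>amb L\<^esub> dif L l'"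
 using assms unfolding quasi_iso_def by blast

text \<open>
  The isomorphism sends \<open>f z\<close> to \<open>g z\<close>; equality of the kernels makes it well defined and injective.
\<close>

lemma module_isomorphicI_same_kernel:
 assumes Z: "module R Z" and X: "module R X" and Y: "module R Y"
  and f: "f \<in> module_hom R Z X" and g: "g \<in> module_hom R Z Y"
  and fs: "f ` carrier Z = carrier X" and gs: "g ` carrier Z = carrier Y"
  and ker: "\<And>z. z \<in> carrier Z ==> f z = \<zero>\<^bsub>X\<^esub> \<longleftrightarrow> g z = \<zero>\<^bsub>Y\<^esub>"
 shows "module_isomorphic R X Y"
proof -
 interpret Z: module R Z by fact
 have eq: "f z = f z' \<longleftrightarrow> g z = g z'" if "z \<in> carrier Z" "z' \<in> carrier Z" for z z'
  using ker[of "z \<ominus>\<^bsub>Z\<^esub> z'"] that module_hom_minus[OF Z X f that] module_hom_minus[OF Z Y g that]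
   module_minus_eq_zero[OF X] module_minus_eq_zero[OF Y] module_hom_closed[OF f] module_hom_closed[OF g]
  by simp
 define s where "s x = (SOME z. z \<in> carrier Z \<and> f z = x)" for x
 have s: "s x \<in> carrier Z \<and> f (s x) = x" if "x \<in> carrier X" for x
  unfolding s_def by (rule someI_ex) (use that fs[symmetric] in auto)
 define h where "h x = g (s x)" for x
 have h: "h (f z) = g z" if "z \<in> carrier Z" for z
  unfolding h_def using eq s[OF module_hom_closed[OF f that]] that by blast
 have "h \<in> module_hom R X Y"
 proof (rule module_homI)
  show "h x \<in> carrier Y" if "x \<in> carrier X" for x
   using s[OF that] module_hom_closed[OF g] by (simp add: h_def)
  show "h (x \<oplus>\<^bsub>X\<^esub> y) = h x \<oplus>\<^bsub>Y\<^esub> h y" if "x \<in> carrier X" "y \<in> carrier X" for x y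
   using h[of "s x \<oplus>\<^bsub>Z\<^esub> s y"] s[OF that(1)] s[OF that(2)] module_hom_add[OF f] module_hom_add[OF g]
   by (simp add: h_def)
  show "h (r \<odot>\<^bsub>X\<^esub> x) = r \<odot>\<^bsub>Y\<^esub> h x" if "r \<in> carrier R" "x \<in> carrier X" for r x
   using h[of "r \<odot>\<^bsub>Z\<^esub> s x"] s[OF that(2)] that(1) module_hom_smult[OF f] module_hom_smult[OF g]
   by (simp add: h_def)
 qed
 moreover have "bij_betw h (carrier X) (carrier Y)"
 proof (rule bij_betw_imageI)
  show "inj_on h (carrier X)"
   unfolding inj_on_def fs[symmetric] using h eq by auto
  show "h ` carrier X = carrier Y"
   unfolding fs[symmetric] gs[symmetric] using h by (auto simp: image_image intro!: image_cong)
 qed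
 ultimately show ?thesis unfolding module_isomorphic_def by blast
qed

lemma has_homology_unique:
 assumes K: "chain_cpx R K" and X: "module R X" and Y: "module R Y"
  and "has_homology R K n X" "has_homology R K n Y"
 shows "module_isomorphic R X Y"
proof -
 have Z: "module R ((amb K)\<lparr>carrier := cycles K n\<rparr>)"
  using submodule.submodule_is_module[OF cycles_submodule[OF K] chain_cpxD(1)[OF K]] .
 from assms(4,5) show ?thesis unfolding has_homology_def
  using module_isomorphicI_same_kernel[OF Z X Y] by auto
qed

text \<open>
  Given homology classes for the cycles of \<open>L\<close>, precompose with \<open>f\<close>. Given classes for the cycles of
  \<open>K\<close>, lifting \<open>(0, l)\<close> for a cycle \<open>l\<close> of \<open>L\<close> yields a cycle \<open>z\<close> of \<open>K\<close> such that \<open>l - f z\<close> is a boundary;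
  \<open>l\<close> gets the class of \<open>z\<close>, which is unique because \<open>f\<close> reflects boundaries.
\<close>

lemma has_homology_quasi_iso:
 assumes f: "quasi_iso R K L f" and X: "module R X"
 shows "has_homology R K n X \<longleftrightarrow> has_homology R L n X"
proof -
 note D = quasi_isoD[OF f]
 note K = D(1) and L = D(2) and fh = D(3)
 interpret K: module R "amb K" by (rule chain_cpxD(1)[OF K])
 interpret L: module R "amb L" by (rule chain_cpxD(1)[OF L])
 interpret X: module R X by fact
 let ?ZK = "(amb K)\<lparr>carrier := cycles K n\<rparr>" and ?ZL = "(amb L)\<lparr>carrier := cycles L n\<rparr>"
 have ZK: "module R ?ZK" and ZL: "module R ?ZL"
  using submodule.submodule_is_module cycles_submodule K L chain_cpxD(1) by blast+
 have zcK: "x \<in> carrier (amb K)" if "x \<in> cycles K n" for x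
  using that grd_carrier[OF K] by (auto simp: cycles_def)
 have zcL: "x \<in> carrier (amb L)" if "x \<in> cycles L n" for x
  using that grd_carrier[OF L] by (auto simp: cycles_def)
 note cK = submodule_iff[OF chain_cpxD(1)[OF K], THEN iffD1, OF cycles_submodule[OF K, of n]]
 note cL = submodule_iff[OF chain_cpxD(1)[OF L], THEN iffD1, OF cycles_submodule[OF L, of n]]
 note bL = submodule_iff[OF chain_cpxD(1)[OF L], THEN iffD1, OF boundaries_submodule[OF L, of n]]
 have fz: "f z \<in> cycles L n" if "z \<in> cycles K n" for z
  using that D(4) D(5)[OF zcK[OF that]] module_hom_zero[OF chain_cpxD(1)[OF K] chain_cpxD(1)[OF L] fh]
  by (auto simp: cycles_def)
 have fb: "f z \<in> boundaries L n \<longleftrightarrow> z \<in> boundaries K n" if z: "z \<in> cycles K n" for z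
 proof
  assume "f z \<in> boundaries L n"
  then obtain l where "l \<in> grd L (n + 1)" "dif L l = f z" by (auto simp: boundaries_def)
  then obtain q where "q \<in> grd K (n + 1)" "dif K q = z"
   using quasi_iso_lift[OF f, of z "n + 1" l] z by (auto simp: cycles_def)
  then show "z \<in> boundaries K n" by (auto simp: boundaries_def)
 next
  assume "z \<in> boundaries K n"
  then obtain y where "y \<in> grd K (n + 1)" "z = dif K y" by (auto simp: boundaries_def)
  then show "f z \<in> boundaries L n"
   using D(4,5) grd_carrier[OF K] by (auto simp: boundaries_def)
 qed
 have fs: "\<exists>z\<in>cycles K n. l \<ominus>\<^bsub>amb L\<^esub> f z \<in> boundaries L n" if l: "l \<in> cycles L n" for l
 proof -
  have "dif L l = f \<zero>\<^bsub>amb K\<^esub>" "dif K \<zero>\<^bsub>amb K\<^esub> = \<zero>\<^bsub>amb K\<^esub>"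
   using l module_hom_zero[OF chain_cpxD(1)[OF K] chain_cpxD(1)[OF L] fh]
    module_hom_zero[OF chain_cpxD(1)[OF K] chain_cpxD(1)[OF K] chain_cpxD(3)[OF K]]
   by (auto simp: cycles_def)
  then obtain q l' where q: "q \<in> grd K n" "l' \<in> grd L (n + 1)" "dif K q = \<zero>\<^bsub>amb K\<^esub>"
    "l = f q \<oplus>\<^bsub>amb L\<^esub> dif L l'"
   using quasi_iso_lift[OF f grd_closed(1)[OF K], of l n] l by (auto simp: cycles_def)
  have c: "f q \<in> carrier (amb L)" "dif L l' \<in> carrier (amb L)"
   using q grd_carrier[OF L D(4)[OF q(1)]] module_hom_closed[OF chain_cpxD(3)[OF L]] grd_carrier[OF L]
   by auto
  have "l \<ominus>\<^bsub>amb L\<^esub> f q = dif L l'"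
   using c unfolding q(4) a_minus_def by (simp add: L.a_comm[of "f q"] L.a_assoc L.r_neg)
  then show ?thesis using q by (auto simp: cycles_def boundaries_def)
 qed
 show ?thesis
 proof
  assume "has_homology R L n X"
  then obtain \<theta> where \<theta>: "\<theta> \<in> module_hom R ?ZL X" "\<theta> ` cycles L n = carrier X"
    "\<And>z. z \<in> cycles L n ==> \<theta> z = \<zero>\<^bsub>X\<^esub> \<longleftrightarrow> z \<in> boundaries L n"
   unfolding has_homology_def by auto
  have "f \<in> module_hom R ?ZK ?ZL"
   by (rule module_homI) (auto simp: fz zcK module_hom_add[OF fh] module_hom_smult[OF fh])
  from module_hom_comp[OF this \<theta>(1)] have "(\<lambda>z. \<theta> (f z)) \<in> module_hom R ?ZK X" .
  moreover have "(\<lambda>z. \<theta> (f z)) ` cycles K n = carrier X"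
  proof
   show "(\<lambda>z. \<theta> (f z)) ` cycles K n \<subseteq> carrier X" using \<theta>(2) fz by auto
   show "carrier X \<subseteq> (\<lambda>z. \<theta> (f z)) ` cycles K n"
   proof
    fix x assume "x \<in> carrier X"
    then obtain l where l: "l \<in> cycles L n" "x = \<theta> l" using \<theta>(2) by auto
    then obtain z where z: "z \<in> cycles K n" "l \<ominus>\<^bsub>amb L\<^esub> f z \<in> boundaries L n" using fs by blast
    have b: "l \<ominus>\<^bsub>amb L\<^esub> f z \<in> cycles L n" using z boundaries_subset_cycles[OF L] by blast
    have "l = (l \<ominus>\<^bsub>amb L\<^esub> f z) \<oplus>\<^bsub>amb L\<^esub> f z"
     using zcL l fz[OF z(1)] by (simp add: a_minus_def L.a_assoc L.l_neg)
    then have "\<theta> l = \<theta> (l \<ominus>\<^bsub>amb L\<^esub> f z) \<oplus>\<^bsub>X\<^esub> \<theta> (f z)"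
     using module_hom_add[OF \<theta>(1), of "l \<ominus>\<^bsub>amb L\<^esub> f z" "f z"] b fz[OF z(1)] by simp
    also have "\<dots> = \<theta> (f z)"
     using z(2) \<theta>(3)[OF b] module_hom_closed[OF \<theta>(1), of "f z"] fz[OF z(1)] by simp
    finally show "x \<in> (\<lambda>z. \<theta> (f z)) ` cycles K n" using z l by auto
   qed
  qed
  moreover have "\<theta> (f z) = \<zero>\<^bsub>X\<^esub> \<longleftrightarrow> z \<in> boundaries K n" if "z \<in> cycles K n" for z
   using \<theta>(3)[OF fz[OF that]] fb[OF that] by simp
  ultimately show "has_homology R K n X" unfolding has_homology_def by blast
 next
  assume "has_homology R K n X"
  then obtain \<theta> where \<theta>: "\<theta> \<in> module_hom R ?ZK X" "\<theta> ` cycles K n = carrier X"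
    "\<And>z. z \<in> cycles K n ==> \<theta> z = \<zero>\<^bsub>X\<^esub> \<longleftrightarrow> z \<in> boundaries K n"
   unfolding has_homology_def by auto
  define good where "good l z \<longleftrightarrow> z \<in> cycles K n \<and> l \<ominus>\<^bsub>amb L\<^esub> f z \<in> boundaries L n" for l z
  have th: "\<theta> z = \<theta> z'" if "good l z" "good l z'" and l: "l \<in> cycles L n" for l z z'
  proof -
   have z: "z \<in> cycles K n" "z' \<in> cycles K n" "z \<ominus>\<^bsub>amb K\<^esub> z' \<in> cycles K n"
    using that submodule_minus[OF chain_cpxD(1)[OF K] cycles_submodule[OF K]] by (auto simp: good_def)
   have "(l \<ominus>\<^bsub>amb L\<^esub> f z') \<ominus>\<^bsub>amb L\<^esub> (l \<ominus>\<^bsub>amb L\<^esub> f z) \<in> boundaries L n"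
    using that submodule_minus[OF chain_cpxD(1)[OF L] boundaries_submodule[OF L]] by (auto simp: good_def)
   moreover have "(l \<ominus>\<^bsub>amb L\<^esub> f z') \<ominus>\<^bsub>amb L\<^esub> (l \<ominus>\<^bsub>amb L\<^esub> f z) = f z \<ominus>\<^bsub>amb L\<^esub> f z'"
    using zcL[OF l] zcL[OF fz[OF z(1)]] zcL[OF fz[OF z(2)]]
    by (simp add: a_minus_def L.minus_add L.a_ac L.r_neg2)
   ultimately have "f (z \<ominus>\<^bsub>amb K\<^esub> z') \<in> boundaries L n"
    using module_hom_minus[OF chain_cpxD(1)[OF K] chain_cpxD(1)[OF L] fh] zcK z by simp
   then have "\<theta> (z \<ominus>\<^bsub>amb K\<^esub> z') = \<zero>\<^bsub>X\<^esub>" using fb \<theta>(3) z by blast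
   moreover have "z = (z \<ominus>\<^bsub>amb K\<^esub> z') \<oplus>\<^bsub>amb K\<^esub> z'"
    using zcK z by (simp add: a_minus_def K.a_assoc K.l_neg)
   then have "\<theta> z = \<theta> (z \<ominus>\<^bsub>amb K\<^esub> z') \<oplus>\<^bsub>X\<^esub> \<theta> z'"
    using module_hom_add[OF \<theta>(1), of "z \<ominus>\<^bsub>amb K\<^esub> z'" z'] z by simp
   ultimately show ?thesis using module_hom_closed[OF \<theta>(1), of z'] z by simp
  qed
  define \<eta> where "\<eta> l = \<theta> (SOME z. good l z)" for l
  have \<eta>: "\<eta> l = \<theta> z" if "good l z" "l \<in> cycles L n" for l z
   unfolding \<eta>_def using someI[of "good l", OF that(1)] th that by blast
  have ex: "\<exists>z. good l z" if "l \<in> cycles L n" for l using fs[OF that] by (auto simp: good_def)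
  have gf: "good (f z) z" if "z \<in> cycles K n" for z
   using that bL zcL[OF fz[OF that]] by (simp add: good_def a_minus_def L.r_neg)
  have gadd: "good (l \<oplus>\<^bsub>amb L\<^esub> l') (z \<oplus>\<^bsub>amb K\<^esub> z')"
   if "good l z" "good l' z'" "l \<in> cycles L n" "l' \<in> cycles L n" for l l' z z'
  proof -
   have z: "z \<in> cycles K n" "z' \<in> cycles K n" using that by (auto simp: good_def)
   have "(l \<oplus>\<^bsub>amb L\<^esub> l') \<ominus>\<^bsub>amb L\<^esub> f (z \<oplus>\<^bsub>amb K\<^esub> z') = (l \<ominus>\<^bsub>amb L\<^esub> f z) \<oplus>\<^bsub>amb L\<^esub> (l' \<ominus>\<^bsub>amb L\<^esub> f z')"
    using zcL[OF that(3)] zcL[OF that(4)] zcL[OF fz[OF z(1)]] zcL[OF fz[OF z(2)]] zcK z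
    by (simp add: module_hom_add[OF fh] a_minus_def L.minus_add L.a_ac)
   then show ?thesis using that cK bL by (auto simp: good_def)
  qed
  have gsm: "good (r \<odot>\<^bsub>amb L\<^esub> l) (r \<odot>\<^bsub>amb K\<^esub> z)"
   if "good l z" "l \<in> cycles L n" "r \<in> carrier R" for l z r
  proof -
   have z: "z \<in> cycles K n" using that by (auto simp: good_def)
   have "r \<odot>\<^bsub>amb L\<^esub> l \<ominus>\<^bsub>amb L\<^esub> f (r \<odot>\<^bsub>amb K\<^esub> z) = r \<odot>\<^bsub>amb L\<^esub> (l \<ominus>\<^bsub>amb L\<^esub> f z)"
    using zcL[OF that(2)] zcL[OF fz[OF z(1)]] zcK z that(3)
    by (simp add: module_hom_smult[OF fh] a_minus_def L.smult_r_distr L.smult_r_minus)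
   then show ?thesis using that cK bL by (auto simp: good_def)
  qed
  have "\<eta> \<in> module_hom R ?ZL X"
  proof (rule module_homI)
   fix l assume "l \<in> carrier ?ZL"
   then have l: "l \<in> cycles L n" by simp
   then obtain z where z: "good l z" using ex by blast
   then show "\<eta> l \<in> carrier X" using \<eta>[OF z l] \<theta>(2) by (auto simp: good_def)
   show "\<eta> (r \<odot>\<^bsub>?ZL\<^esub> l) = r \<odot>\<^bsub>X\<^esub> \<eta> l" if "r \<in> carrier R" for r
    using \<eta>[OF z l] \<eta>[OF gsm[OF z l that]] cL l that module_hom_smult[OF \<theta>(1) that] z
    by (auto simp: good_def)
   fix l' assume "l' \<in> carrier ?ZL"
   then have l': "l' \<in> cycles L n" by simp
   then obtain z' where z': "good l' z'" using ex by blast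
   show "\<eta> (l \<oplus>\<^bsub>?ZL\<^esub> l') = \<eta> l \<oplus>\<^bsub>X\<^esub> \<eta> l'"
    using \<eta>[OF z l] \<eta>[OF z' l'] \<eta>[OF gadd[OF z z' l l']] cL l l' module_hom_add[OF \<theta>(1)] z z'
    by (auto simp: good_def)
  qed
  moreover have "\<eta> ` cycles L n = carrier X"
  proof
   show "\<eta> ` cycles L n \<subseteq> carrier X" using ex \<eta> \<theta>(2) by (force simp: good_def)
   have "\<theta> z \<in> \<eta> ` cycles L n" if "z \<in> cycles K n" for z
    using \<eta>[OF gf[OF that] fz[OF that]] fz[OF that] by (metis image_eqI)
   then show "carrier X \<subseteq> \<eta> ` cycles L n" unfolding \<theta>(2)[symmetric] by blast
  qed
  moreover have "\<eta> l = \<zero>\<^bsub>X\<^esub> \<longleftrightarrow> l \<in> boundaries L n" if l: "l \<in> cycles L n" for l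
  proof -
   obtain z where z: "good l z" using ex l by blast
   then have zc: "z \<in> cycles K n" and b: "l \<ominus>\<^bsub>amb L\<^esub> f z \<in> boundaries L n" by (auto simp: good_def)
   have e: "l = (l \<ominus>\<^bsub>amb L\<^esub> f z) \<oplus>\<^bsub>amb L\<^esub> f z" "f z = l \<ominus>\<^bsub>amb L\<^esub> (l \<ominus>\<^bsub>amb L\<^esub> f z)"
    using zcL[OF l] zcL[OF fz[OF zc]] by (simp_all add: a_minus_def L.a_assoc L.l_neg L.minus_add L.r_neg2)
   have "f z \<in> boundaries L n \<longleftrightarrow> l \<in> boundaries L n"
    using e b bL submodule_minus[OF chain_cpxD(1)[OF L] boundaries_submodule[OF L]] by metis
   then show ?thesis using \<eta>[OF z l] \<theta>(3)[OF zc] fb[OF zc] by simp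
  qed
  ultimately show "has_homology R L n X" unfolding has_homology_def by blast
 qed
qed

lemma quasi_isoI_bij:
 assumes K: "chain_cpx R K" and L: "chain_cpx R L" and f: "f \<in> module_hom R (amb K) (amb L)"
  and d: "\<And>x. x \<in> carrier (amb K) ==> f (dif K x) = dif L (f x)"
  and bij: "\<And>n. bij_betw f (grd K n) (grd L n)"
 shows "quasi_iso R K L f"
 unfolding quasi_iso_def
proof (intro conjI allI ballI impI K L f d)
 show "f x \<in> grd L n" if "x \<in> grd K n" for x n using bij that by (auto simp: bij_betw_def)
 fix n q l assume q: "q \<in> grd K (n - 1)" and l: "l \<in> grd L n" and "dif L l = f q"
 obtain q' where q': "q' \<in> grd K n" "f q' = l"
  using bij_betw_imp_surj_on[OF bij[of n]] l by (metis imageE)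
 have "f (dif K q') = f q" using d grd_carrier[OF K q'(1)] q' \<open>dif L l = f q\<close> by simp
 then have "dif K q' = q"
  using bij[of "n - 1"] q chain_cpxD(4)[OF K q'(1)] by (auto simp: bij_betw_def inj_on_def)
 moreover have "l = f q' \<oplus>\<^bsub>amb L\<^esub> dif L \<zero>\<^bsub>amb L\<^esub>"
 proof -
  interpret L: module R "amb L" by (rule chain_cpxD(1)[OF L])
  show ?thesis using q' l grd_carrier[OF L] module_hom_zero[OF _ _ chain_cpxD(3)[OF L]] chain_cpxD(1)[OF L]
   by simp
 qed
 ultimately show "\<exists>q'\<in>grd K n. \<exists>l'\<in>grd L (n + 1). dif K q' = q \<and> l = f q' \<oplus>\<^bsub>amb L\<^esub> dif L l'"
  using q' grd_closed(1)[OF L] by blast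
qed

definition concentrated :: "('r, 'm) module => ('r, 'm) chain_cpx" where
 "concentrated M = \<lparr>amb = M, grd = (\<lambda>n. if n = 0 then carrier M else {\<zero>\<^bsub>M\<^esub>}), dif = (\<lambda>_. \<zero>\<^bsub>M\<^esub>)\<rparr>"

lemma concentrated_simps [simp]:
 "amb (concentrated M) = M" "dif (concentrated M) = (\<lambda>_. \<zero>\<^bsub>M\<^esub>)"
 "grd (concentrated M) n = (if n = 0 then carrier M else {\<zero>\<^bsub>M\<^esub>})"
 by (simp_all add: concentrated_def)

lemma concentrated_chain_cpx:
 assumes M: "module R M" shows "chain_cpx R (concentrated M)"
proof -
 interpret M: module R M by fact
 show ?thesis unfolding chain_cpx_def
  using submodule_zero[OF M] M.carrier_is_submodule M
  by (auto intro!: module_homI)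
qed

section \<open>Tensor products with based complexes\<close>

definition sgn_elt :: "'r ring => int => 'r" where
 "sgn_elt R n = (if even n then \<one>\<^bsub>R\<^esub> else \<ominus>\<^bsub>R\<^esub> \<one>\<^bsub>R\<^esub>)"

lemma sgn_elt_closed: "cring R ==> sgn_elt R n \<in> carrier R"
proof -
 assume "cring R"
 then interpret cring R .
 show ?thesis by (simp add: sgn_elt_def)
qed

lemma sgn_elt_add:
 assumes "cring R" shows "sgn_elt R m \<otimes>\<^bsub>R\<^esub> sgn_elt R n = sgn_elt R (m + n)"
proof -
 interpret cring R by fact
 show ?thesis by (auto simp: sgn_elt_def l_minus r_minus minus_minus)
qed

lemma sgn_elt_smult:
 assumes "module R M" and "x \<in> carrier M"
 shows "sgn_elt R n \<odot>\<^bsub>M\<^esub> x = (if even n then x else \<ominus>\<^bsub>M\<^esub> x)"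
proof -
 interpret M: module R M by fact
 show ?thesis using assms(2) by (simp add: sgn_elt_def M.smult_l_minus)
qed

lemma sgn_elt_involution:
 assumes "module R M" and "x \<in> carrier M"
 shows "sgn_elt R n \<odot>\<^bsub>M\<^esub> (sgn_elt R n \<odot>\<^bsub>M\<^esub> x) = x"
proof -
 interpret M: module R M by fact
 show ?thesis using assms(2) by (simp add: sgn_elt_smult[OF assms(1)] M.minus_minus)
qed

text \<open>
  A complex of free modules with a chosen basis \<open>bas\<close>; \<open>inc S t s\<close> is the coefficient of \<open>t\<close> in the
  differential of \<open>s\<close>. The rank decreases along the differential without being tied to the degree, so
  that induction on the rank works also for complexes that are unbounded in both directions.
\<close>

record ('r, 's) based_cpx =
 bas :: "'s set"
 dg :: "'s => int"
 rk :: "'s => nat"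
 inc :: "'s => 's => 'r"

definition based_cpx :: "'r ring => ('r, 's) based_cpx => bool" where
 "based_cpx R S \<longleftrightarrow> cring R \<and> (\<forall>s t. inc S t s \<in> carrier R) \<and>
   (\<forall>s\<in>bas S. finite {t. inc S t s \<noteq> \<zero>\<^bsub>R\<^esub>}) \<and>
   (\<forall>s t. inc S t s \<noteq> \<zero>\<^bsub>R\<^esub> \<longrightarrow> s \<in> bas S \<and> t \<in> bas S \<and> dg S t = dg S s - 1 \<and> rk S t < rk S s) \<and>
   (\<forall>s\<in>bas S. \<forall>u. (\<Oplus>\<^bsub>R\<^esub> t\<in>{t. inc S t s \<noteq> \<zero>\<^bsub>R\<^esub>}. inc S u t \<otimes>\<^bsub>R\<^esub> inc S t s) = \<zero>\<^bsub>R\<^esub>)"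

lemma based_cpxD:
 assumes "based_cpx R S"
 shows "cring R" "inc S t s \<in> carrier R" "s \<in> bas S ==> finite {t. inc S t s \<noteq> \<zero>\<^bsub>R\<^esub>}"
  "inc S t s \<noteq> \<zero>\<^bsub>R\<^esub> ==> s \<in> bas S" "inc S t s \<noteq> \<zero>\<^bsub>R\<^esub> ==> t \<in> bas S"
  "inc S t s \<noteq> \<zero>\<^bsub>R\<^esub> ==> dg S t = dg S s - 1" "inc S t s \<noteq> \<zero>\<^bsub>R\<^esub> ==> rk S t < rk S s"
  "s \<in> bas S ==> (\<Oplus>\<^bsub>R\<^esub> t\<in>{t. inc S t s \<noteq> \<zero>\<^bsub>R\<^esub>}. inc S u t \<otimes>\<^bsub>R\<^esub> inc S t s) = \<zero>\<^bsub>R\<^esub>"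
 using assms unfolding based_cpx_def by meson+

text \<open>
  The differential \<open>d(s \<otimes> x) = ds \<otimes> x + (-1)\<^sup>|\<^sup>s\<^sup>| s \<otimes> dx\<close>, where an element of the tensor product is
  a formal sum of basis elements \<open>s\<close> with coefficients \<open>x\<close> in the second complex.
\<close>

definition tens_col :: "'r ring => ('r, 's) based_cpx => ('r, 'm) chain_cpx => 's => 'm => 's => 'm" where
 "tens_col R S K s x = (\<lambda>t. inc S t s \<odot>\<^bsub>amb K\<^esub> x \<oplus>\<^bsub>amb K\<^esub>
   single (amb K) s (sgn_elt R (dg S s) \<odot>\<^bsub>amb K\<^esub> dif K x) t)"

definition tens :: "'r ring => ('r, 's) based_cpx => ('r, 'm) chain_cpx => ('r, 's => 'm) chain_cpx" where
 "tens R S K =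
   \<lparr>amb = formal_sums (amb K) (bas S),
   grd = (\<lambda>n. {c \<in> carrier (formal_sums (amb K) (bas S)). \<forall>s\<in>bas S. c s \<in> grd K (n - dg S s)}),
   dif = lin (amb K) (formal_sums (amb K) (bas S)) (tens_col R S K)\<rparr>"

lemma tens_simps [simp]: "amb (tens R S K) = formal_sums (amb K) (bas S)"
 by (simp add: tens_def)

lemma tens_grd: "c \<in> grd (tens R S K) n \<longleftrightarrow>
  c \<in> carrier (formal_sums (amb K) (bas S)) \<and> (\<forall>s\<in>bas S. c s \<in> grd K (n - dg S s))"
 by (simp add: tens_def)

context
 fixes R :: "'r ring" and S :: "('r, 's) based_cpx" and K :: "('r, 'm) chain_cpx"
 assumes S: "based_cpx R S" and K: "chain_cpx R K"
begin

interpretation M: module R "amb K" by (rule chain_cpxD(1)[OF K])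

abbreviation (input) "FS \<equiv> formal_sums (amb K) (bas S)"

lemma inc_col_closed:
 assumes "s \<in> bas S" "x \<in> carrier (amb K)"
 shows "(\<lambda>t. inc S t s \<odot>\<^bsub>amb K\<^esub> x) \<in> carrier FS"
proof (rule formal_sumsI[OF _ based_cpxD(3)[OF S assms(1)]])
 show "inc S t s \<odot>\<^bsub>amb K\<^esub> x \<in> carrier (amb K)" for t
  using based_cpxD(2)[OF S] assms by simp
 show "inc S t s \<odot>\<^bsub>amb K\<^esub> x = \<zero>\<^bsub>amb K\<^esub>" if "t \<notin> {t. inc S t s \<noteq> \<zero>\<^bsub>R\<^esub>}" for t
  using that assms by simp
 show "inc S t s \<odot>\<^bsub>amb K\<^esub> x = \<zero>\<^bsub>amb K\<^esub>" if "t \<notin> bas S" for t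
 proof -
  have "inc S t s = \<zero>\<^bsub>R\<^esub>" using that based_cpxD(5)[OF S] by blast
  then show ?thesis using assms by simp
 qed
qed

lemma dif_sgn_closed: "x \<in> carrier (amb K) ==> sgn_elt R n \<odot>\<^bsub>amb K\<^esub> dif K x \<in> carrier (amb K)"
 using sgn_elt_closed[OF M.R.is_cring] module_hom_closed[OF chain_cpxD(3)[OF K]] by simp

lemma tens_col_closed:
 assumes "s \<in> bas S" "x \<in> carrier (amb K)"
 shows "tens_col R S K s x \<in> carrier FS"
 unfolding tens_col_def
 by (rule formal_sums_add_closed[OF M.module_axioms inc_col_closed[OF assms]
   single_closed[OF M.module_axioms assms(1) dif_sgn_closed[OF assms(2)]]])

lemma tens_col_hom:
 assumes s: "s \<in> bas S"
 shows "tens_col R S K s \<in> module_hom R (amb K) FS"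
proof (rule module_homI)
 note d = chain_cpxD(3)[OF K]
 note dc = module_hom_closed[OF d]
 note i = based_cpxD(2)[OF S]
 note sg = sgn_elt_closed[OF M.R.is_cring]
 fix x assume x: "x \<in> carrier (amb K)"
 show "tens_col R S K s x \<in> carrier FS" by (rule tens_col_closed[OF s x])
 show "tens_col R S K s (r \<odot>\<^bsub>amb K\<^esub> x) = r \<odot>\<^bsub>FS\<^esub> tens_col R S K s x" if "r \<in> carrier R" for r
  using x that i sg dc
  by (auto simp: tens_col_def single_def fun_eq_iff module_hom_smult[OF d] M.smult_r_distr
   M.smult_assoc1[symmetric] M.R.m_comm)
 show "tens_col R S K s (x \<oplus>\<^bsub>amb K\<^esub> y) = tens_col R S K s x \<oplus>\<^bsub>FS\<^esub> tens_col R S K s y"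
  if y: "y \<in> carrier (amb K)" for y
  using x y i sg dc
  by (auto simp: tens_col_def single_def fun_eq_iff module_hom_add[OF d] M.smult_r_distr M.a_ac)
qed

lemma tens_dif_hom: "dif (tens R S K) \<in> module_hom R FS FS"
 unfolding tens_def using lin_hom[OF M.module_axioms formal_sums_module[OF M.module_axioms] tens_col_hom]
 by simp

lemma tens_dif_single:
 "s \<in> bas S ==> x \<in> carrier (amb K) ==> dif (tens R S K) (single (amb K) s x) = tens_col R S K s x"
 unfolding tens_def using lin_single[OF M.module_axioms formal_sums_module[OF M.module_axioms] tens_col_hom]
 by simp

lemma tens_dif_apply:
 assumes c: "c \<in> carrier FS" and A: "finite A" "supp (amb K) c \<subseteq> A" "A \<subseteq> bas S"
 shows "dif (tens R S K) c t =
  (\<Oplus>\<^bsub>amb K\<^esub> s\<in>A. inc S t s \<odot>\<^bsub>amb K\<^esub> c s) \<oplus>\<^bsub>amb K\<^esub> sgn_elt R (dg S t) \<odot>\<^bsub>amb K\<^esub> dif K (c t)"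
proof -
 have cl: "c s \<in> carrier (amb K)" for s using formal_sums_closed[OF c] .
 have "dif (tens R S K) c = (\<Oplus>\<^bsub>FS\<^esub> s\<in>A. tens_col R S K s (c s))"
  unfolding tens_def using lin_superset[OF M.module_axioms formal_sums_module[OF M.module_axioms]
   tens_col_hom c A] by simp
 then have "dif (tens R S K) c t = (\<Oplus>\<^bsub>amb K\<^esub> s\<in>A. tens_col R S K s (c s) t)"
  using finsum_apply[OF M.module_axioms A(1), of "\<lambda>s. tens_col R S K s (c s)" "bas S"]
   tens_col_closed cl A(3) by (simp add: Pi_def subset_iff)
 also have "\<dots> = (\<Oplus>\<^bsub>amb K\<^esub> s\<in>A. inc S t s \<odot>\<^bsub>amb K\<^esub> c s) \<oplus>\<^bsub>amb K\<^esub>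
   (\<Oplus>\<^bsub>amb K\<^esub> s\<in>A. single (amb K) s (sgn_elt R (dg S s) \<odot>\<^bsub>amb K\<^esub> dif K (c s)) t)"
  unfolding tens_col_def using cl based_cpxD(2)[OF S] dif_sgn_closed
  by (intro M.finsum_addf) (auto simp: single_def)
 also have "(\<Oplus>\<^bsub>amb K\<^esub> s\<in>A. single (amb K) s (sgn_elt R (dg S s) \<odot>\<^bsub>amb K\<^esub> dif K (c s)) t) =
   (\<Oplus>\<^bsub>amb K\<^esub> s\<in>A. if t = s then sgn_elt R (dg S s) \<odot>\<^bsub>amb K\<^esub> dif K (c s) else \<zero>\<^bsub>amb K\<^esub>)"
  by (simp add: single_def)
 also have "\<dots> = sgn_elt R (dg S t) \<odot>\<^bsub>amb K\<^esub> dif K (c t)"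
 proof (cases "t \<in> A")
  case True
  show ?thesis
   by (rule M.finsum_singleton[OF True A(1)]) (simp add: dif_sgn_closed cl)
 next
  case False
  then have "c t = \<zero>\<^bsub>amb K\<^esub>" using A(2) by (auto simp: supp_def)
  then have "dif K (c t) = \<zero>\<^bsub>amb K\<^esub>"
   using module_hom_zero[OF M.module_axioms M.module_axioms chain_cpxD(3)[OF K]] by simp
  moreover have "(\<Oplus>\<^bsub>amb K\<^esub> s\<in>A. if t = s then sgn_elt R (dg S s) \<odot>\<^bsub>amb K\<^esub> dif K (c s) else \<zero>\<^bsub>amb K\<^esub>) =
    \<zero>\<^bsub>amb K\<^esub>"
   by (rule M.add.finprod_one_eqI) (use False in auto)
  ultimately show ?thesis using sgn_elt_closed[OF M.R.is_cring] by simp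
 qed
 finally show ?thesis .
qed

lemma tens_dif_dif_single:
 assumes s: "s \<in> bas S" and x: "x \<in> carrier (amb K)"
 shows "dif (tens R S K) (dif (tens R S K) (single (amb K) s x)) = (\<lambda>_. \<zero>\<^bsub>amb K\<^esub>)"
proof
 fix u
 note d = chain_cpxD(3)[OF K]
 note dc = module_hom_closed[OF d]
 note i = based_cpxD(2)[OF S]
 note sg = sgn_elt_closed[OF M.R.is_cring]
 let ?A = "{t. inc S t s \<noteq> \<zero>\<^bsub>R\<^esub>}" and ?M = "amb K"
 let ?B = "\<lambda>t. inc S t s \<odot>\<^bsub>?M\<^esub> x" and ?y = "sgn_elt R (dg S s) \<odot>\<^bsub>?M\<^esub> dif K x"
 have y: "?y \<in> carrier ?M" using dif_sgn_closed[OF x] .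
 have B: "?B \<in> carrier FS" by (rule inc_col_closed[OF s x])
 have "dif (tens R S K) (single ?M s x) = ?B \<oplus>\<^bsub>FS\<^esub> single ?M s ?y"
  by (simp add: tens_dif_single[OF s x] tens_col_def)
 then have "dif (tens R S K) (dif (tens R S K) (single ?M s x)) =
   dif (tens R S K) ?B \<oplus>\<^bsub>FS\<^esub> tens_col R S K s ?y"
  using module_hom_add[OF tens_dif_hom B single_closed[OF M.module_axioms s y]]
  by (simp add: tens_dif_single[OF s y])
 then have "dif (tens R S K) (dif (tens R S K) (single ?M s x)) u =
   dif (tens R S K) ?B u \<oplus>\<^bsub>?M\<^esub> tens_col R S K s ?y u" by simp
 also have "dif (tens R S K) ?B u = (\<Oplus>\<^bsub>?M\<^esub> t\<in>?A. inc S u t \<odot>\<^bsub>?M\<^esub> ?B t) \<oplus>\<^bsub>?M\<^esub> sgn_elt R (dg S u) \<odot>\<^bsub>?M\<^esub> dif K (?B u)"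
 proof (rule tens_dif_apply[OF B based_cpxD(3)[OF S s]])
  show "supp ?M ?B \<subseteq> ?A" using x by (auto simp: supp_def)
  show "?A \<subseteq> bas S" using based_cpxD(5)[OF S] by auto
 qed
 also have "(\<Oplus>\<^bsub>?M\<^esub> t\<in>?A. inc S u t \<odot>\<^bsub>?M\<^esub> ?B t) = (\<Oplus>\<^bsub>?M\<^esub> t\<in>?A. (inc S u t \<otimes>\<^bsub>R\<^esub> inc S t s) \<odot>\<^bsub>?M\<^esub> x)"
  using i x by (simp add: M.smult_assoc1)
 also have "\<dots> = (\<Oplus>\<^bsub>ring_module R\<^esub> t\<in>?A. inc S u t \<otimes>\<^bsub>R\<^esub> inc S t s) \<odot>\<^bsub>?M\<^esub> x"
 proof (rule module_hom_finsum[symmetric, OF ring_module_module[OF M.R.is_cring] M.module_axioms _ based_cpxD(3)[OF S s]])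
  show "(\<lambda>r. r \<odot>\<^bsub>?M\<^esub> x) \<in> module_hom R (ring_module R) ?M"
   by (rule module_homI) (use x in \<open>auto simp: M.smult_l_distr M.smult_assoc1\<close>)
 qed (use i in auto)
 also have "\<dots> = \<zero>\<^bsub>?M\<^esub>" using based_cpxD(8)[OF S s] x by (simp add: ring_module_finsum)
 finally have e: "dif (tens R S K) (dif (tens R S K) (single ?M s x)) u =
   \<zero>\<^bsub>?M\<^esub> \<oplus>\<^bsub>?M\<^esub> sgn_elt R (dg S u) \<odot>\<^bsub>?M\<^esub> dif K (?B u) \<oplus>\<^bsub>?M\<^esub> tens_col R S K s ?y u" .
 have "dif K ?y = \<zero>\<^bsub>?M\<^esub>"
  using module_hom_smult[OF d sg dc[OF x]] chain_cpxD(5)[OF K x] sg by simp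
 then have "tens_col R S K s ?y u = inc S u s \<odot>\<^bsub>?M\<^esub> ?y"
  using sg i y by (simp add: tens_col_def single_def)
 moreover have "dif K (?B u) = inc S u s \<odot>\<^bsub>?M\<^esub> dif K x" using module_hom_smult[OF d i x] .
 moreover have "sgn_elt R (dg S u) \<odot>\<^bsub>?M\<^esub> (inc S u s \<odot>\<^bsub>?M\<^esub> dif K x) \<oplus>\<^bsub>?M\<^esub> inc S u s \<odot>\<^bsub>?M\<^esub> ?y = \<zero>\<^bsub>?M\<^esub>"
 proof (cases "inc S u s = \<zero>\<^bsub>R\<^esub>")
  case True
  then show ?thesis using dc[OF x] sg y by simp
 next
  case False
  then have "even (dg S u) \<longleftrightarrow> odd (dg S s)" using based_cpxD(6)[OF S False] by simp
  then show ?thesis using i[of u s] dc[OF x]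
   by (simp add: sgn_elt_smult[OF M.module_axioms] M.smult_r_minus M.r_neg M.l_neg)
 qed
 ultimately show "dif (tens R S K) (dif (tens R S K) (single ?M s x)) u = \<zero>\<^bsub>?M\<^esub>"
  using e sg i dc[OF x] by simp
qed

lemma tens_chain_cpx: "chain_cpx R (tens R S K)"
 unfolding chain_cpx_def
proof (intro conjI allI ballI)
 let ?M = "amb K"
 note FS = formal_sums_module[OF M.module_axioms, of "bas S"]
 show "module R (amb (tens R S K))" using FS by simp
 show "dif (tens R S K) \<in> module_hom R (amb (tens R S K)) (amb (tens R S K))"
  using tens_dif_hom by simp
 show "submodule (grd (tens R S K) n) R (amb (tens R S K))" for n
 proof -
  interpret F: module R FS by (rule FS)
  have "\<zero>\<^bsub>FS\<^esub> \<in> carrier FS" "\<And>x y. x \<in> carrier FS ==> y \<in> carrier FS ==> x \<oplus>\<^bsub>FS\<^esub> y \<in> carrier FS"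
   "\<And>r x. r \<in> carrier R ==> x \<in> carrier FS ==> r \<odot>\<^bsub>FS\<^esub> x \<in> carrier FS"
   by (rule F.zero_closed F.a_closed F.smult_closed; assumption?)+
  then show ?thesis unfolding submodule_iff[OF FS] tens_simps
   using grd_closed[OF K] by (auto simp: tens_grd)
 qed
 show "dif (tens R S K) (dif (tens R S K) c) = \<zero>\<^bsub>amb (tens R S K)\<^esub>" if "c \<in> carrier (amb (tens R S K))" for c
 proof -
  have z: "(\<lambda>c. \<lambda>_. \<zero>\<^bsub>?M\<^esub>) \<in> module_hom R FS FS"
   by (rule module_homI) (auto simp: formal_sums_carrier supp_def)
  show ?thesis
   using formal_sums_hom_eqI[OF M.module_axioms FS module_hom_comp[OF tens_dif_hom tens_dif_hom] z
    tens_dif_dif_single] that by simp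
 qed
 fix n c assume c: "c \<in> grd (tens R S K) n"
 then have cF: "c \<in> carrier FS" and cg: "\<And>s. s \<in> bas S ==> c s \<in> grd K (n - dg S s)"
  by (auto simp: tens_grd)
 have A: "finite (supp ?M c)" "supp ?M c \<subseteq> bas S" using cF by (auto simp: formal_sums_carrier)
 show "dif (tens R S K) c \<in> grd (tens R S K) (n - 1)"
  unfolding tens_grd
 proof (intro conjI ballI)
  show "dif (tens R S K) c \<in> carrier FS" using module_hom_closed[OF tens_dif_hom cF] .
  fix t assume t: "t \<in> bas S"
  have "inc S t s \<odot>\<^bsub>?M\<^esub> c s \<in> grd K (n - 1 - dg S t)" if "s \<in> bas S" for s
  proof (cases "inc S t s = \<zero>\<^bsub>R\<^esub>")
   case True
   then show ?thesis using grd_closed(1)[OF K] formal_sums_closed[OF cF] by simp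
  next
   case False
   then have e: "n - 1 - dg S t = n - dg S s" using based_cpxD(6)[OF S False] by simp
   show ?thesis unfolding e by (rule grd_closed(3)[OF K based_cpxD(2)[OF S] cg[OF that]])
  qed
  then have "(\<Oplus>\<^bsub>?M\<^esub> s\<in>supp ?M c. inc S t s \<odot>\<^bsub>?M\<^esub> c s) \<in> grd K (n - 1 - dg S t)"
   using A by (intro submodule_finsum[OF M.module_axioms chain_cpxD(2)[OF K]]) auto
  moreover have "sgn_elt R (dg S t) \<odot>\<^bsub>?M\<^esub> dif K (c t) \<in> grd K (n - 1 - dg S t)"
   using grd_closed(3)[OF K sgn_elt_closed[OF M.R.is_cring] chain_cpxD(4)[OF K cg[OF t]]]
   by (simp add: algebra_simps)
  ultimately show "dif (tens R S K) c t \<in> grd K (n - 1 - dg S t)"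
   unfolding tens_dif_apply[OF cF A(1) order_refl A(2)] by (rule grd_closed(2)[OF K])
 qed
qed

end

section \<open>Quasi-isomorphisms between tensor products\<close>

lemma formal_sums_minus_apply:
 fixes R :: "'r ring"
 assumes M: "module R M" and "c \<in> carrier (formal_sums M S)" "d \<in> carrier (formal_sums M S)"
 shows "(c \<ominus>\<^bsub>formal_sums M S\<^esub> d) s = c s \<ominus>\<^bsub>M\<^esub> d s"
 using module_hom_minus[OF formal_sums_module[OF M] M eval_hom assms(2,3)] .

lemma pointwise_hom:
 assumes M: "module R M" and N: "module R N" and f: "f \<in> module_hom R M N"
 shows "(\<lambda>c s. f (c s)) \<in> module_hom R (formal_sums M S) (formal_sums N S)"
proof (rule module_homI)
 fix c assume c: "c \<in> carrier (formal_sums M S)"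
 note cl = formal_sums_closed[OF c]
 show "(\<lambda>s. f (c s)) \<in> carrier (formal_sums N S)"
 proof (rule formal_sumsI[OF _ formal_sums_finite[OF c]])
  show "f (c s) = \<zero>\<^bsub>N\<^esub>" if "s \<notin> supp M c" for s
   using that module_hom_zero[OF M N f] by (simp add: supp_def)
  show "f (c s) = \<zero>\<^bsub>N\<^esub>" if "s \<notin> S" for s
   using formal_sums_outside[OF c that] module_hom_zero[OF M N f] by simp
 qed (rule module_hom_closed[OF f cl])
 show "(\<lambda>s. f ((r \<odot>\<^bsub>formal_sums M S\<^esub> c) s)) = r \<odot>\<^bsub>formal_sums N S\<^esub> (\<lambda>s. f (c s))"
  if "r \<in> carrier R" for r using module_hom_smult[OF f that cl] by simp
 show "(\<lambda>s. f ((c \<oplus>\<^bsub>formal_sums M S\<^esub> d) s)) = (\<lambda>s. f (c s)) \<oplus>\<^bsub>formal_sums N S\<^esub> (\<lambda>s. f (d s))"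
  if d: "d \<in> carrier (formal_sums M S)" for d
  using module_hom_add[OF f cl formal_sums_closed[OF d]] by simp
qed

lemma hom_single:
 assumes "module R M" and "module R N" and "f \<in> module_hom R M N"
 shows "(\<lambda>t. f (single M s x t)) = single N s (f x)"
 using module_hom_zero[OF assms] by (auto simp: single_def)

text \<open>
  Subtracting from \<open>(q, l)\<close> the boundary of \<open>(q1, l1)\<close> in the mapping cone gives another lifting problem,
  and a solution of it yields one of the original problem.
\<close>

lemma lifting_step:
 assumes K: "chain_cpx R K" and L: "chain_cpx R L" and f: "f \<in> module_hom R (amb K) (amb L)"
  and fg: "\<And>n x. x \<in> grd K n ==> f x \<in> grd L n"
  and fd: "\<And>x. x \<in> carrier (amb K) ==> f (dif K x) = dif L (f x)"
  and q: "q \<in> grd K (n - 1)" "dif K q = \<zero>\<^bsub>amb K\<^esub>" and l: "l \<in> grd L n" "dif L l = f q"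
  and q1: "q1 \<in> grd K n" and l1: "l1 \<in> grd L (n + 1)"
 defines "q2 \<equiv> q \<ominus>\<^bsub>amb K\<^esub> dif K q1" and "l2 \<equiv> l \<ominus>\<^bsub>amb L\<^esub> (f q1 \<oplus>\<^bsub>amb L\<^esub> dif L l1)"
 shows "q2 \<in> grd K (n - 1)" "dif K q2 = \<zero>\<^bsub>amb K\<^esub>" "l2 \<in> grd L n" "dif L l2 = f q2"
  "\<exists>q'\<in>grd K n. \<exists>l'\<in>grd L (n + 1). dif K q' = q2 \<and> l2 = f q' \<oplus>\<^bsub>amb L\<^esub> dif L l' ==>
   \<exists>q'\<in>grd K n. \<exists>l'\<in>grd L (n + 1). dif K q' = q \<and> l = f q' \<oplus>\<^bsub>amb L\<^esub> dif L l'"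
proof -
 interpret K: module R "amb K" by (rule chain_cpxD(1)[OF K])
 interpret L: module R "amb L" by (rule chain_cpxD(1)[OF L])
 note dK = chain_cpxD(3)[OF K] and dL = chain_cpxD(3)[OF L]
 note cK = grd_carrier[OF K] and cL = grd_carrier[OF L]
 have dq1: "dif K q1 \<in> grd K (n - 1)" by (rule chain_cpxD(4)[OF K q1])
 have dl1: "dif L l1 \<in> grd L n" using chain_cpxD(4)[OF L l1] by simp
 have fq1: "f q1 \<in> grd L n" by (rule fg[OF q1])
 have fdl1: "f q1 \<oplus>\<^bsub>amb L\<^esub> dif L l1 \<in> grd L n" by (rule grd_closed(2)[OF L fq1 dl1])
 show "q2 \<in> grd K (n - 1)" unfolding q2_def by (rule grd_closed(4)[OF K q(1) dq1])
 show "l2 \<in> grd L n" unfolding l2_def by (rule grd_closed(4)[OF L l(1) fdl1])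
 show "dif K q2 = \<zero>\<^bsub>amb K\<^esub>"
  unfolding q2_def module_hom_minus[OF K.module_axioms K.module_axioms dK cK[OF q(1)] cK[OF dq1]]
   q(2) chain_cpxD(5)[OF K cK[OF q1]] by (simp add: a_minus_def)
 have "dif L (f q1 \<oplus>\<^bsub>amb L\<^esub> dif L l1) = f (dif K q1)"
  using module_hom_add[OF dL cL[OF fq1] cL[OF dl1]] chain_cpxD(5)[OF L cL[OF l1]] fd[OF cK[OF q1]]
   module_hom_closed[OF dL cL[OF fq1]] by simp
 then show "dif L l2 = f q2"
  unfolding q2_def l2_def
  using module_hom_minus[OF L.module_axioms L.module_axioms dL cL[OF l(1)] cL[OF fdl1]]
   module_hom_minus[OF K.module_axioms L.module_axioms f cK[OF q(1)] cK[OF dq1]] l(2) by simp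
 assume "\<exists>q'\<in>grd K n. \<exists>l'\<in>grd L (n + 1). dif K q' = q2 \<and> l2 = f q' \<oplus>\<^bsub>amb L\<^esub> dif L l'"
 then obtain q' l' where ql: "q' \<in> grd K n" "l' \<in> grd L (n + 1)" "dif K q' = q2"
   "l2 = f q' \<oplus>\<^bsub>amb L\<^esub> dif L l'" by blast
 have dl': "dif L l' \<in> grd L n" using chain_cpxD(4)[OF L ql(2)] by simp
 show "\<exists>q'\<in>grd K n. \<exists>l'\<in>grd L (n + 1). dif K q' = q \<and> l = f q' \<oplus>\<^bsub>amb L\<^esub> dif L l'"
 proof (intro bexI conjI)
  show "q' \<oplus>\<^bsub>amb K\<^esub> q1 \<in> grd K n" by (rule grd_closed(2)[OF K ql(1) q1])
  show "l' \<oplus>\<^bsub>amb L\<^esub> l1 \<in> grd L (n + 1)" by (rule grd_closed(2)[OF L ql(2) l1])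
  show "dif K (q' \<oplus>\<^bsub>amb K\<^esub> q1) = q"
   using module_hom_add[OF dK cK[OF ql(1)] cK[OF q1]] cK[OF q(1)] cK[OF dq1] ql(3)
   by (simp add: q2_def a_minus_def K.a_assoc K.l_neg)
  have "l = l2 \<oplus>\<^bsub>amb L\<^esub> (f q1 \<oplus>\<^bsub>amb L\<^esub> dif L l1)"
   using cL[OF l(1)] cL[OF fdl1] by (simp add: l2_def a_minus_def L.a_assoc L.l_neg)
  then show "l = f (q' \<oplus>\<^bsub>amb K\<^esub> q1) \<oplus>\<^bsub>amb L\<^esub> dif L (l' \<oplus>\<^bsub>amb L\<^esub> l1)"
   using module_hom_add[OF f cK[OF ql(1)] cK[OF q1]] module_hom_add[OF dL cL[OF ql(2)] cL[OF l1]]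
    ql(4) cL[OF fg[OF ql(1)]] cL[OF fq1] cL[OF dl'] cL[OF dl1] by (simp add: L.a_ac)
 qed
qed

lemma tens_dif_top:
 assumes S: "based_cpx R S" and K: "chain_cpx R K" and c: "c \<in> carrier (formal_sums (amb K) (bas S))"
  and top: "\<And>u. u \<in> supp (amb K) c ==> rk S u \<le> rk S s"
 shows "dif (tens R S K) c s = sgn_elt R (dg S s) \<odot>\<^bsub>amb K\<^esub> dif K (c s)"
proof -
 interpret M: module R "amb K" by (rule chain_cpxD(1)[OF K])
 have A: "finite (supp (amb K) c)" "supp (amb K) c \<subseteq> bas S" using c by (auto simp: formal_sums_carrier)
 have "(\<Oplus>\<^bsub>amb K\<^esub> u\<in>supp (amb K) c. inc S s u \<odot>\<^bsub>amb K\<^esub> c u) = \<zero>\<^bsub>amb K\<^esub>"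
 proof (rule M.add.finprod_one_eqI)
  fix u assume "u \<in> supp (amb K) c"
  then have "inc S s u = \<zero>\<^bsub>R\<^esub>" using top[of u] based_cpxD(7)[OF S, of s u] by fastforce
  then show "inc S s u \<odot>\<^bsub>amb K\<^esub> c u = \<zero>\<^bsub>amb K\<^esub>" using formal_sums_closed[OF c] by simp
 qed
 then show ?thesis
  unfolding tens_dif_apply[OF S K c A(1) order_refl A(2)]
  using dif_sgn_closed[OF S K formal_sums_closed[OF c]] by simp
qed

text \<open>
  A lifting problem \<open>(q, l)\<close> in the tensor product is solved by induction on the ranks in the supports of
  \<open>q\<close> and \<open>l\<close>. At a basis element of highest rank only the differentials of \<open>K\<close> and \<open>L\<close> contribute
  (\<open>tens_dif_top\<close>), so the coefficients there form, up to sign, a lifting problem for \<open>f\<close>. Solving it for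
  all elements of highest rank leaves a problem of lower rank.
\<close>

lemma quasi_iso_tens:
 assumes S: "based_cpx R S" and f: "quasi_iso R K L f"
 shows "quasi_iso R (tens R S K) (tens R S L) (\<lambda>c s. f (c s))"
proof -
 note D = quasi_isoD[OF f]
 note K = D(1) and L = D(2) and fh = D(3)
 interpret K: module R "amb K" by (rule chain_cpxD(1)[OF K])
 interpret L: module R "amb L" by (rule chain_cpxD(1)[OF L])
 let ?TK = "tens R S K" and ?TL = "tens R S L" and ?F = "\<lambda>c s. f (c s)"
 let ?FK = "formal_sums (amb K) (bas S)" and ?FL = "formal_sums (amb L) (bas S)"
 note TK = tens_chain_cpx[OF S K] and TL = tens_chain_cpx[OF S L]
 note FK = formal_sums_module[OF K.module_axioms, of "bas S"]
  and FL = formal_sums_module[OF L.module_axioms, of "bas S"]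
 have F: "?F \<in> module_hom R ?FK ?FL" by (rule pointwise_hom[OF K.module_axioms L.module_axioms fh])
 note f0 = module_hom_zero[OF K.module_axioms L.module_axioms fh]
 have Fg: "?F x \<in> grd ?TL n" if "x \<in> grd ?TK n" for x n
  using that module_hom_closed[OF F] D(4) by (auto simp: tens_grd)
 have col: "?F (tens_col R S K s x) = tens_col R S L s (f x)" if s: "s \<in> bas S" and x: "x \<in> carrier (amb K)" for s x
 proof
  fix t
  have y: "sgn_elt R (dg S s) \<odot>\<^bsub>amb K\<^esub> dif K x \<in> carrier (amb K)"
   using dif_sgn_closed[OF S K x] .
  have "f (tens_col R S K s x t) = inc S t s \<odot>\<^bsub>amb L\<^esub> f x \<oplus>\<^bsub>amb L\<^esub>
    f (single (amb K) s (sgn_elt R (dg S s) \<odot>\<^bsub>amb K\<^esub> dif K x) t)"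
   unfolding tens_col_def using x y based_cpxD(2)[OF S]
   by (subst module_hom_add[OF fh]) (auto simp: single_def module_hom_smult[OF fh])
  also have "f (single (amb K) s (sgn_elt R (dg S s) \<odot>\<^bsub>amb K\<^esub> dif K x) t) =
    single (amb L) s (sgn_elt R (dg S s) \<odot>\<^bsub>amb L\<^esub> dif L (f x)) t"
   using f0 sgn_elt_closed[OF K.R.is_cring] module_hom_closed[OF chain_cpxD(3)[OF K] x] D(5)[OF x]
   by (auto simp: single_def module_hom_smult[OF fh])
  finally show "f (tens_col R S K s x t) = tens_col R S L s (f x) t" by (simp add: tens_col_def)
 qed
 have Fd: "?F (dif ?TK c) = dif ?TL (?F c)" if "c \<in> carrier ?FK" for c
 proof (rule formal_sums_hom_eqI[OF K.module_axioms FL module_hom_comp[OF tens_dif_hom[OF S K] F]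
    module_hom_comp[OF F tens_dif_hom[OF S L]] _ that])
  fix s x assume s: "s \<in> bas S" and x: "x \<in> carrier (amb K)"
  show "?F (dif ?TK (single (amb K) s x)) = dif ?TL (?F (single (amb K) s x))"
   unfolding hom_single[OF K.module_axioms L.module_axioms fh] tens_dif_single[OF S K s x]
    tens_dif_single[OF S L s module_hom_closed[OF fh x]] by (rule col[OF s x])
 qed
 let ?lift = "\<lambda>q l n. \<exists>q'\<in>grd ?TK n. \<exists>l'\<in>grd ?TL (n + 1). dif ?TK q' = q \<and> l = ?F q' \<oplus>\<^bsub>amb ?TL\<^esub> dif ?TL l'"
 have main: "?lift q l n"
  if "q \<in> grd ?TK (n - 1)" "dif ?TK q = \<zero>\<^bsub>amb ?TK\<^esub>" "l \<in> grd ?TL n" "dif ?TL l = ?F q"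
   and "\<And>s. s \<in> supp (amb K) q \<union> supp (amb L) l ==> rk S s < r" for q l n r
  using that
 proof (induction r arbitrary: q l)
  case 0
  then have e: "q = (\<lambda>_. \<zero>\<^bsub>amb K\<^esub>)" "l = (\<lambda>_. \<zero>\<^bsub>amb L\<^esub>)" by (auto simp: supp_def)
  show ?case
  proof (intro bexI conjI)
   show "\<zero>\<^bsub>amb ?TK\<^esub> \<in> grd ?TK n" "\<zero>\<^bsub>amb ?TL\<^esub> \<in> grd ?TL (n + 1)"
    by (rule grd_closed(1)[OF TK] grd_closed(1)[OF TL])+
   show "dif ?TK \<zero>\<^bsub>amb ?TK\<^esub> = q"
    using module_hom_zero[OF FK FK tens_dif_hom[OF S K]] e by simp
   show "l = ?F \<zero>\<^bsub>amb ?TK\<^esub> \<oplus>\<^bsub>amb ?TL\<^esub> dif ?TL \<zero>\<^bsub>amb ?TL\<^esub>"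
    using module_hom_zero[OF FL FL tens_dif_hom[OF S L]] e f0 by simp
  qed
 next
  case (Suc r)
  note q = Suc.prems(1,2) and l = Suc.prems(3,4) and bnd = Suc.prems(5)
  have qF: "q \<in> carrier ?FK" and lF: "l \<in> carrier ?FL" using q l by (auto simp: tens_grd)
  define T where "T = {s \<in> supp (amb K) q \<union> supp (amb L) l. rk S s = r}"
  have T: "finite T" "T \<subseteq> bas S" using qF lF by (auto simp: T_def formal_sums_carrier)
  let ?sg = "\<lambda>s. sgn_elt R (dg S s)"
  have sg: "?sg s \<in> carrier R" for s using sgn_elt_closed[OF K.R.is_cring] .
  have "\<exists>a b. a \<in> grd K (n - dg S s) \<and> b \<in> grd L (n + 1 - dg S s) \<and> dif K a = q s \<and>
    ?sg s \<odot>\<^bsub>amb L\<^esub> l s = f a \<oplus>\<^bsub>amb L\<^esub> dif L b" if s: "s \<in> T" for s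
  proof -
   have sb: "s \<in> bas S" using T s by blast
   have qs: "q s \<in> grd K (n - dg S s - 1)" and ls: "l s \<in> grd L (n - dg S s)"
    using q(1) l(1) sb by (auto simp: tens_grd algebra_simps)
   have "dif ?TK q s = ?sg s \<odot>\<^bsub>amb K\<^esub> dif K (q s)"
    by (rule tens_dif_top[OF S K qF]) (use bnd s in \<open>fastforce simp: T_def\<close>)
   then have "?sg s \<odot>\<^bsub>amb K\<^esub> dif K (q s) = \<zero>\<^bsub>amb K\<^esub>" using q(2) by simp
   then have "?sg s \<odot>\<^bsub>amb K\<^esub> (?sg s \<odot>\<^bsub>amb K\<^esub> dif K (q s)) = \<zero>\<^bsub>amb K\<^esub>" using sg by simp
   then have dq: "dif K (q s) = \<zero>\<^bsub>amb K\<^esub>"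
    using sgn_elt_involution[OF K.module_axioms module_hom_closed[OF chain_cpxD(3)[OF K] grd_carrier[OF K qs]]]
    by simp
   have "dif ?TL l s = ?sg s \<odot>\<^bsub>amb L\<^esub> dif L (l s)"
    by (rule tens_dif_top[OF S L lF]) (use bnd s in \<open>fastforce simp: T_def\<close>)
   then have dl: "dif L (?sg s \<odot>\<^bsub>amb L\<^esub> l s) = f (q s)"
    using module_hom_smult[OF chain_cpxD(3)[OF L] sg grd_carrier[OF L ls]] l(2) by simp
   show ?thesis
    using quasi_iso_lift[OF f qs grd_closed(3)[OF L sg ls] dq dl]
    by (metis add.commute diff_add_eq)
  qed
  then obtain a b where ab: "\<And>s. s \<in> T ==> a s \<in> grd K (n - dg S s)"
    "\<And>s. s \<in> T ==> b s \<in> grd L (n + 1 - dg S s)" "\<And>s. s \<in> T ==> dif K (a s) = q s"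
    "\<And>s. s \<in> T ==> ?sg s \<odot>\<^bsub>amb L\<^esub> l s = f (a s) \<oplus>\<^bsub>amb L\<^esub> dif L (b s)"
   by metis
  have abc: "a s \<in> carrier (amb K)" "b s \<in> carrier (amb L)" if "s \<in> T" for s
   using grd_carrier[OF K ab(1)[OF that]] grd_carrier[OF L ab(2)[OF that]] .
  define q1 where "q1 = (\<lambda>s. if s \<in> T then ?sg s \<odot>\<^bsub>amb K\<^esub> a s else \<zero>\<^bsub>amb K\<^esub>)"
  define l1 where "l1 = (\<lambda>s. if s \<in> T then b s else \<zero>\<^bsub>amb L\<^esub>)"
  have q1F: "q1 \<in> carrier ?FK"
   by (rule formal_sumsI[OF _ T(1)]) (use T sg abc in \<open>auto simp: q1_def\<close>)
  have l1F: "l1 \<in> carrier ?FL"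
   by (rule formal_sumsI[OF _ T(1)]) (use T sg abc in \<open>auto simp: l1_def\<close>)
  have q1: "q1 \<in> grd ?TK n" using q1F ab(1) grd_closed(1,3)[OF K] sg by (auto simp: tens_grd q1_def)
  have l1: "l1 \<in> grd ?TL (n + 1)" using l1F ab(2) grd_closed(1)[OF L] by (auto simp: tens_grd l1_def)
  let ?q2 = "q \<ominus>\<^bsub>amb ?TK\<^esub> dif ?TK q1" and ?l2 = "l \<ominus>\<^bsub>amb ?TL\<^esub> (?F q1 \<oplus>\<^bsub>amb ?TL\<^esub> dif ?TL l1)"
  have Fh: "?F \<in> module_hom R (amb ?TK) (amb ?TL)" and Fd': "?F (dif ?TK x) = dif ?TL (?F x)" if "x \<in> carrier (amb ?TK)" for x
   using F Fd that by simp_all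
  note st = lifting_step[OF TK TL _ Fg Fd' q l q1 l1, simplified tens_simps, OF F]
  have dq1F: "dif ?TK q1 \<in> carrier ?FK" and dl1F: "dif ?TL l1 \<in> carrier ?FL"
   using module_hom_closed[OF tens_dif_hom[OF S K] q1F] module_hom_closed[OF tens_dif_hom[OF S L] l1F] by auto
  have Fq1: "?F q1 \<in> carrier ?FL" by (rule module_hom_closed[OF F q1F])
  have Fq1': "?F q1 \<oplus>\<^bsub>?FL\<^esub> dif ?TL l1 \<in> carrier ?FL"
   using formal_sums_add_closed[OF L.module_axioms Fq1 dl1F] by simp
  have zero: "?q2 s = \<zero>\<^bsub>amb K\<^esub> \<and> ?l2 s = \<zero>\<^bsub>amb L\<^esub>" if s: "rk S s \<ge> r" for s
  proof -
   have d1: "dif ?TK q1 s = ?sg s \<odot>\<^bsub>amb K\<^esub> dif K (q1 s)"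
    by (rule tens_dif_top[OF S K q1F]) (use s in \<open>auto simp: T_def q1_def supp_def split: if_splits\<close>)
   have d2: "dif ?TL l1 s = ?sg s \<odot>\<^bsub>amb L\<^esub> dif L (l1 s)"
    by (rule tens_dif_top[OF S L l1F]) (use s in \<open>auto simp: T_def l1_def supp_def split: if_splits\<close>)
   have e1: "?q2 s = q s \<ominus>\<^bsub>amb K\<^esub> dif ?TK q1 s"
    using formal_sums_minus_apply[OF K.module_axioms qF dq1F] by simp
   have e2: "?l2 s = l s \<ominus>\<^bsub>amb L\<^esub> (f (q1 s) \<oplus>\<^bsub>amb L\<^esub> dif ?TL l1 s)"
    using formal_sums_minus_apply[OF L.module_axioms lF Fq1'] by simp
   show ?thesis
   proof (cases "s \<in> T")
    case True
    have a: "a s \<in> carrier (amb K)" "b s \<in> carrier (amb L)"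
     using abc[OF True] .
    have fa: "f (a s) \<in> carrier (amb L)" "dif L (b s) \<in> carrier (amb L)"
     using module_hom_closed[OF fh a(1)] module_hom_closed[OF chain_cpxD(3)[OF L] a(2)] .
    have "dif ?TK q1 s = q s"
     using d1 True ab(3)[OF True] sg a sgn_elt_involution[OF K.module_axioms formal_sums_closed[OF qF]]
     by (simp add: q1_def module_hom_smult[OF chain_cpxD(3)[OF K]])
    moreover have "f (q1 s) \<oplus>\<^bsub>amb L\<^esub> dif ?TL l1 s = ?sg s \<odot>\<^bsub>amb L\<^esub> (?sg s \<odot>\<^bsub>amb L\<^esub> l s)"
     unfolding ab(4)[OF True] d2 using True sg a fa
     by (simp add: q1_def l1_def module_hom_smult[OF fh] L.smult_r_distr)
    then have "f (q1 s) \<oplus>\<^bsub>amb L\<^esub> dif ?TL l1 s = l s"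
     using sgn_elt_involution[OF L.module_axioms formal_sums_closed[OF lF]] by simp
    ultimately show ?thesis unfolding e1 e2
     using formal_sums_closed[OF qF] formal_sums_closed[OF lF] by (simp add: a_minus_def K.r_neg L.r_neg)
   next
    case False
    have "s \<notin> supp (amb K) q \<union> supp (amb L) l"
    proof
     assume m: "s \<in> supp (amb K) q \<union> supp (amb L) l"
     with bnd[OF m] s have "s \<in> T" unfolding T_def by simp
     with False show False ..
    qed
    then have "q s = \<zero>\<^bsub>amb K\<^esub>" "l s = \<zero>\<^bsub>amb L\<^esub>" by (auto simp: supp_def)
    then show ?thesis unfolding e1 e2 d1 d2 using False sg f0
      module_hom_zero[OF K.module_axioms K.module_axioms chain_cpxD(3)[OF K]]
      module_hom_zero[OF L.module_axioms L.module_axioms chain_cpxD(3)[OF L]]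
     by (simp add: q1_def l1_def a_minus_def)
   qed
  qed
  have "?lift ?q2 ?l2 n"
  proof (rule Suc.IH)
   show "rk S s < r" if "s \<in> supp (amb K) ?q2 \<union> supp (amb L) ?l2" for s
   proof (rule ccontr)
    assume "\<not> rk S s < r"
    then have "rk S s \<ge> r" by simp
    from zero[OF this] that show False by (simp add: supp_def del: tens_simps)
   qed
  qed (use st in \<open>simp_all\<close>)
  then show ?case using st(5) by simp
 qed
 show ?thesis
  unfolding quasi_iso_def
 proof (intro conjI allI ballI impI)
  fix n q l assume q: "q \<in> grd ?TK (n - 1)" "dif ?TK q = \<zero>\<^bsub>amb ?TK\<^esub>" and l: "l \<in> grd ?TL n" "dif ?TL l = ?F q"
  have "finite (rk S ` (supp (amb K) q \<union> supp (amb L) l))"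
   using q l by (auto simp: tens_grd formal_sums_carrier)
  then obtain r where "\<And>s. s \<in> supp (amb K) q \<union> supp (amb L) l ==> rk S s < r"
   by (auto simp: finite_nat_set_iff_bounded)
  then show "?lift q l n" using main q l by blast
 qed (use TK TL F Fg Fd in auto)
qed

text \<open>
  The exchange \<open>s \<otimes> t \<mapsto> (-1)\<^sup>|\<^sup>s\<^sup>|\<^sup>|\<^sup>t\<^sup>| t \<otimes> s\<close>; without the sign it would not be a chain map.
\<close>

definition swap ::
  "'r ring => ('r, 's) based_cpx => ('r, 't) based_cpx => ('r, 'm) chain_cpx =>
   ('s => 't => 'm) => 't => 's => 'm" where
 "swap R S T K c = (\<lambda>t s. sgn_elt R (dg S s * dg T t) \<odot>\<^bsub>amb K\<^esub> c s t)"

lemma single_hom: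
 assumes M: "module R M" and s: "s \<in> S"
 shows "single M s \<in> module_hom R M (formal_sums M S)"
proof -
 interpret M: module R M by fact
 show ?thesis
  by (rule module_homI) (auto simp: single_closed[OF M s], auto simp: single_def fun_eq_iff)
qed

lemma formal_sums2_eq0:
 assumes "c \<in> carrier (formal_sums (formal_sums M T) S)"
 shows "s \<notin> supp (formal_sums M T) c ==> c s t = \<zero>\<^bsub>M\<^esub>" "s \<notin> S ==> c s t = \<zero>\<^bsub>M\<^esub>" "t \<notin> T ==> c s t = \<zero>\<^bsub>M\<^esub>"
  "c s t \<in> carrier M"
 using formal_sums_outside[OF assms, of s] formal_sums_closed[OF assms, of s]
 by (auto simp: supp_def formal_sums_carrier)

lemma formal_sums2_hom_eqI:
 assumes M: "module R M" and N: "module R N"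
  and f: "f \<in> module_hom R (formal_sums (formal_sums M T) S) N"
  and g: "g \<in> module_hom R (formal_sums (formal_sums M T) S) N"
  and eq: "\<And>s t x. s \<in> S ==> t \<in> T ==> x \<in> carrier M ==>
    f (single (formal_sums M T) s (single M t x)) = g (single (formal_sums M T) s (single M t x))"
  and c: "c \<in> carrier (formal_sums (formal_sums M T) S)"
 shows "f c = g c"
proof (rule formal_sums_hom_eqI[OF formal_sums_module[OF M] N f g _ c])
 fix s y assume s: "s \<in> S" and y: "y \<in> carrier (formal_sums M T)"
 note sh = single_hom[OF formal_sums_module[OF M] s]
 show "f (single (formal_sums M T) s y) = g (single (formal_sums M T) s y)"
  by (rule formal_sums_hom_eqI[OF M N module_hom_comp[OF sh f] module_hom_comp[OF sh g] eq[OF s] y])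
qed

context
 fixes R :: "'r ring" and S :: "('r, 's) based_cpx" and T :: "('r, 't) based_cpx" and K :: "('r, 'm) chain_cpx"
 assumes S: "based_cpx R S" and T: "based_cpx R T" and K: "chain_cpx R K"
begin

interpretation M: module R "amb K" by (rule chain_cpxD(1)[OF K])

abbreviation (input) "MS \<equiv> formal_sums (amb K) (bas S)"
abbreviation (input) "MT \<equiv> formal_sums (amb K) (bas T)"
abbreviation (input) "MTS \<equiv> formal_sums MT (bas S)"
abbreviation (input) "MST \<equiv> formal_sums MS (bas T)"

lemma swap_closed:
 assumes c: "c \<in> carrier MTS"
 shows "swap R S T K c \<in> carrier MST"
proof -
 note z = formal_sums2_eq0[OF c]
 note sg = sgn_elt_closed[OF M.R.is_cring]
 have fin: "finite (supp MT c)" "finite (supp (amb K) (c s))" for s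
  using formal_sums_finite[OF c] formal_sums_finite[OF formal_sums_closed[OF c]] by auto
 let ?A = "\<Union>s\<in>supp MT c. supp (amb K) (c s)"
 show ?thesis
 proof (rule formal_sumsI[of _ _ ?A])
  show "swap R S T K c t \<in> carrier MS" for t
   by (rule formal_sumsI[OF _ fin(1)]) (use z sg in \<open>auto simp: swap_def\<close>)
  show "finite ?A" using fin by blast
  show "swap R S T K c t = \<zero>\<^bsub>MS\<^esub>" if t: "t \<notin> ?A" for t
  proof -
   have "c s t = \<zero>\<^bsub>amb K\<^esub>" for s using t z(1)[of s] by (cases "s \<in> supp MT c") (auto simp: supp_iff[of t])
   then show ?thesis using sg by (auto simp: swap_def)
  qed
  show "swap R S T K c t = \<zero>\<^bsub>MS\<^esub>" if t: "t \<notin> bas T" for t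
   using z(3)[OF t] sg by (auto simp: swap_def)
 qed
qed

lemma swap_hom: "swap R S T K \<in> module_hom R MTS MST"
proof (rule module_homI)
 note sg = sgn_elt_closed[OF M.R.is_cring]
 fix c assume c: "c \<in> carrier MTS"
 note z = formal_sums2_eq0(4)[OF c]
 show "swap R S T K c \<in> carrier MST" by (rule swap_closed[OF c])
 show "swap R S T K (r \<odot>\<^bsub>MTS\<^esub> c) = r \<odot>\<^bsub>MST\<^esub> swap R S T K c" if "r \<in> carrier R" for r
  using z sg that by (simp add: swap_def M.smult_assoc1[symmetric] M.R.m_comm)
 show "swap R S T K (c \<oplus>\<^bsub>MTS\<^esub> d) = swap R S T K c \<oplus>\<^bsub>MST\<^esub> swap R S T K d" if d: "d \<in> carrier MTS" for d
  using z formal_sums2_eq0(4)[OF d] sg by (simp add: swap_def M.smult_r_distr)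
qed

lemma swap_dif_single:
 assumes s: "s \<in> bas S" and t: "t \<in> bas T" and x: "x \<in> carrier (amb K)"
 shows "swap R S T K (dif (tens R S (tens R T K)) (single MT s (single (amb K) t x))) =
  dif (tens R T (tens R S K)) (swap R S T K (single MT s (single (amb K) t x)))"
proof -
 let ?M = "amb K"
 note d = chain_cpxD(3)[OF K]
 note dx = module_hom_closed[OF d x]
 note sg = sgn_elt_closed[OF M.R.is_cring]
 note TK = tens_chain_cpx[OF T K] and SK = tens_chain_cpx[OF S K]
 let ?z = "sgn_elt R (dg S s * dg T t) \<odot>\<^bsub>?M\<^esub> x"
 have z: "?z \<in> carrier ?M" using sg x by simp
 note xt = single_closed[OF M.module_axioms t x] and zs = single_closed[OF M.module_axioms s z]
 have "swap R S T K (single MT s (single ?M t x)) = single MS t (single ?M s ?z)"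
  using sg by (auto simp: swap_def single_def fun_eq_iff)
 then have R: "dif (tens R T (tens R S K)) (swap R S T K (single MT s (single ?M t x))) =
   tens_col R T (tens R S K) t (single ?M s ?z)"
  using tens_dif_single[OF T SK t] zs by simp
 have L: "dif (tens R S (tens R T K)) (single MT s (single ?M t x)) = tens_col R S (tens R T K) s (single ?M t x)"
  using tens_dif_single[OF S TK s] xt by simp
 have "sgn_elt R (dg S s' * dg T t') \<odot>\<^bsub>?M\<^esub> tens_col R S (tens R T K) s (single ?M t x) s' t' =
   tens_col R T (tens R S K) t (single ?M s ?z) t' s'" for s' t'
 proof -
  have iss: "inc S s s = \<zero>\<^bsub>R\<^esub>" and itt: "inc T t t = \<zero>\<^bsub>R\<^esub>"
   using based_cpxD(7)[OF S, of s s] based_cpxD(7)[OF T, of t t] by auto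
  note i = based_cpxD(2)[OF S] based_cpxD(2)[OF T]
  have l: "tens_col R S (tens R T K) s (single ?M t x) s' t' =
   inc S s' s \<odot>\<^bsub>?M\<^esub> (if t' = t then x else \<zero>\<^bsub>?M\<^esub>) \<oplus>\<^bsub>?M\<^esub>
   (if s' = s then sgn_elt R (dg S s) \<odot>\<^bsub>?M\<^esub> (inc T t' t \<odot>\<^bsub>?M\<^esub> x \<oplus>\<^bsub>?M\<^esub>
    (if t' = t then sgn_elt R (dg T t) \<odot>\<^bsub>?M\<^esub> dif K x else \<zero>\<^bsub>?M\<^esub>)) else \<zero>\<^bsub>?M\<^esub>)"
   using tens_dif_single[OF T K t x] by (auto simp: tens_col_def single_def)
  have r: "tens_col R T (tens R S K) t (single ?M s ?z) t' s' =
   inc T t' t \<odot>\<^bsub>?M\<^esub> (if s' = s then ?z else \<zero>\<^bsub>?M\<^esub>) \<oplus>\<^bsub>?M\<^esub>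
   (if t' = t then sgn_elt R (dg T t) \<odot>\<^bsub>?M\<^esub> (inc S s' s \<odot>\<^bsub>?M\<^esub> ?z \<oplus>\<^bsub>?M\<^esub>
    (if s' = s then sgn_elt R (dg S s) \<odot>\<^bsub>?M\<^esub> dif K ?z else \<zero>\<^bsub>?M\<^esub>)) else \<zero>\<^bsub>?M\<^esub>)"
   using tens_dif_single[OF S K s z] by (auto simp: tens_col_def single_def)
  have dz: "dif K ?z = sgn_elt R (dg S s * dg T t) \<odot>\<^bsub>?M\<^esub> dif K x"
   by (rule module_hom_smult[OF d sg x])
  note sm = sgn_elt_smult[OF M.module_axioms]
  consider "s' = s" "t' = t" | "s' = s" "t' \<noteq> t" | "s' \<noteq> s" "t' = t" | "s' \<noteq> s" "t' \<noteq> t" by blast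
  then show ?thesis
  proof cases
   case 1
   then show ?thesis unfolding l r dz using iss itt i x dx sg
    by (auto simp: sm M.smult_r_minus)
  next
   case 2
   show ?thesis
   proof (cases "inc T t' t = \<zero>\<^bsub>R\<^esub>")
    case True
    then show ?thesis unfolding l r using 2 x z sg i dx by simp
   next
    case False
    then have e: "dg T t' = dg T t - 1" using based_cpxD(6)[OF T] by simp
    have "dg S s * (dg T t - 1) = dg S s * dg T t - dg S s" by (simp add: algebra_simps)
    then show ?thesis unfolding l r e using 2 x z sg i dx
     by (auto simp: sm M.smult_r_minus M.minus_minus)
   qed
  next
   case 3
   show ?thesis
   proof (cases "inc S s' s = \<zero>\<^bsub>R\<^esub>")
    case True
    then show ?thesis unfolding l r using 3 x z sg i dx by simp
   next
    case False
    then have e: "dg S s' = dg S s - 1" using based_cpxD(6)[OF S] by simp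
    have "(dg S s - 1) * dg T t = dg S s * dg T t - dg T t" by (simp add: algebra_simps)
    then show ?thesis unfolding l r e using 3 x z sg i dx
     by (auto simp: sm M.smult_r_minus M.minus_minus)
   qed
  next
   case 4
   then show ?thesis unfolding l r using sg i x z dx by simp
  qed
 qed
 then show ?thesis unfolding R L by (simp add: swap_def)
qed

lemma swap_dif:
 assumes c: "c \<in> carrier MTS"
 shows "swap R S T K (dif (tens R S (tens R T K)) c) = dif (tens R T (tens R S K)) (swap R S T K c)"
proof (rule formal_sums2_hom_eqI[OF M.module_axioms
   formal_sums_module[OF formal_sums_module[OF M.module_axioms]],
   where f = "\<lambda>c. swap R S T K (dif (tens R S (tens R T K)) c)"
    and g = "\<lambda>c. dif (tens R T (tens R S K)) (swap R S T K c)", OF _ _ swap_dif_single c])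
 show "(\<lambda>c. swap R S T K (dif (tens R S (tens R T K)) c)) \<in> module_hom R MTS MST"
  using module_hom_comp[OF tens_dif_hom[OF S tens_chain_cpx[OF T K]], simplified, OF swap_hom] .
 show "(\<lambda>c. dif (tens R T (tens R S K)) (swap R S T K c)) \<in> module_hom R MTS MST"
  using module_hom_comp[OF swap_hom tens_dif_hom[OF T tens_chain_cpx[OF S K], simplified]] .
qed

lemma swap_grd:
 assumes c: "c \<in> grd (tens R S (tens R T K)) n"
 shows "swap R S T K c \<in> grd (tens R T (tens R S K)) n"
proof -
 have cF: "c \<in> carrier MTS" using c by (simp add: tens_grd)
 note sc = swap_closed[OF cF]
 show ?thesis unfolding tens_grd
 proof (intro conjI ballI)
  show "swap R S T K c \<in> carrier (formal_sums (amb (tens R S K)) (bas T))" using sc by simp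
  fix t assume t: "t \<in> bas T"
  show "swap R S T K c t \<in> carrier MS" using formal_sums_closed[OF sc] .
  fix s assume s: "s \<in> bas S"
  have "c s t \<in> grd K (n - dg S s - dg T t)" using c s t by (simp add: tens_grd)
  then show "swap R S T K c t s \<in> grd K (n - dg T t - dg S s)"
   using grd_closed(3)[OF K sgn_elt_closed[OF M.R.is_cring]]
   by (simp add: swap_def algebra_simps)
 qed
qed

end

lemma swap_swap:
 assumes S: "based_cpx R S" and T: "based_cpx R T" and K: "chain_cpx R K"
  and c: "c \<in> carrier (formal_sums (formal_sums (amb K) (bas T)) (bas S))"
 shows "swap R T S K (swap R S T K c) = c"
proof -
 interpret M: module R "amb K" by (rule chain_cpxD(1)[OF K])
 have "sgn_elt R (dg S s * dg T t) = sgn_elt R (dg T t * dg S s)" for s t by (simp add: mult.commute)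
 then show ?thesis
  using sgn_elt_involution[OF M.module_axioms formal_sums2_eq0(4)[OF c]]
  by (simp add: swap_def fun_eq_iff)
qed

lemma quasi_iso_swap:
 assumes S: "based_cpx R S" and T: "based_cpx R T" and K: "chain_cpx R K"
 shows "quasi_iso R (tens R S (tens R T K)) (tens R T (tens R S K)) (swap R S T K)"
proof (rule quasi_isoI_bij)
 show "bij_betw (swap R S T K) (grd (tens R S (tens R T K)) n) (grd (tens R T (tens R S K)) n)" for n
 proof (rule bij_betw_byWitness[of _ "swap R T S K"])
  show "\<forall>c\<in>grd (tens R S (tens R T K)) n. swap R T S K (swap R S T K c) = c"
   using swap_swap[OF S T K] by (simp add: tens_grd)
  show "\<forall>c\<in>grd (tens R T (tens R S K)) n. swap R S T K (swap R T S K c) = c"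
   using swap_swap[OF T S K] by (simp add: tens_grd)
 qed (intro image_subsetI swap_grd S T K; assumption)+
qed (use tens_chain_cpx[OF S tens_chain_cpx[OF T K]] tens_chain_cpx[OF T tens_chain_cpx[OF S K]] swap_hom[OF S T K] swap_dif[OF S T K] in auto)

section \<open>Bases, and submodules of free modules over a principal ideal domain\<close>

definition combo :: "'r ring => ('r, 'm) module => ('b => 'm) => ('b => 'r) => 'm" where
 "combo R M e = lin (ring_module R) M (\<lambda>b r. r \<odot>\<^bsub>M\<^esub> e b)"

definition module_basis :: "'r ring => ('r, 'm) module => 'b set => ('b => 'm) => bool" where
 "module_basis R M B e \<longleftrightarrow> e ` B \<subseteq> carrier M \<and>
   bij_betw (combo R M e) (carrier (free_module R B)) (carrier M)"

lemma free_module_module: "cring R ==> module R (free_module R S)"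
 unfolding free_module_def by (intro formal_sums_module ring_module_module)

lemma smult_hom:
 assumes M: "module R M" and x: "x \<in> carrier M"
 shows "(\<lambda>r. r \<odot>\<^bsub>M\<^esub> x) \<in> module_hom R (ring_module R) M"
proof -
 interpret M: module R M by fact
 show ?thesis by (rule module_homI) (use x in \<open>auto simp: M.smult_l_distr M.smult_assoc1\<close>)
qed

lemma combo_hom:
 assumes M: "module R M" and e: "\<And>b. b \<in> B ==> e b \<in> carrier M"
 shows "combo R M e \<in> module_hom R (free_module R B) M"
proof -
 interpret M: module R M by fact
 show ?thesis unfolding combo_def free_module_def
  by (rule lin_hom[OF ring_module_module[OF M.R.is_cring] M smult_hom[OF M e]])
qed

lemma combo_single:
 assumes M: "module R M" and e: "\<And>b. b \<in> B ==> e b \<in> carrier M" and b: "b \<in> B" and x: "x \<in> carrier R"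
 shows "combo R M e (single (ring_module R) b x) = x \<odot>\<^bsub>M\<^esub> e b"
proof -
 interpret M: module R M by fact
 show ?thesis unfolding combo_def
  using lin_single[OF ring_module_module[OF M.R.is_cring] M smult_hom[OF M e] b, where x = x] x by simp
qed

lemma submodule_inclusion_hom: "(\<lambda>x. x) \<in> module_hom R (M\<lparr>carrier := H\<rparr>) M" if "submodule H R M" "module R M"
 using that submodule_iff[OF that(2)] by (intro module_homI) auto

lemma combo_submodule:
 assumes M: "module R M" and H: "submodule H R M" and e: "\<And>b. b \<in> B ==> e b \<in> H"
  and c: "c \<in> carrier (free_module R B)"
 shows "combo R (M\<lparr>carrier := H\<rparr>) e c = combo R M e c"
proof -
 have HM: "module R (M\<lparr>carrier := H\<rparr>)" by (rule submodule.submodule_is_module[OF H M])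
 interpret HM: module R "M\<lparr>carrier := H\<rparr>" by (rule HM)
 have "finite (supp (ring_module R) c)" "supp (ring_module R) c \<subseteq> B" "\<And>b. c b \<in> carrier R"
  using c by (auto simp: free_module_def formal_sums_carrier)
 then show ?thesis
  using module_hom_finsum[OF HM M submodule_inclusion_hom[OF H M], of "supp (ring_module R) c"
    "\<lambda>b. c b \<odot>\<^bsub>M\<^esub> e b"] e submodule_iff[OF M, of H] H
  by (auto simp: combo_def lin_def Pi_def subset_iff)
qed

lemma ideal_of_submodule:
 assumes R: "cring R" and I: "submodule I R (ring_module R)"
 shows "ideal I R"
proof -
 interpret R: cring R by fact
 have I': "I \<subseteq> carrier R" "\<zero>\<^bsub>R\<^esub> \<in> I" "\<And>x y. x \<in> I ==> y \<in> I ==> x \<oplus>\<^bsub>R\<^esub> y \<in> I" "\<And>r x. r \<in> carrier R ==> x \<in> I ==> r \<otimes>\<^bsub>R\<^esub> x \<in> I"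
  using I unfolding submodule_iff[OF ring_module_module[OF R]] by auto
 show ?thesis
 proof (rule idealI[OF R.ring_axioms])
  have "\<ominus>\<^bsub>R\<^esub> a \<in> I" if "a \<in> I" for a
   using I'(4)[OF _ that, of "\<ominus>\<^bsub>R\<^esub> \<one>\<^bsub>R\<^esub>"] I'(1) that by (auto simp: R.l_minus)
  then show "subgroup I (add_monoid R)"
   using I' by (intro R.add.subgroupI) auto
  show "x \<otimes>\<^bsub>R\<^esub> a \<in> I" if "a \<in> I" "x \<in> carrier R" for a x using I' that by blast
  show "a \<otimes>\<^bsub>R\<^esub> x \<in> I" if "a \<in> I" "x \<in> carrier R" for a x
   using I'(4)[OF that(2,1)] R.m_comm[of a x] I'(1) that by auto
 qed
qed

lemma finite_linear_order_max:
 assumes "finite A" "A \<noteq> {}" and "Linear_order r" "Field r = UNIV"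
 shows "\<exists>m\<in>A. \<forall>x\<in>A. (x, m) \<in> r"
 using assms(1,2)
proof (induction A rule: finite_ne_induct)
 case (singleton x)
 then show ?case using assms(3,4) by (auto simp: order_on_defs refl_on_def)
next
 case (insert x A)
 then obtain m where m: "m \<in> A" "\<forall>y\<in>A. (y, m) \<in> r" by blast
 have rx: "(x, x) \<in> r" and tr: "trans r" and tot: "total_on UNIV r"
  using assms(3,4) by (auto simp: order_on_defs refl_on_def)
 have "x \<noteq> m" using insert.hyps m(1) by blast
 then have "(x, m) \<in> r \<or> (m, x) \<in> r" using tot by (simp add: total_on_def)
 then show ?case
 proof
  assume "(x, m) \<in> r"
  then show ?thesis using m by blast
 next
  assume mx: "(m, x) \<in> r"
  have "(y, x) \<in> r" if "y \<in> A" for y using transD[OF tr _ mx] m(2) that by blast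
  then show ?thesis using rx by blast
 qed
qed

text \<open>
  Well-order the index set. The coefficients at \<open>s\<close> of those elements of \<open>H\<close> whose support has no index
  beyond \<open>s\<close> form an ideal, generated by some \<open>a s\<close>; let \<open>g s\<close> be such an element with coefficient \<open>a s\<close>.
  The \<open>g s\<close> with \<open>a s \<noteq> 0\<close> form a basis: they are independent by comparing leading coefficients, and they
  span \<open>H\<close> because subtracting a multiple of \<open>g s\<close> lowers the leading index.
\<close>

theorem submodule_of_free_has_basis:
 fixes R :: "'r ring" and S :: "'s set"
 assumes R: "principal_domain R" and H: "submodule H R (free_module R S)"
 shows "\<exists>B (e :: 's => 's => 'r). module_basis R ((free_module R S)\<lparr>carrier := H\<rparr>) B e"
proof -
 interpret R: principal_domain R by fact
 have cr: "cring R" by (rule R.is_cring)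
 let ?F = "free_module R S" and ?R = "ring_module R"
 note Rm = ring_module_module[OF cr]
 have F: "module R ?F" by (rule free_module_module[OF cr])
 interpret F: module R ?F by (rule F)
 note H' = submodule_iff[OF F, THEN iffD1, OF H]
 have hS: "h \<in> carrier ?F" if "h \<in> H" for h using that H' by blast
 have hc: "h t \<in> carrier R" if "h \<in> carrier ?F" for h t
  using formal_sums_closed[of h ?R S t] that by (simp add: free_module_def)
 obtain r :: "('s \<times> 's) set" where r': "Well_order r \<and> Field r = UNIV"
  using well_ordering ..
 note r = conjunct1[OF r'] conjunct2[OF r']
 then have lin: "Linear_order r" and wf: "wf (r - Id)" unfolding well_order_on_def by blast+
 have anti: "antisym r" using lin by (simp add: order_on_defs)
 define L where "L s = {h \<in> H. \<forall>t. h t \<noteq> \<zero>\<^bsub>R\<^esub> \<longrightarrow> (t, s) \<in> r}" for s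
 have Lsub: "submodule (L s) R ?F" for s
  unfolding submodule_iff[OF F]
 proof (intro conjI ballI)
  show "L s \<subseteq> carrier ?F" using H' by (auto simp: L_def)
  show "\<zero>\<^bsub>?F\<^esub> \<in> L s" using H' by (auto simp: L_def free_module_def)
  show "x \<oplus>\<^bsub>?F\<^esub> y \<in> L s" if x: "x \<in> L s" and y: "y \<in> L s" for x y
   unfolding L_def
  proof (intro CollectI conjI allI impI)
   show "x \<oplus>\<^bsub>?F\<^esub> y \<in> H" using H' x y by (simp add: L_def)
   fix t assume "(x \<oplus>\<^bsub>?F\<^esub> y) t \<noteq> \<zero>\<^bsub>R\<^esub>"
   then have "x t \<noteq> \<zero>\<^bsub>R\<^esub> \<or> y t \<noteq> \<zero>\<^bsub>R\<^esub>" by (auto simp: free_module_def)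
   then show "(t, s) \<in> r" using x y by (auto simp: L_def)
  qed
  show "b \<odot>\<^bsub>?F\<^esub> x \<in> L s" if b: "b \<in> carrier R" and x: "x \<in> L s" for b x
   unfolding L_def
  proof (intro CollectI conjI allI impI)
   show "b \<odot>\<^bsub>?F\<^esub> x \<in> H" using H' x b by (simp add: L_def)
   fix t assume "(b \<odot>\<^bsub>?F\<^esub> x) t \<noteq> \<zero>\<^bsub>R\<^esub>"
   then have "x t \<noteq> \<zero>\<^bsub>R\<^esub>" using b by (auto simp: free_module_def)
   then show "(t, s) \<in> r" using x by (auto simp: L_def)
  qed
 qed
 have ev: "(\<lambda>h. h s) \<in> module_hom R ?F ?R" for s unfolding free_module_def by (rule eval_hom)
 have "\<exists>a\<in>carrier R. (\<lambda>h. h s) ` L s = PIdl\<^bsub>R\<^esub> a" for s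
  by (rule R.exists_gen[OF ideal_of_submodule[OF cr submodule_image[OF F Rm ev Lsub]]])
 then obtain a where a: "\<And>s. a s \<in> carrier R" "\<And>s. (\<lambda>h. h s) ` L s = PIdl\<^bsub>R\<^esub> (a s)" by metis
 have "\<exists>h\<in>L s. h s = a s" for s
 proof -
  have "a s \<in> (\<lambda>h. h s) ` L s" unfolding a(2) by (rule R.cgenideal_self[OF a(1)])
  then show ?thesis by auto
 qed
 then obtain g where g: "\<And>s. g s \<in> L s" "\<And>s. g s s = a s" by metis
 have gH: "g s \<in> H" for s using g(1) by (auto simp: L_def)
 have gF: "g s \<in> carrier ?F" for s using hS[OF gH] .
 have gle: "(t, s) \<in> r" if "g s t \<noteq> \<zero>\<^bsub>R\<^esub>" for s t using g(1)[of s] that by (auto simp: L_def)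
 define B where "B = {s. a s \<noteq> \<zero>\<^bsub>R\<^esub>}"
 let ?B = "free_module R B"
 have Bm: "module R ?B" by (rule free_module_module[OF cr])
 have ch: "combo R ?F g \<in> module_hom R ?B ?F" by (rule combo_hom[OF F gF])
 have inj: "c = (\<lambda>_. \<zero>\<^bsub>R\<^esub>)" if c: "c \<in> carrier ?B" and z: "combo R ?F g c = (\<lambda>_. \<zero>\<^bsub>R\<^esub>)" for c
 proof (rule ccontr)
  assume nz: "c \<noteq> (\<lambda>_. \<zero>\<^bsub>R\<^esub>)"
  let ?A = "supp ?R c"
  have A: "finite ?A" "?A \<subseteq> B" "?A \<noteq> {}" and cc: "\<And>s. c s \<in> carrier R"
   using c nz by (auto simp: free_module_def formal_sums_carrier supp_def)
  then obtain m where m: "m \<in> ?A" "\<forall>x\<in>?A. (x, m) \<in> r"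
   using finite_linear_order_max[OF A(1,3) lin r(2)] by blast
  have zz: "g s m = \<zero>\<^bsub>R\<^esub>" if "s \<in> ?A" "s \<noteq> m" for s
   using gle[of s m] m(2) that anti by (auto dest: antisymD)
  have "combo R ?F g c m = (\<Oplus>\<^bsub>?R\<^esub> s\<in>?A. (c s \<odot>\<^bsub>?F\<^esub> g s) m)"
   unfolding combo_def lin_def free_module_def
   by (rule finsum_apply[OF Rm A(1)]) (use F.smult_closed[OF cc gF] in \<open>simp add: free_module_def\<close>)
  also have "\<dots> = (\<Oplus>\<^bsub>R\<^esub> s\<in>?A. c s \<otimes>\<^bsub>R\<^esub> g s m)" by (simp add: ring_module_finsum free_module_def)
  also have "\<dots> = (\<Oplus>\<^bsub>R\<^esub> s\<in>?A. if m = s then c s \<otimes>\<^bsub>R\<^esub> g s m else \<zero>\<^bsub>R\<^esub>)"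
   using cc hc[OF gF] zz by (intro R.finsum_cong') auto
  also have "\<dots> = c m \<otimes>\<^bsub>R\<^esub> g m m"
   using cc hc[OF gF] by (intro R.finsum_singleton[OF m(1) A(1)]) auto
  finally have "c m \<otimes>\<^bsub>R\<^esub> a m = \<zero>\<^bsub>R\<^esub>" using z g(2) by simp
  then have "c m = \<zero>\<^bsub>R\<^esub> \<or> a m = \<zero>\<^bsub>R\<^esub>" using R.integral cc a by blast
  then show False using m(1) A(2) by (auto simp: supp_def B_def)
 qed
 define U where "U = combo R ?F g ` carrier ?B"
 have U: "submodule U R ?F"
  unfolding U_def by (rule submodule_image[OF Bm F ch module.carrier_is_submodule[OF Bm]])
 note U' = submodule_iff[OF F, THEN iffD1, OF U]
 have gU: "g s \<in> U" if "s \<in> B" for s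
 proof -
  have "combo R ?F g (single ?R s \<one>\<^bsub>R\<^esub>) = g s"
   using combo_single[OF F, of B g s "\<one>\<^bsub>R\<^esub>"] gF that by (simp add: F.smult_one)
  moreover have "single ?R s \<one>\<^bsub>R\<^esub> \<in> carrier ?B"
   unfolding free_module_def using single_closed[OF Rm that] by simp
  ultimately show ?thesis unfolding U_def by (metis image_eqI)
 qed
 have span: "\<forall>h\<in>L s. h \<in> U" for s
  using wf
 proof (induction s rule: wf_induct_rule)
  case (less s)
  show ?case
  proof
   fix h assume h: "h \<in> L s"
   have step: "h' \<in> U" if h': "h' \<in> L s" "h' s = \<zero>\<^bsub>R\<^esub>" for h'
   proof (cases "supp ?R h' = {}")
    case True
    then have "h' = \<zero>\<^bsub>?F\<^esub>" by (auto simp: supp_def free_module_def)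
    then show ?thesis using U' by simp
   next
    case False
    have h'F: "h' \<in> carrier ?F" using h' hS by (auto simp: L_def)
    then have "finite (supp ?R h')" by (auto simp: free_module_def formal_sums_carrier)
    then obtain m where m: "m \<in> supp ?R h'" "\<forall>x\<in>supp ?R h'. (x, m) \<in> r"
     using finite_linear_order_max[OF _ False lin r(2)] by blast
    then have "h' \<in> L m" "(m, s) \<in> r - Id" using h' by (auto simp: L_def supp_def)
    then show ?thesis using less by blast
   qed
   have "h s \<in> PIdl\<^bsub>R\<^esub> (a s)" using h unfolding a(2)[symmetric] by blast
   then obtain x where x: "x \<in> carrier R" "h s = x \<otimes>\<^bsub>R\<^esub> a s" by (auto simp: cgenideal_def)
   show "h \<in> U"
   proof (cases "a s = \<zero>\<^bsub>R\<^esub>")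
    case True
    then show ?thesis using step[OF h] x by simp
   next
    case False
    let ?k = "x \<odot>\<^bsub>?F\<^esub> g s" and ?h' = "h \<ominus>\<^bsub>?F\<^esub> (x \<odot>\<^bsub>?F\<^esub> g s)"
    have hF: "h \<in> carrier ?F" using h hS by (auto simp: L_def)
    have kF: "?k \<in> carrier ?F" using x gF by simp
    have kL: "?k \<in> L s" using submodule_iff[OF F, THEN iffD1, OF Lsub[of s]] x g(1) by blast
    have "?h' s = h s \<ominus>\<^bsub>?R\<^esub> ?k s"
     unfolding free_module_def
     by (rule formal_sums_minus_apply[OF Rm]) (use hF kF in \<open>simp_all add: free_module_def\<close>)
    also have "?k s = h s" using x g(2) by (simp add: free_module_def)
    also have "h s \<ominus>\<^bsub>?R\<^esub> h s = \<zero>\<^bsub>R\<^esub>"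
     using module_minus_eq_zero[OF Rm, of "h s" "h s"] hc[OF hF] by simp
    finally have "?h' \<in> U"
     using step[of ?h'] submodule_minus[OF F Lsub h kL] by blast
    moreover have "?k \<in> U" using U' x gU[of s] False by (simp add: B_def)
    moreover have "h = ?h' \<oplus>\<^bsub>?F\<^esub> ?k"
     using hF kF by (simp add: a_minus_def F.a_assoc F.l_neg del: formal_sums_simps)
    ultimately show ?thesis using U' by metis
   qed
  qed
 qed
 have HU: "h \<in> U" if "h \<in> H" for h
 proof (cases "supp ?R h = {}")
  case True
  then have "h = \<zero>\<^bsub>?F\<^esub>" by (auto simp: supp_def free_module_def)
  then show ?thesis using U' by simp
 next
  case False
  have "finite (supp ?R h)" using hS[OF that] by (auto simp: free_module_def formal_sums_carrier)
  then obtain m where m: "m \<in> supp ?R h" "\<forall>x\<in>supp ?R h. (x, m) \<in> r"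
   using finite_linear_order_max[OF _ False lin r(2)] by blast
  then have "h \<in> L m" using that by (auto simp: L_def supp_def)
  then show ?thesis using span by blast
 qed
 have UH: "U \<subseteq> H"
 proof -
  have "combo R ?F g c \<in> H" if "c \<in> carrier ?B" for c
   unfolding combo_def
  proof (rule lin_in_submodule[OF Rm F _ H])
   show "(\<lambda>r. r \<odot>\<^bsub>?F\<^esub> g b) \<in> module_hom R ?R ?F" if "b \<in> B" for b by (rule smult_hom[OF F gF])
   show "c \<in> carrier (formal_sums ?R B)" using that by (simp add: free_module_def)
   show "c s \<odot>\<^bsub>?F\<^esub> g s \<in> H" for s
    using H' gH formal_sums_closed[of c ?R B s] that by (simp add: free_module_def)
  qed
  then show ?thesis by (auto simp: U_def)
 qed
 have "module_basis R (?F\<lparr>carrier := H\<rparr>) B g"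
  unfolding module_basis_def
 proof
  show "g ` B \<subseteq> carrier (?F\<lparr>carrier := H\<rparr>)" using gH by auto
  have "bij_betw (combo R ?F g) (carrier ?B) H"
  proof (rule bij_betw_imageI)
   show "inj_on (combo R ?F g) (carrier ?B)"
   proof (rule inj_onI)
    fix c d assume cd: "c \<in> carrier ?B" "d \<in> carrier ?B" "combo R ?F g c = combo R ?F g d"
    interpret B: module R ?B by (rule Bm)
    have "combo R ?F g (c \<ominus>\<^bsub>?B\<^esub> d) = \<zero>\<^bsub>?F\<^esub>"
     using module_hom_minus[OF Bm F ch cd(1,2)] cd(3) module_hom_closed[OF ch cd(2)]
      module_minus_eq_zero[OF F] by simp
    then have "c \<ominus>\<^bsub>?B\<^esub> d = \<zero>\<^bsub>?B\<^esub>"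
     using inj[OF B.minus_closed[OF cd(1,2)]] by (simp add: free_module_def)
    then show "c = d" using module_minus_eq_zero[OF Bm cd(1,2)] by simp
   qed
   show "combo R ?F g ` carrier ?B = H" using UH HU by (auto simp: U_def)
  qed
  then show "bij_betw (combo R (?F\<lparr>carrier := H\<rparr>) g) (carrier ?B) (carrier (?F\<lparr>carrier := H\<rparr>))"
   using bij_betw_cong[of "carrier ?B" "combo R (?F\<lparr>carrier := H\<rparr>) g" "combo R ?F g" H]
    combo_submodule[OF F H, of B g] gH by simp
 qed
 then show ?thesis by blast
qed

section \<open>Tensor products\<close>

definition bilinear :: "'r ring => ('r, 'm) module => ('r, 'n) module => ('r, 'w) module => ('m => 'n => 'w) => bool" where
 "bilinear R M N W \<beta> \<longleftrightarrow> (\<forall>x\<in>carrier M. \<beta> x \<in> module_hom R N W) \<and>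
   (\<forall>y\<in>carrier N. (\<lambda>x. \<beta> x y) \<in> module_hom R M W)"

definition pure_tensor :: "'r ring => ('r, 'm) module => ('r, 'n) module => 'm => 'n => ('m \<times> 'n => 'r) set" where
 "pure_tensor R M N x y =
   tensor_kernel R M N +>\<^bsub>free_module R (carrier M \<times> carrier N)\<^esub> free_gen R (x, y)"

lemma free_gen_single: "free_gen R = (\<lambda>s. single (ring_module R) s \<one>\<^bsub>R\<^esub>)"
 by (simp add: free_gen_def single_def fun_eq_iff)

lemma module_span_submodule:
 assumes M: "module R M" and S: "S \<subseteq> carrier M"
 shows "submodule (module_span R M S) R M" "S \<subseteq> module_span R M S"
proof -
 interpret M: module R M by fact
 have c: "carrier M \<in> {H. submodule H R M \<and> S \<subseteq> H}" using M.carrier_is_submodule S by simp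
 show "S \<subseteq> module_span R M S" by (auto simp: module_span_def)
 show "submodule (module_span R M S) R M"
  unfolding submodule_iff[OF M]
 proof (intro conjI ballI)
  show "module_span R M S \<subseteq> carrier M" using c by (auto simp: module_span_def)
 qed (auto simp: module_span_def submodule_iff[OF M])
qed

lemma module_span_least: "submodule H R M ==> S \<subseteq> H ==> module_span R M S \<subseteq> H"
 by (auto simp: module_span_def)

lemma free_gen_closed:
 assumes R: "cring R" and s: "s \<in> S" shows "free_gen R s \<in> carrier (free_module R S)"
proof -
 interpret R: cring R by fact
 show ?thesis unfolding free_gen_single free_module_def
  using single_closed[OF ring_module_module[OF R] s] by simp
qed

lemma free_module_hom_eqI:
 assumes W: "module R W" and f: "f \<in> module_hom R (free_module R S) W" and g: "g \<in> module_hom R (free_module R S) W"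
  and eq: "\<And>s. s \<in> S ==> f (free_gen R s) = g (free_gen R s)" and c: "c \<in> carrier (free_module R S)"
 shows "f c = g c"
proof -
 interpret W: module R W by fact
 note cr = W.R.is_cring
 have s: "single (ring_module R) s x = x \<odot>\<^bsub>free_module R S\<^esub> free_gen R s" if "x \<in> carrier R" for s x
  using that by (auto simp: free_module_def free_gen_single single_def)
 show ?thesis
 proof (rule formal_sums_hom_eqI[OF ring_module_module[OF cr] W f[unfolded free_module_def]
   g[unfolded free_module_def] _ c[unfolded free_module_def]])
  fix t x assume t: "t \<in> S" and x: "x \<in> carrier (ring_module R)"
  then have x': "x \<in> carrier R" by simp
  show "f (single (ring_module R) t x) = g (single (ring_module R) t x)"
   unfolding s[OF x'] using module_hom_smult[OF f x' free_gen_closed[OF cr t]]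
    module_hom_smult[OF g x' free_gen_closed[OF cr t]] eq[OF t] by simp
 qed
qed

context
 fixes R :: "'r ring" and M :: "('r, 'm) module" and N :: "('r, 'n) module"
 assumes M: "module R M" and N: "module R N"
begin

interpretation M: module R M by (rule M)
interpretation N: module R N by (rule N)

abbreviation (input) "PF \<equiv> free_module R (carrier M \<times> carrier N)"
abbreviation (input) "TK \<equiv> tensor_kernel R M N"

lemma PF: "module R PF"
 by (rule free_module_module[OF M.R.is_cring])

interpretation PF: module R PF by (rule PF)

lemma tensor_rels_closed: "tensor_rels R M N \<subseteq> carrier PF"
proof -
 have e: "free_gen R (x, y) \<in> carrier PF" if "x \<in> carrier M" "y \<in> carrier N" for x y
  by (rule free_gen_closed[OF M.R.is_cring]) (use that in simp)
 show ?thesis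
  by (auto simp: tensor_rels_def Let_def intro!: PF.minus_closed PF.a_closed PF.smult_closed e)
qed

lemma tensor_kernel_submodule: "submodule TK R PF"
 unfolding tensor_kernel_def by (rule module_span_submodule[OF PF tensor_rels_closed])

lemma tensor_is_module: "module R (tensor R M N)"
 unfolding tensor_def by (rule quotient_is_module[OF PF tensor_kernel_submodule])

lemma tensor_rels_kernel: "tensor_rels R M N \<subseteq> TK"
 unfolding tensor_kernel_def by (rule module_span_submodule[OF PF tensor_rels_closed])

lemma tensor_proj_hom: "(\<lambda>c. TK +>\<^bsub>PF\<^esub> c) \<in> module_hom R PF (tensor R M N)"
 unfolding tensor_def by (rule quotient_proj_hom[OF PF tensor_kernel_submodule])

lemma tensor_carrierE:
 assumes "X \<in> carrier (tensor R M N)"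
 obtains c where "c \<in> carrier PF" "X = TK +>\<^bsub>PF\<^esub> c"
 using assms[unfolded tensor_def quotient_carrier_iff[OF PF tensor_kernel_submodule]] by blast

lemma pure_tensor_closed:
 "x \<in> carrier M ==> y \<in> carrier N ==> pure_tensor R M N x y \<in> carrier (tensor R M N)"
 unfolding pure_tensor_def
 by (rule module_hom_closed[OF tensor_proj_hom free_gen_closed[OF M.R.is_cring]]) simp

lemma bilinear_pure_tensor: "bilinear R M N (tensor R M N) (pure_tensor R M N)"
proof -
 have e: "free_gen R (x, y) \<in> carrier PF" if "x \<in> carrier M" "y \<in> carrier N" for x y
  by (rule free_gen_closed[OF M.R.is_cring]) (use that in simp)
 have eq: "TK +>\<^bsub>PF\<^esub> a = TK +>\<^bsub>PF\<^esub> b"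
  if "a \<ominus>\<^bsub>PF\<^esub> b \<in> tensor_rels R M N" "a \<in> carrier PF" "b \<in> carrier PF" for a b
  using quotient_class_eq[OF PF tensor_kernel_submodule that(2,3)] that(1) tensor_rels_kernel by blast
 note h = module_hom_add[OF tensor_proj_hom] module_hom_smult[OF tensor_proj_hom]
 show ?thesis
  unfolding bilinear_def
 proof (intro conjI ballI)
  fix x assume x: "x \<in> carrier M"
  show "pure_tensor R M N x \<in> module_hom R N (tensor R M N)"
  proof (rule module_homI)
   fix y assume y: "y \<in> carrier N"
   show "pure_tensor R M N x y \<in> carrier (tensor R M N)" by (rule pure_tensor_closed[OF x y])
   show "pure_tensor R M N x (y \<oplus>\<^bsub>N\<^esub> y') = pure_tensor R M N x y \<oplus>\<^bsub>tensor R M N\<^esub> pure_tensor R M N x y'"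
    if y': "y' \<in> carrier N" for y'
    unfolding pure_tensor_def h(1)[OF e[OF x y] e[OF x y'], symmetric]
   proof (rule eq)
    show "free_gen R (x, y \<oplus>\<^bsub>N\<^esub> y') \<ominus>\<^bsub>PF\<^esub> (free_gen R (x, y) \<oplus>\<^bsub>PF\<^esub> free_gen R (x, y')) \<in> tensor_rels R M N"
     unfolding tensor_rels_def Let_def using x y y' by blast
   qed (use e x y y' in auto)
   show "pure_tensor R M N x (r \<odot>\<^bsub>N\<^esub> y) = r \<odot>\<^bsub>tensor R M N\<^esub> pure_tensor R M N x y"
    if r: "r \<in> carrier R" for r
    unfolding pure_tensor_def h(2)[OF r e[OF x y], symmetric]
   proof (rule eq)
    show "free_gen R (x, r \<odot>\<^bsub>N\<^esub> y) \<ominus>\<^bsub>PF\<^esub> (r \<odot>\<^bsub>PF\<^esub> free_gen R (x, y)) \<in> tensor_rels R M N"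
     unfolding tensor_rels_def Let_def using x y r by blast
   qed (use e x y r in auto)
  qed
 next
  fix y assume y: "y \<in> carrier N"
  show "(\<lambda>x. pure_tensor R M N x y) \<in> module_hom R M (tensor R M N)"
  proof (rule module_homI)
   fix x assume x: "x \<in> carrier M"
   show "pure_tensor R M N x y \<in> carrier (tensor R M N)" by (rule pure_tensor_closed[OF x y])
   show "pure_tensor R M N (x \<oplus>\<^bsub>M\<^esub> x') y = pure_tensor R M N x y \<oplus>\<^bsub>tensor R M N\<^esub> pure_tensor R M N x' y"
    if x': "x' \<in> carrier M" for x'
    unfolding pure_tensor_def h(1)[OF e[OF x y] e[OF x' y], symmetric]
   proof (rule eq)
    show "free_gen R (x \<oplus>\<^bsub>M\<^esub> x', y) \<ominus>\<^bsub>PF\<^esub> (free_gen R (x, y) \<oplus>\<^bsub>PF\<^esub> free_gen R (x', y)) \<in> tensor_rels R M N"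
     unfolding tensor_rels_def Let_def using x x' y by blast
   qed (use e x y x' in auto)
   show "pure_tensor R M N (r \<odot>\<^bsub>M\<^esub> x) y = r \<odot>\<^bsub>tensor R M N\<^esub> pure_tensor R M N x y"
    if r: "r \<in> carrier R" for r
    unfolding pure_tensor_def h(2)[OF r e[OF x y], symmetric]
   proof (rule eq)
    show "free_gen R (r \<odot>\<^bsub>M\<^esub> x, y) \<ominus>\<^bsub>PF\<^esub> (r \<odot>\<^bsub>PF\<^esub> free_gen R (x, y)) \<in> tensor_rels R M N"
     unfolding tensor_rels_def Let_def using x y r by blast
   qed (use e x y r in auto)
  qed
 qed
qed

lemma tensor_hom_eqI:
 assumes W: "module R W" and f: "f \<in> module_hom R (tensor R M N) W" and g: "g \<in> module_hom R (tensor R M N) W"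
  and eq: "\<And>x y. x \<in> carrier M ==> y \<in> carrier N ==> f (pure_tensor R M N x y) = g (pure_tensor R M N x y)"
  and X: "X \<in> carrier (tensor R M N)"
 shows "f X = g X"
proof -
 obtain c where c: "c \<in> carrier PF" "X = TK +>\<^bsub>PF\<^esub> c"
  by (rule tensor_carrierE[OF X])
 have "f (TK +>\<^bsub>PF\<^esub> c) = g (TK +>\<^bsub>PF\<^esub> c)"
  using c(1)
  by (rule free_module_hom_eqI[OF W module_hom_comp[OF tensor_proj_hom f] module_hom_comp[OF tensor_proj_hom g], rotated])
   (use eq in \<open>auto simp: pure_tensor_def\<close>)
 then show ?thesis using c by simp
qed

lemma tensor_universal:
 assumes W: "module R W" and \<beta>: "bilinear R M N W \<beta>"
 obtains h where "h \<in> module_hom R (tensor R M N) W"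
  "\<And>x y. x \<in> carrier M ==> y \<in> carrier N ==> h (pure_tensor R M N x y) = \<beta> x y"
proof -
 interpret W: module R W by fact
 have b1: "\<beta> x \<in> module_hom R N W" if "x \<in> carrier M" for x using \<beta> that by (simp add: bilinear_def)
 have b2: "(\<lambda>x. \<beta> x y) \<in> module_hom R M W" if "y \<in> carrier N" for y using \<beta> that by (simp add: bilinear_def)
 have bc: "\<beta> x y \<in> carrier W" if "x \<in> carrier M" "y \<in> carrier N" for x y
  using module_hom_closed[OF b1] that by blast
 define f where "f = combo R W (\<lambda>p. \<beta> (fst p) (snd p))"
 have f: "f \<in> module_hom R PF W" unfolding f_def by (rule combo_hom[OF W]) (auto simp: bc)
 have fe: "f (free_gen R (x, y)) = \<beta> x y" if "x \<in> carrier M" "y \<in> carrier N" for x y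
  unfolding f_def free_gen_single
  using combo_single[OF W, of "carrier M \<times> carrier N" "\<lambda>p. \<beta> (fst p) (snd p)" "(x, y)" "\<one>\<^bsub>R\<^esub>"] bc that
  by auto
 have e: "free_gen R (x, y) \<in> carrier PF" if "x \<in> carrier M" "y \<in> carrier N" for x y
  by (rule free_gen_closed[OF M.R.is_cring]) (use that in simp)
 have fm: "f (a \<ominus>\<^bsub>PF\<^esub> b) = \<zero>\<^bsub>W\<^esub>" if "a \<in> carrier PF" "b \<in> carrier PF" "f a = f b" for a b
  using module_hom_minus[OF PF W f that(1,2)] module_minus_eq_zero[OF W] module_hom_closed[OF f] that by simp
 have "tensor_rels R M N \<subseteq> {c \<in> carrier PF. f c \<in> {\<zero>\<^bsub>W\<^esub>}}"
 proof
  fix c assume c: "c \<in> tensor_rels R M N"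
  have "f c = \<zero>\<^bsub>W\<^esub>"
   using c unfolding tensor_rels_def Let_def
   by (auto intro!: fm simp: e fe module_hom_add[OF f] module_hom_smult[OF f]
     module_hom_add[OF b1] module_hom_smult[OF b1] module_hom_add[OF b2] module_hom_smult[OF b2])
  then show "c \<in> {c \<in> carrier PF. f c \<in> {\<zero>\<^bsub>W\<^esub>}}" using c tensor_rels_closed by auto
 qed
 then have "TK \<subseteq> {c \<in> carrier PF. f c \<in> {\<zero>\<^bsub>W\<^esub>}}"
  unfolding tensor_kernel_def
  by (intro module_span_least submodule_vimage[OF PF W f PF.carrier_is_submodule submodule_zero[OF W]])
 then have "\<And>c. c \<in> TK ==> f c = \<zero>\<^bsub>W\<^esub>" by auto
 from quotient_factor[OF PF tensor_kernel_submodule f W this]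
 obtain h where h: "h \<in> module_hom R (tensor R M N) W" "\<And>c. c \<in> carrier PF ==> h (TK +>\<^bsub>PF\<^esub> c) = f c"
  unfolding tensor_def by blast
 have "h (pure_tensor R M N x y) = \<beta> x y" if "x \<in> carrier M" "y \<in> carrier N" for x y
  unfolding pure_tensor_def using h(2)[OF e[OF that]] fe[OF that] by simp
 then show thesis using that h(1) by blast
qed

end

lemma free_module_simps [simp]:
 "\<zero>\<^bsub>free_module R S\<^esub> = (\<lambda>_. \<zero>\<^bsub>R\<^esub>)"
 "c \<oplus>\<^bsub>free_module R S\<^esub> d = (\<lambda>s. c s \<oplus>\<^bsub>R\<^esub> d s)"
 "r \<odot>\<^bsub>free_module R S\<^esub> c = (\<lambda>s. r \<otimes>\<^bsub>R\<^esub> c s)"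
 by (simp_all add: free_module_def)

lemma free_map_id:
 assumes "cring R" and c: "c \<in> carrier (free_module R S)"
 shows "free_map R (map_prod id id) c = c"
proof
 fix t
 interpret R: cring R by fact
 have ct: "c t \<in> carrier R" using c formal_sums_closed[of c "ring_module R" S t] by (simp add: free_module_def)
 have "{s \<in> supp (ring_module R) c. map_prod id id s = t} = (if c t = \<zero>\<^bsub>R\<^esub> then {} else {t})"
  by (auto simp: supp_def)
 then show "free_map R (map_prod id id) c t = c t"
  using ct by (simp add: free_map_def)
qed

text \<open>
  On pure tensors the map defining \<open>Tor1\<close> only reinterprets its argument; that is all that is
  needed to compute its kernel.
\<close>

lemma tensor_map_inclusion:
 fixes R :: "'r ring" and M :: "('r, 'm) module" and N :: "('r, 'n) module"
 assumes M: "module R M" and N: "module R N" and H: "submodule H R M"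
 defines "K \<equiv> M\<lparr>carrier := H\<rparr>"
 shows "tensor_map R M N id id \<in> module_hom R (tensor R K N) (tensor R M N)"
  "\<And>x y. x \<in> H ==> y \<in> carrier N ==> tensor_map R M N id id (pure_tensor R K N x y) = pure_tensor R M N x y"
proof -
 interpret M: module R M by fact
 note cr = M.R.is_cring
 have HM: "H \<subseteq> carrier M" by (rule submoduleD(1)[OF M H])
 have K: "module R K" unfolding K_def by (rule submodule.submodule_is_module[OF H M])
 have Kc: "carrier K = H" by (simp add: K_def)
 let ?FK = "free_module R (carrier K \<times> carrier N)" and ?FM = "free_module R (carrier M \<times> carrier N)"
 let ?TK = "tensor_kernel R K N" and ?TM = "tensor_kernel R M N"
 have FK: "module R ?FK" and FM: "module R ?FM" using free_module_module[OF cr] by auto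
 have sub: "carrier ?FK \<subseteq> carrier ?FM"
  unfolding free_module_def Kc using formal_sums_mono[of "H \<times> carrier N" "carrier M \<times> carrier N"] HM by blast
 have idh: "(\<lambda>c. c) \<in> module_hom R ?FK ?FM"
  by (rule module_homI) (use sub in auto)
 have bM: "bilinear R M N (tensor R M N) (pure_tensor R M N)" by (rule bilinear_pure_tensor[OF M N])
 have "bilinear R K N (tensor R M N) (pure_tensor R M N)"
  unfolding bilinear_def Kc
 proof (intro conjI ballI)
  show "pure_tensor R M N x \<in> module_hom R N (tensor R M N)" if "x \<in> H" for x
   using bM that HM by (auto simp: bilinear_def)
  show "(\<lambda>x. pure_tensor R M N x y) \<in> module_hom R K (tensor R M N)" if "y \<in> carrier N" for y
  proof -
   have "(\<lambda>x. pure_tensor R M N x y) \<in> module_hom R M (tensor R M N)" using bM that by (auto simp: bilinear_def)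
   from module_hom_comp[OF submodule_inclusion_hom[OF H M] this] show ?thesis by (simp add: K_def)
  qed
 qed
 from tensor_universal[OF K N tensor_is_module[OF M N] this]
 obtain h where h: "h \<in> module_hom R (tensor R K N) (tensor R M N)"
  "\<And>x y. x \<in> carrier K ==> y \<in> carrier N ==> h (pure_tensor R K N x y) = pure_tensor R M N x y" by blast
 have hc: "h (?TK +>\<^bsub>?FK\<^esub> c) = ?TM +>\<^bsub>?FM\<^esub> c" if "c \<in> carrier ?FK" for c
  using that
  by (rule free_module_hom_eqI[OF tensor_is_module[OF M N] module_hom_comp[OF tensor_proj_hom[OF K N] h(1)]
    module_hom_comp[OF idh tensor_proj_hom[OF M N]], rotated])
   (use h(2) in \<open>auto simp: pure_tensor_def\<close>)
 note TK = tensor_kernel_submodule[OF K N] and TM = tensor_kernel_submodule[OF M N]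
 have TKF: "c \<in> carrier ?FK" if "c \<in> ?TK" for c using submoduleD(1)[OF FK TK] that by blast
 have TKM: "c \<in> ?TM" if "c \<in> ?TK" for c
 proof -
  have "?TK +>\<^bsub>?FK\<^esub> c = \<zero>\<^bsub>tensor R K N\<^esub>"
   using quotient_class_zero[OF FK TK TKF[OF that]] that by (simp add: tensor_def)
  then have "?TM +>\<^bsub>?FM\<^esub> c = \<zero>\<^bsub>tensor R M N\<^esub>"
   using hc[OF TKF[OF that]] module_hom_zero[OF tensor_is_module[OF K N] tensor_is_module[OF M N] h(1)] by simp
  then show ?thesis using quotient_class_zero[OF FM TM, of c] TKF[OF that] sub by (auto simp: tensor_def)
 qed
 let ?f = "free_map R (map_prod id id)"
 have fid: "?f c = c" if "c \<in> carrier ?FK" for c by (rule free_map_id[OF cr that])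
 have f: "?f \<in> module_hom R ?FK ?FM"
 proof (rule module_homI)
  interpret FK: module R ?FK by (rule FK)
  fix x assume x: "x \<in> carrier ?FK"
  show "?f x \<in> carrier ?FM" using fid[OF x] x sub by auto
  show "?f (r \<odot>\<^bsub>?FK\<^esub> x) = r \<odot>\<^bsub>?FM\<^esub> ?f x" if "r \<in> carrier R" for r
   using fid[OF FK.smult_closed[OF that x]] fid[OF x] by simp
  show "?f (x \<oplus>\<^bsub>?FK\<^esub> y) = ?f x \<oplus>\<^bsub>?FM\<^esub> ?f y" if y: "y \<in> carrier ?FK" for y
   using fid[OF FK.a_closed[OF x y]] fid[OF x] fid[OF y] by simp
 qed
 have tm: "tensor_map R M N id id (?TK +>\<^bsub>?FK\<^esub> c) = h (?TK +>\<^bsub>?FK\<^esub> c)" if c: "c \<in> carrier ?FK" for c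
 proof -
  have "?f x \<in> ?TM" if "x \<in> ?TK" for x using TKM[OF that] fid[OF TKF[OF that]] by simp
  from induced_map_class[OF FK TK f FM TM this c] show ?thesis
   unfolding tensor_map_def hc[OF c] fid[OF c] .
 qed
 have tm': "tensor_map R M N id id X = h X" if X: "X \<in> carrier (tensor R K N)" for X
 proof -
  obtain c where "c \<in> carrier ?FK" "X = ?TK +>\<^bsub>?FK\<^esub> c"
   by (rule tensor_carrierE[OF K N X])
  then show ?thesis using tm by simp
 qed
 interpret TKN: module R "tensor R K N" by (rule tensor_is_module[OF K N])
 show "tensor_map R M N id id \<in> module_hom R (tensor R K N) (tensor R M N)"
  by (rule module_homI) (simp_all add: tm' module_hom_closed[OF h(1)] module_hom_add[OF h(1)] module_hom_smult[OF h(1)])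
 show "tensor_map R M N id id (pure_tensor R K N x y) = pure_tensor R M N x y" if "x \<in> H" "y \<in> carrier N" for x y
  using tm'[OF pure_tensor_closed[OF K N]] h(2) that by (simp add: Kc)
qed

text \<open>
  The map \<open>\<Oplus>\<^sub>b N \<rightarrow> M \<otimes> N\<close> with \<open>b\<close>-th component \<open>n \<mapsto> e\<^sub>b \<otimes> n\<close>. It serves to describe tensor products with
  \<open>M\<close> in coordinates, when \<open>e\<close> is a basis or a generating family of \<open>M\<close>.
\<close>

definition tensor_sum :: "'r ring => ('r, 'm) module => ('r, 'n) module => ('b => 'm) => ('b => 'n) => ('m \<times> 'n => 'r) set" where
 "tensor_sum R M N e = lin N (tensor R M N) (\<lambda>b. pure_tensor R M N (e b))"

lemma tensor_sum_hom:
 assumes M: "module R M" and N: "module R N" and e: "\<And>b. b \<in> B ==> e b \<in> carrier M"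
 shows "tensor_sum R M N e \<in> module_hom R (formal_sums N B) (tensor R M N)"
  "\<And>b n. b \<in> B ==> n \<in> carrier N ==> tensor_sum R M N e (single N b n) = pure_tensor R M N (e b) n"
 unfolding tensor_sum_def
proof -
 have p: "pure_tensor R M N (e b) \<in> module_hom R N (tensor R M N)" if "b \<in> B" for b
  using bilinear_pure_tensor[OF M N] e[OF that] by (simp add: bilinear_def)
 show "lin N (tensor R M N) (\<lambda>b. pure_tensor R M N (e b)) \<in> module_hom R (formal_sums N B) (tensor R M N)"
  by (rule lin_hom[OF N tensor_is_module[OF M N] p])
 show "lin N (tensor R M N) (\<lambda>b. pure_tensor R M N (e b)) (single N b n) = pure_tensor R M N (e b) n"
  if "b \<in> B" "n \<in> carrier N" for b n
  by (rule lin_single[OF N tensor_is_module[OF M N] p that])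
qed

lemma scale_hom:
 assumes N: "module R N" and n: "n \<in> carrier N"
 shows "(\<lambda>c b. c b \<odot>\<^bsub>N\<^esub> n) \<in> module_hom R (free_module R B) (formal_sums N B)"
proof -
 interpret N: module R N by fact
 show ?thesis unfolding free_module_def
  using pointwise_hom[OF ring_module_module[OF N.R.is_cring] N smult_hom[OF N n]] .
qed

lemma tensor_sum_scale:
 assumes M: "module R M" and N: "module R N" and e: "\<And>b. b \<in> B ==> e b \<in> carrier M"
  and c: "c \<in> carrier (free_module R B)" and n: "n \<in> carrier N"
 shows "tensor_sum R M N e (\<lambda>b. c b \<odot>\<^bsub>N\<^esub> n) = pure_tensor R M N (combo R M e c) n"
proof -
 interpret M: module R M by fact
 interpret N: module R N by fact
 have bl: "(\<lambda>x. pure_tensor R M N x n) \<in> module_hom R M (tensor R M N)"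
  using bilinear_pure_tensor[OF M N] n by (simp add: bilinear_def)
 have ts: "tensor_sum R M N e \<in> module_hom R (formal_sums N B) (tensor R M N)"
  "\<And>b n. b \<in> B ==> n \<in> carrier N ==> tensor_sum R M N e (single N b n) = pure_tensor R M N (e b) n"
  using tensor_sum_hom[OF M N, of B e] e by auto
 have ch: "combo R M e \<in> module_hom R (free_module R B) M" by (rule combo_hom[OF M]) (rule e)
 show ?thesis
 proof (rule free_module_hom_eqI[OF tensor_is_module[OF M N] module_hom_comp[OF scale_hom[OF N n] ts(1)]
    module_hom_comp[OF ch bl] _ c])
  fix b assume b: "b \<in> B"
  have "(\<lambda>b'. free_gen R b b' \<odot>\<^bsub>N\<^esub> n) = single N b n" using n by (auto simp: free_gen_def single_def)
  then show "tensor_sum R M N e (\<lambda>b'. free_gen R b b' \<odot>\<^bsub>N\<^esub> n) = pure_tensor R M N (combo R M e (free_gen R b)) n"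
   using ts(2)[OF b n] combo_single[OF M e b, where x = "\<one>\<^bsub>R\<^esub>"] e[OF b] by (simp add: free_gen_single)
 qed
qed

text \<open>
  The inverse sends \<open>x \<otimes> n\<close> to the family of the \<open>x\<^sub>b n\<close>, where \<open>x\<^sub>b\<close> are the coordinates of \<open>x\<close>.
\<close>

theorem tensor_sum_bij:
 fixes R :: "'r ring" and M :: "('r, 'm) module" and N :: "('r, 'n) module"
 assumes M: "module R M" and N: "module R N" and B: "module_basis R M B e"
 shows "bij_betw (tensor_sum R M N e) (carrier (formal_sums N B)) (carrier (tensor R M N))"
proof -
 interpret M: module R M by fact
 interpret N: module R N by fact
 have e: "\<And>b. b \<in> B ==> e b \<in> carrier M" and bij: "bij_betw (combo R M e) (carrier (free_module R B)) (carrier M)"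
  using B by (auto simp: module_basis_def)
 let ?F = "free_module R B" and ?N = "formal_sums N B" and ?\<kappa> = "tensor_sum R M N e"
 have F: "module R ?F" by (rule free_module_module[OF M.R.is_cring])
 interpret F: module R ?F by (rule F)
 have FN: "module R ?N" by (rule formal_sums_module[OF N])
 have ch: "combo R M e \<in> module_hom R ?F M" by (rule combo_hom[OF M]) (rule e)
 have ts: "?\<kappa> \<in> module_hom R ?N (tensor R M N)"
  "\<And>b n. b \<in> B ==> n \<in> carrier N ==> ?\<kappa> (single N b n) = pure_tensor R M N (e b) n"
  using tensor_sum_hom[OF M N, of B e] e by auto
 define co where "co = inv_into (carrier ?F) (combo R M e)"
 have co: "co x \<in> carrier ?F" "combo R M e (co x) = x" if "x \<in> carrier M" for x
  using bij that unfolding co_def by (auto simp: bij_betw_def inv_into_into f_inv_into_f)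
 have co': "co (combo R M e c) = c" if "c \<in> carrier ?F" for c
  unfolding co_def by (rule bij_betw_inv_into_left[OF bij that])
 have coh: "co \<in> module_hom R M ?F"
 proof (rule module_homI)
  fix x assume x: "x \<in> carrier M"
  show "co x \<in> carrier ?F" by (rule co(1)[OF x])
  show "co (r \<odot>\<^bsub>M\<^esub> x) = r \<odot>\<^bsub>?F\<^esub> co x" if r: "r \<in> carrier R" for r
  proof -
   have "combo R M e (r \<odot>\<^bsub>?F\<^esub> co x) = r \<odot>\<^bsub>M\<^esub> x"
    unfolding module_hom_smult[OF ch r co(1)[OF x]] co(2)[OF x] ..
   then show ?thesis using co'[OF F.smult_closed[OF r co(1)[OF x]]] by simp
  qed
  show "co (x \<oplus>\<^bsub>M\<^esub> y) = co x \<oplus>\<^bsub>?F\<^esub> co y" if y: "y \<in> carrier M" for y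
  proof -
   have "combo R M e (co x \<oplus>\<^bsub>?F\<^esub> co y) = x \<oplus>\<^bsub>M\<^esub> y"
    unfolding module_hom_add[OF ch co(1)[OF x] co(1)[OF y]] co(2)[OF x] co(2)[OF y] ..
   then show ?thesis using co'[OF F.a_closed[OF co(1)[OF x] co(1)[OF y]]] by simp
  qed
 qed
 have cc: "co x b \<in> carrier R" if "x \<in> carrier M" for x b
  using formal_sums_closed[of "co x" "ring_module R" B b] co(1)[OF that] by (simp add: free_module_def)
 have "bilinear R M N ?N (\<lambda>x n b. co x b \<odot>\<^bsub>N\<^esub> n)"
  unfolding bilinear_def
 proof (intro conjI ballI)
  show "(\<lambda>x b. co x b \<odot>\<^bsub>N\<^esub> n) \<in> module_hom R M ?N" if "n \<in> carrier N" for n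
   using module_hom_comp[OF coh scale_hom[OF N that]] .
  show "(\<lambda>n b. co x b \<odot>\<^bsub>N\<^esub> n) \<in> module_hom R N ?N" if x: "x \<in> carrier M" for x
  proof (rule module_homI)
   show "(\<lambda>b. co x b \<odot>\<^bsub>N\<^esub> n) \<in> carrier ?N" if "n \<in> carrier N" for n
    by (rule module_hom_closed[OF scale_hom[OF N that] co(1)[OF x]])
  qed (use cc[OF x] in \<open>auto simp: N.smult_r_distr N.smult_assoc1[symmetric] M.R.m_comm\<close>)
 qed
 from tensor_universal[OF M N FN this] obtain h where h: "h \<in> module_hom R (tensor R M N) ?N"
  "\<And>x y. x \<in> carrier M ==> y \<in> carrier N ==> h (pure_tensor R M N x y) = (\<lambda>b. co x b \<odot>\<^bsub>N\<^esub> y)"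
  by blast
 have ce: "co (e b) = free_gen R b" if "b \<in> B" for b
  using co'[OF free_gen_closed[OF M.R.is_cring that]] combo_single[OF M e that, where x = "\<one>\<^bsub>R\<^esub>"] e[OF that]
  by (simp add: free_gen_single)
 have idh: "(\<lambda>x. x) \<in> module_hom R W W" for W :: "('r, 'z) module"
  by (rule module_homI) auto
 have hk: "h (?\<kappa> u) = u" if "u \<in> carrier ?N" for u
  using that
 proof (rule formal_sums_hom_eqI[OF N FN module_hom_comp[OF ts(1) h(1)] idh, rotated])
  fix b n assume b: "b \<in> B" and n: "n \<in> carrier N"
  show "h (?\<kappa> (single N b n)) = single N b n"
   using h(2)[OF e[OF b] n] ts(2)[OF b n] ce[OF b] n by (auto simp: free_gen_def single_def)
 qed
 have kh: "?\<kappa> (h X) = X" if "X \<in> carrier (tensor R M N)" for X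
  using that
  by (rule tensor_hom_eqI[OF M N tensor_is_module[OF M N] module_hom_comp[OF h(1) ts(1)] idh, rotated])
   (simp_all add: h(2) tensor_sum_scale[OF M N e co(1)] co(2))
 show ?thesis
  by (rule bij_betw_byWitness[of _ h]) (use hk kh module_hom_closed[OF h(1)] module_hom_closed[OF ts(1)] in auto)
qed

section \<open>Free presentations\<close>

lemma pres_map_combo: "pres_map R A = combo R A (\<lambda>x. x)"
 by (simp add: pres_map_def combo_def lin_def fun_eq_iff)

definition relations :: "'r ring => ('r, 'a) module => ('a => 'r) set" where
 "relations R A = {c \<in> carrier (free_module R (carrier A)). combo R A (\<lambda>x. x) c = \<zero>\<^bsub>A\<^esub>}"

lemma pres_kernel_eq: "pres_kernel R A = (free_module R (carrier A))\<lparr>carrier := relations R A\<rparr>"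
 by (simp add: pres_kernel_def pres_free_def relations_def a_kernel_def' pres_map_combo)

text \<open>
  A basis of the module of relations in the canonical presentation. As the relations form a submodule of
  a free module on the set \<open>carrier A\<close>, the basis can be indexed by elements of \<open>A\<close> as well.
\<close>

definition rel_basis :: "'r ring => ('r, 'a) module => 'a set \<times> ('a => 'a => 'r)" where
 "rel_basis R A = (SOME p. module_basis R (pres_kernel R A) (fst p) (snd p))"

abbreviation rel_index :: "'r ring => ('r, 'a) module => 'a set" where
 "rel_index R A \<equiv> fst (rel_basis R A)"

abbreviation rel_elt :: "'r ring => ('r, 'a) module => 'a => 'a => 'r" where
 "rel_elt R A \<equiv> snd (rel_basis R A)"

text \<open>
  The map \<open>K \<otimes> N \<rightarrow> F \<otimes> N\<close> of the canonical presentation \<open>0 \<rightarrow> K \<rightarrow> F \<rightarrow> A \<rightarrow> 0\<close>, in coordinates with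
  respect to the bases of \<open>K\<close> and \<open>F\<close>.
\<close>

definition rel_map :: "'r ring => ('r, 'a) module => ('r, 'n) module => ('a => 'n) => 'a => 'n" where
 "rel_map R A N = lin N (formal_sums N (carrier A)) (\<lambda>b n a. rel_elt R A b a \<odot>\<^bsub>N\<^esub> n)"

context
 fixes R :: "'r ring" and A :: "('r, 'a) module"
 assumes R: "principal_domain R" and A: "module R A"
begin

interpretation A: module R A by (rule A)

abbreviation (input) "FA \<equiv> free_module R (carrier A)"
abbreviation (input) "BA \<equiv> rel_index R A"
abbreviation (input) "eA \<equiv> rel_elt R A"

lemma FA: "module R FA" by (rule free_module_module[OF A.R.is_cring])

lemma relations_submodule: "submodule (relations R A) R FA"
proof -
 have c: "combo R A (\<lambda>x. x) \<in> module_hom R FA A" by (rule combo_hom[OF A])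
 from submodule_vimage[OF FA A c module.carrier_is_submodule[OF FA] submodule_zero[OF A]]
 show ?thesis by (simp add: relations_def)
qed

lemma pres_kernel_module: "module R (pres_kernel R A)"
 unfolding pres_kernel_eq by (rule submodule.submodule_is_module[OF relations_submodule FA])

lemma rel_basis: "module_basis R (pres_kernel R A) BA eA"
proof -
 have "\<exists>p. module_basis R (pres_kernel R A) (fst p :: 'a set) (snd p)"
  using submodule_of_free_has_basis[OF R relations_submodule] by (simp add: pres_kernel_eq)
 from someI_ex[OF this] show ?thesis unfolding rel_basis_def .
qed

lemma rel_elt_relation: "b \<in> BA ==> eA b \<in> relations R A"
 using rel_basis by (auto simp: module_basis_def pres_kernel_eq)

lemma rel_elt_closed: "b \<in> BA ==> eA b \<in> carrier FA"
 using rel_elt_relation by (simp add: relations_def)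

lemma rel_combo_bij: "bij_betw (combo R FA eA) (carrier (free_module R BA)) (relations R A)"
proof -
 have "bij_betw (combo R (FA\<lparr>carrier := relations R A\<rparr>) eA) (carrier (free_module R BA)) (relations R A)"
  using rel_basis by (simp add: module_basis_def pres_kernel_eq)
 moreover have "combo R (FA\<lparr>carrier := relations R A\<rparr>) eA c = combo R FA eA c" if "c \<in> carrier (free_module R BA)" for c
  by (rule combo_submodule[OF FA relations_submodule rel_elt_relation that])
 ultimately show ?thesis
  using bij_betw_cong[of "carrier (free_module R BA)" "combo R (FA\<lparr>carrier := relations R A\<rparr>) eA"
   "combo R FA eA" "relations R A"] by simp
qed

lemma rel_combo_hom: "combo R FA eA \<in> module_hom R (free_module R BA) FA"
 by (rule combo_hom[OF FA]) (rule rel_elt_closed)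

context
 fixes N :: "('r, 'n) module"
 assumes N: "module R N"
begin

interpretation N: module R N by (rule N)

abbreviation (input) "NA \<equiv> formal_sums N (carrier A)"
abbreviation (input) "NB \<equiv> formal_sums N BA"

lemma NA: "module R NA" and NB: "module R NB" by (rule formal_sums_module[OF N])+

lemma rel_elt_coeff: "b \<in> BA ==> eA b a \<in> carrier R"
 using formal_sums_closed[of "eA b" "ring_module R" "carrier A" a] rel_elt_closed[of b] by (simp add: free_module_def)

lemma rel_col_hom:
 assumes b: "b \<in> BA" shows "(\<lambda>n a. eA b a \<odot>\<^bsub>N\<^esub> n) \<in> module_hom R N NA"
proof (rule module_homI)
 show "(\<lambda>a. eA b a \<odot>\<^bsub>N\<^esub> n) \<in> carrier NA" if "n \<in> carrier N" for n
  by (rule module_hom_closed[OF scale_hom[OF N that] rel_elt_closed[OF b]])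
qed (use rel_elt_coeff[OF b] in \<open>auto simp: N.smult_r_distr N.smult_assoc1[symmetric] A.R.m_comm\<close>)

lemma rel_map_hom: "rel_map R A N \<in> module_hom R NB NA"
 unfolding rel_map_def by (rule lin_hom[OF N NA rel_col_hom])

lemma rel_map_single: "b \<in> BA ==> n \<in> carrier N ==> rel_map R A N (single N b n) = (\<lambda>a. eA b a \<odot>\<^bsub>N\<^esub> n)"
 unfolding rel_map_def by (rule lin_single[OF N NA rel_col_hom])

lemma rel_map_scale:
 assumes c: "c \<in> carrier (free_module R BA)" and n: "n \<in> carrier N"
 shows "rel_map R A N (\<lambda>b. c b \<odot>\<^bsub>N\<^esub> n) = (\<lambda>a. combo R FA eA c a \<odot>\<^bsub>N\<^esub> n)"
proof (rule free_module_hom_eqI[OF NA module_hom_comp[OF scale_hom[OF N n] rel_map_hom]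
   module_hom_comp[OF rel_combo_hom scale_hom[OF N n]] _ c])
 fix b assume b: "b \<in> BA"
 have "(\<lambda>b'. free_gen R b b' \<odot>\<^bsub>N\<^esub> n) = single N b n" using n by (auto simp: free_gen_def single_def)
 moreover have "combo R FA eA (free_gen R b) = eA b"
  using combo_single[OF FA, of BA eA b "\<one>\<^bsub>R\<^esub>"] rel_elt_closed b rel_elt_coeff[OF b]
  by (simp add: free_gen_single)
 ultimately show "rel_map R A N (\<lambda>b'. free_gen R b b' \<odot>\<^bsub>N\<^esub> n) = (\<lambda>a. combo R FA eA (free_gen R b) a \<odot>\<^bsub>N\<^esub> n)"
  using rel_map_single[OF b n] by simp
qed

lemma relation_scale_in_range:
 assumes k: "k \<in> relations R A" and n: "n \<in> carrier N"
 shows "(\<lambda>a. k a \<odot>\<^bsub>N\<^esub> n) \<in> rel_map R A N ` carrier NB"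
proof -
 obtain c where c: "c \<in> carrier (free_module R BA)" "combo R FA eA c = k"
  using bij_betw_imp_surj_on[OF rel_combo_bij] k by (metis imageE)
 show ?thesis using rel_map_scale[OF c(1) n] c(2) module_hom_closed[OF scale_hom[OF N n] c(1)]
  by (metis image_eqI)
qed

lemma tensor_sum_id_hom: "tensor_sum R A N (\<lambda>x. x) \<in> module_hom R NA (tensor R A N)"
 "a \<in> carrier A ==> n \<in> carrier N ==> tensor_sum R A N (\<lambda>x. x) (single N a n) = pure_tensor R A N a n"
 using tensor_sum_hom[OF A N, of "carrier A" "\<lambda>x. x"] by auto

lemma tensor_sum_id_surj: "tensor_sum R A N (\<lambda>x. x) ` carrier NA = carrier (tensor R A N)"
proof
 show "tensor_sum R A N (\<lambda>x. x) ` carrier NA \<subseteq> carrier (tensor R A N)"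
  using module_hom_closed[OF tensor_sum_id_hom(1)] by blast
 show "carrier (tensor R A N) \<subseteq> tensor_sum R A N (\<lambda>x. x) ` carrier NA"
 proof
  fix X assume "X \<in> carrier (tensor R A N)"
  then obtain c where c: "c \<in> carrier (free_module R (carrier A \<times> carrier N))"
    "X = tensor_kernel R A N +>\<^bsub>free_module R (carrier A \<times> carrier N)\<^esub> c"
   by (rule tensor_carrierE[OF A N])
  let ?s = "\<lambda>p. single N (fst p) (snd p)"
  have sc: "?s p \<in> carrier NA" if "p \<in> carrier A \<times> carrier N" for p
   using single_closed[OF N] that by auto
  have g: "combo R NA ?s \<in> module_hom R (free_module R (carrier A \<times> carrier N)) NA"
   by (rule combo_hom[OF NA sc])
  have "tensor_sum R A N (\<lambda>x. x) (combo R NA ?s c) = X"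
   unfolding c(2)
  proof (rule free_module_hom_eqI[OF tensor_is_module[OF A N] module_hom_comp[OF g tensor_sum_id_hom(1)]
    tensor_proj_hom[OF A N] _ c(1)])
   fix p assume p: "p \<in> carrier A \<times> carrier N"
   have "combo R NA ?s (free_gen R p) = ?s p"
    using combo_single[OF NA, of "carrier A \<times> carrier N" ?s p "\<one>\<^bsub>R\<^esub>"] sc p formal_sums_closed[OF sc[OF p]]
    by (simp add: free_gen_single)
   then show "tensor_sum R A N (\<lambda>x. x) (combo R NA ?s (free_gen R p)) =
     tensor_kernel R A N +>\<^bsub>free_module R (carrier A \<times> carrier N)\<^esub> free_gen R p"
    using tensor_sum_id_hom(2)[of "fst p" "snd p"] p by (auto simp: pure_tensor_def)
  qed
  then show "X \<in> tensor_sum R A N (\<lambda>x. x) ` carrier NA" using module_hom_closed[OF g c(1)] by blast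
 qed
qed

text \<open>
  Right exactness of the tensor product. The cokernel of \<open>rel_map\<close> receives a bilinear map from
  \<open>A \<times> N\<close>, because \<open>a \<otimes> n\<close> depends there only on \<open>a\<close> as an element of \<open>A\<close>; the resulting homomorphism
  from \<open>A \<otimes> N\<close> inverts \<open>tensor_sum\<close> modulo the range of \<open>rel_map\<close>.
\<close>

lemma tensor_sum_id_kernel:
 assumes u: "u \<in> carrier NA"
 shows "tensor_sum R A N (\<lambda>x. x) u = \<zero>\<^bsub>tensor R A N\<^esub> \<longleftrightarrow> u \<in> rel_map R A N ` carrier NB"
proof
 assume "u \<in> rel_map R A N ` carrier NB"
 then obtain v where v: "v \<in> carrier NB" "u = rel_map R A N v" by blast
 have z: "(\<lambda>_. \<zero>\<^bsub>tensor R A N\<^esub>) \<in> module_hom R NB (tensor R A N)"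
 proof -
  interpret T: module R "tensor R A N" by (rule tensor_is_module[OF A N])
  show ?thesis by (rule module_homI) auto
 qed
 have "tensor_sum R A N (\<lambda>x. x) (rel_map R A N v) = \<zero>\<^bsub>tensor R A N\<^esub>"
 proof (rule formal_sums_hom_eqI[OF N tensor_is_module[OF A N] module_hom_comp[OF rel_map_hom tensor_sum_id_hom(1)]
   z _ v(1)])
  fix b n assume b: "b \<in> BA" and n: "n \<in> carrier N"
  have bl: "(\<lambda>x. pure_tensor R A N x n) \<in> module_hom R A (tensor R A N)"
   using bilinear_pure_tensor[OF A N] n by (simp add: bilinear_def)
  show "tensor_sum R A N (\<lambda>x. x) (rel_map R A N (single N b n)) = \<zero>\<^bsub>tensor R A N\<^esub>"
   using tensor_sum_scale[OF A N, of "carrier A" "\<lambda>x. x" "eA b" n] rel_elt_relation[OF b] n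
    module_hom_zero[OF A tensor_is_module[OF A N] bl]
   by (simp add: rel_map_single[OF b n] relations_def)
 qed
 then show "tensor_sum R A N (\<lambda>x. x) u = \<zero>\<^bsub>tensor R A N\<^esub>" using v by simp
next
 assume zero: "tensor_sum R A N (\<lambda>x. x) u = \<zero>\<^bsub>tensor R A N\<^esub>"
 let ?I = "rel_map R A N ` carrier NB"
 have I: "submodule ?I R NA" by (rule submodule_image[OF NB NA rel_map_hom module.carrier_is_submodule[OF NB]])
 let ?W = "quotient_module NA ?I" and ?cl = "\<lambda>x. ?I +>\<^bsub>NA\<^esub> x"
 have W: "module R ?W" by (rule quotient_is_module[OF NA I])
 interpret W: module R ?W by (rule W)
 interpret FA: module R FA by (rule FA)
 have cl: "?cl \<in> module_hom R NA ?W" by (rule quotient_proj_hom[OF NA I])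
 have "bilinear R A N ?W (\<lambda>a n. ?cl (single N a n))"
  unfolding bilinear_def
 proof (intro conjI ballI)
  show "(\<lambda>n. ?cl (single N a n)) \<in> module_hom R N ?W" if "a \<in> carrier A" for a
   by (rule module_hom_comp[OF single_hom[OF N that] cl])
  fix n assume n: "n \<in> carrier N"
  define g where "g = (\<lambda>c. ?cl (\<lambda>a. c a \<odot>\<^bsub>N\<^esub> n))"
  have g: "g \<in> module_hom R FA ?W" unfolding g_def by (rule module_hom_comp[OF scale_hom[OF N n] cl])
  have gk: "g k = \<zero>\<^bsub>?W\<^esub>" if "k \<in> relations R A" for k
   unfolding g_def
   using quotient_class_zero[OF NA I] relation_scale_in_range[OF that n] submoduleD(1)[OF NA I] by blast
  have gs: "g (free_gen R a) = ?cl (single N a n)" for a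
  proof -
   have "(\<lambda>a'. free_gen R a a' \<odot>\<^bsub>N\<^esub> n) = single N a n" using n by (auto simp: free_gen_def single_def)
   then show ?thesis by (simp add: g_def)
  qed
  have eq: "g c = g d" if c: "c \<in> carrier FA" and d: "d \<in> carrier FA" and e: "combo R A (\<lambda>x. x) c = combo R A (\<lambda>x. x) d" for c d
  proof -
   have ch: "combo R A (\<lambda>x. x) \<in> module_hom R FA A" by (rule combo_hom[OF A])
   have "combo R A (\<lambda>x. x) (c \<ominus>\<^bsub>FA\<^esub> d) = \<zero>\<^bsub>A\<^esub>"
    using module_hom_minus[OF FA A ch c d] e module_minus_eq_zero[OF A] module_hom_closed[OF ch d] by simp
   then have "c \<ominus>\<^bsub>FA\<^esub> d \<in> relations R A" using FA.minus_closed[OF c d] by (simp add: relations_def)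
   then have "g c \<ominus>\<^bsub>?W\<^esub> g d = \<zero>\<^bsub>?W\<^esub>" using module_hom_minus[OF FA W g c d] gk by simp
   then show ?thesis using module_minus_eq_zero[OF W] module_hom_closed[OF g] c d by blast
  qed
  have fg: "free_gen R a \<in> carrier FA" "combo R A (\<lambda>x. x) (free_gen R a) = a" if "a \<in> carrier A" for a
   using free_gen_closed[OF A.R.is_cring that] combo_single[OF A, of "carrier A" "\<lambda>x. x" a "\<one>\<^bsub>R\<^esub>"] that
   by (auto simp: free_gen_single)
  have ch: "combo R A (\<lambda>x. x) \<in> module_hom R FA A" by (rule combo_hom[OF A])
  show "(\<lambda>a. ?cl (single N a n)) \<in> module_hom R A ?W"
   unfolding gs[symmetric]
  proof (rule module_homI)
   fix a assume a: "a \<in> carrier A"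
   show "g (free_gen R a) \<in> carrier ?W" by (rule module_hom_closed[OF g fg(1)[OF a]])
   show "g (free_gen R (r \<odot>\<^bsub>A\<^esub> a)) = r \<odot>\<^bsub>?W\<^esub> g (free_gen R a)" if r: "r \<in> carrier R" for r
    unfolding module_hom_smult[OF g r fg(1)[OF a], symmetric]
    by (rule eq[OF fg(1) FA.smult_closed[OF r fg(1)[OF a]]])
     (use a r module_hom_smult[OF ch r fg(1)[OF a]] fg(2) in \<open>simp_all del: free_module_simps\<close>)
   show "g (free_gen R (a \<oplus>\<^bsub>A\<^esub> a')) = g (free_gen R a) \<oplus>\<^bsub>?W\<^esub> g (free_gen R a')" if a': "a' \<in> carrier A" for a'
    unfolding module_hom_add[OF g fg(1)[OF a] fg(1)[OF a'], symmetric]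
    by (rule eq[OF fg(1) FA.a_closed[OF fg(1)[OF a] fg(1)[OF a']]])
     (use a a' module_hom_add[OF ch fg(1)[OF a] fg(1)[OF a']] fg(2) in \<open>simp_all del: free_module_simps\<close>)
  qed
 qed
 from tensor_universal[OF A N W this] obtain h where h: "h \<in> module_hom R (tensor R A N) ?W"
  "\<And>a n. a \<in> carrier A ==> n \<in> carrier N ==> h (pure_tensor R A N a n) = ?cl (single N a n)" by blast
 have "h (tensor_sum R A N (\<lambda>x. x) u) = ?cl u"
  by (rule formal_sums_hom_eqI[OF N W module_hom_comp[OF tensor_sum_id_hom(1) h(1)] cl _ u])
   (simp add: tensor_sum_id_hom(2) h(2))
 then have "?cl u = \<zero>\<^bsub>?W\<^esub>" using zero module_hom_zero[OF tensor_is_module[OF A N] W h(1)] by simp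
 then show "u \<in> ?I" using quotient_class_zero[OF NA I u] by simp
qed

abbreviation (input) "KA \<equiv> pres_kernel R A"

lemma rel_tensor_hom:
 "tensor_sum R KA N eA \<in> module_hom R NB (tensor R KA N)"
 "b \<in> BA ==> n \<in> carrier N ==> tensor_sum R KA N eA (single N b n) = pure_tensor R KA N (eA b) n"
 using tensor_sum_hom[OF pres_kernel_module N, of BA eA] rel_elt_relation by (auto simp: pres_kernel_eq)

lemma rel_tensor_bij: "bij_betw (tensor_sum R KA N eA) (carrier NB) (carrier (tensor R KA N))"
 by (rule tensor_sum_bij[OF pres_kernel_module N rel_basis])

lemma Tor1_carrier: "carrier (Tor1 R A N) =
  {X \<in> carrier (tensor R KA N). tensor_map R (pres_free R A) N id id X = \<zero>\<^bsub>tensor R (pres_free R A) N\<^esub>}"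
 by (simp add: Tor1_def Let_def a_kernel_def')

text \<open>
  In coordinates \<open>Tor1\<close> is the kernel of \<open>rel_map\<close>.
\<close>

lemma rel_tensor_in_Tor1:
 assumes u: "u \<in> carrier NB"
 shows "tensor_sum R KA N eA u \<in> carrier (Tor1 R A N) \<longleftrightarrow> rel_map R A N u = (\<lambda>_. \<zero>\<^bsub>N\<^esub>)"
proof -
 let ?T = "tensor R FA N" and ?\<kappa> = "tensor_sum R FA N (free_gen R)"
 have fg: "free_gen R a \<in> carrier FA" if "a \<in> carrier A" for a by (rule free_gen_closed[OF A.R.is_cring that])
 note T = tensor_is_module[OF FA N]
 have KA: "KA = FA\<lparr>carrier := relations R A\<rparr>" by (rule pres_kernel_eq)
 note tm = tensor_map_inclusion[OF FA N relations_submodule, folded KA]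
 have \<kappa>: "?\<kappa> \<in> module_hom R NA ?T" using tensor_sum_hom(1)[OF FA N, of "carrier A" "free_gen R"] fg by auto
 have idh: "(\<lambda>x. x) \<in> module_hom R FA FA" by (rule module_homI) auto
 have cid: "combo R FA (free_gen R) c = c" if "c \<in> carrier FA" for c
 proof (rule free_module_hom_eqI[OF FA combo_hom[OF FA fg] idh _ that])
  fix a assume a: "a \<in> carrier A"
  interpret FA: module R FA by (rule FA)
  have "\<one>\<^bsub>R\<^esub> \<odot>\<^bsub>FA\<^esub> free_gen R a = free_gen R a" by (rule FA.smult_one[OF fg[OF a]])
  then show "combo R FA (free_gen R) (free_gen R a) = free_gen R a"
   using combo_single[OF FA, of "carrier A" "free_gen R" a "\<one>\<^bsub>R\<^esub>"] fg a
   by (simp add: free_gen_single del: free_module_simps)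
 qed
 have "module_basis R FA (carrier A) (free_gen R)"
  unfolding module_basis_def
 proof
  show "free_gen R ` carrier A \<subseteq> carrier FA" using fg by blast
  have "bij_betw (\<lambda>c. c) (carrier FA) (carrier FA)" by (simp add: bij_betw_def)
  then show "bij_betw (combo R FA (free_gen R)) (carrier FA) (carrier FA)"
   using bij_betw_cong[of "carrier FA" "combo R FA (free_gen R)" "\<lambda>c. c" "carrier FA"] cid by simp
 qed
 from tensor_sum_bij[OF FA N this] have inj: "inj_on ?\<kappa> (carrier NA)" by (simp add: bij_betw_def)
 have "tensor_map R FA N id id (tensor_sum R KA N eA u) = ?\<kappa> (rel_map R A N u)"
 proof (rule formal_sums_hom_eqI[OF N T module_hom_comp[OF rel_tensor_hom(1) tm(1)] module_hom_comp[OF rel_map_hom \<kappa>] _ u])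
  fix b n assume b: "b \<in> BA" and n: "n \<in> carrier N"
  have "?\<kappa> (\<lambda>a. eA b a \<odot>\<^bsub>N\<^esub> n) = pure_tensor R FA N (eA b) n"
   using tensor_sum_scale[OF FA N, of "carrier A" "free_gen R" "eA b" n] fg rel_elt_closed[OF b] n
    cid[OF rel_elt_closed[OF b]] by simp
  then show "tensor_map R FA N id id (tensor_sum R KA N eA (single N b n)) = ?\<kappa> (rel_map R A N (single N b n))"
   unfolding rel_tensor_hom(2)[OF b n] rel_map_single[OF b n] tm(2)[OF rel_elt_relation[OF b] n] by simp
 qed
 moreover have "?\<kappa> (rel_map R A N u) = \<zero>\<^bsub>?T\<^esub> \<longleftrightarrow> rel_map R A N u = \<zero>\<^bsub>NA\<^esub>"
 proof -
  have "?\<kappa> \<zero>\<^bsub>NA\<^esub> = \<zero>\<^bsub>?T\<^esub>" by (rule module_hom_zero[OF NA T \<kappa>])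
  moreover have "\<zero>\<^bsub>NA\<^esub> \<in> carrier NA"
   using submoduleD(2)[OF NA module.carrier_is_submodule[OF NA]] .
  ultimately show ?thesis using inj module_hom_closed[OF rel_map_hom u] by (metis inj_onD)
 qed
 ultimately show ?thesis
  unfolding Tor1_carrier using module_hom_closed[OF rel_tensor_hom(1) u] by (simp add: pres_free_def)
qed

lemma Tor1_submodule: "submodule (carrier (Tor1 R A N)) R (tensor R KA N)"
proof -
 have KA: "KA = FA\<lparr>carrier := relations R A\<rparr>" by (rule pres_kernel_eq)
 note tm = tensor_map_inclusion(1)[OF FA N relations_submodule, folded KA]
 note TK = tensor_is_module[OF pres_kernel_module N]
 show ?thesis
  using submodule_vimage[OF TK tensor_is_module[OF FA N] tm module.carrier_is_submodule[OF TK]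
    submodule_zero[OF tensor_is_module[OF FA N]]]
  unfolding Tor1_carrier by (simp add: pres_free_def)
qed

lemma Tor1_eq: "Tor1 R A N = (tensor R KA N)\<lparr>carrier := carrier (Tor1 R A N)\<rparr>"
 by (simp add: Tor1_def Let_def)

lemma Tor1_module: "module R (Tor1 R A N)"
 by (subst Tor1_eq) (rule submodule.submodule_is_module[OF Tor1_submodule tensor_is_module[OF pres_kernel_module N]])

end

end

section \<open>Free approximations of complexes\<close>

text \<open>
  The direct sum of the canonical presentations of the modules \<open>A i\<close>, with the generators \<open>Inl a\<close> in
  degree \<open>i\<close> and the basis relations \<open>Inr b\<close> in degree \<open>i + 1\<close>.
\<close>

definition pres_cpx ::
  "'r ring => int set => (int => ('r, 'a) module) => ('r, int \<times> ('a + 'a)) based_cpx" where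
 "pres_cpx R I A =
   \<lparr>bas = {(i, Inl a) | i a. i \<in> I \<and> a \<in> carrier (A i)} \<union> {(i, Inr b) | i b. i \<in> I \<and> b \<in> rel_index R (A i)},
   dg = (\<lambda>(i, v). case v of Inl _ => i | Inr _ => i + 1),
   rk = (\<lambda>(i, v). case v of Inl _ => 0 | Inr _ => 1),
   inc = (\<lambda>(j, w) (i, v). case v of Inl _ => \<zero>\<^bsub>R\<^esub> | Inr b => (case w of Inr _ => \<zero>\<^bsub>R\<^esub> | Inl a =>
     if j = i \<and> i \<in> I \<and> b \<in> rel_index R (A i) then rel_elt R (A i) b a else \<zero>\<^bsub>R\<^esub>))\<rparr>"

lemma pres_cpx_simps [simp]:
 "(i, Inl a) \<in> bas (pres_cpx R I A) \<longleftrightarrow> i \<in> I \<and> a \<in> carrier (A i)"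
 "(i, Inr b) \<in> bas (pres_cpx R I A) \<longleftrightarrow> i \<in> I \<and> b \<in> rel_index R (A i)"
 "dg (pres_cpx R I A) (i, Inl a) = i" "dg (pres_cpx R I A) (i, Inr b) = i + 1"
 "rk (pres_cpx R I A) (i, Inl a) = 0" "rk (pres_cpx R I A) (i, Inr b) = 1"
 "inc (pres_cpx R I A) t (i, Inl a) = \<zero>\<^bsub>R\<^esub>"
 "inc (pres_cpx R I A) (j, Inr b') (i, Inr b) = \<zero>\<^bsub>R\<^esub>"
 "inc (pres_cpx R I A) (j, Inl a) (i, Inr b) =
   (if j = i \<and> i \<in> I \<and> b \<in> rel_index R (A i) then rel_elt R (A i) b a else \<zero>\<^bsub>R\<^esub>)"
 by (auto simp: pres_cpx_def split: prod.splits)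

lemma pres_cpx_cases:
 obtains (gen) i a where "s = (i, Inl a)" | (rel) i b where "s = (i, Inr b :: 'a + 'a)"
 by (cases s; cases "snd s") auto

lemma pres_cpx_based:
 fixes A :: "int => ('r, 'a) module"
 assumes R: "principal_domain R" and A: "\<And>i. i \<in> I ==> module R (A i)"
 shows "based_cpx R (pres_cpx R I A)"
proof -
 interpret R: principal_domain R by fact
 let ?P = "pres_cpx R I A"
 have coeff: "rel_elt R (A i) b a \<in> carrier R" if "i \<in> I" "b \<in> rel_index R (A i)" for i a b
  by (rule rel_elt_coeff[OF R A[OF that(1)] ring_module_module[OF R.is_cring] that(2)])
 have col: "rel_elt R (A i) b \<in> carrier (free_module R (carrier (A i)))" if "i \<in> I" "b \<in> rel_index R (A i)" for i b
  by (rule rel_elt_closed[OF R A[OF that(1)] that(2)])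
 show ?thesis
  unfolding based_cpx_def
 proof (intro conjI allI ballI impI)
  show "cring R" by (rule R.is_cring)
  fix s :: "int \<times> ('a + 'a)"
  show "inc ?P t s \<in> carrier R" for t
   by (cases s rule: pres_cpx_cases; cases t rule: pres_cpx_cases) (auto simp: coeff)
  show fin: "finite {t. inc ?P t s \<noteq> \<zero>\<^bsub>R\<^esub>}" if s: "s \<in> bas ?P"
  proof (cases s rule: pres_cpx_cases)
   case (rel i b)
   have "finite (supp (ring_module R) (rel_elt R (A i) b))"
    using col[of i b] s rel by (auto simp: free_module_def formal_sums_carrier)
   moreover have "{t. inc ?P t s \<noteq> \<zero>\<^bsub>R\<^esub>} \<subseteq> (\<lambda>a. (i, Inl a)) ` supp (ring_module R) (rel_elt R (A i) b)"
   proof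
    fix t assume "t \<in> {t. inc ?P t s \<noteq> \<zero>\<^bsub>R\<^esub>}"
    then show "t \<in> (\<lambda>a. (i, Inl a)) ` supp (ring_module R) (rel_elt R (A i) b)"
     by (cases t rule: pres_cpx_cases) (auto simp: rel supp_def split: if_splits)
   qed
   ultimately show ?thesis using finite_surj by blast
  qed simp
  have str: "s \<in> bas ?P \<and> t \<in> bas ?P \<and> dg ?P t = dg ?P s - 1 \<and> rk ?P t < rk ?P s"
   if n: "inc ?P t s \<noteq> \<zero>\<^bsub>R\<^esub>" for t
  proof (cases s rule: pres_cpx_cases)
   case s: (rel i b)
   show ?thesis
   proof (cases t rule: pres_cpx_cases)
    case t: (gen j a)
    have i: "j = i" "i \<in> I" "b \<in> rel_index R (A i)" and nz: "rel_elt R (A i) b a \<noteq> \<zero>\<^bsub>R\<^esub>"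
     using n by (auto simp: s t split: if_splits)
    have "a \<in> carrier (A i)"
     using col[OF i(2,3)] formal_sums_outside[of "rel_elt R (A i) b" "ring_module R" "carrier (A i)" a] nz
     by (auto simp: free_module_def)
    then show ?thesis using i by (simp add: s t)
   qed (use n in \<open>simp add: s\<close>)
  qed (use n in simp)
  show "s \<in> bas ?P" "t \<in> bas ?P" "dg ?P t = dg ?P s - 1" "rk ?P t < rk ?P s" if "inc ?P t s \<noteq> \<zero>\<^bsub>R\<^esub>" for t
   using str[OF that] by auto
  show "(\<Oplus>\<^bsub>R\<^esub> t\<in>{t. inc ?P t s \<noteq> \<zero>\<^bsub>R\<^esub>}. inc ?P u t \<otimes>\<^bsub>R\<^esub> inc ?P t s) = \<zero>\<^bsub>R\<^esub>" if "s \<in> bas ?P" for u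
  proof (rule R.add.finprod_one_eqI)
   fix t
   have "inc ?P t s \<in> carrier R"
    by (cases s rule: pres_cpx_cases; cases t rule: pres_cpx_cases) (auto simp: coeff)
   then show "inc ?P u t \<otimes>\<^bsub>R\<^esub> inc ?P t s = \<zero>\<^bsub>R\<^esub>" if "t \<in> {t. inc ?P t s \<noteq> \<zero>\<^bsub>R\<^esub>}"
    using that by (cases s rule: pres_cpx_cases; cases t rule: pres_cpx_cases) auto
  qed
 qed
qed

text \<open>Extension by zero from the generators, resp. the relations, in one index.\<close>

definition at_gen :: "'r ring => int => ('a => 'r) => int \<times> ('a + 'a) => 'r" where
 "at_gen R i c = (\<lambda>(j, v). case v of Inl a => if j = i then c a else \<zero>\<^bsub>R\<^esub> | Inr _ => \<zero>\<^bsub>R\<^esub>)"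

definition at_rel :: "'r ring => int => ('a => 'r) => int \<times> ('a + 'a) => 'r" where
 "at_rel R i c = (\<lambda>(j, v). case v of Inr a => if j = i then c a else \<zero>\<^bsub>R\<^esub> | Inl _ => \<zero>\<^bsub>R\<^esub>)"

lemma at_simps [simp]:
 "at_gen R i c (j, Inl a) = (if j = i then c a else \<zero>\<^bsub>R\<^esub>)" "at_gen R i c (j, Inr a) = \<zero>\<^bsub>R\<^esub>"
 "at_rel R i c (j, Inr a) = (if j = i then c a else \<zero>\<^bsub>R\<^esub>)" "at_rel R i c (j, Inl a) = \<zero>\<^bsub>R\<^esub>"
 by (auto simp: at_gen_def at_rel_def)

lemma extension_by_zero_hom:
 fixes R :: "'r ring" and M :: "('r, 'm) module"
 assumes M: "module R M" and sub: "\<And>a. a \<in> X ==> f a \<in> Y" and inj: "inj f"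
  and gf: "\<And>c a. g c (f a) = c a" and g0: "\<And>c t. t \<notin> range f ==> g c t = \<zero>\<^bsub>M\<^esub>"
 shows "g \<in> module_hom R (formal_sums M X) (formal_sums M Y)"
  "\<And>a x. g (single M a x) = single M (f a) x"
proof -
 interpret M: module R M by fact
 show "g (single M a x) = single M (f a) x" for a x
 proof
  fix t show "g (single M a x) t = single M (f a) x t"
   using inj g0 by (cases "t \<in> range f") (auto simp: gf single_def inj_eq)
 qed
 show "g \<in> module_hom R (formal_sums M X) (formal_sums M Y)"
 proof (rule module_homI)
  fix c assume c: "c \<in> carrier (formal_sums M X)"
  have c0: "c a = \<zero>\<^bsub>M\<^esub>" if "f a \<notin> Y" for a using formal_sums_outside[OF c] sub that by blast
  show "g c \<in> carrier (formal_sums M Y)"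
  proof (rule formal_sumsI[of _ _ "f ` supp M c"])
   show "g c s \<in> carrier M" for s
    using formal_sums_closed[OF c] g0 by (cases "s \<in> range f") (auto simp: gf)
   show "finite (f ` supp M c)" using formal_sums_finite[OF c] by simp
   show "g c s = \<zero>\<^bsub>M\<^esub>" if "s \<notin> f ` supp M c" for s
    using that g0 by (cases "s \<in> range f") (auto simp: gf supp_def)
   show "g c s = \<zero>\<^bsub>M\<^esub>" if "s \<notin> Y" for s
    using that g0 c0 by (cases "s \<in> range f") (auto simp: gf)
  qed
  show "g (r \<odot>\<^bsub>formal_sums M X\<^esub> c) = r \<odot>\<^bsub>formal_sums M Y\<^esub> g c" if r: "r \<in> carrier R" for r
  proof
   fix s show "g (r \<odot>\<^bsub>formal_sums M X\<^esub> c) s = (r \<odot>\<^bsub>formal_sums M Y\<^esub> g c) s"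
    using r g0 by (cases "s \<in> range f") (auto simp: gf)
  qed
  show "g (c \<oplus>\<^bsub>formal_sums M X\<^esub> d) = g c \<oplus>\<^bsub>formal_sums M Y\<^esub> g d" for d
  proof
   fix s show "g (c \<oplus>\<^bsub>formal_sums M X\<^esub> d) s = (g c \<oplus>\<^bsub>formal_sums M Y\<^esub> g d) s"
    using g0 by (cases "s \<in> range f") (auto simp: gf)
  qed
 qed
qed

lemma at_gen_hom:
 fixes A :: "int => ('r, 'a) module" and a :: 'a
 assumes R: "cring R" and i: "i \<in> I"
 shows "at_gen R i \<in> module_hom R (free_module R (carrier (A i))) (free_module R (bas (pres_cpx R I A)))"
  "at_gen R i (free_gen R a) = free_gen R (i, Inl a)"
proof -
 have "at_gen R i c t = \<zero>\<^bsub>ring_module R\<^esub>" if "t \<notin> range (\<lambda>a. (i, Inl a))" for c t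
  using that by (cases t rule: pres_cpx_cases) auto
 from extension_by_zero_hom[OF ring_module_module[OF R], of "carrier (A i)" "\<lambda>a. (i, Inl a)" "bas (pres_cpx R I A)" "at_gen R i", OF _ _ _ this]
 show "at_gen R i \<in> module_hom R (free_module R (carrier (A i))) (free_module R (bas (pres_cpx R I A)))"
  "at_gen R i (free_gen R a) = free_gen R (i, Inl a)"
  using i by (auto simp: inj_on_def free_module_def free_gen_single)
qed

lemma at_rel_hom:
 fixes A :: "int => ('r, 'a) module" and a :: 'a
 assumes R: "cring R" and i: "i \<in> I"
 shows "at_rel R i \<in> module_hom R (free_module R (rel_index R (A i))) (free_module R (bas (pres_cpx R I A)))"
  "at_rel R i (free_gen R a) = free_gen R (i, Inr a)"
proof -
 have "at_rel R i c t = \<zero>\<^bsub>ring_module R\<^esub>" if "t \<notin> range (\<lambda>a. (i, Inr a))" for c t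
  using that by (cases t rule: pres_cpx_cases) auto
 from extension_by_zero_hom[OF ring_module_module[OF R], of "rel_index R (A i)" "\<lambda>a. (i, Inr a)" "bas (pres_cpx R I A)" "at_rel R i", OF _ _ _ this]
 show "at_rel R i \<in> module_hom R (free_module R (rel_index R (A i))) (free_module R (bas (pres_cpx R I A)))"
  "at_rel R i (free_gen R a) = free_gen R (i, Inr a)"
  using i by (auto simp: inj_on_def free_module_def free_gen_single)
qed

text \<open>
  The generator belonging to \<open>a \<in> A i\<close> is mapped to a cycle \<open>z\<close> in the class \<open>a\<close>. The combination of such
  cycles that belongs to a relation has class zero, so it bounds a chain \<open>y\<close>, to which the basis
  relation is mapped. On homology this is the identity of \<open>A i\<close>. Degrees outside \<open>I\<close> are admitted, since
  the approximation of a module in degree zero should be its own presentation.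
\<close>

theorem free_approximation:
 fixes R :: "'r ring" and K :: "('r, 'm) chain_cpx" and A :: "int => ('r, 'a) module"
 assumes R: "principal_domain R" and K: "chain_cpx R K" and A: "\<And>i. i \<in> I ==> module R (A i)"
  and hom: "\<And>i. i \<in> I ==> has_homology R K i (A i)"
  and exact: "\<And>i. i \<notin> I ==> cycles K i \<subseteq> boundaries K i"
 shows "\<exists>\<phi>. quasi_iso R (tens R (pres_cpx R I A) (concentrated (ring_module R))) K \<phi>"
proof -
 interpret R: principal_domain R by fact
 note cr = R.is_cring
 let ?R = "ring_module R" and ?P = "pres_cpx R I A"
 let ?T = "tens R ?P (concentrated ?R)" and ?F = "free_module R (bas ?P)"
 note Rm = ring_module_module[OF cr]
 have P: "based_cpx R ?P" by (rule pres_cpx_based[OF R]) (rule A)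
 note cR = concentrated_chain_cpx[OF Rm]
 note T = tens_chain_cpx[OF P cR]
 have amb: "amb ?T = ?F" by (simp add: free_module_def)
 have F: "module R ?F" by (rule free_module_module[OF cr])
 have Km: "module R (amb K)" by (rule chain_cpxD(1)[OF K])
 interpret F: module R ?F by (rule F)
 interpret K: module R "amb K" by (rule Km)
 note dK = chain_cpxD(3)[OF K]
 have dT: "dif ?T \<in> module_hom R ?F ?F" using chain_cpxD(3)[OF T] amb by simp
 let ?Z = "\<lambda>i. (amb K)\<lparr>carrier := cycles K i\<rparr>"
 have Z: "module R (?Z i)" for i by (rule submodule.submodule_is_module[OF cycles_submodule[OF K] Km])
 have zc: "x \<in> carrier (amb K)" if "x \<in> cycles K i" for x i
  using submoduleD(1)[OF Km cycles_submodule[OF K]] that by blast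
 obtain \<theta> where \<theta>: "\<And>i. i \<in> I ==> \<theta> i \<in> module_hom R (?Z i) (A i)"
   "\<And>i. i \<in> I ==> \<theta> i ` cycles K i = carrier (A i)"
   "\<And>i z. i \<in> I ==> z \<in> cycles K i ==> \<theta> i z = \<zero>\<^bsub>A i\<^esub> \<longleftrightarrow> z \<in> boundaries K i"
  using hom unfolding has_homology_def by metis
 have "\<exists>z\<in>cycles K i. \<theta> i z = a" if "i \<in> I" "a \<in> carrier (A i)" for i a
  using \<theta>(2)[OF that(1)] that(2) by (metis imageE)
 then obtain z where z: "\<And>i a. i \<in> I ==> a \<in> carrier (A i) ==> z i a \<in> cycles K i"
   "\<And>i a. i \<in> I ==> a \<in> carrier (A i) ==> \<theta> i (z i a) = a" by metis
 let ?FA = "\<lambda>i. free_module R (carrier (A i))"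
 have FA: "module R (?FA i)" for i by (rule free_module_module[OF cr])
 have cz: "combo R (amb K) (z i) c \<in> cycles K i" "\<theta> i (combo R (amb K) (z i) c) = combo R (A i) (\<lambda>x. x) c"
  if i: "i \<in> I" and c: "c \<in> carrier (?FA i)" for i c
 proof -
  have e: "combo R (?Z i) (z i) c = combo R (amb K) (z i) c"
   by (rule combo_submodule[OF Km cycles_submodule[OF K] z(1)[OF i] c])
  have h: "combo R (?Z i) (z i) \<in> module_hom R (?FA i) (?Z i)"
   by (rule combo_hom[OF Z]) (simp add: z(1)[OF i])
  show "combo R (amb K) (z i) c \<in> cycles K i" using module_hom_closed[OF h c] e by simp
  have h2: "combo R (A i) (\<lambda>x. x) \<in> module_hom R (?FA i) (A i)" by (rule combo_hom[OF A[OF i]])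
  have "\<theta> i (combo R (?Z i) (z i) c) = combo R (A i) (\<lambda>x. x) c"
  proof (rule free_module_hom_eqI[OF A[OF i] module_hom_comp[OF h \<theta>(1)[OF i]] h2 _ c])
   fix a assume a: "a \<in> carrier (A i)"
   interpret Zi: module R "?Z i" by (rule Z)
   interpret Ai: module R "A i" by (rule A[OF i])
   show "\<theta> i (combo R (?Z i) (z i) (free_gen R a)) = combo R (A i) (\<lambda>x. x) (free_gen R a)"
    using combo_single[OF Z, of "carrier (A i)" "z i" i a "\<one>\<^bsub>R\<^esub>"] z[OF i] a zc[OF z(1)[OF i a]]
     combo_single[OF A[OF i], of "carrier (A i)" "\<lambda>x. x" a "\<one>\<^bsub>R\<^esub>"]
    by (simp add: free_gen_single)
  qed
  then show "\<theta> i (combo R (amb K) (z i) c) = combo R (A i) (\<lambda>x. x) c" using e by simp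
 qed
 have "\<exists>y\<in>grd K (i + 1). dif K y = combo R (amb K) (z i) (rel_elt R (A i) b)"
  if i: "i \<in> I" and b: "b \<in> rel_index R (A i)" for i b
 proof -
  have r: "rel_elt R (A i) b \<in> carrier (?FA i)" "combo R (A i) (\<lambda>x. x) (rel_elt R (A i) b) = \<zero>\<^bsub>A i\<^esub>"
   using rel_elt_relation[OF R A[OF i] b] by (auto simp: relations_def)
  then have "combo R (amb K) (z i) (rel_elt R (A i) b) \<in> boundaries K i"
   using cz(2)[OF i r(1)] \<theta>(3)[OF i cz(1)[OF i r(1)]] by simp
  then show ?thesis by (auto simp: boundaries_def)
 qed
 then obtain y where y: "\<And>i b. i \<in> I ==> b \<in> rel_index R (A i) ==> y i b \<in> grd K (i + 1)"
   "\<And>i b. i \<in> I ==> b \<in> rel_index R (A i) ==> dif K (y i b) = combo R (amb K) (z i) (rel_elt R (A i) b)"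
  by metis
 define \<zeta> where "\<zeta> = (\<lambda>(i, v). case v of Inl a => z i a | Inr b => y i b)"
 have \<zeta>s: "\<zeta> (i, Inl a) = z i a" "\<zeta> (i, Inr b) = y i b" for i a b by (auto simp: \<zeta>_def)
 have \<zeta>g: "\<zeta> s \<in> grd K (dg ?P s)" if "s \<in> bas ?P" for s
  using that z(1) y(1) by (cases s rule: pres_cpx_cases) (auto simp: \<zeta>s cycles_def)
 have \<zeta>c: "\<zeta> s \<in> carrier (amb K)" if "s \<in> bas ?P" for s by (rule grd_carrier[OF K \<zeta>g[OF that]])
 define \<phi> where "\<phi> = combo R (amb K) \<zeta>"
 have \<phi>: "\<phi> \<in> module_hom R ?F (amb K)" unfolding \<phi>_def by (rule combo_hom[OF Km \<zeta>c])
 have \<phi>gen: "\<phi> (free_gen R s) = \<zeta> s" if "s \<in> bas ?P" for s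
  unfolding \<phi>_def free_gen_single using combo_single[OF Km, of "bas ?P" \<zeta> s "\<one>\<^bsub>R\<^esub>"] \<zeta>c that by simp
 have \<phi>at: "\<phi> (at_gen R i c) = combo R (amb K) (z i) c" if i: "i \<in> I" and c: "c \<in> carrier (?FA i)" for i c
 proof -
  have h: "combo R (amb K) (z i) \<in> module_hom R (?FA i) (amb K)"
   by (rule combo_hom[OF Km]) (rule zc[OF z(1)[OF i]])
  show ?thesis
  proof (rule free_module_hom_eqI[OF Km module_hom_comp[OF at_gen_hom(1)[OF cr i, where A = A] \<phi>] h _ c])
   fix a assume a: "a \<in> carrier (A i)"
   show "\<phi> (at_gen R i (free_gen R a)) = combo R (amb K) (z i) (free_gen R a)"
    unfolding at_gen_hom(2)[OF cr i]
    using combo_single[OF Km, of "carrier (A i)" "z i" a "\<one>\<^bsub>R\<^esub>"] zc[OF z(1)[OF i]] a i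
     \<phi>gen[of "(i, Inl a)"] by (simp add: \<zeta>s free_gen_single)
  qed
 qed
 have colT: "dif ?T (free_gen R s) = (\<lambda>t. inc ?P t s)" if s: "s \<in> bas ?P" for s
 proof -
  have "dif ?T (free_gen R s) = tens_col R ?P (concentrated ?R) s \<one>\<^bsub>R\<^esub>"
   using tens_dif_single[OF P cR s, of "\<one>\<^bsub>R\<^esub>"] by (simp add: free_gen_single)
  then show ?thesis using sgn_elt_closed[OF cr] based_cpxD(2)[OF P]
   by (auto simp: tens_col_def single_def fun_eq_iff)
 qed
 have inc_rel: "(\<lambda>t. inc ?P t (i, Inr b)) = at_gen R i (rel_elt R (A i) b)"
  if "i \<in> I" "b \<in> rel_index R (A i)" for i b
 proof
  fix t show "inc ?P t (i, Inr b) = at_gen R i (rel_elt R (A i) b) t"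
   using that by (cases t rule: pres_cpx_cases) auto
 qed
 have \<phi>d: "\<phi> (dif ?T c) = dif K (\<phi> c)" if c: "c \<in> carrier ?F" for c
 proof (rule free_module_hom_eqI[OF Km module_hom_comp[OF dT \<phi>] module_hom_comp[OF \<phi> dK] _ c])
  fix s assume s: "s \<in> bas ?P"
  show "\<phi> (dif ?T (free_gen R s)) = dif K (\<phi> (free_gen R s))"
   unfolding colT[OF s] \<phi>gen[OF s]
  proof (cases s rule: pres_cpx_cases)
   case (gen i a)
   then show "\<phi> (\<lambda>t. inc ?P t s) = dif K (\<zeta> s)"
    using module_hom_zero[OF F Km \<phi>] z(1) s by (simp add: \<zeta>s cycles_def)
  next
   case (rel i b)
   then have i: "i \<in> I" "b \<in> rel_index R (A i)" using s by auto
   show "\<phi> (\<lambda>t. inc ?P t s) = dif K (\<zeta> s)"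
    unfolding rel inc_rel[OF i] \<zeta>s y(2)[OF i] by (rule \<phi>at[OF i(1) rel_elt_closed[OF R A[OF i(1)] i(2)]])
  qed
 qed
 have \<phi>g: "\<phi> c \<in> grd K n" if c: "c \<in> grd ?T n" for c n
 proof -
  have cF: "c \<in> carrier (formal_sums ?R (bas ?P))" using c by (simp add: tens_grd)
  show ?thesis unfolding \<phi>_def combo_def
  proof (rule lin_in_submodule[OF Rm Km smult_hom[OF Km \<zeta>c] chain_cpxD(2)[OF K] cF])
   fix s assume s: "s \<in> supp ?R c"
   then have sb: "s \<in> bas ?P" and nz: "c s \<noteq> \<zero>\<^bsub>R\<^esub>" using cF by (auto simp: formal_sums_carrier supp_def)
   have "c s \<in> grd (concentrated ?R) (n - dg ?P s)" using c sb by (simp add: tens_grd)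
   then have "n = dg ?P s" using nz by (auto split: if_splits)
   then show "c s \<odot>\<^bsub>amb K\<^esub> \<zeta> s \<in> grd K n"
    using grd_closed(3)[OF K _ \<zeta>g[OF sb]] formal_sums_closed[OF cF, of s] by simp
  qed
 qed
 have drel: "dif ?T (at_rel R i c) = at_gen R i (combo R (?FA i) (rel_elt R (A i)) c)"
  if i: "i \<in> I" and c: "c \<in> carrier (free_module R (rel_index R (A i)))" for i c
 proof (rule free_module_hom_eqI[OF F module_hom_comp[OF at_rel_hom(1)[OF cr i, where A = A] dT]
   module_hom_comp[OF rel_combo_hom[OF R A[OF i]] at_gen_hom(1)[OF cr i, where A = A]] _ c])
  fix b assume b: "b \<in> rel_index R (A i)"
  interpret FAi: module R "?FA i" by (rule FA)
  have "combo R (?FA i) (rel_elt R (A i)) (free_gen R b) = rel_elt R (A i) b"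
   using combo_single[OF FA, of "rel_index R (A i)" "rel_elt R (A i)" i b "\<one>\<^bsub>R\<^esub>"]
    rel_elt_closed[OF R A[OF i]] b FAi.smult_one[OF rel_elt_closed[OF R A[OF i] b]]
   by (simp add: free_gen_single del: free_module_simps)
  then show "dif ?T (at_rel R i (free_gen R b)) = at_gen R i (combo R (?FA i) (rel_elt R (A i)) (free_gen R b))"
   unfolding at_rel_hom(2)[OF cr i] using colT[of "(i, Inr b)"] inc_rel[OF i b] i b by simp
 qed
 have rel_g: "at_rel R i c \<in> grd ?T (i + 1)"
  if i: "i \<in> I" and c: "c \<in> carrier (free_module R (rel_index R (A i)))" for i c
  unfolding tens_grd
 proof (intro conjI ballI)
  show "at_rel R i c \<in> carrier (formal_sums (amb (concentrated ?R)) (bas ?P))"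
   using module_hom_closed[OF at_rel_hom(1)[OF cr i, where A = A] c] by (simp add: free_module_def)
  show "at_rel R i c s \<in> grd (concentrated ?R) (i + 1 - dg ?P s)" for s
   using formal_sums_closed[of c ?R] c by (cases s rule: pres_cpx_cases) (auto simp: free_module_def)
 qed
 have lift: "\<exists>q'\<in>grd ?T n. \<exists>l'\<in>grd K (n + 1). dif ?T q' = q \<and> l = \<phi> q' \<oplus>\<^bsub>amb K\<^esub> dif K l'"
  if q: "q \<in> grd ?T (n - 1)" and l: "l \<in> grd K n" and dq: "dif ?T q = \<zero>\<^bsub>amb ?T\<^esub>" and dl: "dif K l = \<phi> q" for n q l
 proof -
  have qF: "q \<in> carrier ?F" using q by (simp add: tens_grd free_module_def)
  have qc: "q s \<in> carrier R" for s
   using formal_sums_closed[of q ?R "bas ?P" s] qF by (simp add: free_module_def)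
  have q0: "q s = \<zero>\<^bsub>R\<^esub>" if "s \<notin> bas ?P \<or> dg ?P s \<noteq> n - 1" for s
   using that q qF formal_sums_outside[of q ?R "bas ?P" s]
   by (cases "s \<in> bas ?P") (auto simp: tens_grd free_module_def)
  have fin: "finite (supp ?R q)" using qF by (auto simp: free_module_def formal_sums_carrier)
  define qg where "qg = (\<lambda>a. q (n - 1, Inl a))"
  define qr where "qr = (\<lambda>b. q (n - 2, Inr b))"
  have dec: "q = (\<lambda>t. at_gen R (n - 1) qg t \<oplus>\<^bsub>R\<^esub> at_rel R (n - 2) qr t)"
  proof
   fix t show "q t = at_gen R (n - 1) qg t \<oplus>\<^bsub>R\<^esub> at_rel R (n - 2) qr t"
    using qc q0[of t] by (cases t rule: pres_cpx_cases) (auto simp: qg_def qr_def)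
  qed
  have qgF: "qg \<in> carrier (?FA (n - 1))" if "n - 1 \<in> I"
   unfolding free_module_def
  proof (rule formal_sumsI[of _ _ "(\<lambda>a. (n - 1, Inl a)) -` supp ?R q"])
   show "finite ((\<lambda>a. (n - 1, Inl a)) -` supp ?R q)" by (rule finite_vimageI[OF fin]) (auto simp: inj_on_def)
  qed (use qc q0 in \<open>auto simp: qg_def supp_def\<close>)
  have qrF: "qr \<in> carrier (free_module R (rel_index R (A (n - 2))))" if "n - 2 \<in> I"
   unfolding free_module_def
  proof (rule formal_sumsI[of _ _ "(\<lambda>a. (n - 2, Inr a)) -` supp ?R q"])
   show "finite ((\<lambda>a. (n - 2, Inr a)) -` supp ?R q)" by (rule finite_vimageI[OF fin]) (auto simp: inj_on_def)
  qed (use qc q0 in \<open>auto simp: qr_def supp_def\<close>)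
  have dgen: "dif ?T (at_gen R i c) = (\<lambda>_. \<zero>\<^bsub>R\<^esub>)" if i: "i \<in> I" and c: "c \<in> carrier (?FA i)" for i c
  proof -
   have zh: "(\<lambda>c. (\<lambda>_. \<zero>\<^bsub>R\<^esub>)) \<in> module_hom R (?FA i) ?F"
    using F.zero_closed by (intro module_homI) auto
   show ?thesis
   proof (rule free_module_hom_eqI[OF F module_hom_comp[OF at_gen_hom(1)[OF cr i, where A = A] dT] zh _ c])
    fix a assume "a \<in> carrier (A i)"
    then show "dif ?T (at_gen R i (free_gen R a)) = (\<lambda>_. \<zero>\<^bsub>R\<^esub>)"
     using colT[of "(i, Inl a)"] i by (simp add: at_gen_hom(2)[OF cr i])
   qed
  qed
  have qr0: "qr = (\<lambda>_. \<zero>\<^bsub>R\<^esub>)"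
  proof (cases "n - 2 \<in> I")
   case False
   then show ?thesis using q0 by (auto simp: qr_def)
  next
   case True
   have g: "at_gen R (n - 1) qg \<in> carrier ?F \<and> dif ?T (at_gen R (n - 1) qg) = (\<lambda>_. \<zero>\<^bsub>R\<^esub>)"
   proof (cases "n - 1 \<in> I")
    case True
    then show ?thesis using module_hom_closed[OF at_gen_hom(1)[OF cr True, where A = A] qgF[OF True]] dgen[OF True qgF[OF True]] by blast
   next
    case False
    then have "qg a = \<zero>\<^bsub>R\<^esub>" for a using q0[of "(n - 1, Inl a)"] by (simp add: qg_def)
    then have "at_gen R (n - 1) qg = \<zero>\<^bsub>?F\<^esub>" by (auto simp: at_gen_def split: sum.splits)
    then show ?thesis using F.zero_closed module_hom_zero[OF F F dT] by simp
   qed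
   have r: "at_rel R (n - 2) qr \<in> carrier ?F"
    by (rule module_hom_closed[OF at_rel_hom(1)[OF cr True, where A = A] qrF[OF True]])
   have c: "combo R (?FA (n - 2)) (rel_elt R (A (n - 2))) qr \<in> carrier (?FA (n - 2))"
    by (rule module_hom_closed[OF rel_combo_hom[OF R A[OF True]] qrF[OF True]])
   have "q = at_gen R (n - 1) qg \<oplus>\<^bsub>?F\<^esub> at_rel R (n - 2) qr" using dec by simp
   then have "dif ?T q = dif ?T (at_gen R (n - 1) qg) \<oplus>\<^bsub>?F\<^esub> dif ?T (at_rel R (n - 2) qr)"
    using module_hom_add[OF dT conjunct1[OF g] r] by simp
   then have e: "\<zero>\<^bsub>amb ?T\<^esub> = (\<lambda>_. \<zero>\<^bsub>R\<^esub>) \<oplus>\<^bsub>?F\<^esub> at_gen R (n - 2) (combo R (?FA (n - 2)) (rel_elt R (A (n - 2))) qr)"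
    unfolding dq conjunct2[OF g] drel[OF True qrF[OF True]] .
   have "combo R (?FA (n - 2)) (rel_elt R (A (n - 2))) qr a = \<zero>\<^bsub>R\<^esub>" for a
    using fun_cong[OF e, of "(n - 2, Inl a)"] formal_sums_closed[of _ ?R "carrier (A (n - 2))" a] c
    by (simp add: free_module_def)
   then have z0: "combo R (?FA (n - 2)) (rel_elt R (A (n - 2))) qr = (\<lambda>_. \<zero>\<^bsub>R\<^esub>)" by auto
   have FB: "module R (free_module R (rel_index R (A (n - 2))))" by (rule free_module_module[OF cr])
   have "combo R (?FA (n - 2)) (rel_elt R (A (n - 2))) \<zero>\<^bsub>free_module R (rel_index R (A (n - 2)))\<^esub> = (\<lambda>_. \<zero>\<^bsub>R\<^esub>)"
    using module_hom_zero[OF FB FA rel_combo_hom[OF R A[OF True]]] by simp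
   then have "qr = \<zero>\<^bsub>free_module R (rel_index R (A (n - 2)))\<^esub>"
    using bij_betw_imp_inj_on[OF rel_combo_bij[OF R A[OF True]]] qrF[OF True] z0
     submoduleD(2)[OF FB module.carrier_is_submodule[OF FB]] by (metis inj_onD)
   then show ?thesis by simp
  qed
  have qe: "q = at_gen R (n - 1) qg"
  proof
   fix t show "q t = at_gen R (n - 1) qg t"
    using fun_cong[OF dec, of t] qc unfolding qr0 by (cases t rule: pres_cpx_cases) (auto simp: qg_def)
  qed
  have "\<exists>q1\<in>grd ?T n. dif ?T q1 = q"
  proof (cases "n - 1 \<in> I")
   case True
   have "dif K l \<in> boundaries K (n - 1)" using l by (auto simp: boundaries_def)
   then have "combo R (amb K) (z (n - 1)) qg \<in> boundaries K (n - 1)"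
    using dl qe \<phi>at[OF True qgF[OF True]] by simp
   then have "qg \<in> relations R (A (n - 1))"
    using \<theta>(3)[OF True cz(1)[OF True qgF[OF True]]] cz(2)[OF True qgF[OF True]] qgF[OF True]
    by (simp add: relations_def)
   then have "qg \<in> combo R (?FA (n - 1)) (rel_elt R (A (n - 1))) ` carrier (free_module R (rel_index R (A (n - 1))))"
    using bij_betw_imp_surj_on[OF rel_combo_bij[OF R A[OF True]]] by simp
   then obtain c where c: "c \<in> carrier (free_module R (rel_index R (A (n - 1))))"
     "combo R (?FA (n - 1)) (rel_elt R (A (n - 1))) c = qg"
    by blast
   show ?thesis
    using rel_g[OF True c(1)] drel[OF True c(1)] c(2) qe by (intro bexI[of _ "at_rel R (n - 1) c"]) auto
  next
   case False
   then have "qg a = \<zero>\<^bsub>R\<^esub>" for a using q0[of "(n - 1, Inl a)"] by (simp add: qg_def)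
   then have "q = \<zero>\<^bsub>?F\<^esub>" using qe by (auto simp: at_gen_def fun_eq_iff split: sum.splits)
   then show ?thesis using module_hom_zero[OF F F dT] grd_closed(1)[OF T, of n] amb by auto
  qed
  then obtain q1 where q1: "q1 \<in> grd ?T n" "dif ?T q1 = q" by blast
  have q1F: "q1 \<in> carrier ?F" using q1 by (simp add: tens_grd free_module_def)
  let ?l = "l \<ominus>\<^bsub>amb K\<^esub> \<phi> q1"
  have lc: "l \<in> carrier (amb K)" "\<phi> q1 \<in> carrier (amb K)"
   using grd_carrier[OF K] l \<phi>g[OF q1(1)] by auto
  have lz: "?l \<in> cycles K n"
   using grd_closed(4)[OF K l \<phi>g[OF q1(1)]] module_hom_minus[OF Km Km dK lc] dl \<phi>d[OF q1F] q1(2)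
    module_minus_eq_zero[OF Km, of "\<phi> q" "\<phi> q"] module_hom_closed[OF \<phi> qF]
   by (simp add: cycles_def)
  have "\<exists>q2\<in>grd ?T n. dif ?T q2 = \<zero>\<^bsub>?F\<^esub> \<and> ?l \<ominus>\<^bsub>amb K\<^esub> \<phi> q2 \<in> boundaries K n"
  proof (cases "n \<in> I")
   case True
   define a where "a = \<theta> n ?l"
   have a: "a \<in> carrier (A n)" unfolding a_def using module_hom_closed[OF \<theta>(1)[OF True]] lz by simp
   let ?q2 = "free_gen R (n, Inl a)"
   have sb: "(n, Inl a) \<in> bas ?P" using True a by simp
   have "?q2 \<in> grd ?T n"
    unfolding tens_grd using free_gen_closed[OF cr sb] by (auto simp: free_module_def free_gen_def)
   moreover have "dif ?T ?q2 = \<zero>\<^bsub>?F\<^esub>" using colT[OF sb] by simp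
   moreover have "?l \<ominus>\<^bsub>amb K\<^esub> \<phi> ?q2 \<in> boundaries K n"
   proof -
    have za: "z n a \<in> cycles K n" by (rule z(1)[OF True a])
    have d: "?l \<ominus>\<^bsub>amb K\<^esub> z n a \<in> cycles K n" by (rule submodule_minus[OF Km cycles_submodule[OF K] lz za])
    have "?l = (?l \<ominus>\<^bsub>amb K\<^esub> z n a) \<oplus>\<^bsub>amb K\<^esub> z n a"
     using zc[OF lz] zc[OF za] by (simp add: a_minus_def K.a_assoc K.l_neg)
    then have "\<theta> n ?l = \<theta> n (?l \<ominus>\<^bsub>amb K\<^esub> z n a) \<oplus>\<^bsub>A n\<^esub> \<theta> n (z n a)"
     using module_hom_add[OF \<theta>(1)[OF True], of "?l \<ominus>\<^bsub>amb K\<^esub> z n a" "z n a"] d za by simp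
    then have "a = \<theta> n (?l \<ominus>\<^bsub>amb K\<^esub> z n a) \<oplus>\<^bsub>A n\<^esub> a" using z(2)[OF True a] a_def by simp
    moreover interpret An: module R "A n" by (rule A[OF True])
    have "\<theta> n (?l \<ominus>\<^bsub>amb K\<^esub> z n a) \<in> carrier (A n)" using module_hom_closed[OF \<theta>(1)[OF True]] d by simp
    ultimately have "\<theta> n (?l \<ominus>\<^bsub>amb K\<^esub> z n a) = \<zero>\<^bsub>A n\<^esub>"
     using a An.add.l_cancel_one'[of a "\<theta> n (?l \<ominus>\<^bsub>amb K\<^esub> z n a)"] by simp
    then show ?thesis using \<theta>(3)[OF True d] \<phi>gen[OF sb] by (simp add: \<zeta>s)
   qed
   ultimately show ?thesis by blast
  next
   case False
   have e: "?l \<ominus>\<^bsub>amb K\<^esub> \<phi> \<zero>\<^bsub>?F\<^esub> = ?l"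
    unfolding module_hom_zero[OF F Km \<phi>] a_minus_def[of _ _ "\<zero>\<^bsub>amb K\<^esub>"]
    using zc[OF lz] by simp
   have "?l \<ominus>\<^bsub>amb K\<^esub> \<phi> \<zero>\<^bsub>?F\<^esub> \<in> boundaries K n" unfolding e using exact[OF False] lz by blast
   moreover have "\<zero>\<^bsub>?F\<^esub> \<in> grd ?T n" using grd_closed(1)[OF T, of n] unfolding amb .
   ultimately show ?thesis using module_hom_zero[OF F F dT] by blast
  qed
  then obtain q2 where q2: "q2 \<in> grd ?T n" "dif ?T q2 = \<zero>\<^bsub>?F\<^esub>" "?l \<ominus>\<^bsub>amb K\<^esub> \<phi> q2 \<in> boundaries K n" by blast
  then obtain l' where l': "l' \<in> grd K (n + 1)" "?l \<ominus>\<^bsub>amb K\<^esub> \<phi> q2 = dif K l'" by (auto simp: boundaries_def)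
  have q2F: "q2 \<in> carrier ?F" using q2 by (simp add: tens_grd free_module_def)
  have p2: "\<phi> q2 \<in> carrier (amb K)" by (rule module_hom_closed[OF \<phi> q2F])
  show ?thesis
  proof (intro bexI conjI)
   show "q1 \<oplus>\<^bsub>amb ?T\<^esub> q2 \<in> grd ?T n" by (rule grd_closed(2)[OF T q1(1) q2(1)])
   show "l' \<in> grd K (n + 1)" by (rule l'(1))
   show "dif ?T (q1 \<oplus>\<^bsub>amb ?T\<^esub> q2) = q"
    unfolding amb module_hom_add[OF dT q1F q2F] q1(2) q2(2) using qF by (rule F.r_zero)
   show "l = \<phi> (q1 \<oplus>\<^bsub>amb ?T\<^esub> q2) \<oplus>\<^bsub>amb K\<^esub> dif K l'"
    unfolding amb module_hom_add[OF \<phi> q1F q2F] l'(2)[symmetric]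
    using lc p2 by (simp add: a_minus_def K.a_ac K.r_neg K.r_neg1 K.r_neg2)
  qed
 qed
 have "quasi_iso R ?T K \<phi>"
  unfolding quasi_iso_def using T K \<phi> \<phi>g \<phi>d lift unfolding amb by blast
 then show ?thesis by blast
qed

section \<open>The homology of a tensor product of free approximations\<close>

lemma pullback_hom:
 assumes inj: "inj f" and out: "\<And>a. a \<notin> X ==> f a \<notin> Y"
 shows "(\<lambda>c a. c (f a)) \<in> module_hom R (formal_sums M Y) (formal_sums M X)"
proof (rule module_homI)
 fix c assume c: "c \<in> carrier (formal_sums M Y)"
 show "(\<lambda>a. c (f a)) \<in> carrier (formal_sums M X)"
 proof (rule formal_sumsI[of _ _ "f -` supp M c"])
  show "finite (f -` supp M c)" using formal_sums_finite[OF c] by (rule finite_vimageI[OF _ inj])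
  show "c (f a) = \<zero>\<^bsub>M\<^esub>" if "a \<notin> X" for a using formal_sums_outside[OF c out[OF that]] .
 qed (auto simp: formal_sums_closed[OF c] supp_def)
qed auto

lemma rel_map_natural:
 assumes R: "principal_domain R" and A: "module R A" and N: "module R N" and N': "module R N'"
  and f: "f \<in> module_hom R N N'" and v: "v \<in> carrier (formal_sums N (rel_index R A))"
 shows "rel_map R A N' (\<lambda>b. f (v b)) = (\<lambda>a. f (rel_map R A N v a))"
proof -
 note h = pointwise_hom[OF N N' f]
 show ?thesis
 proof (rule formal_sums_hom_eqI[OF N formal_sums_module[OF N']
    module_hom_comp[OF h rel_map_hom[OF R A N']] module_hom_comp[OF rel_map_hom[OF R A N] h] _ v])
  fix b x assume b: "b \<in> rel_index R A" and x: "x \<in> carrier N"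
  have "rel_map R A N' (single N' b (f x)) = (\<lambda>a. rel_elt R A b a \<odot>\<^bsub>N'\<^esub> f x)"
   by (rule rel_map_single[OF R A N' b module_hom_closed[OF f x]])
  then show "rel_map R A N' (\<lambda>b'. f (single N b x b')) = (\<lambda>a. f (rel_map R A N (single N b x) a))"
   unfolding hom_single[OF N N' f] rel_map_single[OF R A N b x]
   using module_hom_smult[OF f rel_elt_coeff[OF R A N b] x] by simp
 qed
qed

definition from_parts :: "(int => 'a => 'n) => (int => 'a => 'n) => int \<times> ('a + 'a) => 'n" where
 "from_parts u w = (\<lambda>(i, v). case v of Inl a => u i a | Inr b => w i b)"

lemma from_parts_simps [simp]: "from_parts u w (i, Inl a) = u i a" "from_parts u w (i, Inr b) = w i b"
 by (auto simp: from_parts_def)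

lemma from_parts_closed:
 fixes A :: "int => ('r, 'a) module"
 assumes N: "module R N" and u: "\<And>i. i \<in> I ==> u i \<in> carrier (formal_sums N (carrier (A i)))"
  and w: "\<And>i. i \<in> I ==> w i \<in> carrier (formal_sums N (rel_index R (A i)))"
  and out: "\<And>i a. i \<notin> I ==> u i a = \<zero>\<^bsub>N\<^esub> \<and> w i a = \<zero>\<^bsub>N\<^esub>"
  and J: "finite J" "\<And>i. i \<notin> J ==> u i = (\<lambda>_. \<zero>\<^bsub>N\<^esub>) \<and> w i = (\<lambda>_. \<zero>\<^bsub>N\<^esub>)"
 shows "from_parts u w \<in> carrier (formal_sums N (bas (pres_cpx R I A)))"
proof -
 interpret N: module R N by fact
 let ?S = "(\<Union>i\<in>J \<inter> I. (\<lambda>a. (i, Inl a)) ` supp N (u i) \<union> (\<lambda>a. (i, Inr a)) ` supp N (w i))"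
 show ?thesis
 proof (rule formal_sumsI[of _ _ ?S])
  show "finite ?S" using J(1) formal_sums_finite[OF u] formal_sums_finite[OF w] by blast
  have cl: "u i a \<in> carrier N" "w i a \<in> carrier N" for i a
   using formal_sums_closed[OF u, of i a] formal_sums_closed[OF w, of i a] out[of i a] by (cases "i \<in> I"; simp)+
  show "from_parts u w s \<in> carrier N" for s by (cases s rule: pres_cpx_cases) (auto simp: cl)
  show "from_parts u w s = \<zero>\<^bsub>N\<^esub>" if s: "s \<notin> ?S" for s
  proof (cases s rule: pres_cpx_cases)
   case (gen i a)
   then show ?thesis using s J(2)[of i] out[of i a] by (cases "i \<in> J \<inter> I") (auto simp: supp_def)
  next
   case (rel i b)
   then show ?thesis using s J(2)[of i] out[of i b] by (cases "i \<in> J \<inter> I") (auto simp: supp_def)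
  qed
  show "from_parts u w s = \<zero>\<^bsub>N\<^esub>" if s: "s \<notin> bas (pres_cpx R I A)" for s
  proof (cases s rule: pres_cpx_cases)
   case (gen i a)
   then show ?thesis using s out[of i a] formal_sums_outside[OF u, of i a] by (cases "i \<in> I") auto
  next
   case (rel i b)
   then show ?thesis using s out[of i b] formal_sums_outside[OF w, of i b] by (cases "i \<in> I") auto
  qed
 qed
qed

context
 fixes R :: "'r ring" and I :: "int set" and A :: "int => ('r, 'a) module" and L :: "('r, 'm) chain_cpx"
 assumes R: "principal_domain R" and A: "\<And>i. i \<in> I ==> module R (A i)" and L: "chain_cpx R L"
  and dL: "\<And>x. dif L x = \<zero>\<^bsub>amb L\<^esub>"
begin

interpretation L: module R "amb L" by (rule chain_cpxD(1)[OF L])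

abbreviation (input) "P \<equiv> pres_cpx R I A"

lemma pres_based: "based_cpx R P"
 by (rule pres_cpx_based[OF R]) (rule A)

lemma gen_part_hom:
 "i \<in> I ==> (\<lambda>c a. c (i, Inl a)) \<in> module_hom R (formal_sums N (bas P)) (formal_sums N (carrier (A i)))"
 by (rule pullback_hom) (auto simp: inj_on_def)

lemma rel_part_hom:
 "i \<in> I ==> (\<lambda>c a. c (i, Inr a)) \<in> module_hom R (formal_sums N (bas P)) (formal_sums N (rel_index R (A i)))"
 by (rule pullback_hom) (auto simp: inj_on_def)

lemma tens_pres_dif_single:
 assumes "s \<in> bas P" "x \<in> carrier (amb L)"
 shows "dif (tens R P L) (single (amb L) s x) = (\<lambda>t. inc P t s \<odot>\<^bsub>amb L\<^esub> x)"
 using tens_dif_single[OF pres_based L assms] sgn_elt_closed[OF L.R.is_cring] based_cpxD(2)[OF pres_based] assms(2)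
 by (simp add: tens_col_def dL single_def)

text \<open>
  As \<open>L\<close> has zero differential, the tensor product with \<open>L\<close> splits into the two-term complexes given by
  \<open>rel_map\<close> for the single modules \<open>A i\<close>.
\<close>

lemma gen_part_dif:
 assumes i: "i \<in> I" and c: "c \<in> carrier (formal_sums (amb L) (bas P))"
 shows "(\<lambda>a. dif (tens R P L) c (i, Inl a)) = rel_map R (A i) (amb L) (\<lambda>b. c (i, Inr b))"
proof (rule formal_sums_hom_eqI[OF L.module_axioms formal_sums_module[OF L.module_axioms]
  module_hom_comp[OF tens_dif_hom[OF pres_based L] gen_part_hom[OF i]]
  module_hom_comp[OF rel_part_hom[OF i] rel_map_hom[OF R A[OF i] L.module_axioms]] _ c])
 fix s x assume s: "s \<in> bas P" and x: "x \<in> carrier (amb L)"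
 note z = module_hom_zero[OF formal_sums_module[OF L.module_axioms] formal_sums_module[OF L.module_axioms]
   rel_map_hom[OF R A[OF i] L.module_axioms], simplified]
 show "(\<lambda>a. dif (tens R P L) (single (amb L) s x) (i, Inl a)) = rel_map R (A i) (amb L) (\<lambda>b. single (amb L) s x (i, Inr b))"
  unfolding tens_pres_dif_single[OF s x]
 proof (cases s rule: pres_cpx_cases)
  case (gen j a)
  then have "(\<lambda>b. single (amb L) s x (i, Inr b)) = (\<lambda>_. \<zero>\<^bsub>amb L\<^esub>)" by (auto simp: single_def)
  then show "(\<lambda>a. inc P (i, Inl a) s \<odot>\<^bsub>amb L\<^esub> x) = rel_map R (A i) (amb L) (\<lambda>b. single (amb L) s x (i, Inr b))"
   using z x by (simp add: gen)
 next
  case (rel j b)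
  show "(\<lambda>a. inc P (i, Inl a) s \<odot>\<^bsub>amb L\<^esub> x) = rel_map R (A i) (amb L) (\<lambda>b. single (amb L) s x (i, Inr b))"
  proof (cases "j = i")
   case True
   then have b: "b \<in> rel_index R (A i)" using s rel by auto
   have "(\<lambda>b'. single (amb L) s x (i, Inr b')) = single (amb L) b x" using rel True by (auto simp: single_def)
   then show ?thesis using rel_map_single[OF R A[OF i] L.module_axioms b x] rel True i b by simp
  next
   case False
   then have "(\<lambda>b'. single (amb L) s x (i, Inr b')) = (\<lambda>_. \<zero>\<^bsub>amb L\<^esub>)" using rel by (auto simp: single_def)
   then show ?thesis using z x rel False by simp
  qed
 qed
qed

lemma rel_part_dif:
 assumes c: "c \<in> carrier (formal_sums (amb L) (bas P))"
 shows "dif (tens R P L) c (i, Inr b) = \<zero>\<^bsub>amb L\<^esub>"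
proof -
 have z: "(\<lambda>_. \<zero>\<^bsub>amb L\<^esub>) \<in> module_hom R (formal_sums (amb L) (bas P)) (amb L)"
  by (rule module_homI) auto
 show ?thesis
 proof (rule formal_sums_hom_eqI[OF L.module_axioms L.module_axioms
   module_hom_comp[OF tens_dif_hom[OF pres_based L] eval_hom] z _ c])
  fix s x assume s: "s \<in> bas P" and x: "x \<in> carrier (amb L)"
  show "dif (tens R P L) (single (amb L) s x) (i, Inr b) = \<zero>\<^bsub>amb L\<^esub>"
   unfolding tens_pres_dif_single[OF s x] using x by (cases s rule: pres_cpx_cases) auto
 qed
qed

end

text \<open>Vanishing of \<open>Tor\<close> makes the presentation of \<open>G\<close> a resolution after tensoring with \<open>G'\<close>.\<close>

lemma quasi_iso_presentation_tensor:
 fixes R :: "'r ring" and G :: "('r, 'g) module" and G' :: "('r, 'h) module"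
 assumes R: "principal_domain R" and G: "module R G" and G': "module R G'"
  and Tor: "carrier (Tor1 R G G') = {\<zero>\<^bsub>Tor1 R G G'\<^esub>}"
 shows "quasi_iso R (tens R (pres_cpx R {0} (\<lambda>_. G)) (concentrated G')) (concentrated (tensor R G G'))
   (\<lambda>c. tensor_sum R G G' (\<lambda>x. x) (\<lambda>a. c (0, Inl a)))"
proof -
 let ?P = "pres_cpx R {0} (\<lambda>_. G)" and ?L = "concentrated G'" and ?N = "tensor R G G'"
 let ?\<kappa> = "tensor_sum R G G' (\<lambda>x. x)" and ?FG = "formal_sums G' (carrier G)" and ?FB = "formal_sums G' (rel_index R G)"
 interpret G': module R G' by fact
 note N = tensor_is_module[OF G G']
 interpret N: module R ?N by (rule N)
 note L = concentrated_chain_cpx[OF G'] and cN = concentrated_chain_cpx[OF N]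
 have dL: "dif ?L x = \<zero>\<^bsub>amb ?L\<^esub>" for x by simp
 have P: "based_cpx R ?P" by (rule pres_based[OF R G L dL])
 note T = tens_chain_cpx[OF P L]
 have gp: "(\<lambda>c a. c (0, Inl a)) \<in> module_hom R (formal_sums G' (bas ?P)) ?FG"
  by (rule gen_part_hom[OF R G L dL]) simp
 have rp: "(\<lambda>c a. c (0, Inr a)) \<in> module_hom R (formal_sums G' (bas ?P)) ?FB"
  by (rule rel_part_hom[OF R G L dL]) simp
 have gd: "(\<lambda>a. dif (tens R ?P ?L) c (0, Inl a)) = rel_map R G G' (\<lambda>b. c (0, Inr b))"
  if "c \<in> carrier (formal_sums G' (bas ?P))" for c
  using gen_part_dif[OF R G L dL, where I = "{0}" and i = 0 and c = c] that by simp
 have rd: "dif (tens R ?P ?L) c (i, Inr b) = \<zero>\<^bsub>G'\<^esub>"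
  if "c \<in> carrier (formal_sums G' (bas ?P))" for c i b
  using rel_part_dif[OF R G L dL, where I = "{0}" and c = c] that by simp
 have FG: "module R ?FG" and FB: "module R ?FB" using formal_sums_module[OF G'] by auto
 note \<kappa> = tensor_sum_id_hom(1)[OF R G G'] and rm = rel_map_hom[OF R G G']
 let ?\<psi> = "\<lambda>c. ?\<kappa> (\<lambda>a. c (0, Inl a))"
 have deg: "c s = \<zero>\<^bsub>G'\<^esub>" if c: "c \<in> grd (tens R ?P ?L) n" and s: "s \<notin> bas ?P \<or> dg ?P s \<noteq> n" for c n s
 proof (cases "s \<in> bas ?P")
  case True
  then have "c s \<in> grd ?L (n - dg ?P s)" using c by (simp add: tens_grd)
  then show ?thesis using True s by (auto split: if_splits)
 next
  case False
  have "c \<in> carrier (formal_sums G' (bas ?P))" using c by (simp add: tens_grd)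
  then show ?thesis using formal_sums_outside False by metis
 qed
 show ?thesis
  unfolding quasi_iso_def
 proof (intro conjI allI ballI impI)
  show "chain_cpx R (tens R ?P ?L)" "chain_cpx R (concentrated ?N)" by fact+
  show h: "?\<psi> \<in> module_hom R (amb (tens R ?P ?L)) (amb (concentrated ?N))"
   using module_hom_comp[OF gp \<kappa>] by simp
  show "?\<psi> c \<in> grd (concentrated ?N) n" if c: "c \<in> grd (tens R ?P ?L) n" for c n
  proof (cases "n = 0")
   case True
   then show ?thesis using c module_hom_closed[OF h, of c] by (simp add: tens_grd)
  next
   case False
   have "c (0, Inl a) = \<zero>\<^bsub>G'\<^esub>" for a
    by (rule deg[OF c]) (use False in simp)
   then show ?thesis using False module_hom_zero[OF FG N \<kappa>] by simp
  qed
  show "?\<psi> (dif (tens R ?P ?L) c) = dif (concentrated ?N) (?\<psi> c)" if c: "c \<in> carrier (amb (tens R ?P ?L))" for c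
  proof -
   have "(\<lambda>a. c (0, Inr a)) \<in> carrier ?FB" using module_hom_closed[OF rp] c by simp
   then show ?thesis using gd[of c] c
    tensor_sum_id_kernel[OF R G G' module_hom_closed[OF rm, of "\<lambda>b. c (0, Inr b)"]] by auto
  qed
  fix n q l assume q: "q \<in> grd (tens R ?P ?L) (n - 1)" and l: "l \<in> grd (concentrated ?N) n"
   and dq: "dif (tens R ?P ?L) q = \<zero>\<^bsub>amb (tens R ?P ?L)\<^esub>" and dl: "dif (concentrated ?N) l = ?\<psi> q"
  have qF: "q \<in> carrier (formal_sums G' (bas ?P))" using q by (simp add: tens_grd)
  have q0: "q s = \<zero>\<^bsub>G'\<^esub>" if "s \<notin> bas ?P \<or> dg ?P s \<noteq> n - 1" for s
   by (rule deg[OF q that])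
  let ?qr = "\<lambda>b. q (0, Inr b)" and ?qg = "\<lambda>a. q (0, Inl a)"
  have qr: "?qr \<in> carrier ?FB" and qg: "?qg \<in> carrier ?FG"
   using module_hom_closed[OF rp qF] module_hom_closed[OF gp qF] by auto
  have "rel_map R G G' ?qr = (\<lambda>_. \<zero>\<^bsub>G'\<^esub>)" using gd[OF qF] dq by simp
  then have "tensor_sum R (pres_kernel R G) G' (rel_elt R G) ?qr \<in> carrier (Tor1 R G G')"
   using rel_tensor_in_Tor1[OF R G G' qr] by simp
  then have "tensor_sum R (pres_kernel R G) G' (rel_elt R G) ?qr = \<zero>\<^bsub>tensor R (pres_kernel R G) G'\<^esub>"
   using Tor by (simp add: Tor1_def Let_def)
  also have "\<dots> = tensor_sum R (pres_kernel R G) G' (rel_elt R G) (\<lambda>_. \<zero>\<^bsub>G'\<^esub>)"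
   using module_hom_zero[OF FB tensor_is_module[OF pres_kernel_module[OF R G] G'] rel_tensor_hom(1)[OF R G G']] by simp
  finally have qr0: "?qr = (\<lambda>_. \<zero>\<^bsub>G'\<^esub>)"
   using bij_betw_imp_inj_on[OF rel_tensor_bij[OF R G G']] qr submoduleD(2)[OF FB module.carrier_is_submodule[OF FB]]
   by (simp add: inj_on_def)
  have "?\<kappa> ?qg = \<zero>\<^bsub>?N\<^esub>" using dl by simp
  then have "?qg \<in> rel_map R G G' ` carrier ?FB" using tensor_sum_id_kernel[OF R G G' qg] by simp
  then obtain w0 where w0: "w0 \<in> carrier ?FB" "rel_map R G G' w0 = ?qg" by (elim imageE) simp
  define w where "w = (if n = 1 then w0 else (\<lambda>_. \<zero>\<^bsub>G'\<^esub>))"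
  have z: "(\<lambda>_. \<zero>\<^bsub>G'\<^esub>) \<in> carrier ?FB" "(\<lambda>_. \<zero>\<^bsub>G'\<^esub>) \<in> carrier ?FG"
   using submoduleD(2)[OF FB module.carrier_is_submodule[OF FB]] submoduleD(2)[OF FG module.carrier_is_submodule[OF FG]]
   by auto
  have w: "w \<in> carrier ?FB" "rel_map R G G' w = ?qg"
  proof -
   have "?qg = (\<lambda>_. \<zero>\<^bsub>G'\<^esub>)" if "n \<noteq> 1" using q0 that by auto
   then show "w \<in> carrier ?FB" "rel_map R G G' w = ?qg"
    using w0 z module_hom_zero[OF FB FG rm] by (auto simp: w_def)
  qed
  have lN: "l \<in> carrier ?N" using grd_carrier[OF cN l] by simp
  have "l \<in> ?\<kappa> ` carrier ?FG" unfolding tensor_sum_id_surj[OF R G G'] by (rule lN)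
  then obtain u0 where u0: "u0 \<in> carrier ?FG" "?\<kappa> u0 = l" by (elim imageE) simp
  define u where "u = (if n = 0 then u0 else (\<lambda>_. \<zero>\<^bsub>G'\<^esub>))"
  have u: "u \<in> carrier ?FG" "?\<kappa> u = l"
  proof -
   show "u \<in> carrier ?FG" using u0(1) z(2) by (simp add: u_def)
   have "l = \<zero>\<^bsub>?N\<^esub>" if "n \<noteq> 0" using l that by simp
   then show "?\<kappa> u = l" using u0(2) module_hom_zero[OF FG N \<kappa>] by (simp add: u_def)
  qed
  define q' where "q' = from_parts (\<lambda>i a. if i = 0 then u a else \<zero>\<^bsub>G'\<^esub>) (\<lambda>i a. if i = 0 then w a else \<zero>\<^bsub>G'\<^esub>)"
  have q'F: "q' \<in> carrier (formal_sums G' (bas ?P))"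
   unfolding q'_def by (rule from_parts_closed[OF G', where J = "{0}"]) (use u(1) w(1) in auto)
  have "q' \<in> grd (tens R ?P ?L) n"
   unfolding tens_grd
  proof (intro conjI ballI)
   show "q' \<in> carrier (formal_sums (amb ?L) (bas ?P))" using q'F by simp
   show "q' s \<in> grd ?L (n - dg ?P s)" if "s \<in> bas ?P" for s
    using that formal_sums_closed[OF q'F, of s]
    by (cases s rule: pres_cpx_cases) (auto simp: q'_def u_def w_def)
  qed
  moreover have "dif (tens R ?P ?L) q' = q"
  proof
   fix s show "dif (tens R ?P ?L) q' s = q s"
   proof (cases s rule: pres_cpx_cases)
    case (gen i a)
    show ?thesis
    proof (cases "i = 0")
     case True
     then show ?thesis using fun_cong[OF gd[OF q'F], of a] fun_cong[OF w(2), of a] by (simp add: gen q'_def)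
    next
     case False
     have "dif (tens R ?P ?L) q' \<in> carrier (formal_sums G' (bas ?P))"
      using module_hom_closed[OF tens_dif_hom[OF P L]] q'F by simp
     then show ?thesis using formal_sums_outside[of _ G' "bas ?P" s] False gen q0[of s] by simp
    qed
   next
    case (rel i b)
    have "q s = \<zero>\<^bsub>G'\<^esub>" using fun_cong[OF qr0, of b] q0[of s] by (cases "i = 0") (auto simp: rel)
    then show ?thesis using rd[OF q'F] by (simp add: rel)
   qed
  qed
  moreover have "?\<psi> q' = l" using u by (simp add: q'_def)
  ultimately show "\<exists>q'\<in>grd (tens R ?P ?L) n. \<exists>l'\<in>grd (concentrated ?N) (n + 1).
    dif (tens R ?P ?L) q' = q \<and> l = ?\<psi> q' \<oplus>\<^bsub>amb (concentrated ?N)\<^esub> dif (concentrated ?N) l'"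
   using u grd_closed(1)[OF cN] module_hom_closed[OF \<kappa> u(1)] by (intro bexI[of _ q'] bexI[of _ "\<zero>\<^bsub>?N\<^esub>"]) auto
 qed
qed

lemma direct_sum_simps [simp]:
 "f \<in> carrier (direct_sum I M) \<longleftrightarrow>
   (\<forall>i\<in>I. f i \<in> carrier (M i)) \<and> f \<in> extensional I \<and> finite {i \<in> I. f i \<noteq> \<zero>\<^bsub>M i\<^esub>}"
 "\<zero>\<^bsub>direct_sum I M\<^esub> = (\<lambda>i\<in>I. \<zero>\<^bsub>M i\<^esub>)"
 "f \<oplus>\<^bsub>direct_sum I M\<^esub> g = (\<lambda>i\<in>I. f i \<oplus>\<^bsub>M i\<^esub> g i)"
 "r \<odot>\<^bsub>direct_sum I M\<^esub> f = (\<lambda>i\<in>I. r \<odot>\<^bsub>M i\<^esub> f i)"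
 by (auto simp: direct_sum_def PiE_iff)

lemma module_sum_simps [simp]:
 "x \<in> carrier (module_sum M N) \<longleftrightarrow> fst x \<in> carrier M \<and> snd x \<in> carrier N"
 "\<zero>\<^bsub>module_sum M N\<^esub> = (\<zero>\<^bsub>M\<^esub>, \<zero>\<^bsub>N\<^esub>)"
 "x \<oplus>\<^bsub>module_sum M N\<^esub> y = (fst x \<oplus>\<^bsub>M\<^esub> fst y, snd x \<oplus>\<^bsub>N\<^esub> snd y)"
 "r \<odot>\<^bsub>module_sum M N\<^esub> x = (r \<odot>\<^bsub>M\<^esub> fst x, r \<odot>\<^bsub>N\<^esub> snd x)"
 by (auto simp: module_sum_def mem_Times_iff split: prod.splits)

lemma direct_sum_module:
 assumes R: "cring R" and M: "\<And>i. i \<in> I ==> module R (M i)"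
 shows "module R (direct_sum I M)"
proof (rule moduleI[OF R], rule abelian_groupI)
 let ?D = "direct_sum I M"
 interpret R: cring R by fact
 note cl = abelian_monoid.a_closed abelian_monoid.zero_closed module.smult_closed
 have ag: "abelian_group (M i)" "abelian_monoid (M i)" if "i \<in> I" for i
  using M[OF that] by (auto simp: module_def abelian_group_def)
 have sub: "finite {i \<in> I. h i \<noteq> \<zero>\<^bsub>M i\<^esub>}"
  if "f \<in> carrier ?D" "g \<in> carrier ?D" "\<And>i. i \<in> I ==> f i = \<zero>\<^bsub>M i\<^esub> ==> g i = \<zero>\<^bsub>M i\<^esub> ==> h i = \<zero>\<^bsub>M i\<^esub>" for f g h
  using that by (auto intro: finite_subset[of _ "{i \<in> I. f i \<noteq> \<zero>\<^bsub>M i\<^esub>} \<union> {i \<in> I. g i \<noteq> \<zero>\<^bsub>M i\<^esub>}"])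
 show "\<zero>\<^bsub>?D\<^esub> \<in> carrier ?D"
 proof -
  have "{i \<in> I. (\<lambda>i\<in>I. \<zero>\<^bsub>M i\<^esub>) i \<noteq> \<zero>\<^bsub>M i\<^esub>} = {}" by auto
  then show ?thesis using ag(2) by (simp add: abelian_monoid.zero_closed)
 qed
 fix f assume f: "f \<in> carrier ?D"
 have fi: "f i \<in> carrier (M i)" if "i \<in> I" for i using f that by simp
 have sm: "r \<odot>\<^bsub>?D\<^esub> f \<in> carrier ?D" if r: "r \<in> carrier R" for r
 proof -
  have "finite {i \<in> I. (r \<odot>\<^bsub>?D\<^esub> f) i \<noteq> \<zero>\<^bsub>M i\<^esub>}"
   by (rule sub[OF f f]) (use r M module.smult_r_null in fastforce)
  moreover have "r \<odot>\<^bsub>M i\<^esub> f i \<in> carrier (M i)" if "i \<in> I" for i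
   by (rule module.smult_closed[OF M[OF that] r fi[OF that]])
  ultimately show ?thesis by simp
 qed
 show "\<zero>\<^bsub>?D\<^esub> \<oplus>\<^bsub>?D\<^esub> f = f"
  using f ag(2) by (intro extensionalityI[of _ I]) (auto simp: abelian_monoid.l_zero)
 show "\<exists>g\<in>carrier ?D. g \<oplus>\<^bsub>?D\<^esub> f = \<zero>\<^bsub>?D\<^esub>"
 proof
  show "(\<ominus>\<^bsub>R\<^esub> \<one>\<^bsub>R\<^esub>) \<odot>\<^bsub>?D\<^esub> f \<in> carrier ?D" by (rule sm) simp
  show "(\<ominus>\<^bsub>R\<^esub> \<one>\<^bsub>R\<^esub>) \<odot>\<^bsub>?D\<^esub> f \<oplus>\<^bsub>?D\<^esub> f = \<zero>\<^bsub>?D\<^esub>"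
  proof -
   have "(\<ominus>\<^bsub>R\<^esub> \<one>\<^bsub>R\<^esub>) \<odot>\<^bsub>M i\<^esub> f i \<oplus>\<^bsub>M i\<^esub> f i = \<zero>\<^bsub>M i\<^esub>" if "i \<in> I" for i
    using module_neg_eq_smult[OF M[OF that] fi[OF that]] abelian_group.l_neg[OF ag(1)[OF that] fi[OF that]] by simp
   then show ?thesis by auto
  qed
 qed
 fix g assume g: "g \<in> carrier ?D"
 have gi: "g i \<in> carrier (M i)" if "i \<in> I" for i using g that by simp
 show "f \<oplus>\<^bsub>?D\<^esub> g \<in> carrier ?D"
 proof -
  have "finite {i \<in> I. (f \<oplus>\<^bsub>?D\<^esub> g) i \<noteq> \<zero>\<^bsub>M i\<^esub>}"
   by (rule sub[OF f g]) (use ag(2) abelian_monoid.l_zero abelian_monoid.zero_closed in fastforce)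
  then show ?thesis using fi gi ag(2) by (simp add: abelian_monoid.a_closed)
 qed
 show "f \<oplus>\<^bsub>?D\<^esub> g = g \<oplus>\<^bsub>?D\<^esub> f"
  using fi gi ag(2) by (auto intro!: restrict_ext abelian_monoid.a_comm)
 show "f \<oplus>\<^bsub>?D\<^esub> g \<oplus>\<^bsub>?D\<^esub> h = f \<oplus>\<^bsub>?D\<^esub> (g \<oplus>\<^bsub>?D\<^esub> h)" if "h \<in> carrier ?D" for h
  using fi gi ag(2) that by (auto intro!: restrict_ext simp: abelian_monoid.a_assoc)
next
 let ?D = "direct_sum I M"
 interpret R: cring R by fact
 fix r f assume r: "r \<in> carrier R" and f: "f \<in> carrier ?D"
 have fi: "f i \<in> carrier (M i)" if "i \<in> I" for i using f that by simp
 have s: "r \<odot>\<^bsub>M i\<^esub> f i = \<zero>\<^bsub>M i\<^esub>" if "i \<in> I" "f i = \<zero>\<^bsub>M i\<^esub>" for i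
  using module.smult_r_null[OF M[OF that(1)] r] that(2) by simp
 have "finite {i \<in> I. (r \<odot>\<^bsub>?D\<^esub> f) i \<noteq> \<zero>\<^bsub>M i\<^esub>}"
  using f s by (auto elim!: rev_finite_subset)
 then show "r \<odot>\<^bsub>?D\<^esub> f \<in> carrier ?D" using fi r M by (auto intro: module.smult_closed)
 show "(r \<oplus>\<^bsub>R\<^esub> r') \<odot>\<^bsub>?D\<^esub> f = r \<odot>\<^bsub>?D\<^esub> f \<oplus>\<^bsub>?D\<^esub> r' \<odot>\<^bsub>?D\<^esub> f" if "r' \<in> carrier R" for r'
  using fi r that M by (auto intro!: restrict_ext simp: module.smult_l_distr)
 show "(r \<otimes>\<^bsub>R\<^esub> r') \<odot>\<^bsub>?D\<^esub> f = r \<odot>\<^bsub>?D\<^esub> (r' \<odot>\<^bsub>?D\<^esub> f)" if "r' \<in> carrier R" for r'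
  using fi r that M by (auto intro!: restrict_ext simp: module.smult_assoc1)
 show "r \<odot>\<^bsub>?D\<^esub> (f \<oplus>\<^bsub>?D\<^esub> g) = r \<odot>\<^bsub>?D\<^esub> f \<oplus>\<^bsub>?D\<^esub> r \<odot>\<^bsub>?D\<^esub> g" if "g \<in> carrier ?D" for g
  using fi r that M by (auto intro!: restrict_ext simp: module.smult_r_distr[OF M])
next
 let ?D = "direct_sum I M"
 fix f assume "f \<in> carrier ?D"
 then show "\<one>\<^bsub>R\<^esub> \<odot>\<^bsub>?D\<^esub> f = f"
  using M by (intro extensionalityI[of _ I]) (auto simp: module.smult_one)
qed

lemma module_sum_module:
 assumes M: "module R M" and N: "module R N"
 shows "module R (module_sum M N)"
proof -
 interpret M: module R M by fact
 interpret N: module R N by fact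
 show ?thesis
 proof (rule moduleI[OF M.R.is_cring], rule abelian_groupI)
  show "\<exists>y\<in>carrier (module_sum M N). y \<oplus>\<^bsub>module_sum M N\<^esub> x = \<zero>\<^bsub>module_sum M N\<^esub>"
   if "x \<in> carrier (module_sum M N)" for x
   using that by (intro bexI[of _ "(\<ominus>\<^bsub>M\<^esub> fst x, \<ominus>\<^bsub>N\<^esub> snd x)"]) (auto simp: M.l_neg N.l_neg)
 qed (auto simp: M.a_ac N.a_ac M.smult_l_distr N.smult_l_distr M.smult_r_distr N.smult_r_distr
   M.smult_assoc1 N.smult_assoc1)
qed

text \<open>
  The simplest complex with prescribed homology. Every complex with this homology has the same free
  approximation.
\<close>

definition graded_cpx :: "(int => ('r, 'm) module) => ('r, int => 'm) chain_cpx" where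
 "graded_cpx A = \<lparr>amb = direct_sum UNIV A,
   grd = (\<lambda>n. {f \<in> carrier (direct_sum UNIV A). \<forall>j. j \<noteq> n \<longrightarrow> f j = \<zero>\<^bsub>A j\<^esub>}),
   dif = (\<lambda>_. \<zero>\<^bsub>direct_sum UNIV A\<^esub>)\<rparr>"

lemma graded_cpx_simps [simp]:
 "amb (graded_cpx A) = direct_sum UNIV A" "dif (graded_cpx A) x = \<zero>\<^bsub>direct_sum UNIV A\<^esub>"
 "f \<in> grd (graded_cpx A) n \<longleftrightarrow> f \<in> carrier (direct_sum UNIV A) \<and> (\<forall>j. j \<noteq> n \<longrightarrow> f j = \<zero>\<^bsub>A j\<^esub>)"
 by (simp_all add: graded_cpx_def)

definition inject :: "(int => ('r, 'm) module) => int => 'm => int => 'm" where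
 "inject A n x = (\<lambda>j. if j = n then x else \<zero>\<^bsub>A j\<^esub>)"

context
 fixes R :: "'r ring" and A :: "int => ('r, 'm) module"
 assumes R: "cring R" and A: "\<And>i. module R (A i)"
begin

abbreviation (input) "DS \<equiv> direct_sum UNIV A"

lemma DS: "module R DS" by (rule direct_sum_module[OF R A])

lemma zero_cl: "\<zero>\<^bsub>A i\<^esub> \<in> carrier (A i)"
 using submoduleD(2)[OF A module.carrier_is_submodule[OF A]] .

lemma component_hom: "(\<lambda>f. f j) \<in> module_hom R DS (A j)"
 by (rule module_homI) auto

lemma inject_hom: "inject A n \<in> module_hom R (A n) DS"
proof (rule module_homI)
 fix x assume x: "x \<in> carrier (A n)"
 have "{i. inject A n x i \<noteq> \<zero>\<^bsub>A i\<^esub>} \<subseteq> {n}" by (auto simp: inject_def)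
 then have "finite {i. inject A n x i \<noteq> \<zero>\<^bsub>A i\<^esub>}" by (rule finite_subset) simp
 then show "inject A n x \<in> carrier DS" using x zero_cl by (auto simp: inject_def)
 show "inject A n (x \<oplus>\<^bsub>A n\<^esub> y) = inject A n x \<oplus>\<^bsub>DS\<^esub> inject A n y" for y
 proof -
  have "\<zero>\<^bsub>A j\<^esub> \<oplus>\<^bsub>A j\<^esub> \<zero>\<^bsub>A j\<^esub> = \<zero>\<^bsub>A j\<^esub>" for j
   using A[of j] zero_cl[of j] by (auto simp: module_def abelian_group_def intro: abelian_monoid.l_zero)
  then show ?thesis by (auto simp: inject_def)
 qed
 show "inject A n (r \<odot>\<^bsub>A n\<^esub> x) = r \<odot>\<^bsub>DS\<^esub> inject A n x" if "r \<in> carrier R" for r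
  using module.smult_r_null[OF A that] by (auto simp: inject_def)
qed

lemma inject_grd: "x \<in> carrier (A n) ==> inject A n x \<in> grd (graded_cpx A) n"
 using module_hom_closed[OF inject_hom, of x n] unfolding graded_cpx_simps
 by (simp del: direct_sum_simps add: inject_def)

lemma inject_component: "f \<in> grd (graded_cpx A) n ==> inject A n (f n) = f"
 by (auto simp: inject_def)

lemma graded_chain_cpx: "chain_cpx R (graded_cpx A)"
proof -
 interpret D: module R DS by (rule DS)
 have "submodule (grd (graded_cpx A) n) R DS" for n
  unfolding submodule_iff[OF DS]
 proof (intro conjI ballI)
  show "grd (graded_cpx A) n \<subseteq> carrier DS" by (auto simp del: direct_sum_simps)
  show "\<zero>\<^bsub>DS\<^esub> \<in> grd (graded_cpx A) n" using D.zero_closed unfolding graded_cpx_simps by simp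
  show "x \<oplus>\<^bsub>DS\<^esub> y \<in> grd (graded_cpx A) n" if "x \<in> grd (graded_cpx A) n" "y \<in> grd (graded_cpx A) n" for x y
  proof -
   have "x \<oplus>\<^bsub>DS\<^esub> y \<in> carrier DS" using that D.a_closed by (simp del: direct_sum_simps)
   moreover have "\<zero>\<^bsub>A j\<^esub> \<oplus>\<^bsub>A j\<^esub> \<zero>\<^bsub>A j\<^esub> = \<zero>\<^bsub>A j\<^esub>" for j
    using A[of j] zero_cl[of j] by (auto simp: module_def abelian_group_def intro: abelian_monoid.l_zero)
   ultimately show ?thesis using that unfolding graded_cpx_simps by simp
  qed
  show "r \<odot>\<^bsub>DS\<^esub> x \<in> grd (graded_cpx A) n" if "r \<in> carrier R" "x \<in> grd (graded_cpx A) n" for r x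
  proof -
   have "r \<odot>\<^bsub>DS\<^esub> x \<in> carrier DS" using that D.smult_closed by (simp del: direct_sum_simps)
   then show ?thesis using that module.smult_r_null[OF A that(1)] unfolding graded_cpx_simps by simp
  qed
 qed
 moreover have "(\<lambda>_. \<zero>\<^bsub>DS\<^esub>) \<in> module_hom R DS DS"
  by (rule module_homI) (auto simp del: direct_sum_simps)
 moreover have "\<zero>\<^bsub>DS\<^esub> \<in> grd (graded_cpx A) n" for n using D.zero_closed unfolding graded_cpx_simps by simp
 ultimately show ?thesis using DS unfolding chain_cpx_def
  by (auto simp: graded_cpx_def simp del: direct_sum_simps)
qed

lemma graded_has_homology: "has_homology R (graded_cpx A) n (A n)"
proof -
 interpret D: module R DS by (rule DS)
 have cyc: "cycles (graded_cpx A) n = grd (graded_cpx A) n"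
  unfolding cycles_def by (auto simp del: direct_sum_simps)
 have bd: "boundaries (graded_cpx A) n = {\<zero>\<^bsub>DS\<^esub>}"
  unfolding boundaries_def using image_constant[OF grd_closed(1)[OF graded_chain_cpx, of "n + 1"], of "\<zero>\<^bsub>DS\<^esub>"]
  by (simp del: direct_sum_simps graded_cpx_simps(3))
 let ?Z = "(amb (graded_cpx A))\<lparr>carrier := cycles (graded_cpx A) n\<rparr>"
 have "(\<lambda>f. f n) \<in> module_hom R ?Z (A n)"
  unfolding cyc by (rule module_homI) auto
 moreover have "(\<lambda>f. f n) ` cycles (graded_cpx A) n = carrier (A n)"
 proof
  show "(\<lambda>f. f n) ` cycles (graded_cpx A) n \<subseteq> carrier (A n)" unfolding cyc by auto
  show "carrier (A n) \<subseteq> (\<lambda>f. f n) ` cycles (graded_cpx A) n"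
  proof
   fix x assume "x \<in> carrier (A n)"
   then show "x \<in> (\<lambda>f. f n) ` cycles (graded_cpx A) n"
    unfolding cyc using inject_grd[of x n] by (intro image_eqI[of _ _ "inject A n x"]) (auto simp: inject_def)
  qed
 qed
 moreover have "f n = \<zero>\<^bsub>A n\<^esub> \<longleftrightarrow> f \<in> boundaries (graded_cpx A) n" if "f \<in> cycles (graded_cpx A) n" for f
  using that unfolding cyc bd by (auto simp: fun_eq_iff)
 ultimately show ?thesis unfolding has_homology_def by blast
qed

end

lemma Tor1_simps:
 "\<zero>\<^bsub>Tor1 R A N\<^esub> = \<zero>\<^bsub>tensor R (pres_kernel R A) N\<^esub>"
 "x \<oplus>\<^bsub>Tor1 R A N\<^esub> y = x \<oplus>\<^bsub>tensor R (pres_kernel R A) N\<^esub> y"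
 "r \<odot>\<^bsub>Tor1 R A N\<^esub> x = r \<odot>\<^bsub>tensor R (pres_kernel R A) N\<^esub> x"
 by (simp_all add: Tor1_def Let_def)

text \<open>
  Both factors are direct sums and the second one has zero differential, so in bidegree \<open>(i, j)\<close> the
  complex is the presentation of \<open>A i\<close> tensored with \<open>A' j\<close>. The cokernel of \<open>rel_map\<close> lives in total
  degree \<open>i + j\<close> and is \<open>A i \<otimes> A' j\<close>; its kernel is \<open>Tor\<^sub>1(A i, A' j)\<close>, in total degree \<open>i + j + 1\<close>.
\<close>

theorem presentation_tensor_homology:
 fixes R :: "'r ring" and A :: "int => ('r, 'a) module" and A' :: "int => ('r, 'b) module"
 assumes R: "principal_domain R" and A: "\<And>i. module R (A i)" and A': "\<And>i. module R (A' i)"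
 shows "has_homology R (tens R (pres_cpx R UNIV A) (graded_cpx A')) n
   (module_sum (direct_sum {(i, j). i + j = n} (\<lambda>(i, j). tensor R (A i) (A' j)))
    (direct_sum {(i, j). i + j = n - 1} (\<lambda>(i, j). Tor1 R (A i) (A' j))))"
proof -
 interpret R: principal_domain R by fact
 note cr = R.is_cring
 let ?P = "pres_cpx R UNIV A" and ?L = "graded_cpx A'"
 let ?T = "tens R ?P ?L" and ?D = "direct_sum UNIV A'"
 let ?F = "formal_sums ?D (bas ?P)"
 let ?I = "{(i, j). i + j = n}" and ?J = "{(i, j). i + j = n - 1}"
 let ?K = "\<lambda>i. pres_kernel R (A i)"
 let ?X = "direct_sum ?I (\<lambda>(i, j). tensor R (A i) (A' j))" and ?Y = "direct_sum ?J (\<lambda>(i, j). Tor1 R (A i) (A' j))"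
 note L = graded_chain_cpx[OF cr A', simplified]
 have dL: "dif ?L x = \<zero>\<^bsub>amb ?L\<^esub>" for x by simp
 have AU: "\<And>i. i \<in> UNIV ==> module R (A i)" using A by simp
 note P = pres_based[OF R AU L dL]
 note T = tens_chain_cpx[OF P L]
 have D: "module R ?D" by (rule DS[OF cr A'])
 have F: "module R ?F" by (rule formal_sums_module[OF D])
 have amb: "amb ?T = ?F" by simp
 have dT: "dif ?T \<in> module_hom R ?F ?F" using chain_cpxD(3)[OF T] by simp
 let ?FA = "\<lambda>i j. formal_sums (A' j) (carrier (A i))" and ?FB = "\<lambda>i j. formal_sums (A' j) (rel_index R (A i))"
 have FA: "module R (?FA i j)" and FB: "module R (?FB i j)" for i j using formal_sums_module[OF A'] by auto
 have gp: "(\<lambda>c a. c (i, Inl a)) \<in> module_hom R (formal_sums N (bas ?P)) (formal_sums N (carrier (A i)))"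
  for i and N :: "('r, 'z) module"
  by (rule pullback_hom) (auto simp: inj_on_def)
 have rp: "(\<lambda>c a. c (i, Inr a)) \<in> module_hom R (formal_sums N (bas ?P)) (formal_sums N (rel_index R (A i)))"
  for i and N :: "('r, 'z) module"
  by (rule pullback_hom) (auto simp: inj_on_def)
 have gd: "(\<lambda>a. dif ?T c (i, Inl a)) = rel_map R (A i) ?D (\<lambda>b. c (i, Inr b))" if "c \<in> carrier ?F" for c i
  using gen_part_dif[OF R AU L dL, where i = i and c = c] that by simp
 have rd: "dif ?T c (i, Inr b) = \<zero>\<^bsub>?D\<^esub>" if "c \<in> carrier ?F" for c i b
  using rel_part_dif[OF R AU L dL, where c = c] that by simp
 have ev: "(\<lambda>f. f j) \<in> module_hom R ?D (A' j)" for j by (rule component_hom[OF cr A'])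
 have ij: "inject A' j \<in> module_hom R (A' j) ?D" for j by (rule inject_hom[OF cr A'])
 define u where "u i j c = (\<lambda>a. c (i, Inl a) j)" for i j and c :: "int \<times> ('a + 'a) => int => 'b"
 define v where "v i j c = (\<lambda>b. c (i, Inr b) j)" for i j and c :: "int \<times> ('a + 'a) => int => 'b"
 have u: "u i j \<in> module_hom R ?F (?FA i j)" for i j
  unfolding u_def using module_hom_comp[OF gp pointwise_hom[OF D A' ev]] .
 have v: "v i j \<in> module_hom R ?F (?FB i j)" for i j
  unfolding v_def using module_hom_comp[OF rp pointwise_hom[OF D A' ev]] .
 let ?\<kappa> = "\<lambda>i j. tensor_sum R (A i) (A' j) (\<lambda>x. x)"
 let ?\<rho> = "\<lambda>i j. tensor_sum R (?K i) (A' j) (rel_elt R (A i))"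
 have \<kappa>: "?\<kappa> i j \<in> module_hom R (?FA i j) (tensor R (A i) (A' j))" for i j by (rule tensor_sum_id_hom(1)[OF R A A'])
 have \<rho>: "?\<rho> i j \<in> module_hom R (?FB i j) (tensor R (?K i) (A' j))" for i j by (rule rel_tensor_hom(1)[OF R A A'])
 have tA: "module R (tensor R (A i) (A' j))" and tK: "module R (tensor R (?K i) (A' j))" for i j
  using tensor_is_module[OF A A'] tensor_is_module[OF pres_kernel_module[OF R A] A'] by auto
 have \<rho>0: "w = (\<lambda>_. \<zero>\<^bsub>A' j\<^esub>)" if w: "w \<in> carrier (?FB i j)" and e: "?\<rho> i j w = \<zero>\<^bsub>tensor R (?K i) (A' j)\<^esub>" for w i j
 proof -
  have z: "(\<lambda>_. \<zero>\<^bsub>A' j\<^esub>) \<in> carrier (?FB i j)"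
   using submoduleD(2)[OF FB module.carrier_is_submodule[OF FB]] by simp
  have "?\<rho> i j (\<lambda>_. \<zero>\<^bsub>A' j\<^esub>) = \<zero>\<^bsub>tensor R (?K i) (A' j)\<^esub>" using module_hom_zero[OF FB tK \<rho>] by simp
  then show ?thesis using inj_onD[OF bij_betw_imp_inj_on[OF rel_tensor_bij[OF R A A']] _ w z] e by simp
 qed
 (* k1 and k2 take the classes of the generator part and of the relation part in bidegree (i, j) *)
 define k1 where "k1 i j c = ?\<kappa> i j (u i j c)" for i j c
 define k2 where "k2 i j c = ?\<rho> i j (v i j c)" for i j c
 have k1: "k1 i j \<in> module_hom R ?F (tensor R (A i) (A' j))" for i j
  unfolding k1_def by (rule module_hom_comp[OF u \<kappa>])
 have k2: "k2 i j \<in> module_hom R ?F (tensor R (?K i) (A' j))" for i j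
  unfolding k2_def by (rule module_hom_comp[OF v \<rho>])
 have rm_comp: "rel_map R (A i) (A' j) (v i j c) = (\<lambda>a. rel_map R (A i) ?D (\<lambda>b. c (i, Inr b)) a j)"
  if c: "c \<in> carrier ?F" for i j c
  unfolding v_def by (rule rel_map_natural[OF R A D A' ev module_hom_closed[OF rp c]])
 have u_dif: "u i j (dif ?T c) = rel_map R (A i) (A' j) (v i j c)" if c: "c \<in> carrier ?F" for i j c
  unfolding rm_comp[OF c] gd[OF c, symmetric] by (simp add: u_def)
 have v_dif: "v i j (dif ?T c) = (\<lambda>_. \<zero>\<^bsub>A' j\<^esub>)" if c: "c \<in> carrier ?F" for i j c
  unfolding v_def rd[OF c] by simp
 have cycF: "c \<in> carrier ?F" if "c \<in> cycles ?T m" for c m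
  using that by (simp add: cycles_def tens_grd)
 have Tor: "k2 i j c \<in> carrier (Tor1 R (A i) (A' j))" if c: "c \<in> cycles ?T m" for i j c m
 proof -
  have "dif ?T c = \<zero>\<^bsub>?F\<^esub>" using c by (simp add: cycles_def)
  then have "u i j (dif ?T c) = \<zero>\<^bsub>?FA i j\<^esub>" using module_hom_zero[OF F FA u] by simp
  then have "rel_map R (A i) (A' j) (v i j c) = (\<lambda>_. \<zero>\<^bsub>A' j\<^esub>)" using u_dif[OF cycF[OF c]] by simp
  then show ?thesis
   unfolding k2_def using rel_tensor_in_Tor1[OF R A A' module_hom_closed[OF v cycF[OF c]]] by simp
 qed
 have comp: "c s = inject A' (m - dg ?P s) (c s (m - dg ?P s))" if c: "c \<in> grd ?T m" for c m s
 proof (cases "s \<in> bas ?P")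
  case True
  then have "c s \<in> grd ?L (m - dg ?P s)" using c by (simp add: tens_grd del: graded_cpx_simps)
  from inject_component[OF cr A' this] show ?thesis by simp
 next
  case False
  have "c \<in> carrier ?F" using c by (simp add: tens_grd)
  from formal_sums_outside[OF this False] show ?thesis by (auto simp: inject_def)
 qed
 have inj0: "inject A' j \<zero>\<^bsub>A' j\<^esub> = \<zero>\<^bsub>?D\<^esub>" for j by (rule module_hom_zero[OF A' D ij])
 have from_parts_grd: "from_parts (\<lambda>i a. inject A' (m - i) (f i a)) (\<lambda>i b. inject A' (m - 1 - i) (g i b)) \<in> grd ?T m"
  if f: "\<And>i. f i \<in> carrier (?FA i (m - i))" and g: "\<And>i. g i \<in> carrier (?FB i (m - 1 - i))"
   and fin: "finite J" "\<And>i. i \<notin> J ==> f i = (\<lambda>_. \<zero>\<^bsub>A' (m - i)\<^esub>)" "\<And>i. i \<notin> J ==> g i = (\<lambda>_. \<zero>\<^bsub>A' (m - 1 - i)\<^esub>)"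
  for m f g and J :: "int set"
  unfolding tens_grd
 proof (intro conjI ballI)
  let ?c = "from_parts (\<lambda>i a. inject A' (m - i) (f i a)) (\<lambda>i b. inject A' (m - 1 - i) (g i b))"
  show "?c \<in> carrier (formal_sums (amb ?L) (bas ?P))"
   unfolding graded_cpx_simps
  proof (rule from_parts_closed[OF D, where J = J])
   show "(\<lambda>a. inject A' (m - i) (f i a)) \<in> carrier (formal_sums ?D (carrier (A i)))" for i
    by (rule module_hom_closed[OF pointwise_hom[OF A' D ij] f])
   show "(\<lambda>b. inject A' (m - 1 - i) (g i b)) \<in> carrier (formal_sums ?D (rel_index R (A i)))" for i
    by (rule module_hom_closed[OF pointwise_hom[OF A' D ij] g])
   show "finite J" by fact
   show "(\<lambda>a. inject A' (m - i) (f i a)) = (\<lambda>_. \<zero>\<^bsub>?D\<^esub>) \<and> (\<lambda>b. inject A' (m - 1 - i) (g i b)) = (\<lambda>_. \<zero>\<^bsub>?D\<^esub>)"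
    if "i \<notin> J" for i using fin(2,3)[OF that] inj0 by (simp del: direct_sum_simps)
  qed simp
  fix s assume "s \<in> bas ?P"
  show "?c s \<in> grd ?L (m - dg ?P s)"
  proof (cases s rule: pres_cpx_cases)
   case (gen i a)
   then show ?thesis using inject_grd[where A = A' and n = "m - i", OF cr A' formal_sums_closed[OF f, of i a]] by (simp del: graded_cpx_simps)
  next
   case (rel i b)
   have e: "m - (i + 1) = m - 1 - i" by simp
   show ?thesis unfolding rel from_parts_simps pres_cpx_simps e by (rule inject_grd[where A = A' and n = "m - 1 - i", OF cr A' formal_sums_closed[OF g, of i b]])
  qed
 qed
 define \<Psi> where "\<Psi> c = ((\<lambda>p\<in>?I. k1 (fst p) (snd p) c), (\<lambda>p\<in>?J. k2 (fst p) (snd p) c))" for c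
 let ?Z = "(amb ?T)\<lparr>carrier := cycles ?T n\<rparr>"
 have fin_supp: "finite (fst ` supp ?D c)" if "c \<in> carrier ?F" for c using formal_sums_finite[OF that] by simp
 have off: "u i j c = (\<lambda>_. \<zero>\<^bsub>A' j\<^esub>)" "v i j c = (\<lambda>_. \<zero>\<^bsub>A' j\<^esub>)" if "i \<notin> fst ` supp ?D c" for i j c
 proof -
  have "c (i, x) = \<zero>\<^bsub>?D\<^esub>" for x using that by (force simp: supp_def simp del: direct_sum_simps)
  then show "u i j c = (\<lambda>_. \<zero>\<^bsub>A' j\<^esub>)" "v i j c = (\<lambda>_. \<zero>\<^bsub>A' j\<^esub>)" by (auto simp: u_def v_def)
 qed
 have zFA: "(\<lambda>_. \<zero>\<^bsub>A' j\<^esub>) \<in> carrier (?FA i j)" for i j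
  using submoduleD(2)[OF FA module.carrier_is_submodule[OF FA]] by simp
 have zFB: "(\<lambda>_. \<zero>\<^bsub>A' j\<^esub>) \<in> carrier (?FB i j)" for i j
  using submoduleD(2)[OF FB module.carrier_is_submodule[OF FB]] by simp
 have \<kappa>z: "?\<kappa> i j (\<lambda>_. \<zero>\<^bsub>A' j\<^esub>) = \<zero>\<^bsub>tensor R (A i) (A' j)\<^esub>" for i j using module_hom_zero[OF FA tA \<kappa>] by simp
 have \<rho>z: "?\<rho> i j (\<lambda>_. \<zero>\<^bsub>A' j\<^esub>) = \<zero>\<^bsub>tensor R (?K i) (A' j)\<^esub>" for i j using module_hom_zero[OF FB tK \<rho>] by simp
 have \<Psi>c: "\<Psi> c \<in> carrier (module_sum ?X ?Y)" if c: "c \<in> cycles ?T n" for c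
 proof -
  note cF = cycF[OF c]
  have "{p \<in> ?I. k1 (fst p) (snd p) c \<noteq> \<zero>\<^bsub>tensor R (A (fst p)) (A' (snd p))\<^esub>} \<subseteq> (\<lambda>i. (i, n - i)) ` fst ` supp ?D c"
  proof
   fix p assume p: "p \<in> {p \<in> ?I. k1 (fst p) (snd p) c \<noteq> \<zero>\<^bsub>tensor R (A (fst p)) (A' (snd p))\<^esub>}"
   then have "fst p \<in> fst ` supp ?D c" using off(1)[of "fst p" c "snd p"] \<kappa>z by (auto simp: k1_def)
   moreover have "p = (fst p, n - fst p)" using p by (cases p) auto
   ultimately show "p \<in> (\<lambda>i. (i, n - i)) ` fst ` supp ?D c" by (rule rev_image_eqI)
  qed
  then have f1: "finite {p \<in> ?I. k1 (fst p) (snd p) c \<noteq> \<zero>\<^bsub>tensor R (A (fst p)) (A' (snd p))\<^esub>}"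
   using finite_subset fin_supp[OF cF] by blast
  have "{p \<in> ?J. k2 (fst p) (snd p) c \<noteq> \<zero>\<^bsub>tensor R (?K (fst p)) (A' (snd p))\<^esub>} \<subseteq> (\<lambda>i. (i, n - 1 - i)) ` fst ` supp ?D c"
  proof
   fix p assume p: "p \<in> {p \<in> ?J. k2 (fst p) (snd p) c \<noteq> \<zero>\<^bsub>tensor R (?K (fst p)) (A' (snd p))\<^esub>}"
   then have "fst p \<in> fst ` supp ?D c" using off(2)[of "fst p" c "snd p"] \<rho>z by (auto simp: k2_def)
   moreover have "p = (fst p, n - 1 - fst p)" using p by (cases p) auto
   ultimately show "p \<in> (\<lambda>i. (i, n - 1 - i)) ` fst ` supp ?D c" by (rule rev_image_eqI)
  qed
  then have f2: "finite {p \<in> ?J. k2 (fst p) (snd p) c \<noteq> \<zero>\<^bsub>tensor R (?K (fst p)) (A' (snd p))\<^esub>}"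
   using finite_subset fin_supp[OF cF] by blast
  have c1: "(\<lambda>p\<in>?I. k1 (fst p) (snd p) c) \<in> carrier ?X"
   unfolding direct_sum_simps
  proof (intro conjI ballI)
   show "finite {p \<in> ?I. (\<lambda>p\<in>?I. k1 (fst p) (snd p) c) p \<noteq> \<zero>\<^bsub>case p of (i, j) => tensor R (A i) (A' j)\<^esub>}"
    by (rule finite_subset[OF _ f1], rule subsetI) (simp add: case_prod_beta cong: conj_cong)
  qed (auto simp: module_hom_closed[OF k1 cF])
  have c2: "(\<lambda>p\<in>?J. k2 (fst p) (snd p) c) \<in> carrier ?Y"
   unfolding direct_sum_simps
  proof (intro conjI ballI)
   show "finite {p \<in> ?J. (\<lambda>p\<in>?J. k2 (fst p) (snd p) c) p \<noteq> \<zero>\<^bsub>case p of (i, j) => Tor1 R (A i) (A' j)\<^esub>}"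
    by (rule finite_subset[OF _ f2], rule subsetI) (simp add: case_prod_beta Tor1_simps cong: conj_cong)
  qed (auto simp: Tor[OF c])
  show ?thesis using c1 c2 by (simp add: \<Psi>_def del: direct_sum_simps)
 qed
 have "\<Psi> \<in> module_hom R ?Z (module_sum ?X ?Y)"
 proof (rule module_homI)
  fix c assume "c \<in> carrier ?Z"
  then have c: "c \<in> cycles ?T n" by simp
  show "\<Psi> c \<in> carrier (module_sum ?X ?Y)" by (rule \<Psi>c[OF c])
  show "\<Psi> (r \<odot>\<^bsub>?Z\<^esub> c) = r \<odot>\<^bsub>module_sum ?X ?Y\<^esub> \<Psi> c" if r: "r \<in> carrier R" for r
  proof -
   have "r \<odot>\<^bsub>?Z\<^esub> c = r \<odot>\<^bsub>?F\<^esub> c" by simp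
   then show ?thesis
    by (auto simp: \<Psi>_def module_hom_smult[OF k1 r cycF[OF c]] module_hom_smult[OF k2 r cycF[OF c]] Tor1_simps
      intro!: restrict_ext simp del: formal_sums_simps)
  qed
  show "\<Psi> (c \<oplus>\<^bsub>?Z\<^esub> d) = \<Psi> c \<oplus>\<^bsub>module_sum ?X ?Y\<^esub> \<Psi> d" if "d \<in> carrier ?Z" for d
  proof -
   have d: "d \<in> cycles ?T n" using that by simp
   have "c \<oplus>\<^bsub>?Z\<^esub> d = c \<oplus>\<^bsub>?F\<^esub> d" by simp
   then show ?thesis
    by (auto simp: \<Psi>_def module_hom_add[OF k1 cycF[OF c] cycF[OF d]] module_hom_add[OF k2 cycF[OF c] cycF[OF d]]
      Tor1_simps intro!: restrict_ext simp del: formal_sums_simps)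
  qed
 qed
 moreover have "\<Psi> ` cycles ?T n = carrier (module_sum ?X ?Y)"
 proof
  show "\<Psi> ` cycles ?T n \<subseteq> carrier (module_sum ?X ?Y)" using \<Psi>c by blast
  show "carrier (module_sum ?X ?Y) \<subseteq> \<Psi> ` cycles ?T n"
  proof
   fix x assume x: "x \<in> carrier (module_sum ?X ?Y)"
   obtain f g where fg: "x = (f, g)" by (cases x)
   have f: "f \<in> carrier ?X" and g: "g \<in> carrier ?Y" using x by (simp_all add: fg del: direct_sum_simps)
   have fi: "f (i, n - i) \<in> carrier (tensor R (A i) (A' (n - i)))" for i using f by fastforce
   have gi: "g (i, n - 1 - i) \<in> carrier (Tor1 R (A i) (A' (n - 1 - i)))" for i using g by fastforce
   have "\<exists>w. w \<in> carrier (?FA i (n - i)) \<and> ?\<kappa> i (n - i) w = f (i, n - i) \<and>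
     (f (i, n - i) = \<zero>\<^bsub>tensor R (A i) (A' (n - i))\<^esub> \<longrightarrow> w = (\<lambda>_. \<zero>\<^bsub>A' (n - i)\<^esub>))" for i
   proof (cases "f (i, n - i) = \<zero>\<^bsub>tensor R (A i) (A' (n - i))\<^esub>")
    case True
    then show ?thesis
     using \<kappa>z zFA
     by (intro exI[of _ "\<lambda>_. \<zero>\<^bsub>A' (n - i)\<^esub>"]) simp
   next
    case False
    have "f (i, n - i) \<in> ?\<kappa> i (n - i) ` carrier (?FA i (n - i))"
     unfolding tensor_sum_id_surj[OF R A A'] by (rule fi)
    then show ?thesis using False by (elim imageE) auto
   qed
   then obtain w where w: "\<And>i. w i \<in> carrier (?FA i (n - i))" "\<And>i. ?\<kappa> i (n - i) (w i) = f (i, n - i)"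
     "\<And>i. f (i, n - i) = \<zero>\<^bsub>tensor R (A i) (A' (n - i))\<^esub> ==> w i = (\<lambda>_. \<zero>\<^bsub>A' (n - i)\<^esub>)" by metis
   have "\<exists>w. w \<in> carrier (?FB i (n - 1 - i)) \<and> ?\<rho> i (n - 1 - i) w = g (i, n - 1 - i)" for i
   proof -
    have "g (i, n - 1 - i) \<in> carrier (tensor R (?K i) (A' (n - 1 - i)))"
     using gi[of i] submoduleD(1)[OF tK Tor1_submodule[OF R A A']] by blast
    then have "g (i, n - 1 - i) \<in> ?\<rho> i (n - 1 - i) ` carrier (?FB i (n - 1 - i))"
     unfolding bij_betw_imp_surj_on[OF rel_tensor_bij[OF R A A']] .
    then show ?thesis by (elim imageE) auto
   qed
   then obtain z where z: "\<And>i. z i \<in> carrier (?FB i (n - 1 - i))" "\<And>i. ?\<rho> i (n - 1 - i) (z i) = g (i, n - 1 - i)"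
    by metis
   let ?S = "fst ` {p \<in> ?I. f p \<noteq> \<zero>\<^bsub>case p of (i, j) => tensor R (A i) (A' j)\<^esub>} \<union>
     fst ` {p \<in> ?J. g p \<noteq> \<zero>\<^bsub>case p of (i, j) => Tor1 R (A i) (A' j)\<^esub>}"
   have S: "finite ?S" using f g by simp
   have w0: "w i = (\<lambda>_. \<zero>\<^bsub>A' (n - i)\<^esub>)" if "i \<notin> ?S" for i
    using that w(3)[of i] by (force simp: image_iff)
   have z0: "z i = (\<lambda>_. \<zero>\<^bsub>A' (n - 1 - i)\<^esub>)" if "i \<notin> ?S" for i
   proof (rule \<rho>0[OF z(1)])
    have "g (i, n - 1 - i) = \<zero>\<^bsub>Tor1 R (A i) (A' (n - 1 - i))\<^esub>" using that by (force simp: image_iff)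
    then show "?\<rho> i (n - 1 - i) (z i) = \<zero>\<^bsub>tensor R (?K i) (A' (n - 1 - i))\<^esub>" by (simp add: z(2) Tor1_simps)
   qed
   define c where "c = from_parts (\<lambda>i a. inject A' (n - i) (w i a)) (\<lambda>i b. inject A' (n - 1 - i) (z i b))"
   have cg: "c \<in> grd ?T n" unfolding c_def by (rule from_parts_grd[OF w(1) z(1) S w0 z0])
   then have cF: "c \<in> carrier ?F" by (simp add: tens_grd)
   have uc: "u i (n - i) c = w i" and vc: "v i (n - 1 - i) c = z i" for i
    by (auto simp: u_def v_def c_def inject_def)
   have "dif ?T c = \<zero>\<^bsub>?F\<^esub>"
   proof
    fix s show "dif ?T c s = \<zero>\<^bsub>?F\<^esub> s"
    proof (cases s rule: pres_cpx_cases)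
     case (gen i a)
     have "rel_map R (A i) (A' (n - 1 - i)) (z i) = (\<lambda>_. \<zero>\<^bsub>A' (n - 1 - i)\<^esub>)"
      using rel_tensor_in_Tor1[OF R A A' z(1)] z(2) gi by simp
     moreover have "rel_map R (A i) ?D (\<lambda>b. inject A' (n - 1 - i) (z i b)) =
       (\<lambda>a. inject A' (n - 1 - i) (rel_map R (A i) (A' (n - 1 - i)) (z i) a))"
      by (rule rel_map_natural[OF R A A' D ij z(1)])
     ultimately have "rel_map R (A i) ?D (\<lambda>b. c (i, Inr b)) = (\<lambda>_. \<zero>\<^bsub>?D\<^esub>)"
      using inj0 by (simp add: c_def del: direct_sum_simps)
     then show ?thesis using fun_cong[OF gd[OF cF], of i a] by (simp add: gen del: direct_sum_simps)
    next
     case (rel i b)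
     show ?thesis using rd[OF cF] by (simp add: rel del: direct_sum_simps)
    qed
   qed
   then have cyc: "c \<in> cycles ?T n" using cg unfolding cycles_def amb by blast
   have "\<Psi> c = x"
   proof -
    have "(\<lambda>p\<in>?I. k1 (fst p) (snd p) c) = f"
    proof (rule extensionalityI[of _ ?I])
     show "(\<lambda>p\<in>?I. k1 (fst p) (snd p) c) p = f p" if p: "p \<in> ?I" for p
     proof -
      have "snd p = n - fst p" "p = (fst p, n - fst p)" using p by (cases p; auto)+
      then show ?thesis using p uc w(2)[of "fst p"] by (simp add: k1_def)
     qed
    qed (use f in auto)
    moreover have "(\<lambda>p\<in>?J. k2 (fst p) (snd p) c) = g"
    proof (rule extensionalityI[of _ ?J])
     show "(\<lambda>p\<in>?J. k2 (fst p) (snd p) c) p = g p" if p: "p \<in> ?J" for p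
     proof -
      have "snd p = n - 1 - fst p" "p = (fst p, n - 1 - fst p)" using p by (cases p; auto)+
      then show ?thesis using p vc z(2)[of "fst p"] by (simp add: k2_def)
     qed
    qed (use g in auto)
    ultimately show ?thesis by (simp add: \<Psi>_def fg)
   qed
   then show "x \<in> \<Psi> ` cycles ?T n" using cyc by blast
  qed
 qed
 moreover have "\<Psi> c = \<zero>\<^bsub>module_sum ?X ?Y\<^esub> \<longleftrightarrow> c \<in> boundaries ?T n" if c: "c \<in> cycles ?T n" for c
 proof
  note cF = cycF[OF c]
  have cg: "c \<in> grd ?T n" using c by (simp add: cycles_def)
  assume "\<Psi> c = \<zero>\<^bsub>module_sum ?X ?Y\<^esub>"
  then have e: "(\<lambda>p\<in>?I. k1 (fst p) (snd p) c) = \<zero>\<^bsub>?X\<^esub>" "(\<lambda>p\<in>?J. k2 (fst p) (snd p) c) = \<zero>\<^bsub>?Y\<^esub>"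
   by (simp_all add: \<Psi>_def)
  have k1z: "k1 i (n - i) c = \<zero>\<^bsub>tensor R (A i) (A' (n - i))\<^esub>" for i
   using fun_cong[OF e(1), of "(i, n - i)"] by simp
  have k2z: "k2 i (n - 1 - i) c = \<zero>\<^bsub>tensor R (?K i) (A' (n - 1 - i))\<^esub>" for i
   using fun_cong[OF e(2), of "(i, n - 1 - i)"] by (simp add: Tor1_simps)
  have vz: "v i (n - 1 - i) c = (\<lambda>_. \<zero>\<^bsub>A' (n - 1 - i)\<^esub>)" for i
   using \<rho>0[OF module_hom_closed[OF v cF]] k2z[of i] by (simp add: k2_def)
  have "\<exists>w. w \<in> carrier (?FB i (n - i)) \<and> rel_map R (A i) (A' (n - i)) w = u i (n - i) c \<and>
     (i \<notin> fst ` supp ?D c \<longrightarrow> w = (\<lambda>_. \<zero>\<^bsub>A' (n - i)\<^esub>))" for i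
  proof (cases "i \<in> fst ` supp ?D c")
   case True
   have "u i (n - i) c \<in> rel_map R (A i) (A' (n - i)) ` carrier (?FB i (n - i))"
    using k1z[of i] tensor_sum_id_kernel[OF R A A' module_hom_closed[OF u cF]] by (simp add: k1_def)
   then show ?thesis using True by (elim imageE) auto
  next
   case False
   then show ?thesis
    using off(1)[OF False] module_hom_zero[OF FB FA rel_map_hom[OF R A A'], of i "n - i"] zFB
    by (intro exI[of _ "\<lambda>_. \<zero>\<^bsub>A' (n - i)\<^esub>"]) simp
  qed
  then obtain w where w: "\<And>i. w i \<in> carrier (?FB i (n - i))" "\<And>i. rel_map R (A i) (A' (n - i)) (w i) = u i (n - i) c"
    "\<And>i. i \<notin> fst ` supp ?D c ==> w i = (\<lambda>_. \<zero>\<^bsub>A' (n - i)\<^esub>)" by metis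
  define y where "y = from_parts (\<lambda>i a. inject A' (n + 1 - i) \<zero>\<^bsub>A' (n + 1 - i)\<^esub>) (\<lambda>i b. inject A' (n + 1 - 1 - i) (w i b))"
  have yg: "y \<in> grd ?T (n + 1)"
   unfolding y_def
  proof (rule from_parts_grd[OF _ _ fin_supp[OF cF]])
   show "(\<lambda>_. \<zero>\<^bsub>A' (n + 1 - i)\<^esub>) \<in> carrier (?FA i (n + 1 - i))" for i
    by (rule zFA)
  qed (use w(1,3) in simp_all)
  then have yF: "y \<in> carrier ?F" by (simp add: tens_grd)
  have "dif ?T y = c"
  proof
   fix s show "dif ?T y s = c s"
   proof (cases s rule: pres_cpx_cases)
    case (gen i a)
    have "dif ?T y s = rel_map R (A i) ?D (\<lambda>b. inject A' (n - i) (w i b)) a"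
     using fun_cong[OF gd[OF yF], of i a] by (simp add: gen y_def)
    also have "\<dots> = inject A' (n - i) (u i (n - i) c a)"
     using rel_map_natural[OF R A A' D ij w(1)] w(2) by simp
    also have "\<dots> = c s" using comp[OF cg, of s] by (simp add: u_def gen)
    finally show ?thesis .
   next
    case (rel i b)
    have e: "n - (i + 1) = n - 1 - i" by simp
    have "c s = inject A' (n - 1 - i) (v i (n - 1 - i) c b)" using comp[OF cg, of s] unfolding rel pres_cpx_simps e v_def .
    then show ?thesis using vz[of i] inj0 rd[OF yF] by (simp add: rel del: direct_sum_simps)
   qed
  qed
  then show "c \<in> boundaries ?T n" using yg unfolding boundaries_def by blast
 next
  assume "c \<in> boundaries ?T n"
  then obtain y where y: "y \<in> grd ?T (n + 1)" "c = dif ?T y" unfolding boundaries_def by blast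
  have yF: "y \<in> carrier ?F" using y by (simp add: tens_grd)
  have "k1 i j c = \<zero>\<^bsub>tensor R (A i) (A' j)\<^esub>" for i j
   unfolding k1_def y(2) u_dif[OF yF]
   using tensor_sum_id_kernel[OF R A A' module_hom_closed[OF rel_map_hom[OF R A A'] module_hom_closed[OF v yF]]]
    module_hom_closed[OF v yF] by blast
  moreover have "k2 i j c = \<zero>\<^bsub>tensor R (?K i) (A' j)\<^esub>" for i j
   unfolding k2_def y(2) v_dif[OF yF] by (rule \<rho>z)
  ultimately show "\<Psi> c = \<zero>\<^bsub>module_sum ?X ?Y\<^esub>"
   by (auto simp: \<Psi>_def Tor1_simps intro!: restrict_ext)
 qed
 ultimately show ?thesis unfolding has_homology_def by blast
qed

section \<open>Ordered simplicial chains\<close>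

lemma module_neg_zero:
 assumes M: "module R M" shows "\<ominus>\<^bsub>M\<^esub> \<zero>\<^bsub>M\<^esub> = \<zero>\<^bsub>M\<^esub>"
proof -
 interpret M: module R M by fact
 show ?thesis using module_neg_eq_smult[OF M M.zero_closed] by simp
qed

text \<open>
  The coefficient of \<open>k\<close> in the boundary of the ordered simplex \<open>l\<close>, computed from the recursion
  \<open>d(v l) = l - v (dl)\<close>. Unlike the alternating sum over faces it lends itself to induction on \<open>l\<close>, also
  when faces coincide because of repeated vertices.
\<close>

primrec face_coeff :: "'r ring => 'v list => 'v list => 'r" where
 "face_coeff R [] = (\<lambda>k. \<zero>\<^bsub>R\<^esub>)"
| "face_coeff R (v # l) = (\<lambda>k. (if k = l then \<one>\<^bsub>R\<^esub> else \<zero>\<^bsub>R\<^esub>) \<ominus>\<^bsub>R\<^esub>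
   (case k of [] => \<zero>\<^bsub>R\<^esub> | w # k' => if w = v then face_coeff R l k' else \<zero>\<^bsub>R\<^esub>))"

lemma face_coeff_closed:
 assumes "cring R" shows "face_coeff R l k \<in> carrier R"
proof -
 interpret cring R by fact
 show ?thesis by (induction l arbitrary: k) (auto split: list.splits)
qed

lemma face_coeff_nonzero:
 assumes "cring R" and "face_coeff R l k \<noteq> \<zero>\<^bsub>R\<^esub>"
 shows "length l = Suc (length k)" "set k \<subseteq> set l"
proof -
 interpret cring R by fact
 have "length l = Suc (length k) \<and> set k \<subseteq> set l" using assms(2)
 proof (induction l arbitrary: k)
  case (Cons v l)
  show ?case
  proof (cases "k = l")
   case False
   have "(case k of [] => \<zero>\<^bsub>R\<^esub> | w # k' => if w = v then face_coeff R l k' else \<zero>\<^bsub>R\<^esub>) \<noteq> \<zero>\<^bsub>R\<^esub>"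
    using Cons.prems False by (intro notI) (simp add: a_minus_def)
   then obtain k' where k: "k = v # k'" "face_coeff R l k' \<noteq> \<zero>\<^bsub>R\<^esub>"
    by (auto split: list.splits if_splits)
   then show ?thesis using Cons.IH[OF k(2)] by auto
  qed auto
 qed simp
 then show "length l = Suc (length k)" "set k \<subseteq> set l" by auto
qed

lemma finite_face_coeff:
 assumes "cring R" shows "finite {k. face_coeff R l k \<noteq> \<zero>\<^bsub>R\<^esub>}"
proof (rule finite_subset)
 show "{k. face_coeff R l k \<noteq> \<zero>\<^bsub>R\<^esub>} \<subseteq> {k. set k \<subseteq> set l \<and> length k \<le> length l}"
  using face_coeff_nonzero[OF assms, of l] by force
 show "finite {k. set k \<subseteq> set l \<and> length k \<le> length l}" by (rule finite_lists_length_le) simp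
qed

lemma face_sum:
 assumes G: "module R G" and x: "x \<in> carrier G"
 shows "(\<Oplus>\<^bsub>G\<^esub> i\<in>{..<length l}. if face i l = k then (if even i then x else \<ominus>\<^bsub>G\<^esub> x) else \<zero>\<^bsub>G\<^esub>) =
  face_coeff R l k \<odot>\<^bsub>G\<^esub> x"
 using x
proof (induction l arbitrary: k x)
 case Nil
 interpret G: module R G by fact
 show ?case using Nil by simp
next
 case (Cons v l)
 interpret G: module R G by fact
 note fc = face_coeff_closed[OF G.R.is_cring]
 let ?f = "\<lambda>i. if face i (v # l) = k then (if even i then x else \<ominus>\<^bsub>G\<^esub> x) else \<zero>\<^bsub>G\<^esub>"
 let ?c = "case k of [] => \<zero>\<^bsub>R\<^esub> | w # k' => if w = v then face_coeff R l k' else \<zero>\<^bsub>R\<^esub>"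
 have c: "?c \<in> carrier R" using fc by (auto split: list.splits)
 have "{..<length (v # l)} = insert 0 (Suc ` {..<length l})" by (simp add: lessThan_Suc_eq_insert_0)
 then have "(\<Oplus>\<^bsub>G\<^esub> i\<in>{..<length (v # l)}. ?f i) = ?f 0 \<oplus>\<^bsub>G\<^esub> (\<Oplus>\<^bsub>G\<^esub> i\<in>Suc ` {..<length l}. ?f i)"
  using Cons.prems by (simp add: G.finsum_insert)
 also have "(\<Oplus>\<^bsub>G\<^esub> i\<in>Suc ` {..<length l}. ?f i) = (\<Oplus>\<^bsub>G\<^esub> i\<in>{..<length l}. ?f (Suc i))"
  using Cons.prems by (intro G.finsum_reindex) auto
 also have "\<dots> = ?c \<odot>\<^bsub>G\<^esub> (\<ominus>\<^bsub>G\<^esub> x)"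
 proof (cases k)
  case Nil
  then show ?thesis using Cons.prems by (simp add: face_def)
 next
  case k: (Cons w k')
  show ?thesis
  proof (cases "w = v")
   case True
   have "(\<Oplus>\<^bsub>G\<^esub> i\<in>{..<length l}. ?f (Suc i)) =
    (\<Oplus>\<^bsub>G\<^esub> i\<in>{..<length l}. if face i l = k' then (if even i then \<ominus>\<^bsub>G\<^esub> x else \<ominus>\<^bsub>G\<^esub> (\<ominus>\<^bsub>G\<^esub> x)) else \<zero>\<^bsub>G\<^esub>)"
    using Cons.prems k True by (intro G.finsum_cong') (auto simp: face_def G.minus_minus)
   then show ?thesis using Cons.IH[of "\<ominus>\<^bsub>G\<^esub> x" k'] Cons.prems k True by simp
  next
   case False
   then show ?thesis using Cons.prems k by (simp add: face_def)
  qed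
 qed
 finally have "(\<Oplus>\<^bsub>G\<^esub> i\<in>{..<length (v # l)}. ?f i) = ?f 0 \<oplus>\<^bsub>G\<^esub> ?c \<odot>\<^bsub>G\<^esub> (\<ominus>\<^bsub>G\<^esub> x)" .
 moreover have "face_coeff R (v # l) k \<odot>\<^bsub>G\<^esub> x = (if k = l then x else \<zero>\<^bsub>G\<^esub>) \<oplus>\<^bsub>G\<^esub> ?c \<odot>\<^bsub>G\<^esub> (\<ominus>\<^bsub>G\<^esub> x)"
  using Cons.prems c by (simp add: a_minus_def G.smult_l_distr G.smult_l_minus G.smult_r_minus del: list.case)
 moreover have "?f 0 = (if k = l then x else \<zero>\<^bsub>G\<^esub>)" by (auto simp: face_def)
 ultimately show ?case by simp
qed

lemma boundary_apply:
 assumes G: "module R G" and c: "c \<in> carrier (formal_sums G S)" and A: "finite A" "supp G c \<subseteq> A"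
 shows "boundary G c k = (\<Oplus>\<^bsub>G\<^esub> l\<in>A. face_coeff R l k \<odot>\<^bsub>G\<^esub> c l)"
proof -
 interpret G: module R G by fact
 note fc = face_coeff_closed[OF G.R.is_cring]
 have cl: "c l \<in> carrier G" for l using formal_sums_closed[OF c] .
 have "boundary G c k = (\<Oplus>\<^bsub>G\<^esub> l\<in>supp G c. face_coeff R l k \<odot>\<^bsub>G\<^esub> c l)"
  unfolding boundary_def by (simp add: face_sum[OF G cl])
 also have "\<dots> = (\<Oplus>\<^bsub>G\<^esub> l\<in>A. face_coeff R l k \<odot>\<^bsub>G\<^esub> c l)"
  by (rule G.add.finprod_mono_neutral_cong_left[OF A]) (use cl in \<open>auto simp: fc supp_def\<close>)
 finally show ?thesis .
qed

definition prepend :: "('r, 'm) module => 'v => ('v list => 'm) => 'v list => 'm" where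
 "prepend M v c = (\<lambda>k. case k of [] => \<zero>\<^bsub>M\<^esub> | w # k' => if w = v then c k' else \<zero>\<^bsub>M\<^esub>)"

lemma prepend_simps [simp]:
 "prepend M v c [] = \<zero>\<^bsub>M\<^esub>" "prepend M v c (w # k) = (if w = v then c k else \<zero>\<^bsub>M\<^esub>)"
 by (simp_all add: prepend_def)

lemma prepend_hom:
 fixes R :: "'r ring"
 assumes M: "module R M"
 shows "prepend M v \<in> module_hom R (formal_sums M UNIV) (formal_sums M UNIV)"
  "prepend M v (single M l x) = single M (v # l) x"
proof -
 have "prepend M v c t = \<zero>\<^bsub>M\<^esub>" if "t \<notin> range ((#) v)" for c t
  using that by (cases t) auto
 from extension_by_zero_hom[OF M, of UNIV "(#) v" UNIV "prepend M v", OF _ _ _ this]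
 show "prepend M v \<in> module_hom R (formal_sums M UNIV) (formal_sums M UNIV)"
  "prepend M v (single M l x) = single M (v # l) x"
  by auto
qed

definition down_closed :: "'v set set => bool" where
 "down_closed \<Gamma> \<longleftrightarrow> (\<forall>\<sigma>\<in>\<Gamma>. \<forall>\<tau>. \<tau> \<subseteq> \<sigma> \<longrightarrow> \<tau> \<in> \<Gamma>)"

text \<open>
  The free complex of the relative ordered chains, with the simplices of \<open>\<Gamma>\<close> outside \<open>\<Delta>\<close> as basis.
  Incidence coefficients with a simplex of \<open>\<Delta>\<close> are dropped.
\<close>

definition simplex_cpx :: "'r ring => 'v set set => 'v set set => ('r, 'v list) based_cpx" where
 "simplex_cpx R \<Gamma> \<Delta> =
   \<lparr>bas = {l. set l \<in> \<Gamma> - \<Delta>}, dg = (\<lambda>l. int (length l) - 1), rk = length,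
   inc = (\<lambda>k l. if set k \<in> \<Gamma> - \<Delta> \<and> set l \<in> \<Gamma> - \<Delta> then face_coeff R l k else \<zero>\<^bsub>R\<^esub>)\<rparr>"

lemma simplex_cpx_simps [simp]:
 "l \<in> bas (simplex_cpx R \<Gamma> \<Delta>) \<longleftrightarrow> set l \<in> \<Gamma> \<and> set l \<notin> \<Delta>"
 "dg (simplex_cpx R \<Gamma> \<Delta>) l = int (length l) - 1" "rk (simplex_cpx R \<Gamma> \<Delta>) l = length l"
 "inc (simplex_cpx R \<Gamma> \<Delta>) k l =
   (if set k \<in> \<Gamma> - \<Delta> \<and> set l \<in> \<Gamma> - \<Delta> then face_coeff R l k else \<zero>\<^bsub>R\<^esub>)"
 by (auto simp: simplex_cpx_def)

lemma boundary_hom: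
 fixes R :: "'r ring" and l :: "'v list"
 assumes G: "module R G"
 shows "boundary G \<in> module_hom R (formal_sums G (UNIV :: 'v list set)) (formal_sums G UNIV)"
  and "x \<in> carrier G ==> boundary G (single G l x) = (\<lambda>k. face_coeff R l k \<odot>\<^bsub>G\<^esub> x)"
proof -
 interpret G: module R G by fact
 note fc = face_coeff_closed[OF G.R.is_cring]
 let ?F = "formal_sums G (UNIV :: 'v list set)" and ?\<phi> = "\<lambda>l x k. face_coeff R l k \<odot>\<^bsub>G\<^esub> x"
 have FG: "module R ?F" by (rule formal_sums_module[OF G])
 have \<phi>: "?\<phi> l \<in> module_hom R G ?F" for l :: "'v list"
 proof (rule module_homI)
  show "?\<phi> l x \<in> carrier ?F" if "x \<in> carrier G" for x
   by (rule formal_sumsI[OF _ finite_face_coeff[OF G.R.is_cring, of l]]) (use that in \<open>auto simp: fc\<close>)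
 qed (auto simp: fc G.smult_r_distr G.smult_assoc1[symmetric] G.R.m_comm)
 have e: "boundary G c = lin G ?F ?\<phi> c" if c: "c \<in> carrier ?F" for c
 proof
  fix k
  have A: "finite (supp G c)" using formal_sums_finite[OF c] .
  have "lin G ?F ?\<phi> c k = (\<Oplus>\<^bsub>G\<^esub> l\<in>supp G c. ?\<phi> l (c l) k)"
   unfolding lin_def by (rule finsum_apply[OF G A]) (use module_hom_closed[OF \<phi> formal_sums_closed[OF c]] in auto)
  then show "boundary G c k = lin G ?F ?\<phi> c k" using boundary_apply[OF G c A order_refl] by simp
 qed
 note h = lin_hom[OF G FG \<phi>, where S = UNIV]
 interpret FG: module R ?F by (rule FG)
 show "boundary G \<in> module_hom R ?F ?F"
 proof (rule module_homI)
  fix c assume c: "c \<in> carrier ?F"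
  show "boundary G c \<in> carrier ?F" unfolding e[OF c] by (rule module_hom_closed[OF h c])
  show "boundary G (r \<odot>\<^bsub>?F\<^esub> c) = r \<odot>\<^bsub>?F\<^esub> boundary G c" if r: "r \<in> carrier R" for r
   unfolding e[OF c] e[OF FG.smult_closed[OF r c]] by (rule module_hom_smult[OF h r c])
  show "boundary G (c \<oplus>\<^bsub>?F\<^esub> d) = boundary G c \<oplus>\<^bsub>?F\<^esub> boundary G d" if d: "d \<in> carrier ?F" for d
   unfolding e[OF c] e[OF d] e[OF FG.a_closed[OF c d]] by (rule module_hom_add[OF h c d])
 qed
 show "boundary G (single G l x) = ?\<phi> l x" if "x \<in> carrier G"
  unfolding e[OF single_closed[OF G UNIV_I that]] by (rule lin_single[OF G FG \<phi> UNIV_I that])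
qed

lemma boundary_prepend_single:
 fixes R :: "'r ring"
 assumes G: "module R G" and x: "x \<in> carrier G"
 shows "boundary G (single G (v # l) x) = single G l x \<ominus>\<^bsub>formal_sums G UNIV\<^esub> prepend G v (boundary G (single G l x))"
proof
 fix k
 interpret G: module R G by fact
 note fc = face_coeff_closed[OF G.R.is_cring]
 have "(single G l x \<ominus>\<^bsub>formal_sums G UNIV\<^esub> prepend G v (boundary G (single G l x))) k =
   single G l x k \<ominus>\<^bsub>G\<^esub> prepend G v (boundary G (single G l x)) k"
  by (rule formal_sums_minus_apply[OF G single_closed[OF G UNIV_I x]
    module_hom_closed[OF prepend_hom(1)[OF G] module_hom_closed[OF boundary_hom(1)[OF G] single_closed[OF G UNIV_I x]]]])
 then show "boundary G (single G (v # l) x) k = (single G l x \<ominus>\<^bsub>formal_sums G UNIV\<^esub> prepend G v (boundary G (single G l x))) k"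
  unfolding boundary_hom(2)[OF G x] using x by (cases k) (auto simp: fc single_def module_neg_zero[OF G] a_minus_def G.smult_l_distr G.smult_l_minus)
qed

text \<open>
  By induction on a simplex \<open>v l\<close>: from \<open>d(v c) = c - v (dc)\<close> follows \<open>d(d(v l)) = dl - (dl - v (d(dl)))\<close>.
\<close>

lemma boundary_boundary:
 fixes R :: "'r ring"
 assumes G: "module R G" and c: "c \<in> carrier (formal_sums G UNIV)"
 shows "boundary G (boundary G c) = (\<lambda>_. \<zero>\<^bsub>G\<^esub>)"
proof -
 let ?F = "formal_sums G (UNIV :: 'b list set)"
 have F: "module R ?F" by (rule formal_sums_module[OF G])
 interpret G: module R G by fact
 interpret F: module R ?F by (rule F)
 note b = boundary_hom(1)[OF G] and p = prepend_hom[OF G]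
 have prep: "boundary G (prepend G v c) = c \<ominus>\<^bsub>?F\<^esub> prepend G v (boundary G c)" if c: "c \<in> carrier ?F" for v c
 proof (rule formal_sums_hom_eqI[OF G F module_hom_comp[OF p(1) b] _ _ c])
  show "(\<lambda>c. c \<ominus>\<^bsub>?F\<^esub> prepend G v (boundary G c)) \<in> module_hom R ?F ?F"
  proof (rule module_homI)
   note pb = module_hom_comp[OF b p(1)[of v]]
   note cl = module_hom_closed[OF pb]
   fix c assume c: "c \<in> carrier ?F"
   show "c \<ominus>\<^bsub>?F\<^esub> prepend G v (boundary G c) \<in> carrier ?F" by (rule F.minus_closed[OF c cl[OF c]])
   show "(r \<odot>\<^bsub>?F\<^esub> c) \<ominus>\<^bsub>?F\<^esub> prepend G v (boundary G (r \<odot>\<^bsub>?F\<^esub> c)) = r \<odot>\<^bsub>?F\<^esub> (c \<ominus>\<^bsub>?F\<^esub> prepend G v (boundary G c))"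
    if r: "r \<in> carrier R" for r
    unfolding module_hom_smult[OF pb r c] using c cl[OF c] r
    by (simp add: a_minus_def F.smult_r_distr F.smult_r_minus del: formal_sums_simps)
   show "(c \<oplus>\<^bsub>?F\<^esub> d) \<ominus>\<^bsub>?F\<^esub> prepend G v (boundary G (c \<oplus>\<^bsub>?F\<^esub> d)) =
    (c \<ominus>\<^bsub>?F\<^esub> prepend G v (boundary G c)) \<oplus>\<^bsub>?F\<^esub> (d \<ominus>\<^bsub>?F\<^esub> prepend G v (boundary G d))" if d: "d \<in> carrier ?F" for d
    unfolding module_hom_add[OF pb c d] using c d cl[OF c] cl[OF d]
    by (simp add: a_minus_def F.minus_add F.a_ac del: formal_sums_simps)
  qed
  show "boundary G (prepend G v (single G l x)) = single G l x \<ominus>\<^bsub>?F\<^esub> prepend G v (boundary G (single G l x))"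
   if "x \<in> carrier G" for l x
   unfolding p(2) by (rule boundary_prepend_single[OF G that])
 qed
 have z: "(\<lambda>_. \<zero>\<^bsub>?F\<^esub>) \<in> module_hom R ?F ?F"
  by (rule module_homI) (auto simp del: formal_sums_simps)
 have "boundary G (boundary G c) = \<zero>\<^bsub>?F\<^esub>"
 proof (rule formal_sums_hom_eqI[OF G F module_hom_comp[OF b b] z _ c])
  fix l :: "'b list" and x assume x: "x \<in> carrier G"
  show "boundary G (boundary G (single G l x)) = \<zero>\<^bsub>?F\<^esub>"
  proof (induction l)
   case Nil
   have "boundary G (single G [] x) = \<zero>\<^bsub>?F\<^esub>" using x by (simp add: boundary_hom(2)[OF G x])
   then show ?case using module_hom_zero[OF F F b] by simp
  next
   case (Cons v l)
   let ?s = "single G l x"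
   have s: "?s \<in> carrier ?F" by (rule single_closed[OF G UNIV_I x])
   note bs = module_hom_closed[OF b s]
   have "boundary G (boundary G (single G (v # l) x)) = boundary G (?s \<ominus>\<^bsub>?F\<^esub> prepend G v (boundary G ?s))"
    by (simp only: boundary_prepend_single[OF G x])
   also have "\<dots> = boundary G ?s \<ominus>\<^bsub>?F\<^esub> (boundary G ?s \<ominus>\<^bsub>?F\<^esub> prepend G v (boundary G (boundary G ?s)))"
    unfolding module_hom_minus[OF F F b s module_hom_closed[OF p(1) bs]] prep[OF bs] ..
   also have "\<dots> = \<zero>\<^bsub>?F\<^esub>"
    unfolding Cons.IH module_hom_zero[OF F F p(1)] using bs
    by (simp add: a_minus_def F.r_neg module_neg_zero[OF F] del: formal_sums_simps)
   finally show ?case .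
  qed
 qed
 then show ?thesis by simp
qed

lemma simplex_cpx_based:
 assumes R: "cring R" and \<Gamma>: "down_closed \<Gamma>" and \<Delta>: "down_closed \<Delta>"
 shows "based_cpx R (simplex_cpx R \<Gamma> \<Delta>)"
proof -
 interpret R: cring R by fact
 let ?S = "simplex_cpx R \<Gamma> \<Delta>" and ?R = "ring_module R"
 note fc = face_coeff_closed[OF R] and nz = face_coeff_nonzero[OF R]
 note Rm = ring_module_module[OF R]
 show ?thesis
  unfolding based_cpx_def
 proof (intro conjI allI ballI impI R)
  fix s t show "inc ?S t s \<in> carrier R" by (simp add: fc)
 next
  fix s show "finite {t. inc ?S t s \<noteq> \<zero>\<^bsub>R\<^esub>}"
   by (rule finite_subset[OF _ finite_face_coeff[OF R, of s]]) auto
 next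
  fix s t assume "inc ?S t s \<noteq> \<zero>\<^bsub>R\<^esub>"
  then have "set s \<in> \<Gamma> - \<Delta>" "set t \<in> \<Gamma> - \<Delta>" "face_coeff R s t \<noteq> \<zero>\<^bsub>R\<^esub>" by (auto split: if_splits)
  then show "s \<in> bas ?S" "t \<in> bas ?S" "dg ?S t = dg ?S s - 1" "rk ?S t < rk ?S s" using nz(1)[of s t] by auto
 next
  fix s u assume s: "s \<in> bas ?S"
  let ?A = "{t. face_coeff R s t \<noteq> \<zero>\<^bsub>R\<^esub>}"
  have A: "finite ?A" by (rule finite_face_coeff[OF R])
  show "(\<Oplus>\<^bsub>R\<^esub> t\<in>{t. inc ?S t s \<noteq> \<zero>\<^bsub>R\<^esub>}. inc ?S u t \<otimes>\<^bsub>R\<^esub> inc ?S t s) = \<zero>\<^bsub>R\<^esub>"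
  proof (cases "set u \<in> \<Gamma> - \<Delta>")
   case False
   then show ?thesis by (intro R.add.finprod_one_eqI) (auto simp: fc)
  next
   case True
   have "(\<Oplus>\<^bsub>R\<^esub> t\<in>{t. inc ?S t s \<noteq> \<zero>\<^bsub>R\<^esub>}. inc ?S u t \<otimes>\<^bsub>R\<^esub> inc ?S t s) =
     (\<Oplus>\<^bsub>R\<^esub> t\<in>?A. face_coeff R t u \<otimes>\<^bsub>R\<^esub> face_coeff R s t)"
   proof (rule R.add.finprod_mono_neutral_cong_left[OF A])
    fix t assume t: "t \<in> ?A - {t. inc ?S t s \<noteq> \<zero>\<^bsub>R\<^esub>}"
    then have "set t \<notin> \<Gamma> - \<Delta>" using s by (auto split: if_splits)
    moreover have "set t \<in> \<Gamma>" using nz(2)[of s t] t s \<Gamma> by (auto simp: down_closed_def)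
    ultimately have "set t \<in> \<Delta>" by blast
    have "face_coeff R t u = \<zero>\<^bsub>R\<^esub>"
    proof (rule ccontr)
     assume "face_coeff R t u \<noteq> \<zero>\<^bsub>R\<^esub>"
     then have "set u \<in> \<Delta>" using nz(2)[of t u] \<open>set t \<in> \<Delta>\<close> \<Delta> by (auto simp: down_closed_def)
     then show False using True by simp
    qed
    then show "face_coeff R t u \<otimes>\<^bsub>R\<^esub> face_coeff R s t = \<zero>\<^bsub>R\<^esub>" by (simp add: fc)
   qed (use True s in \<open>auto simp: fc split: if_splits\<close>)
   also have "\<dots> = (\<Oplus>\<^bsub>?R\<^esub> t\<in>?A. face_coeff R t u \<odot>\<^bsub>?R\<^esub> face_coeff R s t)"
    by (simp add: ring_module_finsum)
   also have "\<dots> = boundary ?R (boundary ?R (single ?R s \<one>\<^bsub>R\<^esub>)) u"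
   proof -
    have e: "boundary ?R (single ?R s \<one>\<^bsub>R\<^esub>) = face_coeff R s"
     using boundary_hom(2)[OF Rm, of "\<one>\<^bsub>R\<^esub>" s] by (simp add: fc)
    have "face_coeff R s \<in> carrier (formal_sums ?R UNIV)"
     by (rule formal_sumsI[OF _ A]) (auto simp: fc)
    from boundary_apply[OF Rm this A] show ?thesis unfolding e by (simp add: supp_def)
   qed
   also have "\<dots> = \<zero>\<^bsub>R\<^esub>"
    using boundary_boundary[OF Rm single_closed[OF Rm UNIV_I, of "\<one>\<^bsub>R\<^esub>" s]] by simp
   finally show ?thesis .
  qed
 qed
qed

lemma chains_mem: "c \<in> carrier (chains G \<Sigma> q) \<longleftrightarrow>
  c \<in> carrier (formal_sums G UNIV) \<and> (\<forall>l. c l \<noteq> \<zero>\<^bsub>G\<^esub> \<longrightarrow> set l \<in> \<Sigma> \<and> int (length l) = q + 1)"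
 by (auto simp: chains_def formal_sums_carrier ordered_simplices_def supp_def)

lemma chains_ops [simp]:
 "\<zero>\<^bsub>chains G \<Sigma> q\<^esub> = (\<lambda>_. \<zero>\<^bsub>G\<^esub>)"
 "c \<oplus>\<^bsub>chains G \<Sigma> q\<^esub> d = (\<lambda>s. c s \<oplus>\<^bsub>G\<^esub> d s)"
 "r \<odot>\<^bsub>chains G \<Sigma> q\<^esub> c = (\<lambda>s. r \<odot>\<^bsub>G\<^esub> c s)"
 by (simp_all add: chains_def)

lemma chains_module: "module R G ==> module R (chains G \<Sigma> q)"
 unfolding chains_def by (rule formal_sums_module)

lemma boundary_chains:
 fixes R :: "'r ring"
 assumes G: "module R G" and \<Sigma>: "down_closed \<Sigma>" and c: "c \<in> carrier (chains G \<Sigma> q)"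
 shows "boundary G c \<in> carrier (chains G \<Sigma> (q - 1))"
 unfolding chains_mem
proof (intro conjI allI impI)
 interpret G: module R G by fact
 have cF: "c \<in> carrier (formal_sums G UNIV)" using c by (simp add: chains_mem)
 show "boundary G c \<in> carrier (formal_sums G UNIV)" by (rule module_hom_closed[OF boundary_hom(1)[OF G] cF])
 fix k assume "boundary G c k \<noteq> \<zero>\<^bsub>G\<^esub>"
 then have nz: "(\<Oplus>\<^bsub>G\<^esub> l\<in>supp G c. face_coeff R l k \<odot>\<^bsub>G\<^esub> c l) \<noteq> \<zero>\<^bsub>G\<^esub>"
  using boundary_apply[OF G cF formal_sums_finite[OF cF] order_refl, of k] by simp
 have "\<exists>l\<in>supp G c. face_coeff R l k \<odot>\<^bsub>G\<^esub> c l \<noteq> \<zero>\<^bsub>G\<^esub>"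
 proof (rule ccontr)
  assume "\<not> ?thesis"
  then have "(\<Oplus>\<^bsub>G\<^esub> l\<in>supp G c. face_coeff R l k \<odot>\<^bsub>G\<^esub> c l) = \<zero>\<^bsub>G\<^esub>"
   by (intro G.add.finprod_one_eqI) blast
  with nz show False by blast
 qed
 then obtain l where l: "c l \<noteq> \<zero>\<^bsub>G\<^esub>" "face_coeff R l k \<odot>\<^bsub>G\<^esub> c l \<noteq> \<zero>\<^bsub>G\<^esub>" by (auto simp: supp_def)
 then have "face_coeff R l k \<noteq> \<zero>\<^bsub>R\<^esub>" using formal_sums_closed[OF cF, of l] by auto
 with face_coeff_nonzero[OF G.R.is_cring this] l(1) c \<Sigma>
 show "set k \<in> \<Sigma>" "int (length k) = q - 1 + 1" by (auto simp: chains_mem down_closed_def)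
qed

section \<open>Relative homology of a pair\<close>

lemma module_hom_restrict:
 assumes M: "module R M" and N: "module R N" and h: "h \<in> module_hom R M N" and H: "submodule H R M" and L: "submodule L R N"
  and sub: "\<And>x. x \<in> H ==> h x \<in> L"
 shows "h \<in> module_hom R (M\<lparr>carrier := H\<rparr>) (N\<lparr>carrier := L\<rparr>)"
proof -
 have c: "x \<in> carrier M" if "x \<in> H" for x using submoduleD(1)[OF M H] that by blast
 show ?thesis by (rule module_homI) (simp_all add: sub c module_hom_add[OF h] module_hom_smult[OF h])
qed

text \<open>
  Relative homology classes are represented by chains of \<open>\<Gamma>\<close> with boundary in \<open>\<Delta>\<close>. The map \<open>hcl\<close> takes
  such a chain to its class; \<open>hcl_surj\<close> and \<open>hcl_zero\<close> are what later arguments use instead of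
  the iterated cosets in the definition of homology.
\<close>

locale chain_pair =
 fixes R :: "'r ring" and G :: "('r, 'g) module" and \<Gamma> \<Delta> :: "'v set set"
 assumes G: "module R G" and \<Gamma>: "down_closed \<Gamma>" and \<Delta>: "down_closed \<Delta>" and sub: "\<Delta> \<subseteq> \<Gamma>"
begin

abbreviation "C q \<equiv> chains G \<Gamma> q"
abbreviation "E q \<equiv> carrier (chains G \<Delta> q)"
abbreviation "Q q \<equiv> quotient_module (C q) (E q)"
abbreviation "cl q c \<equiv> E q +>\<^bsub>C q\<^esub> c"
abbreviation "rd q \<equiv> rel_boundary G (\<Gamma>, \<Delta>) q"

definition "rel_cycles q = {c \<in> carrier (C q). boundary G c \<in> E (q - 1)}"

lemma C: "module R (C q)" by (rule chains_module[OF G])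

lemma E: "submodule (E q) R (C q)"
proof -
 interpret D: module R "chains G \<Delta> q" by (rule chains_module[OF G])
 have "E q \<subseteq> carrier (C q)" unfolding subset_iff chains_mem using sub by blast
 then show ?thesis unfolding submodule_iff[OF C]
  using D.zero_closed D.a_closed D.smult_closed by auto
qed

lemma C_sub: "carrier (C q) \<subseteq> carrier (formal_sums G UNIV)" by (auto simp: chains_mem)

lemma boundary_C: "boundary G \<in> module_hom R (C q) (C (q - 1))"
proof (rule module_homI)
 note b = boundary_hom(1)[OF G]
 fix c assume c: "c \<in> carrier (C q)"
 have cF: "c \<in> carrier (formal_sums G UNIV)" using c C_sub by blast
 show "boundary G c \<in> carrier (C (q - 1))" by (rule boundary_chains[OF G \<Gamma> c])
 show "boundary G (r \<odot>\<^bsub>C q\<^esub> c) = r \<odot>\<^bsub>C (q - 1)\<^esub> boundary G c" if "r \<in> carrier R" for r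
  using module_hom_smult[OF b that cF] by simp
 show "boundary G (c \<oplus>\<^bsub>C q\<^esub> d) = boundary G c \<oplus>\<^bsub>C (q - 1)\<^esub> boundary G d" if d: "d \<in> carrier (C q)" for d
  using module_hom_add[OF b cF, of d] d C_sub by auto
qed

lemma boundary_E: "c \<in> E q ==> boundary G c \<in> E (q - 1)"
 by (rule boundary_chains[OF G \<Delta>])

lemma boundary_squared: "c \<in> carrier (C q) ==> boundary G (boundary G c) = (\<lambda>_. \<zero>\<^bsub>G\<^esub>)"
 using boundary_boundary[OF G] C_sub by blast

lemma Q: "module R (Q q)" by (rule quotient_is_module[OF C E])

lemma cl_hom: "cl q \<in> module_hom R (C q) (Q q)" by (rule quotient_proj_hom[OF C E])

lemma Q_E:
 assumes "X \<in> carrier (Q q)" obtains c where "c \<in> carrier (C q)" "X = cl q c"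
 using assms unfolding quotient_carrier_iff[OF C E] by blast

lemma rd_cl: "c \<in> carrier (C q) ==> rd q (cl q c) = cl (q - 1) (boundary G c)"
 using induced_map_class[OF C E boundary_C C E boundary_E] by simp

lemma rd_hom: "rd q \<in> module_hom R (Q q) (Q (q - 1))"
proof (rule module_homI)
 interpret C: module R "C q" by (rule C)
 note h = module_hom_comp[OF boundary_C cl_hom, of q]
 fix X assume "X \<in> carrier (Q q)"
 then obtain c where c: "c \<in> carrier (C q)" "X = cl q c" by (rule Q_E)
 show "rd q X \<in> carrier (Q (q - 1))" unfolding c(2) rd_cl[OF c(1)] by (rule module_hom_closed[OF h c(1)])
 show "rd q (r \<odot>\<^bsub>Q q\<^esub> X) = r \<odot>\<^bsub>Q (q - 1)\<^esub> rd q X" if r: "r \<in> carrier R" for r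
  unfolding c(2) module_hom_smult[OF cl_hom r c(1), symmetric] rd_cl[OF c(1)] rd_cl[OF C.smult_closed[OF r c(1)]]
  by (rule module_hom_smult[OF h r c(1)])
 show "rd q (X \<oplus>\<^bsub>Q q\<^esub> Y) = rd q X \<oplus>\<^bsub>Q (q - 1)\<^esub> rd q Y" if Y: "Y \<in> carrier (Q q)" for Y
 proof -
  obtain d where d: "d \<in> carrier (C q)" "Y = cl q d" using Y by (rule Q_E)
  show ?thesis
   unfolding c(2) d(2) module_hom_add[OF cl_hom c(1) d(1), symmetric] rd_cl[OF c(1)] rd_cl[OF d(1)]
    rd_cl[OF C.a_closed[OF c(1) d(1)]]
   by (rule module_hom_add[OF h c(1) d(1)])
 qed
qed

definition "KQ q = {X \<in> carrier (Q q). rd q X = \<zero>\<^bsub>Q (q - 1)\<^esub>}"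
definition "BQ q = rd (q + 1) ` carrier (Q (q + 1))"

lemma aug_homology_eq: "aug_homology G (\<Gamma>, \<Delta>) q = quotient_module ((Q q)\<lparr>carrier := KQ q\<rparr>) (BQ q)"
 by (simp add: aug_homology_def homology_module_def KQ_def BQ_def a_kernel_def')

lemma KQ: "submodule (KQ q) R (Q q)"
 using submodule_vimage[OF Q Q rd_hom module.carrier_is_submodule[OF Q] submodule_zero[OF Q]]
 by (simp add: KQ_def)

lemma cl_zero: "c \<in> carrier (C q) ==> cl q c = \<zero>\<^bsub>Q q\<^esub> \<longleftrightarrow> c \<in> E q"
 by (rule quotient_class_zero[OF C E])

lemma cl_KQ: "c \<in> carrier (C q) ==> cl q c \<in> KQ q \<longleftrightarrow> c \<in> rel_cycles q"
 using rd_cl[of c q] cl_zero[OF module_hom_closed[OF boundary_C, of c q]] module_hom_closed[OF cl_hom, of c q]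
 by (simp add: KQ_def rel_cycles_def)

lemma BQ_iff:
 assumes c: "c \<in> carrier (C q)"
 shows "cl q c \<in> BQ q \<longleftrightarrow> (\<exists>y\<in>carrier (C (q + 1)). c \<ominus>\<^bsub>C q\<^esub> boundary G y \<in> E q)"
proof -
 have e: "cl q c = rd (q + 1) (cl (q + 1) y) \<longleftrightarrow> c \<ominus>\<^bsub>C q\<^esub> boundary G y \<in> E q" if y: "y \<in> carrier (C (q + 1))" for y
  using rd_cl[OF y] quotient_class_eq[OF C E c] module_hom_closed[OF boundary_C y] by simp
 show ?thesis
 proof
  assume "cl q c \<in> BQ q"
  then obtain X where X: "X \<in> carrier (Q (q + 1))" "cl q c = rd (q + 1) X" unfolding BQ_def by blast
  then obtain y where y: "y \<in> carrier (C (q + 1))" "X = cl (q + 1) y" by (elim Q_E)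
  then show "\<exists>y\<in>carrier (C (q + 1)). c \<ominus>\<^bsub>C q\<^esub> boundary G y \<in> E q" using e X by blast
 next
  assume "\<exists>y\<in>carrier (C (q + 1)). c \<ominus>\<^bsub>C q\<^esub> boundary G y \<in> E q"
  then obtain y where y: "y \<in> carrier (C (q + 1))" "cl q c = rd (q + 1) (cl (q + 1) y)" using e by blast
  then show "cl q c \<in> BQ q" unfolding BQ_def using module_hom_closed[OF cl_hom y(1)] by blast
 qed
qed

lemma BQ: "submodule (BQ q) R ((Q q)\<lparr>carrier := KQ q\<rparr>)"
proof (rule submodule_mono[OF Q _ KQ])
 have h: "rd (q + 1) \<in> module_hom R (Q (q + 1)) (Q q)" using rd_hom[of "q + 1"] by simp
 show "submodule (BQ q) R (Q q)"
  unfolding BQ_def by (rule submodule_image[OF Q Q h module.carrier_is_submodule[OF Q]])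
 show "BQ q \<subseteq> KQ q"
 proof
  fix X assume "X \<in> BQ q"
  then obtain Y where Y: "Y \<in> carrier (Q (q + 1))" "X = rd (q + 1) Y" unfolding BQ_def by blast
  then obtain y where y: "y \<in> carrier (C (q + 1))" "Y = cl (q + 1) y" by (elim Q_E)
  have b: "boundary G y \<in> carrier (C q)" using module_hom_closed[OF boundary_C y(1)] by simp
  have "boundary G y \<in> rel_cycles q"
   using b boundary_squared[OF y(1)] submoduleD(2)[OF C E, of "q - 1"] by (simp add: rel_cycles_def)
  then show "X \<in> KQ q" using cl_KQ[OF b] Y(2) y rd_cl[OF y(1)] by simp
 qed
qed

lemma KQ_module: "module R ((Q q)\<lparr>carrier := KQ q\<rparr>)"
 by (rule submodule.submodule_is_module[OF KQ Q])

lemma aug_homology_module: "module R (aug_homology G (\<Gamma>, \<Delta>) q)"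
 unfolding aug_homology_eq by (rule quotient_is_module[OF KQ_module BQ])

lemma rel_cycles_submodule: "submodule (rel_cycles q) R (C q)"
 unfolding rel_cycles_def
 by (rule submodule_vimage[OF C C boundary_C module.carrier_is_submodule[OF C] E])

definition "hcl q c = BQ q +>\<^bsub>(Q q)\<lparr>carrier := KQ q\<rparr>\<^esub> (cl q c)"

lemma hcl_hom: "hcl q \<in> module_hom R ((C q)\<lparr>carrier := rel_cycles q\<rparr>) (aug_homology G (\<Gamma>, \<Delta>) q)"
proof -
 have "cl q \<in> module_hom R ((C q)\<lparr>carrier := rel_cycles q\<rparr>) ((Q q)\<lparr>carrier := KQ q\<rparr>)"
  by (rule module_hom_restrict[OF C Q cl_hom rel_cycles_submodule KQ])
   (use cl_KQ in \<open>auto simp: rel_cycles_def\<close>)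
 from module_hom_comp[OF this quotient_proj_hom[OF KQ_module BQ]]
 show ?thesis unfolding aug_homology_eq hcl_def .
qed

lemma hcl_surj: "hcl q ` rel_cycles q = carrier (aug_homology G (\<Gamma>, \<Delta>) q)"
proof
 show "hcl q ` rel_cycles q \<subseteq> carrier (aug_homology G (\<Gamma>, \<Delta>) q)"
  using module_hom_closed[OF hcl_hom] by auto
 show "carrier (aug_homology G (\<Gamma>, \<Delta>) q) \<subseteq> hcl q ` rel_cycles q"
 proof
  fix Z assume "Z \<in> carrier (aug_homology G (\<Gamma>, \<Delta>) q)"
  then obtain X where X: "X \<in> KQ q" "Z = BQ q +>\<^bsub>(Q q)\<lparr>carrier := KQ q\<rparr>\<^esub> X"
   unfolding aug_homology_eq quotient_carrier_iff[OF KQ_module BQ] by auto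
  then have "X \<in> carrier (Q q)" by (simp add: KQ_def)
  then obtain c where c: "c \<in> carrier (C q)" "X = cl q c" by (rule Q_E)
  then have "c \<in> rel_cycles q" using X cl_KQ by simp
  then show "Z \<in> hcl q ` rel_cycles q" using X(2) c(2) by (simp add: hcl_def)
 qed
qed

lemma hcl_zero:
 assumes c: "c \<in> rel_cycles q"
 shows "hcl q c = \<zero>\<^bsub>aug_homology G (\<Gamma>, \<Delta>) q\<^esub> \<longleftrightarrow> (\<exists>y\<in>carrier (C (q + 1)). c \<ominus>\<^bsub>C q\<^esub> boundary G y \<in> E q)"
proof -
 have cC: "c \<in> carrier (C q)" using c by (simp add: rel_cycles_def)
 have "cl q c \<in> carrier ((Q q)\<lparr>carrier := KQ q\<rparr>)" using cl_KQ[OF cC] c by simp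
 then show ?thesis
  unfolding hcl_def aug_homology_eq using quotient_class_zero[OF KQ_module BQ] BQ_iff[OF cC] by simp
qed

end

lemma simplex_dif:
 fixes R :: "'r ring"
 assumes R: "cring R" and \<Gamma>: "down_closed \<Gamma>" and \<Delta>: "down_closed \<Delta>" and G: "module R G"
  and c: "c \<in> carrier (formal_sums G (bas (simplex_cpx R \<Gamma> \<Delta>)))"
 shows "dif (tens R (simplex_cpx R \<Gamma> \<Delta>) (concentrated G)) c t =
  (if set t \<in> \<Gamma> - \<Delta> then boundary G c t else \<zero>\<^bsub>G\<^esub>)"
proof -
 interpret G: module R G by fact
 let ?S = "simplex_cpx R \<Gamma> \<Delta>"
 note S = simplex_cpx_based[OF R \<Gamma> \<Delta>] and cG = concentrated_chain_cpx[OF G]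
 note fc = face_coeff_closed[OF R]
 have A: "finite (supp G c)" "supp G c \<subseteq> bas ?S" using c by (auto simp: formal_sums_carrier)
 have cl: "c l \<in> carrier G" for l using formal_sums_closed[OF c] .
 have "dif (tens R ?S (concentrated G)) c t = (\<Oplus>\<^bsub>G\<^esub> s\<in>supp G c. inc ?S t s \<odot>\<^bsub>G\<^esub> c s) \<oplus>\<^bsub>G\<^esub>
   sgn_elt R (dg ?S t) \<odot>\<^bsub>G\<^esub> \<zero>\<^bsub>G\<^esub>"
  using tens_dif_apply[OF S cG, of c "supp G c" t] c A by simp
 also have "\<dots> = (\<Oplus>\<^bsub>G\<^esub> s\<in>supp G c. inc ?S t s \<odot>\<^bsub>G\<^esub> c s)"
  using sgn_elt_closed[OF R] cl based_cpxD(2)[OF S] by (simp add: G.finsum_closed Pi_def del: simplex_cpx_simps)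
 also have "\<dots> = (if set t \<in> \<Gamma> - \<Delta> then boundary G c t else \<zero>\<^bsub>G\<^esub>)"
 proof (cases "set t \<in> \<Gamma> - \<Delta>")
  case True
  have "(\<Oplus>\<^bsub>G\<^esub> s\<in>supp G c. inc ?S t s \<odot>\<^bsub>G\<^esub> c s) = (\<Oplus>\<^bsub>G\<^esub> s\<in>supp G c. face_coeff R s t \<odot>\<^bsub>G\<^esub> c s)"
   using A(2) True cl by (intro G.finsum_cong') (auto simp: fc)
  then show ?thesis using True boundary_apply[OF G c A(1) order_refl, of t] by simp
 next
  case False
  then show ?thesis using cl by (auto intro!: G.add.finprod_one_eqI)
 qed
 finally show ?thesis .
qed

definition cut_off :: "('r, 'm) module => 's set => ('s => 'm) => 's => 'm" where
 "cut_off M S c = (\<lambda>s. if s \<in> S then c s else \<zero>\<^bsub>M\<^esub>)"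

lemma cut_off_hom:
 assumes M: "module R M"
 shows "cut_off M S \<in> module_hom R (formal_sums M T) (formal_sums M S)"
proof -
 interpret M: module R M by fact
 show ?thesis
 proof (rule module_homI)
  fix c assume c: "c \<in> carrier (formal_sums M T)"
  show "cut_off M S c \<in> carrier (formal_sums M S)"
   by (rule formal_sumsI[OF _ formal_sums_finite[OF c]])
    (use formal_sums_closed[OF c] in \<open>auto simp: cut_off_def supp_def\<close>)
 qed (auto simp: cut_off_def fun_eq_iff)
qed

context chain_pair
begin

abbreviation "S \<equiv> simplex_cpx R \<Gamma> \<Delta>"

lemma R: "cring R" using G by (simp add: module_def)

lemma grd_simplex:
 "c \<in> grd (tens R S (concentrated G)) q \<longleftrightarrow> c \<in> carrier (C q) \<and> (\<forall>l. set l \<in> \<Delta> \<longrightarrow> c l = \<zero>\<^bsub>G\<^esub>)"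
proof
 assume "c \<in> grd (tens R S (concentrated G)) q"
 then have c: "c \<in> carrier (formal_sums G (bas S))"
  and g: "\<And>l. l \<in> bas S ==> c l \<in> grd (concentrated G) (q - dg S l)" by (auto simp: tens_grd)
 have out: "c l = \<zero>\<^bsub>G\<^esub>" if "l \<notin> bas S" for l using formal_sums_outside[OF c that] .
 have "set l \<in> \<Gamma> \<and> int (length l) = q + 1" if "c l \<noteq> \<zero>\<^bsub>G\<^esub>" for l
  using that out[of l] g[of l] by (cases "l \<in> bas S") (auto split: if_splits)
 then show "c \<in> carrier (C q) \<and> (\<forall>l. set l \<in> \<Delta> \<longrightarrow> c l = \<zero>\<^bsub>G\<^esub>)"
  using formal_sums_mono[OF subset_UNIV c] out unfolding chains_mem by simp
next
 assume "c \<in> carrier (C q) \<and> (\<forall>l. set l \<in> \<Delta> \<longrightarrow> c l = \<zero>\<^bsub>G\<^esub>)"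
 then have cF: "c \<in> carrier (formal_sums G UNIV)" and z: "\<And>l. set l \<in> \<Delta> ==> c l = \<zero>\<^bsub>G\<^esub>"
  and n: "\<And>l. c l \<noteq> \<zero>\<^bsub>G\<^esub> ==> set l \<in> \<Gamma> \<and> int (length l) = q + 1" unfolding chains_mem by blast+
 have "c \<in> carrier (formal_sums G (bas S))"
  by (rule formal_sumsI[OF formal_sums_closed[OF cF] formal_sums_finite[OF cF]])
   (use z n in \<open>auto simp: supp_def\<close>)
 moreover have "c l \<in> grd (concentrated G) (q - dg S l)" for l
  using n[of l] formal_sums_closed[OF cF, of l] by (cases "c l = \<zero>\<^bsub>G\<^esub>") auto
 ultimately show "c \<in> grd (tens R S (concentrated G)) q" by (simp add: tens_grd)
qed

text \<open>
  Omitting the simplices of \<open>\<Delta>\<close> from a chain changes it by a chain of \<open>\<Delta>\<close> only, hence it does not affect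
  relative homology classes, and what is left is a chain of the free complex.
\<close>

lemma pair_has_homology: "has_homology R (tens R S (concentrated G)) q (aug_homology G (\<Gamma>, \<Delta>) q)"
proof -
 let ?T = "tens R S (concentrated G)"
 interpret G: module R G by (rule G)
 interpret F: module R "formal_sums G (UNIV :: 'v list set)" by (rule formal_sums_module[OF G])
 note T = tens_chain_cpx[OF simplex_cpx_based[OF R \<Gamma> \<Delta>] concentrated_chain_cpx[OF G]]
 note b = boundary_hom(1)[OF G]
 let ?t = "cut_off G (bas S)"
 have tT: "?t c \<in> grd ?T m" if "c \<in> carrier (C m)" for c m
  using module_hom_closed[OF cut_off_hom[OF G], of c UNIV "bas S"] that formal_sums_mono[of "bas S" UNIV]
  unfolding grd_simplex chains_mem by (auto simp: cut_off_def)
 have inC: "c \<in> carrier (C m)" if "c \<in> grd ?T m" for c m using that grd_simplex by blast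
 have inS: "c \<in> carrier (formal_sums G (bas S))" if "c \<in> grd ?T m" for c m using that by (simp add: tens_grd)
 have d: "dif ?T c = ?t (boundary G c)" if "c \<in> grd ?T m" for c m
  using simplex_dif[OF R \<Gamma> \<Delta> G inS[OF that]] by (auto simp: cut_off_def fun_eq_iff)
 have tE: "c \<in> E m \<longleftrightarrow> ?t c = (\<lambda>_. \<zero>\<^bsub>G\<^esub>)" if "c \<in> carrier (C m)" for c m
  using that by (auto simp: chains_mem cut_off_def fun_eq_iff split: if_splits)
 have tm: "?t (c \<ominus>\<^bsub>C m\<^esub> e) = (\<lambda>l. ?t c l \<ominus>\<^bsub>G\<^esub> ?t e l)" if "c \<in> carrier (C m)" "e \<in> carrier (C m)" for c e m
 proof
  fix l show "?t (c \<ominus>\<^bsub>C m\<^esub> e) l = ?t c l \<ominus>\<^bsub>G\<^esub> ?t e l"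
   using formal_sums_minus_apply[OF G, of c _ e l] that by (simp add: cut_off_def chains_def a_minus_def module_neg_zero[OF G])
 qed
 have tt: "?t c = c" if "c \<in> grd ?T m" for c m
  using formal_sums_outside[OF inS[OF that]] by (auto simp: cut_off_def fun_eq_iff)
 have ct: "c \<ominus>\<^bsub>C m\<^esub> ?t c \<in> E m" if c: "c \<in> carrier (C m)" for c m
 proof -
  interpret Cm: module R "C m" by (rule C)
  have tc: "?t c \<in> carrier (C m)" by (rule inC[OF tT[OF c]])
  have "?t (c \<ominus>\<^bsub>C m\<^esub> ?t c) = (\<lambda>_. \<zero>\<^bsub>G\<^esub>)"
  proof -
   have "?t c l \<in> carrier G" for l using formal_sums_closed[of "?t c" G UNIV l] tc by (simp add: chains_mem)
   then show ?thesis unfolding tm[OF c tc] tt[OF tT[OF c]] by (simp add: a_minus_def G.r_neg)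
  qed
  then show ?thesis using tE[OF Cm.minus_closed[OF c tc]] by simp
 qed
 have bt: "?t (boundary G (?t y)) = ?t (boundary G y)" if y: "y \<in> carrier (C m)" for y m
 proof -
  have ty: "?t y \<in> carrier (C m)" by (rule inC[OF tT[OF y]])
  have bc: "boundary G y \<in> carrier (C (m - 1))" "boundary G (?t y) \<in> carrier (C (m - 1))"
   using module_hom_closed[OF boundary_C] y ty by auto
  have "boundary G (y \<ominus>\<^bsub>C m\<^esub> ?t y) \<in> E (m - 1)" by (rule boundary_E[OF ct[OF y]])
  then have e: "boundary G y \<ominus>\<^bsub>C (m - 1)\<^esub> boundary G (?t y) \<in> E (m - 1)"
   using module_hom_minus[OF C C boundary_C y ty] by simp
  then have "?t (boundary G y \<ominus>\<^bsub>C (m - 1)\<^esub> boundary G (?t y)) = (\<lambda>_. \<zero>\<^bsub>G\<^esub>)"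
   using tE submoduleD(1)[OF C E] by blast
  then have z: "?t (boundary G y) l \<ominus>\<^bsub>G\<^esub> ?t (boundary G (?t y)) l = \<zero>\<^bsub>G\<^esub>" for l
   unfolding tm[OF bc] by (rule fun_cong)
  have "?t c l \<in> carrier G" if "c \<in> carrier (C (m - 1))" for c l
   using formal_sums_closed[of c G] that by (simp add: cut_off_def chains_def)
  then have "?t (boundary G y) l = ?t (boundary G (?t y)) l" for l
   using z[of l] module_minus_eq_zero[OF G] bc by blast
  then show ?thesis by (intro ext) simp
 qed
 have cyc: "c \<in> rel_cycles q" if "c \<in> cycles ?T q" for c
 proof -
  have g: "c \<in> grd ?T q" and z: "?t (boundary G c) = (\<lambda>_. \<zero>\<^bsub>G\<^esub>)" using that d by (auto simp: cycles_def)
  then show ?thesis using inC[OF g] tE[OF module_hom_closed[OF boundary_C inC[OF g]]] by (simp add: rel_cycles_def)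
 qed
 have "hcl q \<in> module_hom R ((amb ?T)\<lparr>carrier := cycles ?T q\<rparr>) (aug_homology G (\<Gamma>, \<Delta>) q)"
  by (rule module_homI)
   (use cyc module_hom_closed[OF hcl_hom, of _ q] module_hom_add[OF hcl_hom, of _ q] module_hom_smult[OF hcl_hom, of _ _ q] in auto)
 moreover have "hcl q ` cycles ?T q = carrier (aug_homology G (\<Gamma>, \<Delta>) q)"
 proof
  show "hcl q ` cycles ?T q \<subseteq> carrier (aug_homology G (\<Gamma>, \<Delta>) q)" using cyc hcl_surj by blast
  show "carrier (aug_homology G (\<Gamma>, \<Delta>) q) \<subseteq> hcl q ` cycles ?T q"
   unfolding hcl_surj[symmetric]
  proof
   fix Z assume "Z \<in> hcl q ` rel_cycles q"
   then obtain z where z: "z \<in> rel_cycles q" "Z = hcl q z" by blast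
   have zC: "z \<in> carrier (C q)" and bz: "boundary G z \<in> E (q - 1)" using z by (auto simp: rel_cycles_def)
   interpret Cq: module R "C q" by (rule C)
   have "dif ?T (?t z) = ?t (boundary G z)" using d[OF tT[OF zC]] bt[OF zC] by simp
   also have "\<dots> = (\<lambda>_. \<zero>\<^bsub>G\<^esub>)" using tE[OF module_hom_closed[OF boundary_C zC]] bz by simp
   finally have c: "?t z \<in> cycles ?T q" using tT[OF zC] by (simp add: cycles_def)
   have e: "z \<ominus>\<^bsub>C q\<^esub> ?t z \<in> rel_cycles q"
    by (rule submodule_minus[OF C rel_cycles_submodule z(1) cyc[OF c]])
   have "hcl q (z \<ominus>\<^bsub>C q\<^esub> ?t z) = \<zero>\<^bsub>aug_homology G (\<Gamma>, \<Delta>) q\<^esub>"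
    unfolding hcl_zero[OF e]
   proof
    show "\<zero>\<^bsub>C (q + 1)\<^esub> \<in> carrier (C (q + 1))" by (rule submoduleD(2)[OF C module.carrier_is_submodule[OF C]])
    have "boundary G \<zero>\<^bsub>C (q + 1)\<^esub> = \<zero>\<^bsub>C q\<^esub>" using module_hom_zero[OF C C boundary_C, of "q + 1"] by simp
    then show "z \<ominus>\<^bsub>C q\<^esub> ?t z \<ominus>\<^bsub>C q\<^esub> boundary G \<zero>\<^bsub>C (q + 1)\<^esub> \<in> E q"
     using ct[OF zC] zC inC[OF tT[OF zC]] by (simp add: a_minus_def[of _ _ "\<zero>\<^bsub>C q\<^esub>"] module_neg_zero[OF C] del: chains_ops)
   qed
   moreover have "z = (z \<ominus>\<^bsub>C q\<^esub> ?t z) \<oplus>\<^bsub>C q\<^esub> ?t z"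
    using zC inC[OF tT[OF zC]] by (simp add: a_minus_def Cq.a_assoc Cq.l_neg del: chains_ops)
   then have "hcl q z = hcl q (z \<ominus>\<^bsub>C q\<^esub> ?t z) \<oplus>\<^bsub>aug_homology G (\<Gamma>, \<Delta>) q\<^esub> hcl q (?t z)"
    using module_hom_add[OF hcl_hom, of "z \<ominus>\<^bsub>C q\<^esub> ?t z" q "?t z"] e cyc[OF c] by simp
   moreover interpret H: module R "aug_homology G (\<Gamma>, \<Delta>) q" by (rule aug_homology_module)
   have "hcl q (?t z) \<in> carrier (aug_homology G (\<Gamma>, \<Delta>) q)" using module_hom_closed[OF hcl_hom, of _ q] cyc[OF c] by simp
   ultimately have "hcl q z = hcl q (?t z)" by simp
   then show "Z \<in> hcl q ` cycles ?T q" using z(2) c by blast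
  qed
 qed
 moreover have "hcl q c = \<zero>\<^bsub>aug_homology G (\<Gamma>, \<Delta>) q\<^esub> \<longleftrightarrow> c \<in> boundaries ?T q" if c: "c \<in> cycles ?T q" for c
 proof -
  have cg: "c \<in> grd ?T q" using c by (simp add: cycles_def)
  have key: "c \<ominus>\<^bsub>C q\<^esub> boundary G y \<in> E q \<longleftrightarrow> c = ?t (boundary G y)" if y: "y \<in> carrier (C (q + 1))" for y
  proof -
   interpret Cq: module R "C q" by (rule C)
   have byC: "boundary G y \<in> carrier (C q)" using module_hom_closed[OF boundary_C y] by simp
   have "c \<ominus>\<^bsub>C q\<^esub> boundary G y \<in> E q \<longleftrightarrow> (\<lambda>l. ?t c l \<ominus>\<^bsub>G\<^esub> ?t (boundary G y) l) = (\<lambda>_. \<zero>\<^bsub>G\<^esub>)"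
    using tE[OF Cq.minus_closed[OF inC[OF cg] byC]] tm[OF inC[OF cg] byC] by simp
   also have "\<dots> \<longleftrightarrow> c = ?t (boundary G y)"
   proof -
    have "?t (boundary G y) l \<in> carrier G" "c l \<in> carrier G" for l
     using formal_sums_closed[of "boundary G y" G] formal_sums_closed[OF inS[OF cg]] byC by (auto simp: cut_off_def chains_def)
    then show ?thesis unfolding tt[OF cg] fun_eq_iff using module_minus_eq_zero[OF G] by simp
   qed
   finally show ?thesis .
  qed
  show ?thesis unfolding hcl_zero[OF cyc[OF c]]
  proof
   assume "\<exists>y\<in>carrier (C (q + 1)). c \<ominus>\<^bsub>C q\<^esub> boundary G y \<in> E q"
   then obtain y where y: "y \<in> carrier (C (q + 1))" "c = ?t (boundary G y)" using key by blast
   then have "c = dif ?T (?t y)" using d[OF tT[OF y(1)]] bt[OF y(1)] by simp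
   then show "c \<in> boundaries ?T q" unfolding boundaries_def using tT[OF y(1)] by blast
  next
   assume "c \<in> boundaries ?T q"
   then obtain y where y: "y \<in> grd ?T (q + 1)" "c = dif ?T y" unfolding boundaries_def by blast
   then have "c = ?t (boundary G y)" using d by simp
   then show "\<exists>y\<in>carrier (C (q + 1)). c \<ominus>\<^bsub>C q\<^esub> boundary G y \<in> E q" using key inC[OF y(1)] by blast
  qed
 qed
 ultimately show ?thesis unfolding has_homology_def by blast
qed

end

section \<open>Shuffling ordered simplices of a join\<close>

lemma module_hom_sum:
 assumes N: "module R N" and f: "f \<in> module_hom R M N" and g: "g \<in> module_hom R M N"
 shows "(\<lambda>x. f x \<oplus>\<^bsub>N\<^esub> g x) \<in> module_hom R M N"
proof -
 interpret N: module R N by fact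
 show ?thesis
  by (rule module_homI) (auto simp: module_hom_closed[OF f] module_hom_closed[OF g] module_hom_add[OF f] module_hom_add[OF g]
   module_hom_smult[OF f] module_hom_smult[OF g] N.smult_r_distr N.a_ac)
qed

lemma module_hom_diff:
 assumes N: "module R N" and f: "f \<in> module_hom R M N" and g: "g \<in> module_hom R M N"
 shows "(\<lambda>x. f x \<ominus>\<^bsub>N\<^esub> g x) \<in> module_hom R M N"
proof -
 interpret N: module R N by fact
 show ?thesis
  by (rule module_homI) (auto simp: module_hom_closed[OF f] module_hom_closed[OF g] module_hom_add[OF f] module_hom_add[OF g]
   module_hom_smult[OF f] module_hom_smult[OF g] a_minus_def N.smult_r_distr N.smult_r_minus N.minus_add N.a_ac)
qed

lemma module_hom_id: "(\<lambda>x. x) \<in> module_hom R M M"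
 by (rule module_homI) auto

lemma module_hom_const_zero: "module R N ==> (\<lambda>_. \<zero>\<^bsub>N\<^esub>) \<in> module_hom R M N"
proof -
 assume "module R N"
 then interpret N: module R N .
 show ?thesis by (rule module_homI) auto
qed

lemma module_hom_mono: "S \<subseteq> T ==> h \<in> module_hom R (formal_sums M T) W ==> h \<in> module_hom R (formal_sums M S) W"
 using formal_sums_mono[of S T] by (auto simp: module_hom_def)

text \<open>
  A property that defines a submodule is inherited from the summands of a formal sum. This reduces all
  statements about the support of images to single simplices.
\<close>

lemma hom_in_submodule:
 fixes R :: "'r ring"
 assumes M: "module R M" and W: "module R W" and f: "f \<in> module_hom R (formal_sums M S) W"
  and U: "submodule U R W" and c: "c \<in> carrier (formal_sums M S)"
  and s: "\<And>s. s \<in> S ==> f (single M s (c s)) \<in> U"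
 shows "f c \<in> U"
proof -
 have h: "(\<lambda>x. f (single M s x)) \<in> module_hom R M W" if "s \<in> S" for s
  by (rule module_hom_comp[OF single_hom[OF M that] f])
 have "f c = lin M W (\<lambda>s x. f (single M s x)) c"
 proof (rule formal_sums_hom_eqI[OF M W f lin_hom[OF M W h] _ c])
  show "f (single M s x) = lin M W (\<lambda>s x. f (single M s x)) (single M s x)" if s: "s \<in> S" and x: "x \<in> carrier M" for s x
   by (rule lin_single[OF M W, of S "\<lambda>s x. f (single M s x)", OF _ s x, symmetric]) (rule h)
 qed
 moreover have "lin M W (\<lambda>s x. f (single M s x)) c \<in> U"
  by (rule lin_in_submodule[OF M W h U c]) (use s c in \<open>auto simp: formal_sums_carrier\<close>)
 ultimately show ?thesis by simp
qed

lemma hom_in_submodule2: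
 fixes R :: "'r ring"
 assumes M: "module R M" and W: "module R W" and f: "f \<in> module_hom R (formal_sums (formal_sums M T) S) W"
  and U: "submodule U R W" and c: "c \<in> carrier (formal_sums (formal_sums M T) S)"
  and st: "\<And>s t. s \<in> S ==> t \<in> T ==> f (single (formal_sums M T) s (single M t (c s t))) \<in> U"
 shows "f c \<in> U"
proof (rule hom_in_submodule[OF formal_sums_module[OF M] W f U c])
 fix s assume s: "s \<in> S"
 have h: "(\<lambda>z. f (single (formal_sums M T) s z)) \<in> module_hom R (formal_sums M T) W"
  by (rule module_hom_comp[OF single_hom[OF formal_sums_module[OF M] s] f])
 show "f (single (formal_sums M T) s (c s)) \<in> U"
  by (rule hom_in_submodule[OF M W h U formal_sums_closed[OF c] st[OF s]])
qed

abbreviation full_cpx :: "'r ring => ('r, 'v list) based_cpx" where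
 "full_cpx R \<equiv> simplex_cpx R UNIV {}"

lemma full_cpx_bas [simp]: "bas (full_cpx R) = UNIV"
 by auto

lemma full_cpx_based: "cring R ==> based_cpx R (full_cpx R)"
 by (rule simplex_cpx_based) (auto simp: down_closed_def)

lemma full_dif:
 fixes R :: "'r ring"
 assumes G: "module R G" and c: "c \<in> carrier (formal_sums G UNIV)"
 shows "dif (tens R (full_cpx R) (concentrated G)) c = boundary G c"
proof
 have "cring R" using G by (simp add: module_def)
 then show "dif (tens R (full_cpx R) (concentrated G)) c t = boundary G c t" for t
  using simplex_dif[of R UNIV "{}" G c t] G c by (simp add: down_closed_def)
qed

text \<open>
  If all sequences of vertices are simplices, prepending a vertex \<open>v\<close> is a contraction: \<open>d(v c) + v (dc) = c\<close>.
  The contraction passes to tensor products from the left.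
\<close>

lemma cone_identity:
 fixes R :: "'r ring" and v :: 'v
 assumes K: "chain_cpx R K" and c: "c \<in> carrier (formal_sums (amb K) UNIV)"
 shows "dif (tens R (full_cpx R) K) (prepend (amb K) v c) \<oplus>\<^bsub>formal_sums (amb K) UNIV\<^esub>
   prepend (amb K) v (dif (tens R (full_cpx R) K) c) = c"
proof -
 let ?M = "amb K" let ?F = "formal_sums ?M (UNIV :: 'v list set)" let ?T = "tens R (full_cpx R) K"
 interpret M: module R ?M by (rule chain_cpxD(1)[OF K])
 note cr = M.R.is_cring
 note Lb = full_cpx_based[OF cr]
 note F = formal_sums_module[OF M.module_axioms, of UNIV]
 have d: "dif ?T \<in> module_hom R ?F ?F" using tens_dif_hom[OF Lb K] by simp
 note p = prepend_hom[OF M.module_axioms, of v]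
 note fc = face_coeff_closed[OF cr]
 note dK = module_hom_closed[OF chain_cpxD(3)[OF K]]
 show ?thesis
 proof (rule formal_sums_hom_eqI[OF M.module_axioms F module_hom_sum[OF F module_hom_comp[OF p(1) d] module_hom_comp[OF d p(1)]]
   module_hom_id _ c])
  fix l :: "'v list" and x assume x: "x \<in> carrier ?M"
  have e: "dif ?T (single ?M k x) = tens_col R (full_cpx R) K k x" for k
   by (rule tens_dif_single[OF Lb K _ x]) simp
  show "dif ?T (prepend ?M v (single ?M l x)) \<oplus>\<^bsub>?F\<^esub> prepend ?M v (dif ?T (single ?M l x)) = single ?M l x"
   unfolding p(2) e
  proof
   fix k
   show "(tens_col R (full_cpx R) K (v # l) x \<oplus>\<^bsub>?F\<^esub> prepend ?M v (tens_col R (full_cpx R) K l x)) k = single ?M l x k"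
   proof (cases k)
    case Nil
    then show ?thesis using x by (auto simp: tens_col_def single_def a_minus_def fc module_neg_zero[OF ring_module_module[OF cr], simplified])
   next
    case (Cons w k')
    have sg: "sgn_elt R (int (length l)) \<odot>\<^bsub>?M\<^esub> dif K x \<oplus>\<^bsub>?M\<^esub> sgn_elt R (int (length l) - 1) \<odot>\<^bsub>?M\<^esub> dif K x = \<zero>\<^bsub>?M\<^esub>"
     using dK[OF x] by (simp add: sgn_elt_smult[OF M.module_axioms] M.r_neg M.l_neg)
    have cl: "sgn_elt R m \<odot>\<^bsub>?M\<^esub> dif K x \<in> carrier ?M" for m using sgn_elt_closed[OF cr] dK[OF x] by simp
    define a where "a = face_coeff R l k' \<odot>\<^bsub>?M\<^esub> x"
    have a: "a \<in> carrier ?M" using x by (simp add: a_def fc)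
    have ma: "(\<ominus>\<^bsub>R\<^esub> face_coeff R l k') \<odot>\<^bsub>?M\<^esub> x = \<ominus>\<^bsub>?M\<^esub> a" using x by (simp add: a_def fc M.smult_l_minus)
    define b where "b = (if w # k' = l then x else \<zero>\<^bsub>?M\<^esub>)"
    have b: "b \<in> carrier ?M" using x by (simp add: b_def)
    show ?thesis
    proof (cases "w = v")
     case True
     have L: "tens_col R (full_cpx R) K (v # l) x k = (b \<oplus>\<^bsub>?M\<^esub> \<ominus>\<^bsub>?M\<^esub> a) \<oplus>\<^bsub>?M\<^esub>
       (if k' = l then sgn_elt R (int (length l)) \<odot>\<^bsub>?M\<^esub> dif K x else \<zero>\<^bsub>?M\<^esub>)"
      using x True ma by (simp add: fc Cons tens_col_def single_def a_minus_def M.smult_l_distr b_def)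
     have Rr: "prepend ?M v (tens_col R (full_cpx R) K l x) k = a \<oplus>\<^bsub>?M\<^esub>
       (if k' = l then sgn_elt R (int (length l) - 1) \<odot>\<^bsub>?M\<^esub> dif K x else \<zero>\<^bsub>?M\<^esub>)"
      using True by (simp add: Cons tens_col_def single_def a_def)
     have key: "(b \<oplus>\<^bsub>?M\<^esub> \<ominus>\<^bsub>?M\<^esub> a) \<oplus>\<^bsub>?M\<^esub> s \<oplus>\<^bsub>?M\<^esub> (a \<oplus>\<^bsub>?M\<^esub> t) = b"
      if "s \<in> carrier ?M" "t \<in> carrier ?M" "s \<oplus>\<^bsub>?M\<^esub> t = \<zero>\<^bsub>?M\<^esub>" for s t
     proof -
      have "(b \<oplus>\<^bsub>?M\<^esub> n) \<oplus>\<^bsub>?M\<^esub> s \<oplus>\<^bsub>?M\<^esub> (a \<oplus>\<^bsub>?M\<^esub> t) = b \<oplus>\<^bsub>?M\<^esub> ((n \<oplus>\<^bsub>?M\<^esub> a) \<oplus>\<^bsub>?M\<^esub> (s \<oplus>\<^bsub>?M\<^esub> t))" if "n \<in> carrier ?M" for n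
       using that \<open>s \<in> carrier ?M\<close> \<open>t \<in> carrier ?M\<close> a b by (simp add: M.a_ac)
      from this[OF M.a_inv_closed[OF a]] show ?thesis using that(3) a b by (simp only: M.l_neg M.l_zero M.r_zero M.zero_closed)
     qed
     have b': "single ?M l x k = b" using Cons by (auto simp: single_def b_def)
     show ?thesis unfolding formal_sums_simps(2) L Rr b'
      by (rule key) (use sg cl in auto)
    next
     case False
     then show ?thesis using x by (auto simp: Cons tens_col_def single_def a_minus_def fc module_neg_zero[OF ring_module_module[OF cr], simplified])
    qed
   qed
  qed
 qed
qed

definition suspend :: "'r ring => ('r, 's) based_cpx => ('r, 'm) module => ('m => 'm) => ('s => 'm) => 's => 'm" where
 "suspend R S M h c = (\<lambda>s. sgn_elt R (dg S s) \<odot>\<^bsub>M\<^esub> h (c s))"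

lemma suspend_hom:
 fixes R :: "'r ring"
 assumes M: "module R M" and h: "h \<in> module_hom R M M"
 shows "suspend R S M h \<in> module_hom R (formal_sums M T) (formal_sums M T)"
  "suspend R S M h (single M s x) = single M s (sgn_elt R (dg S s) \<odot>\<^bsub>M\<^esub> h x)"
proof -
 interpret M: module R M by fact
 note sg = sgn_elt_closed[OF M.R.is_cring] and h0 = module_hom_zero[OF M M h]
 show "suspend R S M h (single M s x) = single M s (sgn_elt R (dg S s) \<odot>\<^bsub>M\<^esub> h x)"
  using h0 sg by (auto simp: suspend_def single_def)
 show "suspend R S M h \<in> module_hom R (formal_sums M T) (formal_sums M T)"
 proof (rule module_homI)
  fix c assume c: "c \<in> carrier (formal_sums M T)"
  note cl = formal_sums_closed[OF c]
  have hc: "h (c s) \<in> carrier M" for s by (rule module_hom_closed[OF h cl])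
  show "suspend R S M h c \<in> carrier (formal_sums M T)"
   by (rule formal_sumsI[OF _ formal_sums_finite[OF c]])
    (use hc h0 sg formal_sums_outside[OF c] in \<open>auto simp: suspend_def supp_def\<close>)
  show "suspend R S M h (r \<odot>\<^bsub>formal_sums M T\<^esub> c) = r \<odot>\<^bsub>formal_sums M T\<^esub> suspend R S M h c" if "r \<in> carrier R" for r
   using that hc sg by (auto simp: suspend_def fun_eq_iff module_hom_smult[OF h _ cl] M.smult_assoc1[symmetric] M.R.m_comm)
  show "suspend R S M h (c \<oplus>\<^bsub>formal_sums M T\<^esub> d) = suspend R S M h c \<oplus>\<^bsub>formal_sums M T\<^esub> suspend R S M h d"
   if d: "d \<in> carrier (formal_sums M T)" for d
   using hc module_hom_closed[OF h formal_sums_closed[OF d]] sg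
   by (auto simp: suspend_def fun_eq_iff module_hom_add[OF h cl formal_sums_closed[OF d]] M.smult_r_distr)
 qed
qed

text \<open>
  A contraction \<open>h\<close> of the second factor contracts the tensor product through \<open>s \<otimes> x \<mapsto> (-1)\<^sup>|\<^sup>s\<^sup>| s \<otimes> h x\<close>.
\<close>

lemma suspend_contraction:
 fixes R :: "'r ring"
 assumes S: "based_cpx R S" and K: "chain_cpx R K" and h: "h \<in> module_hom R (amb K) (amb K)"
  and dh: "\<And>x. x \<in> carrier (amb K) ==> dif K (h x) \<oplus>\<^bsub>amb K\<^esub> h (dif K x) = x"
  and c: "c \<in> carrier (formal_sums (amb K) (bas S))"
 shows "dif (tens R S K) (suspend R S (amb K) h c) \<oplus>\<^bsub>formal_sums (amb K) (bas S)\<^esub>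
   suspend R S (amb K) h (dif (tens R S K) c) = c"
proof -
 let ?M = "amb K" let ?F = "formal_sums ?M (bas S)" let ?T = "tens R S K" let ?s = "suspend R S ?M h"
 interpret M: module R ?M by (rule chain_cpxD(1)[OF K])
 note M = M.module_axioms
 note sg = sgn_elt_closed[OF M.R.is_cring] and i = based_cpxD(2)[OF S]
 note F = formal_sums_module[OF M, of "bas S"]
 note d = tens_dif_hom[OF S K] and s = suspend_hom[OF M h, of S]
 note dK = chain_cpxD(3)[OF K]
 show ?thesis
 proof (rule formal_sums_hom_eqI[OF M F module_hom_sum[OF F module_hom_comp[OF s(1) d] module_hom_comp[OF d s(1)]]
   module_hom_id _ c])
  fix b x assume b: "b \<in> bas S" and x: "x \<in> carrier ?M"
  have hx: "h x \<in> carrier ?M" and dx: "dif K x \<in> carrier ?M" using module_hom_closed[OF h x] module_hom_closed[OF dK x] .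
  have sx: "sgn_elt R m \<odot>\<^bsub>?M\<^esub> h x \<in> carrier ?M" "sgn_elt R m \<odot>\<^bsub>?M\<^esub> dif K x \<in> carrier ?M" for m using sg hx dx by auto
  have ibb: "inc S b b = \<zero>\<^bsub>R\<^esub>" using based_cpxD(7)[OF S, of b b] by auto
  have h0: "h \<zero>\<^bsub>?M\<^esub> = \<zero>\<^bsub>?M\<^esub>" by (rule module_hom_zero[OF M M h])
  show "dif ?T (?s (single ?M b x)) \<oplus>\<^bsub>?F\<^esub> ?s (dif ?T (single ?M b x)) = single ?M b x"
   unfolding s(2) tens_dif_single[OF S K b x] tens_dif_single[OF S K b sx(1)]
  proof
   fix t
   show "(tens_col R S K b (sgn_elt R (dg S b) \<odot>\<^bsub>?M\<^esub> h x) \<oplus>\<^bsub>?F\<^esub> ?s (tens_col R S K b x)) t = single ?M b x t"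
   proof (cases "t = b")
    case True
    have "dif K (sgn_elt R (dg S b) \<odot>\<^bsub>?M\<^esub> h x) = sgn_elt R (dg S b) \<odot>\<^bsub>?M\<^esub> dif K (h x)"
     by (rule module_hom_smult[OF dK sg hx])
    moreover have "h (sgn_elt R (dg S b) \<odot>\<^bsub>?M\<^esub> dif K x) = sgn_elt R (dg S b) \<odot>\<^bsub>?M\<^esub> h (dif K x)"
     by (rule module_hom_smult[OF h sg dx])
    ultimately show ?thesis
     using True x sx hx dx ibb dh[OF x] sgn_elt_involution[OF M] module_hom_closed[OF dK hx] module_hom_closed[OF h dx]
     by (simp add: tens_col_def suspend_def single_def)
   next
    case False
    have e: "(tens_col R S K b (sgn_elt R (dg S b) \<odot>\<^bsub>?M\<^esub> h x) \<oplus>\<^bsub>?F\<^esub> ?s (tens_col R S K b x)) t =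
      inc S t b \<odot>\<^bsub>?M\<^esub> (sgn_elt R (dg S b) \<odot>\<^bsub>?M\<^esub> h x) \<oplus>\<^bsub>?M\<^esub> sgn_elt R (dg S t) \<odot>\<^bsub>?M\<^esub> (inc S t b \<odot>\<^bsub>?M\<^esub> h x)"
     using False x hx sx i by (simp add: tens_col_def suspend_def single_def module_hom_smult[OF h i x])
    show ?thesis
    proof (cases "inc S t b = \<zero>\<^bsub>R\<^esub>")
     case True
     then show ?thesis unfolding e using False hx sx sg by (simp add: single_def)
    next
     case nz: False
     then have "even (dg S t) \<longleftrightarrow> odd (dg S b)" using based_cpxD(6)[OF S nz] by simp
     then show ?thesis unfolding e using False hx i[of t b]
      by (simp add: single_def sgn_elt_smult[OF M] M.smult_r_minus M.r_neg M.l_neg)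
    qed
   qed
  qed
 qed
qed

(* From here on sums of chains are treated as elements of abstract modules. *)
declare formal_sums_simps [simp del]

lemma module_diff_eqI:
 assumes M: "module R M" and x: "x \<in> carrier M" and y: "y \<in> carrier M" and e: "x \<oplus>\<^bsub>M\<^esub> y = z"
 shows "x = z \<ominus>\<^bsub>M\<^esub> y"
proof -
 interpret M: module R M by fact
 show ?thesis using x y unfolding e[symmetric] by (simp add: a_minus_def M.a_assoc M.r_neg)
qed

lemma formal_sums_zero_apply: "\<zero>\<^bsub>formal_sums M S\<^esub> s = \<zero>\<^bsub>M\<^esub>"
 by (simp add: formal_sums_simps)

lemma smult_single:
 fixes R :: "'r ring"
 assumes M: "module R M" and r: "r \<in> carrier R"
 shows "r \<odot>\<^bsub>formal_sums M S\<^esub> single M s x = single M s (r \<odot>\<^bsub>M\<^esub> x)"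
proof -
 interpret M: module R M by fact
 show ?thesis using r by (auto simp: formal_sums_simps single_def)
qed

text \<open>
  The vertices are divided in two classes by the predicate \<open>P\<close>. The ambient complexes consist of all
  sequences of vertices; subcomplexes enter later, through conditions on supports.
\<close>

locale shuffle =
 fixes R :: "'r ring" and N :: "('r, 'm) module" and P :: "'v => bool"
 assumes N: "module R N"
begin

sublocale N: module R N by (rule N)

abbreviation X :: "('r, 'v list => 'm) module" where "X \<equiv> formal_sums N UNIV"
abbreviation Y :: "('r, 'v list => 'v list => 'm) module" where "Y \<equiv> formal_sums X UNIV"
abbreviation XX :: "('r, 'v list => 'm) chain_cpx" where "XX \<equiv> tens R (full_cpx R) (concentrated N)"
abbreviation YY :: "('r, 'v list => 'v list => 'm) chain_cpx" where "YY \<equiv> tens R (full_cpx R) XX"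
abbreviation D :: "('v list => 'v list => 'm) => 'v list => 'v list => 'm" where "D \<equiv> dif YY"
abbreviation bnd :: "('v list => 'm) => 'v list => 'm" where "bnd \<equiv> boundary N"

lemma cr: "cring R" by (rule N.R.is_cring)

lemma X: "module R X" by (rule formal_sums_module[OF N])
lemma Y: "module R Y" by (rule formal_sums_module[OF X])

lemma XX: "chain_cpx R XX" by (rule tens_chain_cpx[OF full_cpx_based[OF cr] concentrated_chain_cpx[OF N]])

lemma D_hom: "D \<in> module_hom R Y Y"
 using tens_dif_hom[OF full_cpx_based[OF cr] XX] by simp

lemma bnd_hom: "bnd \<in> module_hom R X X" by (rule boundary_hom(1)[OF N])

lemma dif_XX: "c \<in> carrier X ==> dif XX c = bnd c" by (rule full_dif[OF N])

lemma bnd_cone: "c \<in> carrier X ==> bnd (prepend N v c) \<oplus>\<^bsub>X\<^esub> prepend N v (bnd c) = c"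
 using cone_identity[OF concentrated_chain_cpx[OF N], of c v] dif_XX[of c]
  dif_XX[OF module_hom_closed[OF prepend_hom(1)[OF N, of v]]] by simp

text \<open>
  The cone with apex \<open>v\<close>, in the factor to which \<open>v\<close> belongs.
\<close>

definition add_vertex :: "'v => ('v list => 'v list => 'm) => 'v list => 'v list => 'm" where
 "add_vertex v = (if P v then prepend X v else suspend R (full_cpx R) X (prepend N v))"

lemma add_vertex_hom: "add_vertex v \<in> module_hom R Y Y"
 using prepend_hom(1)[OF X, of v] suspend_hom(1)[OF X prepend_hom(1)[OF N, of v], of "full_cpx R" "UNIV :: 'v list set"]
 by (simp add: add_vertex_def)

lemma add_vertex_cone:
 assumes y: "y \<in> carrier Y"
 shows "D (add_vertex v y) \<oplus>\<^bsub>Y\<^esub> add_vertex v (D y) = y"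
proof (cases "P v")
 case True
 then show ?thesis using cone_identity[OF XX, of y v] y by (simp add: add_vertex_def)
next
 case False
 have "dif XX (prepend N v x) \<oplus>\<^bsub>X\<^esub> prepend N v (dif XX x) = x" if "x \<in> carrier X" for x
  using bnd_cone[OF that] dif_XX[OF that] dif_XX[OF module_hom_closed[OF prepend_hom(1)[OF N] that]] by simp
 with suspend_contraction[OF full_cpx_based[OF cr] XX, of "prepend N v" y] False y prepend_hom(1)[OF N, of v]
 show ?thesis by (simp add: add_vertex_def)
qed

text \<open>
  The shuffle sign is not written down but accumulated by \<open>add_vertex\<close>. As \<open>add_vertex\<close> is a contraction
  just like prepending a vertex is on ordinary chains, the recursion produces a chain map.
\<close>

primrec split_word :: "'v list => 'm => 'v list => 'v list => 'm" where
 "split_word [] x = single X [] (single N [] x)"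
| "split_word (v # l) x = add_vertex v (split_word l x)"

definition split :: "('v list => 'm) => 'v list => 'v list => 'm" where
 "split = lin N Y split_word"

lemma split_word_hom: "split_word l \<in> module_hom R N Y"
proof (induction l)
 case Nil
 have "split_word [] = (\<lambda>x. single X [] (single N [] x))" by auto
 then show ?case using module_hom_comp[OF single_hom[OF N UNIV_I] single_hom[OF X UNIV_I]] by simp
next
 case (Cons v l)
 have "split_word (v # l) = (\<lambda>x. add_vertex v (split_word l x))" by auto
 then show ?case using module_hom_comp[OF Cons add_vertex_hom] by simp
qed

lemma split_hom: "split \<in> module_hom R X Y"
 unfolding split_def by (rule lin_hom[OF N Y split_word_hom])

lemma split_single: "x \<in> carrier N ==> split (single N l x) = split_word l x"
 unfolding split_def by (rule lin_single[OF N Y split_word_hom UNIV_I])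

lemma split_chain_map:
 assumes "c \<in> carrier X" shows "split (bnd c) = D (split c)"
proof (rule formal_sums_hom_eqI[OF N Y module_hom_comp[OF bnd_hom split_hom] module_hom_comp[OF split_hom D_hom] _ assms])
 fix l x assume x: "x \<in> carrier N"
 show "split (bnd (single N l x)) = D (split (single N l x))"
 proof (induction l)
  case Nil
  have s: "single N [] x \<in> carrier X" by (rule single_closed[OF N UNIV_I x])
  have b: "bnd (single N [] x) = \<zero>\<^bsub>X\<^esub>" unfolding boundary_hom(2)[OF N x] using x by (simp add: formal_sums_simps)
  have "D (single X [] (single N [] x)) = tens_col R (full_cpx R) XX [] (single N [] x)"
   using tens_dif_single[OF full_cpx_based[OF cr] XX, of "[]" "single N [] x"] s by simp
  also have "\<dots> = \<zero>\<^bsub>Y\<^esub>"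
  proof
   fix t :: "'v list"
   interpret X: module R X by (rule X)
   have "single X [] \<zero>\<^bsub>X\<^esub> t = \<zero>\<^bsub>X\<^esub>" by (simp add: single_def)
   then show "tens_col R (full_cpx R) XX [] (single N [] x) t = \<zero>\<^bsub>Y\<^esub> t"
    using s by (simp add: tens_col_def dif_XX[OF s] b sgn_elt_closed[OF cr] formal_sums_zero_apply)
  qed
  finally show ?case
   unfolding b split_single[OF x] split_word.simps using module_hom_zero[OF X Y split_hom] by simp
 next
  case (Cons v l)
  let ?s = "single N l x"
  have s: "?s \<in> carrier X" by (rule single_closed[OF N UNIV_I x])
  note ps = module_hom_closed[OF split_hom s] and bs = module_hom_closed[OF bnd_hom s]
  have p: "split (prepend N v c) = add_vertex v (split c)" if "c \<in> carrier X" for c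
   by (rule formal_sums_hom_eqI[OF N Y module_hom_comp[OF prepend_hom(1)[OF N] split_hom]
    module_hom_comp[OF split_hom add_vertex_hom] _ that]) (simp add: prepend_hom(2)[OF N] split_single)
  have "split (bnd (single N (v # l) x)) = split ?s \<ominus>\<^bsub>Y\<^esub> add_vertex v (D (split ?s))"
   unfolding boundary_prepend_single[OF N x] module_hom_minus[OF X Y split_hom s module_hom_closed[OF prepend_hom(1)[OF N] bs]]
    p[OF bs] Cons ..
  also have "\<dots> = D (add_vertex v (split ?s))"
   by (rule module_diff_eqI[OF Y _ _ add_vertex_cone[OF ps], symmetric])
    (rule module_hom_closed[OF D_hom] module_hom_closed[OF add_vertex_hom] ps)+
  finally show ?case unfolding split_single[OF x] split_word.simps .
 qed
qed

lemma split_word_shape: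
 assumes x: "x \<in> carrier N"
 shows "\<exists>e\<in>carrier R. split_word l x = single X (filter P l) (single N (filter (\<lambda>v. \<not> P v) l) (e \<odot>\<^bsub>N\<^esub> x))"
proof (induction l)
 case Nil
 show ?case by (rule bexI[of _ "\<one>\<^bsub>R\<^esub>"]) (use x in auto)
next
 case (Cons v l)
 then obtain e where e: "e \<in> carrier R"
  "split_word l x = single X (filter P l) (single N (filter (\<lambda>v. \<not> P v) l) (e \<odot>\<^bsub>N\<^esub> x))" by blast
 show ?case
 proof (cases "P v")
  case True
  then show ?thesis using e by (auto simp: add_vertex_def prepend_hom(2)[OF X])
 next
  case False
  let ?g = "sgn_elt R (int (length (filter P l)) - 1)"
  have "split_word (v # l) x = single X (filter P l) (single N (v # filter (\<lambda>v. \<not> P v) l) ((?g \<otimes>\<^bsub>R\<^esub> e) \<odot>\<^bsub>N\<^esub> x))"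
   using False e x sgn_elt_closed[OF cr]
   by (simp add: add_vertex_def suspend_hom(2)[OF X prepend_hom(1)[OF N]] prepend_hom(2)[OF N]
    smult_single[OF N] N.smult_assoc1)
  then show ?thesis using False e sgn_elt_closed[OF cr] by (intro bexI[of _ "?g \<otimes>\<^bsub>R\<^esub> e"]) auto
 qed
qed

lemma split_word_outside:
 assumes "\<forall>v\<in>set l. \<not> P v" and x: "x \<in> carrier N"
 shows "split_word l x = single X [] (single N l (sgn_elt R (length l) \<odot>\<^bsub>N\<^esub> x))"
 using assms(1)
proof (induction l)
 case Nil
 show ?case using x by (simp add: sgn_elt_def)
next
 case (Cons v l)
 have "sgn_elt R (int (length l) - 1) = sgn_elt R (1 + int (length l))" by (simp add: sgn_elt_def)
 with Cons show ?case using x sgn_elt_closed[OF cr]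
  by (simp add: add_vertex_def suspend_hom(2)[OF X prepend_hom(1)[OF N]] prepend_hom(2)[OF N]
    smult_single[OF N] N.smult_assoc1[symmetric] sgn_elt_add[OF cr])
qed

lemma split_word_append:
 assumes "\<forall>v\<in>set l1. P v" and "split_word l2 x = single X [] y"
 shows "split_word (l1 @ l2) x = single X l1 y"
 using assms by (induction l1) (auto simp: add_vertex_def prepend_hom(2)[OF X])

text \<open>
  Concatenation of sequences. The empty sequence of the first factor has degree \<open>-1\<close> instead of \<open>0\<close>, so
  that the differential of the second factor appears with the wrong sign; the sign in the base case
  corrects this.
\<close>

primrec merge_word :: "'v list => ('v list => 'm) => 'v list => 'm" where
 "merge_word [] y = (\<lambda>k. sgn_elt R (int (length k)) \<odot>\<^bsub>N\<^esub> y k)"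
| "merge_word (v # l) y = prepend N v (merge_word l y)"

definition merge :: "('v list => 'v list => 'm) => 'v list => 'm" where
 "merge = lin X X merge_word"

lemma merge_word_hom: "merge_word l \<in> module_hom R X X"
proof (induction l)
 case Nil
 note sg = sgn_elt_closed[OF cr]
 show ?case
 proof (rule module_homI)
  fix c assume c: "c \<in> carrier X"
  note cl = formal_sums_closed[OF c]
  show "merge_word [] c \<in> carrier X"
   by (rule formal_sumsI[OF _ formal_sums_finite[OF c]]) (auto simp: cl sg supp_def)
  show "merge_word [] (r \<odot>\<^bsub>X\<^esub> c) = r \<odot>\<^bsub>X\<^esub> merge_word [] c" if "r \<in> carrier R" for r
   using that cl sg by (auto simp: formal_sums_simps fun_eq_iff N.smult_assoc1[symmetric] N.R.m_comm)
  show "merge_word [] (c \<oplus>\<^bsub>X\<^esub> d) = merge_word [] c \<oplus>\<^bsub>X\<^esub> merge_word [] d" if d: "d \<in> carrier X" for d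
   using cl formal_sums_closed[OF d] sg by (auto simp: formal_sums_simps fun_eq_iff N.smult_r_distr)
 qed
next
 case (Cons v l)
 have "merge_word (v # l) = (\<lambda>x. prepend N v (merge_word l x))" by auto
 then show ?case using module_hom_comp[OF Cons prepend_hom(1)[OF N]] by simp
qed

lemma merge_hom: "merge \<in> module_hom R Y X"
 unfolding merge_def by (rule lin_hom[OF X X merge_word_hom])

lemma merge_single: "y \<in> carrier X ==> merge (single X l y) = merge_word l y"
 unfolding merge_def by (rule lin_single[OF X X merge_word_hom UNIV_I])

lemma merge_word_single:
 assumes x: "x \<in> carrier N"
 shows "merge_word l (single N k x) = single N (l @ k) (sgn_elt R (length k) \<odot>\<^bsub>N\<^esub> x)"
proof (induction l)
 case Nil
 show ?case using x sgn_elt_closed[OF cr] by (auto simp: single_def)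
next
 case (Cons v l)
 then show ?case by (simp add: prepend_hom(2)[OF N])
qed

lemma bnd_merge_Nil:
 assumes "y \<in> carrier X" shows "bnd (merge_word [] y) = \<ominus>\<^bsub>X\<^esub> merge_word [] (bnd y)"
proof -
 interpret X: module R X by (rule X)
 note h = module_hom_comp[OF merge_word_hom[of "[]"] bnd_hom] and h' = module_hom_comp[OF bnd_hom merge_word_hom[of "[]"]]
 have "bnd (merge_word [] y) \<oplus>\<^bsub>X\<^esub> merge_word [] (bnd y) = \<zero>\<^bsub>X\<^esub>"
 proof (rule formal_sums_hom_eqI[OF N X module_hom_sum[OF X h h'] module_hom_const_zero[OF X] _ assms])
  fix l :: "'v list" and x assume x: "x \<in> carrier N"
  have sx: "sgn_elt R n \<odot>\<^bsub>N\<^esub> x \<in> carrier N" for n using x sgn_elt_closed[OF cr] by simp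
  show "bnd (merge_word [] (single N l x)) \<oplus>\<^bsub>X\<^esub> merge_word [] (bnd (single N l x)) = \<zero>\<^bsub>X\<^esub>"
   unfolding merge_word_single[OF x] boundary_hom(2)[OF N x] boundary_hom(2)[OF N sx] append_Nil merge_word.simps
  proof
   fix k
   have c: "face_coeff R l k \<odot>\<^bsub>N\<^esub> x \<in> carrier N" using x by (simp add: face_coeff_closed[OF cr])
   show "((\<lambda>k. face_coeff R l k \<odot>\<^bsub>N\<^esub> (sgn_elt R (int (length l)) \<odot>\<^bsub>N\<^esub> x)) \<oplus>\<^bsub>X\<^esub>
     (\<lambda>k. sgn_elt R (int (length k)) \<odot>\<^bsub>N\<^esub> (face_coeff R l k \<odot>\<^bsub>N\<^esub> x))) k = \<zero>\<^bsub>X\<^esub> k"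
   proof (cases "face_coeff R l k = \<zero>\<^bsub>R\<^esub>")
    case True
    then show ?thesis using x sx sgn_elt_closed[OF cr] by (simp add: formal_sums_simps)
   next
    case False
    then have "length l = Suc (length k)" by (rule face_coeff_nonzero(1)[OF cr])
    then show ?thesis using x c
     by (simp add: formal_sums_simps sgn_elt_smult[OF N] N.smult_r_minus face_coeff_closed[OF cr] N.r_neg N.l_neg)
   qed
  qed
 qed
 then show ?thesis
  using X.minus_equality module_hom_closed[OF h assms] module_hom_closed[OF h' assms] by metis
qed

lemma merge_chain_map:
 assumes "y \<in> carrier Y" shows "bnd (merge y) = merge (D y)"
proof (rule formal_sums_hom_eqI[OF X X module_hom_comp[OF merge_hom bnd_hom] module_hom_comp[OF D_hom merge_hom] _ assms])
 fix l :: "'v list" and y assume y: "y \<in> carrier X"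
 interpret X: module R X by (rule X)
 have dy: "bnd y \<in> carrier X" by (rule module_hom_closed[OF bnd_hom y])
 show "bnd (merge (single X l y)) = merge (D (single X l y))"
 proof (induction l)
  case Nil
  have "D (single X [] y) = tens_col R (full_cpx R) XX [] y"
   using tens_dif_single[OF full_cpx_based[OF cr] XX, of "[]" y] y by simp
  also have "\<dots> = single X [] (\<ominus>\<^bsub>X\<^esub> bnd y)"
  proof
   fix t :: "'v list"
   have "single X [] (\<ominus>\<^bsub>X\<^esub> bnd y) t \<in> carrier X" using dy by (auto simp: single_def)
   then show "tens_col R (full_cpx R) XX [] y t = single X [] (\<ominus>\<^bsub>X\<^esub> bnd y) t"
    using y dy by (simp add: tens_col_def dif_XX[OF y] sgn_elt_smult[OF X])
  qed
  finally have e: "D (single X [] y) = single X [] (\<ominus>\<^bsub>X\<^esub> bnd y)" .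
  show ?case unfolding e merge_single[OF y] merge_single[OF X.a_inv_closed[OF dy]] bnd_merge_Nil[OF y]
   by (rule module_hom_neg[OF X X merge_word_hom dy, symmetric])
 next
  case (Cons v l)
  let ?s = "single X l y"
  have s: "?s \<in> carrier Y" by (rule single_closed[OF X UNIV_I y])
  note ps = module_hom_closed[OF merge_hom s] and bs = module_hom_closed[OF D_hom s]
  note pre = prepend_hom[OF X, of v] and preN = prepend_hom(1)[OF N, of v]
  have p: "merge (prepend X v c) = prepend N v (merge c)" if "c \<in> carrier Y" for c
   by (rule formal_sums_hom_eqI[OF X X module_hom_comp[OF pre(1) merge_hom]
    module_hom_comp[OF merge_hom preN] _ that]) (simp add: pre(2) merge_single)
  have "D (prepend X v ?s) = ?s \<ominus>\<^bsub>Y\<^esub> prepend X v (D ?s)"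
  proof (rule module_diff_eqI[OF Y])
   show "D (prepend X v ?s) \<oplus>\<^bsub>Y\<^esub> prepend X v (D ?s) = ?s" using cone_identity[OF XX, of ?s v] s by simp
  qed (rule module_hom_closed[OF D_hom] module_hom_closed[OF pre(1)] s)+
  then have "merge (D (single X (v # l) y)) = merge ?s \<ominus>\<^bsub>X\<^esub> prepend N v (bnd (merge ?s))"
   unfolding pre(2) by (simp add: module_hom_minus[OF Y X merge_hom s module_hom_closed[OF pre(1) bs]] p[OF bs] Cons)
  also have "\<dots> = bnd (prepend N v (merge ?s))"
   by (rule module_diff_eqI[OF X _ _ bnd_cone[OF ps], symmetric])
    (rule module_hom_closed[OF bnd_hom] module_hom_closed[OF preN] ps)+
  finally show ?case unfolding merge_single[OF y] merge_word.simps by simp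
 qed
qed

lemma split_merge:
 assumes "\<forall>v\<in>set l1. P v" and "\<forall>v\<in>set l2. \<not> P v" and x: "x \<in> carrier N"
 shows "split (merge (single X l1 (single N l2 x))) = single X l1 (single N l2 x)"
proof -
 have sx: "sgn_elt R (length l2) \<odot>\<^bsub>N\<^esub> x \<in> carrier N" using x sgn_elt_closed[OF cr] by simp
 have "split_word l2 (sgn_elt R (length l2) \<odot>\<^bsub>N\<^esub> x) = single X [] (single N l2 x)"
  using split_word_outside[OF assms(2) sx] sgn_elt_involution[OF N x] by simp
 from split_word_append[OF assms(1) this] show ?thesis
  unfolding merge_single[OF single_closed[OF N UNIV_I x]] merge_word_single[OF x] split_single[OF sx] .
qed

end

context shuffle
begin

lemma chains_X: "c \<in> carrier (chains N \<Gamma> q) ==> c \<in> carrier X"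
 by (simp add: chains_mem)

lemma chains_submodule: "submodule (carrier (chains N \<Gamma> q)) R X"
 unfolding submodule_iff[OF X]
proof (intro conjI ballI)
 interpret X: module R X by (rule X)
 show "carrier (chains N \<Gamma> q) \<subseteq> carrier X" using chains_X by blast
 show "\<zero>\<^bsub>X\<^esub> \<in> carrier (chains N \<Gamma> q)" using X.zero_closed by (simp add: chains_mem formal_sums_zero_apply)
 fix c assume c: "c \<in> carrier (chains N \<Gamma> q)"
 show "c \<oplus>\<^bsub>X\<^esub> d \<in> carrier (chains N \<Gamma> q)" if d: "d \<in> carrier (chains N \<Gamma> q)" for d
  unfolding chains_mem
 proof (intro conjI allI impI)
  show "c \<oplus>\<^bsub>X\<^esub> d \<in> carrier X" by (rule X.a_closed[OF chains_X[OF c] chains_X[OF d]])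
  fix l assume "(c \<oplus>\<^bsub>X\<^esub> d) l \<noteq> \<zero>\<^bsub>N\<^esub>"
  then have "c l \<noteq> \<zero>\<^bsub>N\<^esub> \<or> d l \<noteq> \<zero>\<^bsub>N\<^esub>" by (auto simp: formal_sums_simps)
  then show "set l \<in> \<Gamma>" "int (length l) = q + 1" using c d unfolding chains_mem by blast+
 qed
 show "r \<odot>\<^bsub>X\<^esub> c \<in> carrier (chains N \<Gamma> q)" if r: "r \<in> carrier R" for r
  unfolding chains_mem
 proof (intro conjI allI impI)
  show "r \<odot>\<^bsub>X\<^esub> c \<in> carrier X" by (rule X.smult_closed[OF r chains_X[OF c]])
  fix l assume "(r \<odot>\<^bsub>X\<^esub> c) l \<noteq> \<zero>\<^bsub>N\<^esub>"
  then have "c l \<noteq> \<zero>\<^bsub>N\<^esub>" using r by (auto simp: formal_sums_simps)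
  then show "set l \<in> \<Gamma>" "int (length l) = q + 1" using c unfolding chains_mem by blast+
 qed
qed

lemma single_chains:
 assumes "x \<in> carrier N" and "set l \<in> \<Gamma>" shows "single N l x \<in> carrier (chains N \<Gamma> (int (length l) - 1))"
 unfolding chains_mem using single_closed[OF N UNIV_I assms(1)] assms(2) by (simp add: single_def)

lemma chains_hom_in:
 assumes W: "module R W" and f: "f \<in> module_hom R X W" and U: "submodule U R W" and c: "c \<in> carrier (chains N \<Gamma> q)"
  and s: "\<And>l x. x \<in> carrier N ==> set l \<in> \<Gamma> ==> int (length l) = q + 1 ==> f (single N l x) \<in> U"
 shows "f c \<in> U"
proof (rule hom_in_submodule[OF N W module_hom_mono[OF subset_UNIV f] U])
 show "c \<in> carrier (formal_sums N (ordered_simplices \<Gamma> q))" using c by (simp add: chains_def)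
 show "f (single N l (c l)) \<in> U" if "l \<in> ordered_simplices \<Gamma> q" for l
  using that s[OF formal_sums_closed[OF chains_X[OF c]]] by (auto simp: ordered_simplices_def)
qed

text \<open>
  The difference of two chain maps that are to be shown homotopic.
\<close>

definition defect :: "('v list => 'm) => 'v list => 'm" where
 "defect c = c \<ominus>\<^bsub>X\<^esub> merge (split c)"

lemma ms_hom: "(\<lambda>c. merge (split c)) \<in> module_hom R X X"
 by (rule module_hom_comp[OF split_hom merge_hom])

lemma defect_hom: "defect \<in> module_hom R X X"
 using module_hom_diff[OF X module_hom_id ms_hom] by (simp add: defect_def[abs_def])

lemma defect_chain_map: "c \<in> carrier X ==> bnd (defect c) = defect (bnd c)"
 unfolding defect_def
 by (simp add: module_hom_minus[OF X X bnd_hom _ module_hom_closed[OF ms_hom]] merge_chain_map split_chain_map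
  module_hom_closed[OF split_hom])

lemma merge_split_single:
 assumes x: "x \<in> carrier N"
 shows "\<exists>y\<in>carrier N. merge (split (single N l x)) = single N (filter P l @ filter (\<lambda>v. \<not> P v) l) y"
proof -
 obtain e where e: "e \<in> carrier R"
  "split_word l x = single X (filter P l) (single N (filter (\<lambda>v. \<not> P v) l) (e \<odot>\<^bsub>N\<^esub> x))"
  using split_word_shape[OF x] by blast
 then have ex: "e \<odot>\<^bsub>N\<^esub> x \<in> carrier N" using x by simp
 show ?thesis
  unfolding split_single[OF x] e(2) merge_single[OF single_closed[OF N UNIV_I ex]] merge_word_single[OF ex]
  using ex sgn_elt_closed[OF cr] by blast
qed

lemma defect_chains:
 assumes "c \<in> carrier (chains N \<Gamma> q)" shows "defect c \<in> carrier (chains N \<Gamma> q)"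
proof (rule chains_hom_in[OF X defect_hom chains_submodule assms])
 fix l x assume x: "x \<in> carrier N" and l: "set l \<in> \<Gamma>" "int (length l) = q + 1"
 let ?k = "filter P l @ filter (\<lambda>v. \<not> P v) l"
 have "set ?k = set l" by auto
 moreover have "length ?k = length l" using sum_length_filter_compl[of P l] by simp
 ultimately have k: "single N ?k y \<in> carrier (chains N \<Gamma> q)" if "y \<in> carrier N" for y
  using single_chains[OF that, of ?k \<Gamma>] l by simp
 have s: "single N l x \<in> carrier (chains N \<Gamma> q)" using single_chains[OF x l(1)] l(2) by simp
 show "defect (single N l x) \<in> carrier (chains N \<Gamma> q)"
  unfolding defect_def
  by (rule submodule_minus[OF X chains_submodule s]) (use merge_split_single[OF x] k in metis)
qed

lemma prepend_chains:
 fixes v :: 'v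
 assumes z: "z \<in> carrier (chains N (Pow \<sigma>) q)" and v: "v \<in> \<sigma>"
 shows "prepend N v z \<in> carrier (chains N (Pow \<sigma>) (q + 1))"
 unfolding chains_mem
proof (intro conjI allI impI)
 show "prepend N v z \<in> carrier X" by (rule module_hom_closed[OF prepend_hom(1)[OF N] chains_X[OF z]])
 fix l assume "prepend N v z l \<noteq> \<zero>\<^bsub>N\<^esub>"
 then obtain k where "l = v # k" "z k \<noteq> \<zero>\<^bsub>N\<^esub>" by (cases l) (auto split: if_splits)
 then show "set l \<in> Pow \<sigma>" "int (length l) = q + 1 + 1" using z v by (auto simp: chains_mem)
qed

text \<open>
  The usual homotopy of the method of acyclic models: the chain that has to be bounded involves only
  vertices of the simplex \<open>v l\<close> and is therefore bounded by its cone with apex \<open>v\<close>.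
  The number argument is the length of the sequences to which the map is applied.
\<close>

primrec shuffle_htpy :: "nat => ('v list => 'm) => 'v list => 'm" where
 "shuffle_htpy 0 = (\<lambda>c. \<zero>\<^bsub>X\<^esub>)"
| "shuffle_htpy (Suc n) = lin N X (\<lambda>l x. case l of [] => \<zero>\<^bsub>X\<^esub> | v # _ =>
   prepend N v (defect (single N l x) \<ominus>\<^bsub>X\<^esub> shuffle_htpy n (bnd (single N l x))))"

lemma shuffle_htpy_col_hom:
 assumes "shuffle_htpy n \<in> module_hom R X X"
 shows "(\<lambda>x. case l of [] => \<zero>\<^bsub>X\<^esub> | v # _ =>
   prepend N v (defect (single N l x) \<ominus>\<^bsub>X\<^esub> shuffle_htpy n (bnd (single N l x)))) \<in> module_hom R N X"
proof (cases l)
 case Nil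
 then show ?thesis using module_hom_const_zero[OF X] by simp
next
 case (Cons v k)
 note s = single_hom[OF N UNIV_I, of l]
 show ?thesis unfolding Cons list.case
  using module_hom_comp[OF module_hom_diff[OF X module_hom_comp[OF s defect_hom]
   module_hom_comp[OF module_hom_comp[OF s bnd_hom] assms]] prepend_hom(1)[OF N, of v]] Cons by simp
qed

lemma shuffle_htpy_hom: "shuffle_htpy n \<in> module_hom R X X"
proof (induction n)
 case 0
 show ?case using module_hom_const_zero[OF X] by simp
next
 case (Suc n)
 show ?case unfolding shuffle_htpy.simps by (rule lin_hom[OF N X shuffle_htpy_col_hom[OF Suc]])
qed

lemma shuffle_htpy_single:
 assumes "x \<in> carrier N"
 shows "shuffle_htpy (Suc n) (single N (v # l) x) =
  prepend N v (defect (single N (v # l) x) \<ominus>\<^bsub>X\<^esub> shuffle_htpy n (bnd (single N (v # l) x)))"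
 unfolding shuffle_htpy.simps
 by (subst lin_single[OF N X _ UNIV_I assms], rule shuffle_htpy_col_hom[OF shuffle_htpy_hom]) simp

text \<open>
  The homotopy does not leave the full simplex on the vertices of a given simplex, hence it
  preserves every simplicial complex.
\<close>

lemma shuffle_htpy_Pow:
 "c \<in> carrier (chains N (Pow \<sigma>) (int n - 1)) ==> shuffle_htpy n c \<in> carrier (chains N (Pow \<sigma>) (int n))"
proof (induction n arbitrary: c)
 case 0
 show ?case using submoduleD(2)[OF X chains_submodule] by simp
next
 case (Suc n)
 show ?case
 proof (rule chains_hom_in[OF X shuffle_htpy_hom chains_submodule Suc.prems])
  fix l x assume x: "x \<in> carrier N" and l: "set l \<in> Pow \<sigma>" "int (length l) = int (Suc n) - 1 + 1"
  obtain v k where vk: "l = v # k" using l(2) by (cases l) auto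
  have s: "single N l x \<in> carrier (chains N (Pow \<sigma>) (int n))" using single_chains[OF x l(1)] l(2) by simp
  have "bnd (single N l x) \<in> carrier (chains N (Pow \<sigma>) (int n - 1))"
   by (rule boundary_chains[OF N _ s]) (auto simp: down_closed_def)
  from prepend_chains[OF submodule_minus[OF X chains_submodule defect_chains[OF s] Suc.IH[OF this]], of v]
  show "shuffle_htpy (Suc n) (single N l x) \<in> carrier (chains N (Pow \<sigma>) (int (Suc n)))"
   using l(1) unfolding vk shuffle_htpy_single[OF x] by (simp add: add.commute)
 qed
qed

lemma shuffle_htpy_chains:
 assumes \<Gamma>: "down_closed \<Gamma>" and c: "c \<in> carrier (chains N \<Gamma> (int n - 1))"
 shows "shuffle_htpy n c \<in> carrier (chains N \<Gamma> (int n))"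
proof (rule chains_hom_in[OF X shuffle_htpy_hom chains_submodule c])
 fix l x assume x: "x \<in> carrier N" and l: "set l \<in> \<Gamma>" "int (length l) = int n - 1 + 1"
 have "single N l x \<in> carrier (chains N (Pow (set l)) (int n - 1))" using single_chains[OF x, of l] l(2) by simp
 from shuffle_htpy_Pow[OF this] show "shuffle_htpy n (single N l x) \<in> carrier (chains N \<Gamma> (int n))"
  using \<Gamma> l(1) by (auto simp: chains_mem down_closed_def)
qed

lemma shuffle_htpy_identity:
 "c \<in> carrier (chains N UNIV (int n - 1)) ==>
  bnd (shuffle_htpy n c) \<oplus>\<^bsub>X\<^esub> shuffle_htpy (n - 1) (bnd c) = defect c"
proof (induction n arbitrary: c)
 interpret X: module R X by (rule X)
 note bz = module_hom_zero[OF X X bnd_hom]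
 let ?O = "\<lambda>n. ordered_simplices UNIV (int n - 1)"
 note h = shuffle_htpy_hom
 note mono = module_hom_mono[OF subset_UNIV]
 {
  case 0
  show ?case
  proof (rule formal_sums_hom_eqI[OF N X mono[OF module_hom_sum[OF X module_hom_comp[OF h bnd_hom] module_hom_comp[OF bnd_hom h]]]
    mono[OF defect_hom]])
   show "c \<in> carrier (formal_sums N (?O 0))" using 0 by (simp add: chains_def)
   fix l :: "'v list" and x assume l: "l \<in> ?O 0" and x: "x \<in> carrier N"
   have "l = []" using l by (simp add: ordered_simplices_def)
   moreover have "merge (split (single N [] x)) = single N [] x"
    unfolding split_single[OF x] split_word.simps merge_single[OF single_closed[OF N UNIV_I x]] merge_word_single[OF x]
    using x by (simp add: sgn_elt_def)
   ultimately have "defect (single N l x) = \<zero>\<^bsub>X\<^esub>"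
    using single_closed[OF N UNIV_I x, of l] by (simp add: defect_def a_minus_def X.r_neg)
   then show "bnd (shuffle_htpy 0 (single N l x)) \<oplus>\<^bsub>X\<^esub> shuffle_htpy (0 - 1) (bnd (single N l x)) = defect (single N l x)"
    by (simp add: bz)
  qed
 next
  case (Suc n)
  show ?case
  proof (rule formal_sums_hom_eqI[OF N X mono[OF module_hom_sum[OF X module_hom_comp[OF h bnd_hom] module_hom_comp[OF bnd_hom h]]]
    mono[OF defect_hom]])
   show "c \<in> carrier (formal_sums N (?O (Suc n)))" using Suc.prems by (simp add: chains_def)
   fix l :: "'v list" and x assume l: "l \<in> ?O (Suc n)" and x: "x \<in> carrier N"
   have len: "length l = Suc n" using l by (simp add: ordered_simplices_def)
   then obtain v k where vk: "l = v # k" by (cases l) auto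
   let ?s = "single N l x" let ?z = "defect ?s \<ominus>\<^bsub>X\<^esub> shuffle_htpy n (bnd ?s)"
   have s: "?s \<in> carrier X" by (rule single_closed[OF N UNIV_I x])
   note ds = module_hom_closed[OF defect_hom s] and bs = module_hom_closed[OF bnd_hom s]
   note hbs = module_hom_closed[OF h[of n] bs]
   note z = X.minus_closed[OF ds hbs]
   have "?s \<in> carrier (chains N UNIV (int n))" using single_chains[OF x, of l UNIV] len by simp
   then have "bnd ?s \<in> carrier (chains N UNIV (int n - 1))"
    by (intro boundary_chains[OF N]) (auto simp: down_closed_def)
   from Suc.IH[OF this] have "bnd (shuffle_htpy n (bnd ?s)) \<oplus>\<^bsub>X\<^esub> shuffle_htpy (n - 1) (bnd (bnd ?s)) = defect (bnd ?s)" .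
   moreover have "bnd (bnd ?s) = \<zero>\<^bsub>X\<^esub>" using boundary_boundary[OF N s] by (simp add: formal_sums_simps)
   ultimately have "bnd (shuffle_htpy n (bnd ?s)) = bnd (defect ?s)"
    using module_hom_zero[OF X X h[of "n - 1"]] module_hom_closed[OF bnd_hom hbs] by (simp add: defect_chain_map[OF s])
   then have "bnd ?z = \<zero>\<^bsub>X\<^esub>"
    unfolding module_hom_minus[OF X X bnd_hom ds hbs] using module_hom_closed[OF bnd_hom ds]
    by (simp add: a_minus_def X.r_neg)
   then have "bnd (prepend N v ?z) = ?z"
    using bnd_cone[OF z, of v] module_hom_zero[OF X X prepend_hom(1)[OF N, of v]]
     module_hom_closed[OF bnd_hom module_hom_closed[OF prepend_hom(1)[OF N, of v] z]] by simp
   then have "bnd (shuffle_htpy (Suc n) ?s) = ?z" unfolding vk shuffle_htpy_single[OF x] .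
   then show "bnd (shuffle_htpy (Suc n) ?s) \<oplus>\<^bsub>X\<^esub> shuffle_htpy (Suc n - 1) (bnd ?s) = defect ?s"
    using ds hbs by (simp add: a_minus_def X.a_assoc X.l_neg)
  qed
 }
qed

end

section \<open>The join of two pairs\<close>

lemma module_minus_split:
 assumes M: "module R M" and c: "x \<in> carrier M" "a \<in> carrier M" "b \<in> carrier M" "m \<in> carrier M"
 shows "(x \<ominus>\<^bsub>M\<^esub> a) \<ominus>\<^bsub>M\<^esub> b = ((x \<ominus>\<^bsub>M\<^esub> m) \<ominus>\<^bsub>M\<^esub> b) \<oplus>\<^bsub>M\<^esub> (m \<ominus>\<^bsub>M\<^esub> a)"
proof -
 interpret M: module R M by fact
 have "((x \<oplus>\<^bsub>M\<^esub> m') \<oplus>\<^bsub>M\<^esub> b') \<oplus>\<^bsub>M\<^esub> (m \<oplus>\<^bsub>M\<^esub> a') = (m' \<oplus>\<^bsub>M\<^esub> m) \<oplus>\<^bsub>M\<^esub> ((x \<oplus>\<^bsub>M\<^esub> a') \<oplus>\<^bsub>M\<^esub> b')"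
  if "a' \<in> carrier M" "b' \<in> carrier M" "m' \<in> carrier M" for a' b' m'
  using that c by (simp add: M.a_ac)
 from this[of "\<ominus>\<^bsub>M\<^esub> a" "\<ominus>\<^bsub>M\<^esub> b" "\<ominus>\<^bsub>M\<^esub> m"] c show ?thesis
  by (simp add: a_minus_def M.l_neg)
qed

context chain_pair
begin

lemma C_minus:
 assumes "c \<in> carrier (C q)" "d \<in> carrier (C q)"
 shows "c \<ominus>\<^bsub>C q\<^esub> d = c \<ominus>\<^bsub>formal_sums G UNIV\<^esub> d"
 unfolding a_minus_def module_neg_eq_smult[OF C assms(2)]
  module_neg_eq_smult[OF formal_sums_module[OF G] subsetD[OF C_sub assms(2)]]
 by (simp add: formal_sums_simps)

lemma hcl_eqI:
 assumes z: "z \<in> rel_cycles q" and z': "z' \<in> rel_cycles q" and w: "w \<in> carrier (C (q + 1))"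
  and e: "(z \<ominus>\<^bsub>C q\<^esub> z') \<ominus>\<^bsub>C q\<^esub> boundary G w \<in> E q"
 shows "hcl q z = hcl q z'"
proof -
 interpret H: module R "aug_homology G (\<Gamma>, \<Delta>) q" by (rule aug_homology_module)
 interpret Cq: module R "C q" by (rule C)
 have d: "z \<ominus>\<^bsub>C q\<^esub> z' \<in> rel_cycles q" by (rule submodule_minus[OF C rel_cycles_submodule z z'])
 have zC: "z \<in> carrier (C q)" "z' \<in> carrier (C q)" using z z' by (auto simp: rel_cycles_def)
 have "hcl q (z \<ominus>\<^bsub>C q\<^esub> z') = \<zero>\<^bsub>aug_homology G (\<Gamma>, \<Delta>) q\<^esub>" using hcl_zero[OF d] e w by blast
 moreover have "z = (z \<ominus>\<^bsub>C q\<^esub> z') \<oplus>\<^bsub>C q\<^esub> z'"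
  using zC by (simp add: a_minus_def Cq.a_assoc Cq.l_neg del: chains_ops)
 then have "hcl q z = hcl q (z \<ominus>\<^bsub>C q\<^esub> z') \<oplus>\<^bsub>aug_homology G (\<Gamma>, \<Delta>) q\<^esub> hcl q z'"
  using module_hom_add[OF hcl_hom, of "z \<ominus>\<^bsub>C q\<^esub> z'" q z'] d z' by simp
 moreover have "hcl q z' \<in> carrier (aug_homology G (\<Gamma>, \<Delta>) q)" using module_hom_closed[OF hcl_hom, of z' q] z' by simp
 ultimately show ?thesis by simp
qed

end

lemma down_closed_join:
 assumes "down_closed \<Gamma>" "down_closed \<Delta>" shows "down_closed (complex_join \<Gamma> \<Delta>)"
 unfolding down_closed_def
proof (intro ballI allI impI)
 fix \<sigma> \<tau> assume "\<sigma> \<in> complex_join \<Gamma> \<Delta>" and \<tau>: "\<tau> \<subseteq> \<sigma>"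
 then obtain s t where s: "\<sigma> = s \<union> t" "s \<in> \<Gamma>" "t \<in> \<Delta>" unfolding complex_join_def by blast
 have "\<tau> = (\<tau> \<inter> s) \<union> (\<tau> \<inter> t)" using \<tau> s(1) by blast
 moreover have "\<tau> \<inter> s \<in> \<Gamma>" "\<tau> \<inter> t \<in> \<Delta>" using assms s unfolding down_closed_def by auto
 ultimately show "\<tau> \<in> complex_join \<Gamma> \<Delta>" unfolding complex_join_def by blast
qed

text \<open>
  The homotopy formula for relative cycles: the contribution of the boundary stays in \<open>\<Delta>\<close>.
\<close>

lemma (in shuffle) defect_boundary:
 assumes \<Gamma>: "down_closed \<Gamma>" and \<Delta>: "down_closed \<Delta>" and z: "z \<in> carrier (chains N \<Gamma> q)"
  and bz: "bnd z \<in> carrier (chains N \<Delta> (q - 1))"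
 shows "\<exists>w\<in>carrier (chains N \<Gamma> (q + 1)). defect z \<ominus>\<^bsub>X\<^esub> bnd w \<in> carrier (chains N \<Delta> q)"
proof (cases "q + 1 < 0")
 case True
 interpret X: module R X by (rule X)
 have "z l = \<zero>\<^bsub>N\<^esub>" for l using z True unfolding chains_mem by (metis of_nat_less_0_iff)
 then have "z = \<zero>\<^bsub>X\<^esub>" by (auto simp: formal_sums_simps)
 then have "defect z \<ominus>\<^bsub>X\<^esub> bnd \<zero>\<^bsub>X\<^esub> = \<zero>\<^bsub>X\<^esub>"
  using module_hom_zero[OF X X defect_hom] module_hom_zero[OF X X bnd_hom] by (simp add: a_minus_def X.r_neg)
 then show ?thesis using submoduleD(2)[OF X chains_submodule] by metis
next
 case False
 interpret X: module R X by (rule X)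
 define n where "n = nat (q + 1)"
 have n: "int n - 1 = q" using False by (simp add: n_def)
 have w: "shuffle_htpy n z \<in> carrier (chains N \<Gamma> (q + 1))"
  using shuffle_htpy_chains[OF \<Gamma>, of z n] z n[symmetric] by simp
 have w': "shuffle_htpy (n - 1) (bnd z) \<in> carrier (chains N \<Delta> q)"
 proof (cases n)
  case 0
  then show ?thesis using submoduleD(2)[OF X chains_submodule] by simp
 next
  case (Suc m)
  then show ?thesis using shuffle_htpy_chains[OF \<Delta>, of "bnd z" m] bz n by simp
 qed
 have "z \<in> carrier (chains N UNIV (int n - 1))" using z n by (simp add: chains_mem)
 from shuffle_htpy_identity[OF this]
 have "shuffle_htpy (n - 1) (bnd z) = defect z \<ominus>\<^bsub>X\<^esub> bnd (shuffle_htpy n z)"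
  using module_hom_closed[OF bnd_hom chains_X[OF w]] chains_X[OF w'] by (intro module_diff_eqI[OF X]) (simp_all add: X.a_comm)
 then show ?thesis using w w' by metis
qed

text \<open>
  The join of two pairs, where \<open>P\<close> distinguishes the vertices of the first pair from those of the second.
\<close>

locale join_shuffle = shuffle R N P
 for R :: "'r ring" and N :: "('r, 'm) module" and P :: "'v => bool" +
 fixes \<Gamma>\<^sub>1 \<Delta>\<^sub>1 \<Gamma>\<^sub>2 \<Delta>\<^sub>2 :: "'v set set"
 assumes down: "down_closed \<Gamma>\<^sub>1" "down_closed \<Delta>\<^sub>1" "down_closed \<Gamma>\<^sub>2" "down_closed \<Delta>\<^sub>2"
  and sub1: "\<Delta>\<^sub>1 \<subseteq> \<Gamma>\<^sub>1" and sub2: "\<Delta>\<^sub>2 \<subseteq> \<Gamma>\<^sub>2"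
  and P1: "\<And>\<sigma> v. \<sigma> \<in> \<Gamma>\<^sub>1 ==> v \<in> \<sigma> ==> P v" and P2: "\<And>\<sigma> v. \<sigma> \<in> \<Gamma>\<^sub>2 ==> v \<in> \<sigma> ==> \<not> P v"
begin

abbreviation "GJ \<equiv> complex_join \<Gamma>\<^sub>1 \<Gamma>\<^sub>2"
abbreviation "DJ \<equiv> complex_join \<Gamma>\<^sub>1 \<Delta>\<^sub>2 \<union> complex_join \<Delta>\<^sub>1 \<Gamma>\<^sub>2"
abbreviation "T2 \<equiv> tens R (simplex_cpx R \<Gamma>\<^sub>2 \<Delta>\<^sub>2) (concentrated N)"
abbreviation "TT \<equiv> tens R (simplex_cpx R \<Gamma>\<^sub>1 \<Delta>\<^sub>1) T2"

lemma join_down: "down_closed GJ" "down_closed DJ"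
proof -
 show "down_closed GJ" by (intro down_closed_join down)
 have "down_closed (complex_join \<Gamma>\<^sub>1 \<Delta>\<^sub>2)" "down_closed (complex_join \<Delta>\<^sub>1 \<Gamma>\<^sub>2)" by (intro down_closed_join down)+
 then show "down_closed DJ" unfolding down_closed_def by blast
qed

sublocale J: chain_pair R N GJ DJ
proof
 show "DJ \<subseteq> GJ" using sub1 sub2 unfolding complex_join_def by blast
qed (fact N join_down)+

text \<open>
  Chains of the tensor product with prescribed support. Relations of interest are \<open>bi m\<close>, for pairs of
  simplices with \<open>m\<close> vertices in total, and \<open>null m\<close>, for those pairs that vanish in the relative complex.
\<close>

definition on :: "('v list => 'v list => bool) => ('v list => 'v list => 'm) set" where
 "on U = {y \<in> carrier Y. \<forall>k l. y k l \<noteq> \<zero>\<^bsub>N\<^esub> \<longrightarrow> U k l}"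

definition bi :: "int => 'v list => 'v list => bool" where
 "bi m k l \<longleftrightarrow> set k \<in> \<Gamma>\<^sub>1 \<and> set l \<in> \<Gamma>\<^sub>2 \<and> int (length k) + int (length l) = m"

definition null :: "int => 'v list => 'v list => bool" where
 "null m k l \<longleftrightarrow> bi m k l \<and> (set k \<in> \<Delta>\<^sub>1 \<or> set l \<in> \<Delta>\<^sub>2)"

lemma on_Y: "y \<in> on U ==> y \<in> carrier Y" by (simp add: on_def)

lemma on_mono: "(\<And>k l. U k l ==> U' k l) ==> y \<in> on U ==> y \<in> on U'" by (auto simp: on_def)

lemma null_bi: "y \<in> on (null m) ==> y \<in> on (bi m)" by (rule on_mono) (simp_all add: null_def)

lemma on_submodule: "submodule (on U) R Y"
 unfolding submodule_iff[OF Y]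
proof (intro conjI ballI)
 interpret Y: module R Y by (rule Y)
 show "on U \<subseteq> carrier Y" using on_Y by blast
 show "\<zero>\<^bsub>Y\<^esub> \<in> on U" using Y.zero_closed by (simp add: on_def formal_sums_simps)
 fix y assume y: "y \<in> on U"
 show "y \<oplus>\<^bsub>Y\<^esub> z \<in> on U" if z: "z \<in> on U" for z
 proof -
  have "U k l" if "(y \<oplus>\<^bsub>Y\<^esub> z) k l \<noteq> \<zero>\<^bsub>N\<^esub>" for k l
  proof -
   have "y k l \<noteq> \<zero>\<^bsub>N\<^esub> \<or> z k l \<noteq> \<zero>\<^bsub>N\<^esub>" using that by (auto simp: formal_sums_simps)
   then show ?thesis using y z unfolding on_def by blast
  qed
  then show ?thesis using Y.a_closed[OF on_Y[OF y] on_Y[OF z]] unfolding on_def by blast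
 qed
 show "r \<odot>\<^bsub>Y\<^esub> y \<in> on U" if r: "r \<in> carrier R" for r
 proof -
  have "U k l" if "(r \<odot>\<^bsub>Y\<^esub> y) k l \<noteq> \<zero>\<^bsub>N\<^esub>" for k l
  proof -
   have "y k l \<noteq> \<zero>\<^bsub>N\<^esub>" using that r by (auto simp: formal_sums_simps)
   then show ?thesis using y unfolding on_def by blast
  qed
  then show ?thesis using Y.smult_closed[OF r on_Y[OF y]] unfolding on_def by blast
 qed
qed

lemma Y_at: "y \<in> carrier Y ==> y k l \<in> carrier N"
 using formal_sums_closed[OF formal_sums_closed] by fast

lemma on_hom_in:
 assumes W: "module R W" and f: "f \<in> module_hom R Y W" and H: "submodule H R W" and y: "y \<in> on U"
  and s: "\<And>k l x. x \<in> carrier N ==> U k l ==> f (single X k (single N l x)) \<in> H"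
 shows "f y \<in> H"
proof (rule hom_in_submodule2[OF N W f H on_Y[OF y]])
 fix k l
 show "f (single X k (single N l (y k l))) \<in> H"
 proof (cases "y k l = \<zero>\<^bsub>N\<^esub>")
  case True
  have "single X k (single N l \<zero>\<^bsub>N\<^esub>) = \<zero>\<^bsub>Y\<^esub>" by (auto simp: single_def formal_sums_simps)
  then show ?thesis using True module_hom_zero[OF Y W f] submoduleD(2)[OF W H] by simp
 next
  case False
  then show ?thesis using s[OF Y_at[OF on_Y[OF y]]] y by (simp add: on_def)
 qed
qed

lemma single_on: "x \<in> carrier N ==> U k l ==> single X k (single N l x) \<in> on U"
 using single_closed[OF X UNIV_I single_closed[OF N UNIV_I]] by (auto simp: on_def single_def formal_sums_simps)

lemma merge_on:
 assumes y: "y \<in> on U" and U: "\<And>k l. U k l ==> set k \<union> set l \<in> \<Sigma> \<and> int (length k) + int (length l) = m"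
 shows "merge y \<in> carrier (chains N \<Sigma> (m - 1))"
proof (rule on_hom_in[OF X merge_hom chains_submodule y])
 fix k l x assume x: "x \<in> carrier N" and kl: "U k l"
 have "sgn_elt R (length l) \<odot>\<^bsub>N\<^esub> x \<in> carrier N" using x sgn_elt_closed[OF cr] by simp
 from single_chains[OF this, of "k @ l" \<Sigma>] U[OF kl]
 show "merge (single X k (single N l x)) \<in> carrier (chains N \<Sigma> (m - 1))"
  unfolding merge_single[OF single_closed[OF N UNIV_I x]] merge_word_single[OF x] by simp
qed

lemma merge_bi: "y \<in> on (bi m) ==> merge y \<in> carrier (J.C (m - 1))"
 by (erule merge_on) (auto simp: bi_def complex_join_def)

lemma merge_null: "y \<in> on (null m) ==> merge y \<in> J.E (m - 1)"
 by (erule merge_on) (auto simp: null_def bi_def complex_join_def)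

lemma split_on:
 assumes z: "z \<in> carrier (chains N \<Sigma> (m - 1))"
  and U: "\<And>l. set l \<in> \<Sigma> ==> int (length l) = m ==> U (filter P l) (filter (\<lambda>v. \<not> P v) l)"
 shows "split z \<in> on U"
proof (rule chains_hom_in[OF Y split_hom on_submodule z])
 fix l x assume x: "x \<in> carrier N" and l: "set l \<in> \<Sigma>" "int (length l) = m - 1 + 1"
 obtain e where e: "e \<in> carrier R"
  "split_word l x = single X (filter P l) (single N (filter (\<lambda>v. \<not> P v) l) (e \<odot>\<^bsub>N\<^esub> x))"
  using split_word_shape[OF x] by blast
 show "split (single N l x) \<in> on U"
  unfolding split_single[OF x] e(2) by (rule single_on) (use e(1) x U l in auto)
qed

lemma filter_join:
 assumes "set l = \<sigma> \<union> \<tau>" "\<sigma> \<in> \<Gamma>\<^sub>1" "\<tau> \<in> \<Gamma>\<^sub>2"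
 shows "set (filter P l) = \<sigma>" "set (filter (\<lambda>v. \<not> P v) l) = \<tau>"
 using assms P1 P2 by auto

lemma split_bi:
 assumes "z \<in> carrier (J.C (m - 1))" shows "split z \<in> on (bi m)"
proof (rule split_on[OF assms])
 fix l assume "set l \<in> GJ" and m: "int (length l) = m"
 then obtain \<sigma> \<tau> where s: "set l = \<sigma> \<union> \<tau>" "\<sigma> \<in> \<Gamma>\<^sub>1" "\<tau> \<in> \<Gamma>\<^sub>2" unfolding complex_join_def by blast
 show "bi m (filter P l) (filter (\<lambda>v. \<not> P v) l)"
  using filter_join[OF s] s m sum_length_filter_compl[of P l] unfolding bi_def by simp
qed

lemma split_null:
 assumes "z \<in> J.E (m - 1)" shows "split z \<in> on (null m)"
proof (rule split_on[OF assms])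
 fix l assume "set l \<in> DJ" and m: "int (length l) = m"
 then obtain \<sigma> \<tau> where s: "set l = \<sigma> \<union> \<tau>" "\<sigma> \<in> \<Gamma>\<^sub>1" "\<tau> \<in> \<Gamma>\<^sub>2" and d: "\<sigma> \<in> \<Delta>\<^sub>1 \<or> \<tau> \<in> \<Delta>\<^sub>2"
  unfolding complex_join_def using sub1 sub2 by blast
 show "null m (filter P l) (filter (\<lambda>v. \<not> P v) l)"
  using filter_join[OF s] s m d sum_length_filter_compl[of P l] unfolding null_def bi_def by simp
qed

lemma split_merge_bi:
 assumes y: "y \<in> on (bi m)" shows "split (merge y) = y"
proof -
 note h = module_hom_comp[OF merge_hom split_hom]
 have "split (merge y) \<ominus>\<^bsub>Y\<^esub> y \<in> {\<zero>\<^bsub>Y\<^esub>}"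
 proof (rule on_hom_in[OF Y module_hom_diff[OF Y h module_hom_id] submodule_zero[OF Y] y])
  fix k l x assume x: "x \<in> carrier N" and kl: "bi m k l"
  have "single X k (single N l x) \<in> carrier Y" by (intro single_closed[OF X] single_closed[OF N] UNIV_I x)
  moreover have "split (merge (single X k (single N l x))) = single X k (single N l x)"
   by (rule split_merge[OF _ _ x]) (use kl P1 P2 in \<open>auto simp: bi_def\<close>)
  ultimately show "split (merge (single X k (single N l x))) \<ominus>\<^bsub>Y\<^esub> single X k (single N l x) \<in> {\<zero>\<^bsub>Y\<^esub>}"
   using module_minus_eq_zero[OF Y] by simp
 qed
 then show ?thesis using module_minus_eq_zero[OF Y module_hom_closed[OF h on_Y[OF y]] on_Y[OF y]] by simp
qed

text \<open>
  On chains of the right support \<open>merge\<close> is inverted by \<open>split\<close>, so that the differential can be computed in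
  the join, where it is known to preserve subcomplexes.
\<close>

lemma D_split_merge: "y \<in> on (bi m) ==> D y = split (bnd (merge y))"
 using split_chain_map[OF module_hom_closed[OF merge_hom on_Y]] split_merge_bi by metis

lemma D_bi: "y \<in> on (bi m) ==> D y \<in> on (bi (m - 1))"
 unfolding D_split_merge using boundary_chains[OF N join_down(1) merge_bi] split_bi[of _ "m - 1"] by simp

lemma D_null: "y \<in> on (null m) ==> D y \<in> on (null (m - 1))"
 unfolding D_split_merge[OF null_bi] using boundary_chains[OF N join_down(2) merge_null] split_null[of _ "m - 1"] by simp

text \<open>
  The representative of a relative chain in the free complex on the simplices outside the subcomplexes.
\<close>

definition trim :: "('v list => 'v list => 'm) => 'v list => 'v list => 'm" where
 "trim y = (\<lambda>k l. if set k \<in> \<Gamma>\<^sub>1 - \<Delta>\<^sub>1 \<and> set l \<in> \<Gamma>\<^sub>2 - \<Delta>\<^sub>2 then y k l else \<zero>\<^bsub>N\<^esub>)"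

lemma trim_hom: "trim \<in> module_hom R Y Y"
proof (rule module_homI)
 fix y assume y: "y \<in> carrier Y"
 have fs: "finite {k. y k \<noteq> \<zero>\<^bsub>X\<^esub>}" using formal_sums_finite[OF y] by (simp add: supp_def)
 have fl: "finite {l. y k l \<noteq> \<zero>\<^bsub>N\<^esub>}" for k using formal_sums_finite[OF formal_sums_closed[OF y]] by (simp add: supp_def)
 show "trim y \<in> carrier Y"
 proof (rule formal_sumsI[OF _ fs])
  show "trim y k \<in> carrier X" for k
   by (rule formal_sumsI[OF _ fl[of k]]) (auto simp: trim_def Y_at[OF y])
  show "trim y k = \<zero>\<^bsub>X\<^esub>" if "k \<notin> {k. y k \<noteq> \<zero>\<^bsub>X\<^esub>}" for k using that by (auto simp: trim_def formal_sums_simps)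
 qed simp
qed (auto simp: trim_def formal_sums_simps fun_eq_iff)

lemma Y_minus_at: "y \<in> carrier Y ==> z \<in> carrier Y ==> (y \<ominus>\<^bsub>Y\<^esub> z) k l = y k l \<ominus>\<^bsub>N\<^esub> z k l"
 using formal_sums_minus_apply[OF X, of y UNIV z k] formal_sums_minus_apply[OF N, of "y k" UNIV "z k" l]
  formal_sums_closed by fastforce

lemma trim_rest:
 assumes y: "y \<in> on (bi m)" shows "y \<ominus>\<^bsub>Y\<^esub> trim y \<in> on (null m)"
proof -
 interpret Y: module R Y by (rule Y)
 note t = module_hom_closed[OF trim_hom on_Y[OF y]]
 have "null m k l" if "(y \<ominus>\<^bsub>Y\<^esub> trim y) k l \<noteq> \<zero>\<^bsub>N\<^esub>" for k l
 proof -
  have e: "y k l \<ominus>\<^bsub>N\<^esub> trim y k l \<noteq> \<zero>\<^bsub>N\<^esub>" using that Y_minus_at[OF on_Y[OF y] t] by simp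
  then have "trim y k l \<noteq> y k l" using Y_at[OF on_Y[OF y], of k l] by (auto simp: a_minus_def N.r_neg)
  then have nz: "y k l \<noteq> \<zero>\<^bsub>N\<^esub>" and "\<not> (set k \<in> \<Gamma>\<^sub>1 - \<Delta>\<^sub>1 \<and> set l \<in> \<Gamma>\<^sub>2 - \<Delta>\<^sub>2)"
   by (auto simp: trim_def split: if_splits)
  moreover have "bi m k l" using nz y unfolding on_def by blast
  ultimately show ?thesis by (auto simp: null_def bi_def)
 qed
 then show ?thesis using Y.minus_closed[OF on_Y[OF y] t] unfolding on_def by blast
qed

lemma trim_zero:
 assumes y: "y \<in> on (bi m)" shows "trim y = \<zero>\<^bsub>Y\<^esub> \<longleftrightarrow> y \<in> on (null m)"
proof
 interpret Y: module R Y by (rule Y)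
 show "y \<in> on (null m)" if "trim y = \<zero>\<^bsub>Y\<^esub>"
  using trim_rest[OF y] on_Y[OF y] unfolding that by (simp add: a_minus_def module_neg_zero[OF Y])
 show "trim y = \<zero>\<^bsub>Y\<^esub>" if "y \<in> on (null m)"
  using that by (auto simp: trim_def on_def null_def formal_sums_simps fun_eq_iff)
qed

lemma trim_bi: "y \<in> on (bi m) ==> trim y \<in> on (bi m)"
 using module_hom_closed[OF trim_hom] by (auto simp: on_def trim_def)

lemma trim_idem: "trim (trim y) = trim y" by (auto simp: trim_def fun_eq_iff)

end

context join_shuffle
begin

abbreviation "F2 \<equiv> formal_sums N (bas (simplex_cpx R \<Gamma>\<^sub>2 \<Delta>\<^sub>2))"
abbreviation "F1 \<equiv> formal_sums F2 (bas (simplex_cpx R \<Gamma>\<^sub>1 \<Delta>\<^sub>1))"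

lemma F2: "module R F2" by (rule formal_sums_module[OF N])
lemma F1: "module R F1" by (rule formal_sums_module[OF F2])

lemma F2_X: "c \<in> carrier F2 ==> c \<in> carrier X" by (rule formal_sums_mono[OF subset_UNIV])

lemma F_ops:
 "\<zero>\<^bsub>F2\<^esub> = \<zero>\<^bsub>X\<^esub>" "\<zero>\<^bsub>F1\<^esub> = \<zero>\<^bsub>Y\<^esub>" "c \<oplus>\<^bsub>F1\<^esub> d = c \<oplus>\<^bsub>Y\<^esub> d" "r \<odot>\<^bsub>F1\<^esub> c = r \<odot>\<^bsub>Y\<^esub> c"
 by (simp_all add: formal_sums_simps)

lemma F1_iff: "c \<in> carrier F1 \<longleftrightarrow> c \<in> carrier Y \<and> trim c = c"
proof
 assume c: "c \<in> carrier F1"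
 have c2: "c k \<in> carrier F2" for k by (rule formal_sums_closed[OF c])
 have "finite {k. c k \<noteq> \<zero>\<^bsub>X\<^esub>}" using formal_sums_finite[OF c] by (simp add: supp_def F_ops)
 then have "c \<in> carrier Y" by (rule formal_sumsI[rotated]) (auto simp: F2_X[OF c2])
 moreover have "c k l = \<zero>\<^bsub>N\<^esub>" if "\<not> (set k \<in> \<Gamma>\<^sub>1 - \<Delta>\<^sub>1 \<and> set l \<in> \<Gamma>\<^sub>2 - \<Delta>\<^sub>2)" for k l
  using that formal_sums_outside[OF c, of k] formal_sums_outside[OF c2, of l k] by (auto simp: formal_sums_simps)
 then have "trim c = c" by (auto simp: trim_def fun_eq_iff)
 ultimately show "c \<in> carrier Y \<and> trim c = c" ..
next
 assume c: "c \<in> carrier Y \<and> trim c = c"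
 then have cY: "c \<in> carrier Y" and t: "trim c k l = c k l" for k l by simp_all
 have z: "c k l = \<zero>\<^bsub>N\<^esub>" if "\<not> (set k \<in> \<Gamma>\<^sub>1 - \<Delta>\<^sub>1 \<and> set l \<in> \<Gamma>\<^sub>2 - \<Delta>\<^sub>2)" for k l
  using t[of k l] that by (auto simp: trim_def)
 have f: "finite {k. c k \<noteq> \<zero>\<^bsub>X\<^esub>}" using formal_sums_finite[OF cY] by (simp add: supp_def)
 show "c \<in> carrier F1"
 proof (rule formal_sumsI[OF _ f])
  show "c k \<in> carrier F2" for k
   by (rule formal_sumsI[OF Y_at[OF cY] formal_sums_finite[OF formal_sums_closed[OF cY, of k]]]) (auto simp: supp_def z)
  show "c k = \<zero>\<^bsub>F2\<^esub>" if "k \<notin> bas (simplex_cpx R \<Gamma>\<^sub>1 \<Delta>\<^sub>1)" for k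
   using that z[of k] by (auto simp: formal_sums_simps fun_eq_iff)
 qed (simp add: F_ops)
qed

lemma F1_Y: "c \<in> carrier F1 ==> c \<in> carrier Y" by (simp add: F1_iff)

lemma TT_grd: "c \<in> grd TT q \<longleftrightarrow> c \<in> on (bi (q + 2)) \<and> trim c = c"
proof -
 have "c \<in> grd TT q \<longleftrightarrow> c \<in> carrier F1 \<and> (\<forall>k l. set k \<in> \<Gamma>\<^sub>1 - \<Delta>\<^sub>1 \<and> set l \<in> \<Gamma>\<^sub>2 - \<Delta>\<^sub>2 \<longrightarrow>
   c k l \<noteq> \<zero>\<^bsub>N\<^esub> \<longrightarrow> int (length k) + int (length l) = q + 2)"
 proof -
  have e: "c k \<in> grd T2 (q - dg (simplex_cpx R \<Gamma>\<^sub>1 \<Delta>\<^sub>1) k) \<longleftrightarrow> (\<forall>l. set l \<in> \<Gamma>\<^sub>2 - \<Delta>\<^sub>2 \<longrightarrow>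
    c k l \<noteq> \<zero>\<^bsub>N\<^esub> \<longrightarrow> int (length k) + int (length l) = q + 2)" if c: "c \<in> carrier F1" for k
  proof -
   have ck: "c k \<in> carrier F2" by (rule formal_sums_closed[OF c])
   have "c k l \<in> grd (concentrated N) (q - dg (simplex_cpx R \<Gamma>\<^sub>1 \<Delta>\<^sub>1) k - dg (simplex_cpx R \<Gamma>\<^sub>2 \<Delta>\<^sub>2) l) \<longleftrightarrow>
     (c k l \<noteq> \<zero>\<^bsub>N\<^esub> \<longrightarrow> int (length k) + int (length l) = q + 2)" for l
    using formal_sums_closed[OF ck, of l] by (auto simp: algebra_simps)
   then show ?thesis unfolding tens_grd using ck by (simp add: Ball_def)
  qed
  have "c \<in> grd TT q \<longleftrightarrow> c \<in> carrier F1 \<and> (\<forall>k\<in>bas (simplex_cpx R \<Gamma>\<^sub>1 \<Delta>\<^sub>1). c k \<in> grd T2 (q - dg (simplex_cpx R \<Gamma>\<^sub>1 \<Delta>\<^sub>1) k))"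
   unfolding tens_grd[of c] by simp
  also have "\<dots> \<longleftrightarrow> c \<in> carrier F1 \<and> (\<forall>k l. set k \<in> \<Gamma>\<^sub>1 - \<Delta>\<^sub>1 \<and> set l \<in> \<Gamma>\<^sub>2 - \<Delta>\<^sub>2 \<longrightarrow>
   c k l \<noteq> \<zero>\<^bsub>N\<^esub> \<longrightarrow> int (length k) + int (length l) = q + 2)"
   using e by (auto simp: Ball_def)
  finally show ?thesis .
 qed
 also have "\<dots> \<longleftrightarrow> c \<in> on (bi (q + 2)) \<and> trim c = c"
 proof -
  have "set k \<in> \<Gamma>\<^sub>1 - \<Delta>\<^sub>1 \<and> set l \<in> \<Gamma>\<^sub>2 - \<Delta>\<^sub>2" if "trim c = c" "c k l \<noteq> \<zero>\<^bsub>N\<^esub>" for k l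
   using fun_cong[OF fun_cong[OF that(1)], of k l] that(2) by (auto simp: trim_def split: if_splits)
  then show ?thesis unfolding F1_iff on_def bi_def by blast
 qed
 finally show ?thesis .
qed

lemma T2_based: "based_cpx R (simplex_cpx R \<Gamma>\<^sub>2 \<Delta>\<^sub>2)" and T1_based: "based_cpx R (simplex_cpx R \<Gamma>\<^sub>1 \<Delta>\<^sub>1)"
 by (rule simplex_cpx_based[OF cr down(3,4)] simplex_cpx_based[OF cr down(1,2)])+

lemma T2_cpx: "chain_cpx R T2" by (rule tens_chain_cpx[OF T2_based concentrated_chain_cpx[OF N]])
lemma TT_cpx: "chain_cpx R TT" by (rule tens_chain_cpx[OF T1_based T2_cpx])

lemma TT_dif:
 assumes "c \<in> carrier F1" shows "dif TT c = trim (D c)"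
proof (rule formal_sums_hom_eqI[OF F2 Y _ _ _ assms])
 have h: "dif TT \<in> module_hom R F1 F1" using tens_dif_hom[OF T1_based T2_cpx] by simp
 show "dif TT \<in> module_hom R F1 Y"
  by (rule module_homI) (simp_all add: F1_Y module_hom_closed[OF h] module_hom_add[OF h, unfolded F_ops] module_hom_smult[OF h, unfolded F_ops] F_ops)
 note tD = module_hom_comp[OF D_hom trim_hom]
 show "(\<lambda>c. trim (D c)) \<in> module_hom R F1 Y"
  by (rule module_homI) (simp_all add: F1_Y module_hom_closed[OF tD] module_hom_add[OF tD] module_hom_smult[OF tD] F_ops)
 fix k x assume k: "k \<in> bas (simplex_cpx R \<Gamma>\<^sub>1 \<Delta>\<^sub>1)" and x: "x \<in> carrier F2"
 have xX: "x \<in> carrier X" by (rule F2_X[OF x])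
 have bx: "bnd x l \<in> carrier N" for l by (rule formal_sums_closed[OF module_hom_closed[OF bnd_hom xX]])
 have xl: "x l \<in> carrier N" for l by (rule formal_sums_closed[OF x])
 have x0: "x l = \<zero>\<^bsub>N\<^esub>" if "\<not> set l \<in> \<Gamma>\<^sub>2 - \<Delta>\<^sub>2" for l using formal_sums_outside[OF x] that by simp
 have e1: "dif TT (single F2 k x) = tens_col R (simplex_cpx R \<Gamma>\<^sub>1 \<Delta>\<^sub>1) T2 k x"
  using tens_dif_single[OF T1_based T2_cpx k, of x] x by simp
 have e2: "D (single F2 k x) = tens_col R (full_cpx R) XX k x"
 proof -
  have "single F2 k x = single X k x" unfolding single_def F_ops ..
  then show ?thesis using tens_dif_single[OF full_cpx_based[OF cr] XX, of k x] xX by simp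
 qed
 have dT2: "dif T2 x l = (if set l \<in> \<Gamma>\<^sub>2 - \<Delta>\<^sub>2 then bnd x l else \<zero>\<^bsub>N\<^esub>)" for l
  by (rule simplex_dif[OF cr down(3,4) N x])
 show "dif TT (single F2 k x) = trim (D (single F2 k x))"
  unfolding e1 e2
 proof (intro ext)
  fix t l
  show "tens_col R (simplex_cpx R \<Gamma>\<^sub>1 \<Delta>\<^sub>1) T2 k x t l = trim (tens_col R (full_cpx R) XX k x) t l"
   using k x0[of l] xl[of l] bx[of l] sgn_elt_closed[OF cr]
   by (auto simp: tens_col_def trim_def formal_sums_simps single_def dT2 dif_XX[OF xX] face_coeff_closed[OF cr])
 qed
qed

text \<open>
  A cycle \<open>c\<close> of the tensor product is assigned the class of \<open>merge c\<close>. Every class arises, because \<open>z\<close>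
  and \<open>merge (split z)\<close> are homologous for a relative cycle \<open>z\<close>; and if \<open>merge c\<close> is a relative boundary,
  then so is \<open>c = split (merge c)\<close>, because \<open>split\<close> is a chain map of pairs. The shift by one in the degree
  comes from \<open>int (length k) + int (length l) = q + 2\<close>, while a simplex of degree \<open>q\<close> has \<open>q + 1\<close> vertices.
\<close>

lemma TT_has_homology: "has_homology R TT q (aug_homology N (GJ, DJ) (q + 1))"
proof -
 let ?H = "aug_homology N (GJ, DJ) (q + 1)" let ?\<theta> = "\<lambda>c. J.hcl (q + 1) (merge c)"
 interpret X: module R X by (rule X)
 interpret Y: module R Y by (rule Y)
 have g: "c \<in> on (bi (q + 2))" "trim c = c" "c \<in> carrier F1" if "c \<in> grd TT q" for c q
  using that unfolding TT_grd F1_iff using on_Y by auto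
 have m1: "merge y \<in> carrier (J.C (q + 1))" if "y \<in> on (bi (q + 2))" for y q using merge_bi[OF that] by (simp add: add.commute)
 have m2: "merge y \<in> J.E (q + 1)" if "y \<in> on (null (q + 2))" for y q using merge_null[OF that] by (simp add: add.commute)
 have Db: "D y \<in> on (bi (q + 1))" if "y \<in> on (bi (q + 2))" for y q using D_bi[OF that] by (simp add: add.commute)
 have Dn: "D y \<in> on (null (q + 1))" if "y \<in> on (null (q + 2))" for y q using D_null[OF that] by (simp add: add.commute)
 have cyc: "c \<in> cycles TT q \<longleftrightarrow> c \<in> grd TT q \<and> D c \<in> on (null (q + 1))" for c
  using TT_dif[OF g(3)] trim_zero[OF Db[OF g(1)]] by (auto simp: cycles_def F_ops)
 have trimD: "trim (D y) = trim (D (trim y))" if y: "y \<in> on (bi m)" for y m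
 proof -
  note t = module_hom_closed[OF trim_hom on_Y[OF y]]
  have d: "D y \<ominus>\<^bsub>Y\<^esub> D (trim y) \<in> on (null (m - 1))"
   using D_null[OF trim_rest[OF y]] unfolding module_hom_minus[OF Y Y D_hom on_Y[OF y] t] .
  have "trim (D y) \<ominus>\<^bsub>Y\<^esub> trim (D (trim y)) = \<zero>\<^bsub>Y\<^esub>"
   using trim_zero[OF null_bi[OF d]] d
   unfolding module_hom_minus[OF Y Y trim_hom module_hom_closed[OF D_hom on_Y[OF y]] module_hom_closed[OF D_hom t]] by simp
  then show ?thesis
   using module_minus_eq_zero[OF Y] module_hom_closed[OF trim_hom] module_hom_closed[OF D_hom] on_Y[OF y] t by blast
 qed
 have rc: "merge c \<in> J.rel_cycles (q + 1)" if "c \<in> cycles TT q" for c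
 proof -
  have c: "c \<in> grd TT q" "D c \<in> on (null (q + 1))" using that cyc by auto
  have "bnd (merge c) \<in> J.E (q + 1 - 1)" using merge_null[OF c(2)] merge_chain_map[OF on_Y[OF g(1)[OF c(1)]]] by simp
  then show ?thesis using m1[OF g(1)[OF c(1)]] unfolding J.rel_cycles_def by simp
 qed
 have cY: "c \<in> carrier Y" if "c \<in> cycles TT q" for c using that cyc g(1) on_Y by blast
 have hom: "?\<theta> \<in> module_hom R ((amb TT)\<lparr>carrier := cycles TT q\<rparr>) ?H"
 proof (rule module_homI)
  fix c assume "c \<in> carrier ((amb TT)\<lparr>carrier := cycles TT q\<rparr>)"
  then have c: "c \<in> cycles TT q" by simp
  show "?\<theta> c \<in> carrier ?H" using rc[OF c] J.hcl_surj by blast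
  show "?\<theta> (r \<odot>\<^bsub>(amb TT)\<lparr>carrier := cycles TT q\<rparr>\<^esub> c) = r \<odot>\<^bsub>?H\<^esub> ?\<theta> c" if r: "r \<in> carrier R" for r
   using module_hom_smult[OF J.hcl_hom r, of "merge c" "q + 1"] rc[OF c] module_hom_smult[OF merge_hom r cY[OF c]]
   by (simp add: F_ops) (simp add: formal_sums_simps)
  show "?\<theta> (c \<oplus>\<^bsub>(amb TT)\<lparr>carrier := cycles TT q\<rparr>\<^esub> d) = ?\<theta> c \<oplus>\<^bsub>?H\<^esub> ?\<theta> d"
   if "d \<in> carrier ((amb TT)\<lparr>carrier := cycles TT q\<rparr>)" for d
  proof -
   have d: "d \<in> cycles TT q" using that by simp
   show ?thesis
    using module_hom_add[OF J.hcl_hom, of "merge c" "q + 1" "merge d"] rc[OF c] rc[OF d] module_hom_add[OF merge_hom cY[OF c] cY[OF d]]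
    by (simp add: F_ops) (simp add: formal_sums_simps)
  qed
 qed
 have surj: "?\<theta> ` cycles TT q = carrier ?H"
 proof
  show "?\<theta> ` cycles TT q \<subseteq> carrier ?H" using rc J.hcl_surj by blast
  show "carrier ?H \<subseteq> ?\<theta> ` cycles TT q"
   unfolding J.hcl_surj[symmetric]
  proof
   fix h assume "h \<in> J.hcl (q + 1) ` J.rel_cycles (q + 1)"
   then obtain z where z: "z \<in> J.rel_cycles (q + 1)" "h = J.hcl (q + 1) z" by blast
   have zC: "z \<in> carrier (J.C (q + 1))" and bz: "bnd z \<in> J.E q" using z(1) by (auto simp: J.rel_cycles_def)
   have y: "split z \<in> on (bi (q + 2))" using split_bi[of z "q + 2"] zC by (simp add: add.commute)
   let ?c = "trim (split z)"
   have Dy: "D (split z) \<in> on (null (q + 1))"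
    using split_null[of "bnd z" "q + 1"] bz split_chain_map[OF chains_X[OF zC]] by simp
   have c: "?c \<in> grd TT q" unfolding TT_grd using trim_bi[OF y] trim_idem by simp
   have "trim (D ?c) = \<zero>\<^bsub>Y\<^esub>" using trimD[OF y] trim_zero[OF null_bi[OF Dy]] Dy by simp
   then have cc: "?c \<in> cycles TT q" using cyc c trim_zero[OF Db[OF g(1)[OF c]]] by blast
   (* w bounds the difference of z and merge (split z) up to a chain of the subcomplex *)
   obtain w where w: "w \<in> carrier (J.C (q + 1 + 1))" "defect z \<ominus>\<^bsub>X\<^esub> bnd w \<in> J.E (q + 1)"
    using defect_boundary[OF join_down zC] bz by auto
   note wb = module_hom_closed[OF J.boundary_C w(1), simplified add_diff_cancel_right']
   note mc = m1[OF g(1)[OF c]]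
   have "merge (split z \<ominus>\<^bsub>Y\<^esub> ?c) \<in> J.E (q + 1)" by (rule m2[OF trim_rest[OF y]])
   then have r: "merge (split z) \<ominus>\<^bsub>X\<^esub> merge ?c \<in> J.E (q + 1)"
    using module_hom_minus[OF Y X merge_hom on_Y[OF y] on_Y[OF g(1)[OF c]]] by simp
   have "(z \<ominus>\<^bsub>X\<^esub> merge ?c) \<ominus>\<^bsub>X\<^esub> bnd w = (defect z \<ominus>\<^bsub>X\<^esub> bnd w) \<oplus>\<^bsub>X\<^esub> (merge (split z) \<ominus>\<^bsub>X\<^esub> merge ?c)"
    unfolding defect_def
    by (rule module_minus_split[OF X chains_X[OF zC] chains_X[OF mc] chains_X[OF wb] chains_X[OF m1[OF y]]])
   then have "(z \<ominus>\<^bsub>X\<^esub> merge ?c) \<ominus>\<^bsub>X\<^esub> bnd w \<in> J.E (q + 1)"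
    using submoduleD(3)[OF X chains_submodule w(2) r] by simp
   moreover have "z \<ominus>\<^bsub>J.C (q + 1)\<^esub> merge ?c \<in> carrier (J.C (q + 1))"
    by (rule submodule_minus[OF J.C module.carrier_is_submodule[OF J.C] zC mc])
   ultimately have "(z \<ominus>\<^bsub>J.C (q + 1)\<^esub> merge ?c) \<ominus>\<^bsub>J.C (q + 1)\<^esub> bnd w \<in> J.E (q + 1)"
    using J.C_minus[OF _ wb] J.C_minus[OF zC mc] by simp
   from J.hcl_eqI[OF z(1) rc[OF cc] w(1) this]
   show "h \<in> ?\<theta> ` cycles TT q" using z(2) cc by blast
  qed
 qed
 have ker: "?\<theta> c = \<zero>\<^bsub>?H\<^esub> \<longleftrightarrow> c \<in> boundaries TT q" if c: "c \<in> cycles TT q" for c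
 proof -
  have cg: "c \<in> grd TT q" using c cyc by blast
  note cb = g(1)[OF cg] and ct = g(2)[OF cg]
  show ?thesis unfolding J.hcl_zero[OF rc[OF c]]
  proof
   assume "\<exists>y\<in>carrier (J.C (q + 1 + 1)). merge c \<ominus>\<^bsub>J.C (q + 1)\<^esub> bnd y \<in> J.E (q + 1)"
   then obtain w where w: "w \<in> carrier (J.C (q + 1 + 1))" "merge c \<ominus>\<^bsub>J.C (q + 1)\<^esub> bnd w \<in> J.E (q + 1)" by blast
   note wb = module_hom_closed[OF J.boundary_C w(1), simplified add_diff_cancel_right']
   have "merge c \<ominus>\<^bsub>X\<^esub> bnd w \<in> J.E (q + 1)" using w(2) J.C_minus[OF m1[OF cb] wb] by simp
   then have "split (merge c \<ominus>\<^bsub>X\<^esub> bnd w) \<in> on (null (q + 2))" using split_null[of _ "q + 2"] by (simp add: add.commute)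
   moreover have "split (merge c \<ominus>\<^bsub>X\<^esub> bnd w) = c \<ominus>\<^bsub>Y\<^esub> D (split w)"
    unfolding module_hom_minus[OF X Y split_hom chains_X[OF m1[OF cb]] chains_X[OF wb]]
     split_merge_bi[OF cb] split_chain_map[OF chains_X[OF w(1)]] ..
   ultimately have n: "c \<ominus>\<^bsub>Y\<^esub> D (split w) \<in> on (null (q + 2))" by simp
   have sw: "split w \<in> on (bi (q + 3))" using split_bi[of w "q + 3"] w(1) by (simp add: algebra_simps)
   note Dw = module_hom_closed[OF D_hom on_Y[OF sw]]
   have "c \<ominus>\<^bsub>Y\<^esub> trim (D (split w)) = \<zero>\<^bsub>Y\<^esub>"
    using trim_zero[OF null_bi[OF n]] n ct
    unfolding module_hom_minus[OF Y Y trim_hom on_Y[OF cb] Dw] by simp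
   then have ce: "c = trim (D (split w))"
    using module_minus_eq_zero[OF Y on_Y[OF cb] module_hom_closed[OF trim_hom Dw]] by simp
   have u: "trim (split w) \<in> grd TT (q + 1)"
    unfolding TT_grd using trim_bi[OF sw] trim_idem by (simp add: algebra_simps)
   have "c = dif TT (trim (split w))" unfolding TT_dif[OF g(3)[OF u]] using ce trimD[OF sw] by simp
   then show "c \<in> boundaries TT q" unfolding boundaries_def using u by blast
  next
   assume "c \<in> boundaries TT q"
   then obtain u where u: "u \<in> grd TT (q + 1)" "c = dif TT u" unfolding boundaries_def by blast
   have ub: "u \<in> on (bi (q + 3))" using g(1)[OF u(1)] by (simp add: algebra_simps)
   have Du: "D u \<in> on (bi (q + 2))" using D_bi[OF ub] by (simp add: add.commute)
   have ce: "c = trim (D u)" using u(2) TT_dif[OF g(3)[OF u(1)]] by simp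
   have w: "merge u \<in> carrier (J.C (q + 1 + 1))" using merge_bi[OF ub] by (simp add: algebra_simps)
   note wb = module_hom_closed[OF J.boundary_C w, simplified add_diff_cancel_right']
   have "D u \<ominus>\<^bsub>Y\<^esub> c \<in> on (null (q + 2))" using trim_rest[OF Du] ce by simp
   then have "\<ominus>\<^bsub>Y\<^esub> (D u \<ominus>\<^bsub>Y\<^esub> c) \<in> on (null (q + 2))" by (rule submodule_neg[OF Y on_submodule])
   moreover have "\<ominus>\<^bsub>Y\<^esub> (D u \<ominus>\<^bsub>Y\<^esub> c) = c \<ominus>\<^bsub>Y\<^esub> D u"
    using on_Y[OF Du] on_Y[OF cb] by (simp add: a_minus_def Y.minus_add Y.a_comm)
   ultimately have "merge (c \<ominus>\<^bsub>Y\<^esub> D u) \<in> J.E (q + 1)" using m2 by simp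
   then have "merge c \<ominus>\<^bsub>X\<^esub> bnd (merge u) \<in> J.E (q + 1)"
    using module_hom_minus[OF Y X merge_hom on_Y[OF cb] on_Y[OF Du]] merge_chain_map[OF on_Y[OF ub]] by simp
   then show "\<exists>y\<in>carrier (J.C (q + 1 + 1)). merge c \<ominus>\<^bsub>J.C (q + 1)\<^esub> bnd y \<in> J.E (q + 1)"
    using J.C_minus[OF m1[OF cb] wb] by (intro bexI[OF _ w]) simp
  qed
 qed
 show ?thesis unfolding has_homology_def using hom surj ker by blast
qed

end

section \<open>The Kuenneth formula\<close>

lemma concentrated_has_homology:
 fixes R :: "'r ring"
 assumes M: "module R M"
 shows "has_homology R (concentrated M) 0 M"
  and "i \<noteq> 0 ==> cycles (concentrated M) i \<subseteq> boundaries (concentrated M) i"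
proof -
 interpret M: module R M by fact
 have b: "boundaries (concentrated M) i = {\<zero>\<^bsub>M\<^esub>}" for i by (auto simp: boundaries_def)
 have "(\<lambda>x. x) \<in> module_hom R ((amb (concentrated M))\<lparr>carrier := cycles (concentrated M) 0\<rparr>) M"
  by (rule module_homI) (auto simp: cycles_def)
 then show "has_homology R (concentrated M) 0 M"
  unfolding has_homology_def b by (rule bexI[rotated]) (auto simp: cycles_def)
 show "cycles (concentrated M) i \<subseteq> boundaries (concentrated M) i" if "i \<noteq> 0"
  unfolding b using that by (auto simp: cycles_def)
qed

text \<open>
  The modules \<open>G \<otimes> G'\<close>, \<open>G\<close> and the second factor are replaced by free complexes \<open>?E\<close>, \<open>?P\<close> and \<open>?Q\<close> one
  after the other. Free factors can be exchanged, so each replacement is a quasi-isomorphism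
  tensored with a free complex.
\<close>

theorem kunneth_based:
 fixes R :: "'r ring" and G :: "('r, 'g) module" and G' :: "('r, 'h) module"
  and A :: "int => ('r, 'a) module" and A' :: "int => ('r, 'b) module"
 assumes R: "principal_domain R" and G: "module R G" and G': "module R G'"
  and Tor: "carrier (Tor1 R G G') = {\<zero>\<^bsub>Tor1 R G G'\<^esub>}"
  and S: "based_cpx R S" and S': "based_cpx R S'"
  and A: "\<And>i. module R (A i)" and A': "\<And>i. module R (A' i)"
  and hA: "\<And>i. has_homology R (tens R S (concentrated G)) i (A i)"
  and hA': "\<And>i. has_homology R (tens R S' (concentrated G')) i (A' i)"
 shows "has_homology R (tens R S (tens R S' (concentrated (tensor R G G')))) n
   (module_sum (direct_sum {(i, j). i + j = n} (\<lambda>(i, j). tensor R (A i) (A' j)))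
    (direct_sum {(i, j). i + j = n - 1} (\<lambda>(i, j). Tor1 R (A i) (A' j))))"
  (is "has_homology R _ n ?X")
proof -
 interpret R: principal_domain R by (rule R)
 note cr = R.is_cring
 let ?E = "pres_cpx R {0} (\<lambda>_. G)" and ?P = "pres_cpx R UNIV A" and ?Q = "pres_cpx R UNIV A'"
 let ?r = "concentrated (ring_module R)"
 have E: "based_cpx R ?E" by (rule pres_cpx_based[OF R]) (rule G)
 have P: "based_cpx R ?P" by (rule pres_cpx_based[OF R]) (rule A)
 have Q: "based_cpx R ?Q" by (rule pres_cpx_based[OF R]) (rule A')
 note r = concentrated_chain_cpx[OF ring_module_module[OF cr]]
 note cG = concentrated_chain_cpx[OF G] and cG' = concentrated_chain_cpx[OF G']
 have X: "module R ?X"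
  by (intro module_sum_module direct_sum_module cr) (auto simp: tensor_is_module Tor1_module A A' R)
 note iff = has_homology_quasi_iso[OF _ X, of _ _ _ n]
 obtain \<phi> where \<phi>: "quasi_iso R (tens R ?E ?r) (concentrated G) \<phi>"
  using free_approximation[OF R cG, of "{0}" "\<lambda>_. G"] concentrated_has_homology[OF G] G by auto
 have hE: "has_homology R (tens R S (tens R ?E ?r)) i (A i)" for i
  using has_homology_quasi_iso[OF quasi_iso_tens[OF S \<phi>] A] hA by blast
 (* With G replaced by E the complex S E consists of free modules, yet it still has homology A. *)
 obtain \<psi> where \<psi>: "quasi_iso R (tens R ?P ?r) (tens R S (tens R ?E ?r)) \<psi>"
  using free_approximation[OF R tens_chain_cpx[OF S tens_chain_cpx[OF E r]], of UNIV A] hE A by auto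
 obtain \<chi> where \<chi>: "quasi_iso R (tens R ?Q ?r) (tens R S' (concentrated G')) \<chi>"
  using free_approximation[OF R tens_chain_cpx[OF S' cG'], of UNIV A'] hA' A' by auto
 obtain \<omega> where \<omega>: "quasi_iso R (tens R ?Q ?r) (graded_cpx A') \<omega>"
 proof -
  have g: "chain_cpx R (graded_cpx A')" by (rule graded_chain_cpx[OF cr]) (rule A')
  have "has_homology R (graded_cpx A') i (A' i)" for i by (rule graded_has_homology[OF cr]) (rule A')
  then show thesis using free_approximation[OF R g, of UNIV A'] A' that by auto
 qed
 have "has_homology R (tens R ?P (graded_cpx A')) n ?X"
  by (rule presentation_tensor_homology[OF R A A'])
 then have "has_homology R (tens R ?P (tens R ?Q ?r)) n ?X"
  using iff[OF quasi_iso_tens[OF P \<omega>]] by blast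
 then have "has_homology R (tens R ?Q (tens R ?P ?r)) n ?X"
  using iff[OF quasi_iso_swap[OF Q P r]] by blast
 then have "has_homology R (tens R ?Q (tens R S (tens R ?E ?r))) n ?X"
  using iff[OF quasi_iso_tens[OF Q \<psi>]] by blast
 then have "has_homology R (tens R S (tens R ?Q (tens R ?E ?r))) n ?X"
  using iff[OF quasi_iso_swap[OF S Q tens_chain_cpx[OF E r]]] by blast
 then have "has_homology R (tens R S (tens R ?E (tens R ?Q ?r))) n ?X"
  using iff[OF quasi_iso_tens[OF S quasi_iso_swap[OF E Q r]]] by blast
 then have "has_homology R (tens R S (tens R ?E (tens R S' (concentrated G')))) n ?X"
  using iff[OF quasi_iso_tens[OF S quasi_iso_tens[OF E \<chi>]]] by blast
 then have "has_homology R (tens R S (tens R S' (tens R ?E (concentrated G')))) n ?X"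
  using iff[OF quasi_iso_tens[OF S quasi_iso_swap[OF S' E cG']]] by blast
 then show ?thesis
  using iff[OF quasi_iso_tens[OF S quasi_iso_tens[OF S' quasi_iso_presentation_tensor[OF R G G' Tor]]]] by blast
qed

lemma simplicial_complex_down_closed: "simplicial_complex V \<Sigma> ==> down_closed \<Sigma>"
 by (auto simp: simplicial_complex_def down_closed_def)

text \<open>
  The homology of the join is that of the tensor product of the two relative chain complexes, to which
  the Kuenneth formula applies.
\<close>

theorem proposition1:
  fixes R :: "'r ring"
    and G :: "('r, 'g) module" and G' :: "('r, 'h) module"
    and \<Gamma>\<^sub>1 \<Delta>\<^sub>1 \<Gamma>\<^sub>2 \<Delta>\<^sub>2 :: "'v set set" and V\<^sub>1 W\<^sub>1 V\<^sub>2 W\<^sub>2 :: "'v set"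
    and q :: int
  assumes "principal_domain R" and "module R G" and "module R G'"
    and "carrier (Tor1 R G G') = {\<zero>\<^bsub>Tor1 R G G'\<^esub>}"
    and "simplicial_complex V\<^sub>1 \<Gamma>\<^sub>1" and "simplicial_complex W\<^sub>1 \<Delta>\<^sub>1" and "\<Delta>\<^sub>1 \<subseteq> \<Gamma>\<^sub>1"
    and "simplicial_complex V\<^sub>2 \<Gamma>\<^sub>2" and "simplicial_complex W\<^sub>2 \<Delta>\<^sub>2" and "\<Delta>\<^sub>2 \<subseteq> \<Gamma>\<^sub>2"
    and "V\<^sub>1 \<inter> V\<^sub>2 = {}"
  shows "module_isomorphic R
    (aug_homology (tensor R G G') (join_pair (\<Gamma>\<^sub>1, \<Delta>\<^sub>1) (\<Gamma>\<^sub>2, \<Delta>\<^sub>2)) (q + 1))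
    (module_sum
      (direct_sum {(i, j). i + j = q}
        (\<lambda>(i, j). tensor R (aug_homology G (\<Gamma>\<^sub>1, \<Delta>\<^sub>1) i) (aug_homology G' (\<Gamma>\<^sub>2, \<Delta>\<^sub>2) j)))
      (direct_sum {(i, j). i + j = q - 1}
        (\<lambda>(i, j). Tor1 R (aug_homology G (\<Gamma>\<^sub>1, \<Delta>\<^sub>1) i) (aug_homology G' (\<Gamma>\<^sub>2, \<Delta>\<^sub>2) j))))"
proof -
  interpret R: principal_domain R by fact
  note cr = R.is_cring and G = assms(2) and G' = assms(3)
  note down = assms(5,6,8,9)[THEN simplicial_complex_down_closed]
  interpret K1: chain_pair R G \<Gamma>\<^sub>1 \<Delta>\<^sub>1 by (rule chain_pair.intro) (fact G down assms(7))+
  interpret K2: chain_pair R G' \<Gamma>\<^sub>2 \<Delta>\<^sub>2 by (rule chain_pair.intro) (fact G' down assms(10))+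
  let ?N = "tensor R G G'"
  interpret N: module R ?N by (rule tensor_is_module[OF G G'])
  interpret J: join_shuffle R ?N "\<lambda>v. v \<in> V\<^sub>1" \<Gamma>\<^sub>1 \<Delta>\<^sub>1 \<Gamma>\<^sub>2 \<Delta>\<^sub>2
  proof (intro join_shuffle.intro shuffle.intro join_shuffle_axioms.intro)
    show "v \<in> V\<^sub>1" if "\<sigma> \<in> \<Gamma>\<^sub>1" "v \<in> \<sigma>" for \<sigma> v
      using that assms(5) by (auto simp: simplicial_complex_def)
    show "v \<notin> V\<^sub>1" if "\<sigma> \<in> \<Gamma>\<^sub>2" "v \<in> \<sigma>" for \<sigma> v
      using that assms(8,11) by (fastforce simp: simplicial_complex_def)
  qed (fact N.module_axioms down assms(7,10))+
  let ?X = "module_sum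
      (direct_sum {(i, j). i + j = q}
        (\<lambda>(i, j). tensor R (aug_homology G (\<Gamma>\<^sub>1, \<Delta>\<^sub>1) i) (aug_homology G' (\<Gamma>\<^sub>2, \<Delta>\<^sub>2) j)))
      (direct_sum {(i, j). i + j = q - 1}
        (\<lambda>(i, j). Tor1 R (aug_homology G (\<Gamma>\<^sub>1, \<Delta>\<^sub>1) i) (aug_homology G' (\<Gamma>\<^sub>2, \<Delta>\<^sub>2) j)))"
  have "has_homology R J.TT q ?X"
    by (rule kunneth_based[OF assms(1) G G' assms(4) J.T1_based J.T2_based K1.aug_homology_module K2.aug_homology_module
      K1.pair_has_homology K2.pair_has_homology])
  moreover have "module R ?X"
    by (intro module_sum_module direct_sum_module cr)
      (auto simp: tensor_is_module Tor1_module K1.aug_homology_module K2.aug_homology_module assms(1))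
  ultimately show ?thesis
    using has_homology_unique[OF J.TT_cpx J.J.aug_homology_module _ J.TT_has_homology] by simp
qed

end
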